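(* Let $\Bbbk$ be an algebraically closed field of characteristic zero, let $\mathcal C$ be a (not necessarily semisimple) modular tensor category over $\Bbbk$, and let $L=\int^{X\in\mathcal C}X^*\otimes X$ be its canonical Hopf algebra. The subalgebra of $\mathrm{End}_L(L)$ generated by the defect operators $(\mathcal O_D)_{D\in\mathcal C}$ is isomorphic, as an algebra, to the linearised Grothendieck ring $\mathrm{Gr}_\Bbbk(\mathcal C)=\Bbbk\otimes_{\mathbb Z}\mathrm{Gr}(\mathcal C)$.
   Context: A modular tensor category $\mathcal C$ over $\Bbbk$ is a finite ribbon tensor category (equivalent as a linear category to finite-dimensional modules over a finite-dimensional algebra; rigid, bilinear $\otimes$, simple unit $\mathbf 1$; braiding $\beta$ and twist $\vartheta$) whose canonical Hopf pairing $\omega\colon L\otimes L\to\mathbf 1$ is non-degenerate; equivalently, the canonical functor $\mathcal C\boxtimes\overline{\mathcal C}\to\mathcal Z(\mathcal C)$ to the Drinfeld centre is an equivalence. $\mathcal C$ is taken strictly monoidal and strictly pivotal. Let $\iota_X\colon X^*\otimes X\to L$ be the universal dinatural transformation of the coend $L$. The product $\mu\colon L\otimes L\to L$ and unit $\eta$ of $L$ are determined by $$\mu\circ(\iota_X\otimes\iota_Y)=\iota_{X\otimes Y}\circ(\beta_{X^*\otimes X,\,Y^*}\otimes\mathrm{id}_Y),\qquad \eta=\iota_{\mathbf 1},$$ using $Y^*\otimes X^*=(X\otimes Y)^*$. $\mathrm{End}_L(L)$ is the algebra, under composition, of endomorphisms in $\mathcal C$ of $L$ as a right $L$-module (regular right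 module). For $D\in\mathcal C$, the internal cocharacter is $\check\chi_D=\iota_D\circ\widetilde{\mathrm{coev}}_D\colon\mathbf 1\to L$, with $\widetilde{\mathrm{coev}}_D\colon\mathbf 1\to D^*\otimes D$ the coevaluation. The defect operator of $D$ is $$\mathcal O_D=\mu\circ(\check\chi_D\otimes\mathrm{id}_L)\in\mathrm{End}_L(L).$$ (In the paper $\mathcal O_D$ is the endomorphism of the object of bulk fields $\mathbb F_{S^1}\cong L$, under the equivalence of $\mathcal C\boxtimes\overline{\mathcal C}$ with right $L$-modules in $\mathcal C$, corresponding to the correlator, in the diagonal full CFT built from $\mathcal C$, of the cylinder $S^1\times I$ with a $D$-labelled line defect along $S^1\times\{1/2\}$; it is given by the formula above.) $\mathrm{Gr}(\mathcal C)$ is the Grothendieck ring of the abelian category $\mathcal C$, with product $[X][Y]=[X\otimes Y]$. *)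

theory Defs
  imports
    "HOL-Algebra.QuotRing"
    "HOL-Library.Poly_Mapping"
    "HOL-Computational_Algebra.Group_Closure"
    "HOL-Computational_Algebra.Polynomial"
    "Jordan_Normal_Form.Matrix"
begin

section \<open>Linear categories\<close>

text \<open>
  The data of a (small) strictly monoidal, strictly pivotal ribbon category over a field.
  Every element of the type of objects is an object. All hom-spaces are linear subspaces of one
  vector space of type 'm; this is no restriction, as one can take the direct sum of all
  hom-spaces and extend composition and tensor product bilinearly. In particular one element
  may serve as the zero morphism of all hom-spaces.
\<close>

record ('k, 'o, 'm) ribbon_data =
  scale :: "'k \<Rightarrow> 'm \<Rightarrow> 'm"
  hom :: "'o \<Rightarrow> 'o \<Rightarrow> 'm set"
  ident :: "'o \<Rightarrow> 'm"
  comp :: "'m \<Rightarrow> 'm \<Rightarrow> 'm"  (infixl "\<cdot>\<index>" 70)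
  tensor_ob :: "'o \<Rightarrow> 'o \<Rightarrow> 'o"  (infixl "\<otimes>\<^sub>o\<index>" 75)
  tensor_mor :: "'m \<Rightarrow> 'm \<Rightarrow> 'm"  (infixl "\<otimes>\<^sub>m\<index>" 75)
  unit :: "'o"  ("\<one>\<^sub>o\<index>")
  dual :: "'o \<Rightarrow> 'o"
  ev :: "'o \<Rightarrow> 'm"
  coev :: "'o \<Rightarrow> 'm"
  braid :: "'o \<Rightarrow> 'o \<Rightarrow> 'm"
  twist :: "'o \<Rightarrow> 'm"

locale linear_category = vector_space "scale C"
  for C :: "('k::field, 'o, 'm::ab_group_add) ribbon_data" (structure) +
  assumes hom_subspace: "subspace (hom C X Y)"
    and ident_in_hom: "ident C X \<in> hom C X X"
    and comp_in_hom: "f \<in> hom C X Y \<Longrightarrow> g \<in> hom C Y Z \<Longrightarrow> g \<cdot> f \<in> hom C X Z"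
    and comp_assoc: "f \<in> hom C W X \<Longrightarrow> g \<in> hom C X Y \<Longrightarrow> h \<in> hom C Y Z \<Longrightarrow>
          h \<cdot> (g \<cdot> f) = (h \<cdot> g) \<cdot> f"
    and comp_ident_right: "f \<in> hom C X Y \<Longrightarrow> f \<cdot> ident C X = f"
    and comp_ident_left: "f \<in> hom C X Y \<Longrightarrow> ident C Y \<cdot> f = f"
    and comp_add_right: "f \<in> hom C X Y \<Longrightarrow> f' \<in> hom C X Y \<Longrightarrow> g \<in> hom C Y Z \<Longrightarrow>
          g \<cdot> (f + f') = g \<cdot> f + g \<cdot> f'"
    and comp_add_left: "f \<in> hom C X Y \<Longrightarrow> g \<in> hom C Y Z \<Longrightarrow> g' \<in> hom C Y Z \<Longrightarrow>
          (g + g') \<cdot> f = g \<cdot> f + g' \<cdot> f"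
    and comp_scale_right: "f \<in> hom C X Y \<Longrightarrow> g \<in> hom C Y Z \<Longrightarrow>
          g \<cdot> scale C c f = scale C c (g \<cdot> f)"
    and comp_scale_left: "f \<in> hom C X Y \<Longrightarrow> g \<in> hom C Y Z \<Longrightarrow>
          scale C c g \<cdot> f = scale C c (g \<cdot> f)"

context
  fixes C :: "('k::field, 'o, 'm::ab_group_add) ribbon_data" (structure)
begin

definition is_iso :: "'o \<Rightarrow> 'o \<Rightarrow> 'm \<Rightarrow> bool" where
  "is_iso X Y f \<longleftrightarrow>
     f \<in> hom C X Y \<and> (\<exists>g \<in> hom C Y X. g \<cdot> f = ident C X \<and> f \<cdot> g = ident C Y)"

definition is_mono :: "'o \<Rightarrow> 'o \<Rightarrow> 'm \<Rightarrow> bool" where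
  "is_mono X Y f \<longleftrightarrow>
     f \<in> hom C X Y \<and>
     (\<forall>W. \<forall>g \<in> hom C W X. \<forall>h \<in> hom C W X. f \<cdot> g = f \<cdot> h \<longrightarrow> g = h)"

definition simple_object :: "'o \<Rightarrow> bool" where
  "simple_object X \<longleftrightarrow>
     ident C X \<noteq> 0 \<and> (\<forall>Y f. is_mono Y X f \<longrightarrow> f = 0 \<or> is_iso Y X f)"

definition is_kernel :: "'o \<Rightarrow> 'o \<Rightarrow> 'o \<Rightarrow> 'm \<Rightarrow> 'm \<Rightarrow> bool" where
  "is_kernel X Y Z f g \<longleftrightarrow>
     f \<in> hom C X Y \<and> g \<in> hom C Y Z \<and> g \<cdot> f = 0 \<and>
     (\<forall>W. \<forall>h \<in> hom C W Y. g \<cdot> h = 0 \<longrightarrow> (\<exists>!h'. h' \<in> hom C W X \<and> f \<cdot> h' = h))"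

definition is_cokernel :: "'o \<Rightarrow> 'o \<Rightarrow> 'o \<Rightarrow> 'm \<Rightarrow> 'm \<Rightarrow> bool" where
  "is_cokernel X Y Z f g \<longleftrightarrow>
     f \<in> hom C X Y \<and> g \<in> hom C Y Z \<and> g \<cdot> f = 0 \<and>
     (\<forall>W. \<forall>h \<in> hom C Y W. h \<cdot> f = 0 \<longrightarrow> (\<exists>!h'. h' \<in> hom C Z W \<and> h' \<cdot> g = h))"

definition short_exact :: "'o \<Rightarrow> 'o \<Rightarrow> 'o \<Rightarrow> 'm \<Rightarrow> 'm \<Rightarrow> bool" where
  "short_exact X Y Z f g \<longleftrightarrow> is_kernel X Y Z f g \<and> is_cokernel X Y Z f g"

end


section \<open>Finiteness\<close>

text \<open>A finite-dimensional unital associative algebra; up to isomorphism its underlying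
  vector space is \<open>carrier_vec n\<close>. Its finite-dimensional modules are given by matrix
  representations.\<close>

definition fd_algebra :: "nat \<Rightarrow> ('k::field vec \<Rightarrow> 'k vec \<Rightarrow> 'k vec) \<Rightarrow> 'k vec \<Rightarrow> bool" where
  "fd_algebra n m e \<longleftrightarrow>
     e \<in> carrier_vec n \<and>
     (\<forall>a \<in> carrier_vec n. m e a = a \<and> m a e = a) \<and>
     (\<forall>a \<in> carrier_vec n. \<forall>b \<in> carrier_vec n.
        m a b \<in> carrier_vec n \<and>
        (\<forall>c. m (c \<cdot>\<^sub>v a) b = c \<cdot>\<^sub>v m a b \<and> m a (c \<cdot>\<^sub>v b) = c \<cdot>\<^sub>v m a b) \<and>
        (\<forall>d \<in> carrier_vec n.
           m (a + b) d = m a d + m b d \<and> m d (a + b) = m d a + m d b \<and>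
           m (m a b) d = m a (m b d)))"

definition fd_module ::
  "nat \<Rightarrow> ('k::field vec \<Rightarrow> 'k vec \<Rightarrow> 'k vec) \<Rightarrow> 'k vec \<Rightarrow> nat \<Rightarrow> ('k vec \<Rightarrow> 'k mat) \<Rightarrow> bool" where
  "fd_module n m e d \<rho> \<longleftrightarrow>
     \<rho> e = 1\<^sub>m d \<and>
     (\<forall>a \<in> carrier_vec n.
        \<rho> a \<in> carrier_mat d d \<and> (\<forall>c. \<rho> (c \<cdot>\<^sub>v a) = c \<cdot>\<^sub>m \<rho> a) \<and>
        (\<forall>b \<in> carrier_vec n. \<rho> (a + b) = \<rho> a + \<rho> b \<and> \<rho> (m a b) = \<rho> a * \<rho> b))"

definition fd_module_hom ::
  "nat \<Rightarrow> nat \<Rightarrow> ('k::field vec \<Rightarrow> 'k mat) \<Rightarrow> nat \<Rightarrow> ('k vec \<Rightarrow> 'k mat) \<Rightarrow> 'k mat set" where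
  "fd_module_hom n d \<rho> d' \<rho>' =
     {T \<in> carrier_mat d' d. \<forall>a \<in> carrier_vec n. T * \<rho> a = \<rho>' a * T}"

text \<open>A linear category is finite if there is a linear, fully faithful and essentially
  surjective functor \<open>F\<close> to the finite-dimensional modules over a finite-dimensional algebra.
  On objects, \<open>F\<close> is given by the dimension \<open>d X\<close> and the action \<open>\<rho> X\<close>.\<close>

definition finite_category :: "('k::field, 'o, 'm::ab_group_add) ribbon_data \<Rightarrow> bool" where
  "finite_category C \<longleftrightarrow>
     (\<exists>n m e (d :: 'o \<Rightarrow> nat) \<rho> (F :: 'o \<Rightarrow> 'o \<Rightarrow> 'm \<Rightarrow> 'k mat).
        fd_algebra n m e \<and>
        (\<forall>X. fd_module n m e (d X) (\<rho> X)) \<and>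
        (\<forall>X. F X X (ident C X) = 1\<^sub>m (d X)) \<and>
        (\<forall>X Y Z. \<forall>f \<in> hom C X Y. \<forall>g \<in> hom C Y Z.
           F X Z (g \<cdot>\<^bsub>C\<^esub> f) = F Y Z g * F X Y f) \<and>
        (\<forall>X Y. \<forall>f \<in> hom C X Y.
           (\<forall>g \<in> hom C X Y. F X Y (f + g) = F X Y f + F X Y g) \<and>
           (\<forall>c. F X Y (scale C c f) = c \<cdot>\<^sub>m F X Y f)) \<and>
        (\<forall>X Y. bij_betw (F X Y) (hom C X Y) (fd_module_hom n (d X) (\<rho> X) (d Y) (\<rho> Y))) \<and>
        (\<forall>d' \<rho>'. fd_module n m e d' \<rho>' \<longrightarrow>
           (\<exists>X. \<exists>S \<in> fd_module_hom n (d X) (\<rho> X) d' \<rho>'.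
                \<exists>T \<in> fd_module_hom n d' \<rho>' (d X) (\<rho> X).
                  T * S = 1\<^sub>m (d X) \<and> S * T = 1\<^sub>m d')))"


section \<open>Finite ribbon tensor categories\<close>

locale strict_monoidal_category = linear_category +
  assumes tensor_ob_assoc: "(X \<otimes>\<^sub>o Y) \<otimes>\<^sub>o Z = X \<otimes>\<^sub>o (Y \<otimes>\<^sub>o Z)"
    and tensor_ob_unit_left: "\<one>\<^sub>o \<otimes>\<^sub>o X = X"
    and tensor_ob_unit_right: "X \<otimes>\<^sub>o \<one>\<^sub>o = X"
    and tensor_in_hom: "f \<in> hom C X Y \<Longrightarrow> f' \<in> hom C X' Y' \<Longrightarrow>
          f \<otimes>\<^sub>m f' \<in> hom C (X \<otimes>\<^sub>o X') (Y \<otimes>\<^sub>o Y')"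
    and tensor_ident: "ident C X \<otimes>\<^sub>m ident C Y = ident C (X \<otimes>\<^sub>o Y)"
    and tensor_comp: "f \<in> hom C X Y \<Longrightarrow> g \<in> hom C Y Z \<Longrightarrow>
          f' \<in> hom C X' Y' \<Longrightarrow> g' \<in> hom C Y' Z' \<Longrightarrow>
          (g \<cdot> f) \<otimes>\<^sub>m (g' \<cdot> f') = (g \<otimes>\<^sub>m g') \<cdot> (f \<otimes>\<^sub>m f')"
    and tensor_assoc: "f \<in> hom C X Y \<Longrightarrow> f' \<in> hom C X' Y' \<Longrightarrow> f'' \<in> hom C X'' Y'' \<Longrightarrow>
          (f \<otimes>\<^sub>m f') \<otimes>\<^sub>m f'' = f \<otimes>\<^sub>m (f' \<otimes>\<^sub>m f'')"
    and tensor_unit_left: "f \<in> hom C X Y \<Longrightarrow> ident C \<one>\<^sub>o \<otimes>\<^sub>m f = f"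
    and tensor_unit_right: "f \<in> hom C X Y \<Longrightarrow> f \<otimes>\<^sub>m ident C \<one>\<^sub>o = f"
    and tensor_add_left: "f \<in> hom C X Y \<Longrightarrow> g \<in> hom C X Y \<Longrightarrow> f' \<in> hom C X' Y' \<Longrightarrow>
          (f + g) \<otimes>\<^sub>m f' = f \<otimes>\<^sub>m f' + g \<otimes>\<^sub>m f'"
    and tensor_add_right: "f \<in> hom C X Y \<Longrightarrow> g \<in> hom C X Y \<Longrightarrow> f' \<in> hom C X' Y' \<Longrightarrow>
          f' \<otimes>\<^sub>m (f + g) = f' \<otimes>\<^sub>m f + f' \<otimes>\<^sub>m g"
    and tensor_scale_left: "f \<in> hom C X Y \<Longrightarrow> f' \<in> hom C X' Y' \<Longrightarrow>
          scale C c f \<otimes>\<^sub>m f' = scale C c (f \<otimes>\<^sub>m f')"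
    and tensor_scale_right: "f \<in> hom C X Y \<Longrightarrow> f' \<in> hom C X' Y' \<Longrightarrow>
          f \<otimes>\<^sub>m scale C c f' = scale C c (f \<otimes>\<^sub>m f')"

text \<open>The left dual morphism \<open>f\<^sup>* : Y\<^sup>* \<rightarrow> X\<^sup>*\<close> of \<open>f : X \<rightarrow> Y\<close>.\<close>

definition dual_mor ::
  "('k, 'o, 'm) ribbon_data \<Rightarrow> 'o \<Rightarrow> 'o \<Rightarrow> 'm \<Rightarrow> 'm" where
  "dual_mor C X Y f =
     (ev C Y \<otimes>\<^sub>m\<^bsub>C\<^esub> ident C (dual C X)) \<cdot>\<^bsub>C\<^esub>
     (ident C (dual C Y) \<otimes>\<^sub>m\<^bsub>C\<^esub> f \<otimes>\<^sub>m\<^bsub>C\<^esub> ident C (dual C X)) \<cdot>\<^bsub>C\<^esub>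
     (ident C (dual C Y) \<otimes>\<^sub>m\<^bsub>C\<^esub> coev C X)"

text \<open>Strict pivotality: the canonical isomorphisms \<open>\<one>\<^sup>* \<cong> \<one>\<close> and
  \<open>Y\<^sup>* \<otimes> X\<^sup>* \<cong> (X \<otimes> Y)\<^sup>*\<close> and the pivotal structure \<open>X \<cong> X\<^sup>*\<^sup>*\<close> are
  identities. Hence the right duality is given by \<open>ev C (dual C X) : X \<otimes> X\<^sup>* \<rightarrow> \<one>\<close>
  and \<open>coev C (dual C X) : \<one> \<rightarrow> X\<^sup>* \<otimes> X\<close>.\<close>

locale strict_pivotal_category = strict_monoidal_category +
  assumes ev_in_hom: "ev C X \<in> hom C (dual C X \<otimes>\<^sub>o X) \<one>\<^sub>o"
    and coev_in_hom: "coev C X \<in> hom C \<one>\<^sub>o (X \<otimes>\<^sub>o dual C X)"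
    and zigzag: "(ident C X \<otimes>\<^sub>m ev C X) \<cdot> (coev C X \<otimes>\<^sub>m ident C X) = ident C X"
    and zigzag_dual: "(ev C X \<otimes>\<^sub>m ident C (dual C X)) \<cdot> (ident C (dual C X) \<otimes>\<^sub>m coev C X)
          = ident C (dual C X)"
    and dual_unit: "dual C \<one>\<^sub>o = \<one>\<^sub>o"
    and ev_unit: "ev C \<one>\<^sub>o = ident C \<one>\<^sub>o"
    and dual_tensor: "dual C (X \<otimes>\<^sub>o Y) = dual C Y \<otimes>\<^sub>o dual C X"
    and ev_tensor: "ev C (X \<otimes>\<^sub>o Y) =
          ev C Y \<cdot> (ident C (dual C Y) \<otimes>\<^sub>m ev C X \<otimes>\<^sub>m ident C Y)"
    and coev_tensor: "coev C (X \<otimes>\<^sub>o Y) =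
          (ident C X \<otimes>\<^sub>m coev C Y \<otimes>\<^sub>m ident C (dual C X)) \<cdot> coev C X"
    and dual_dual: "dual C (dual C X) = X"
    and dual_mor_dual_mor: "f \<in> hom C X Y \<Longrightarrow>
          dual_mor C (dual C Y) (dual C X) (dual_mor C X Y f) = f"

text \<open>The axiom \<open>twist_eq_partial_trace\<close> expresses that the pivotal structure is the one
  induced by the twist.\<close>

locale ribbon_category = strict_pivotal_category +
  assumes braid_iso: "is_iso C (X \<otimes>\<^sub>o Y) (Y \<otimes>\<^sub>o X) (braid C X Y)"
    and braid_natural: "f \<in> hom C X X' \<Longrightarrow> g \<in> hom C Y Y' \<Longrightarrow>
          braid C X' Y' \<cdot> (f \<otimes>\<^sub>m g) = (g \<otimes>\<^sub>m f) \<cdot> braid C X Y"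
    and hexagon_right: "braid C X (Y \<otimes>\<^sub>o Z) =
          (ident C Y \<otimes>\<^sub>m braid C X Z) \<cdot> (braid C X Y \<otimes>\<^sub>m ident C Z)"
    and hexagon_left: "braid C (X \<otimes>\<^sub>o Y) Z =
          (braid C X Z \<otimes>\<^sub>m ident C Y) \<cdot> (ident C X \<otimes>\<^sub>m braid C Y Z)"
    and twist_iso: "is_iso C X X (twist C X)"
    and twist_natural: "f \<in> hom C X Y \<Longrightarrow> twist C Y \<cdot> f = f \<cdot> twist C X"
    and twist_tensor: "twist C (X \<otimes>\<^sub>o Y) =
          braid C Y X \<cdot> braid C X Y \<cdot> (twist C X \<otimes>\<^sub>m twist C Y)"
    and twist_dual: "twist C (dual C X) = dual_mor C X X (twist C X)"
    and twist_eq_partial_trace: "twist C X =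
          (ident C X \<otimes>\<^sub>m ev C (dual C X)) \<cdot> (braid C X X \<otimes>\<^sub>m ident C (dual C X)) \<cdot>
          (ident C X \<otimes>\<^sub>m coev C X)"

locale finite_ribbon_tensor_category = ribbon_category +
  assumes finite_category: "finite_category C"
    and unit_simple: "simple_object C \<one>\<^sub>o"


section \<open>The coend, defect operators and modularity\<close>

context
  fixes C :: "('k::field, 'o, 'm::ab_group_add) ribbon_data" (structure)
begin

definition dinatural :: "'o \<Rightarrow> ('o \<Rightarrow> 'm) \<Rightarrow> bool" where
  "dinatural T j \<longleftrightarrow>
     (\<forall>X. j X \<in> hom C (dual C X \<otimes>\<^sub>o X) T) \<and>
     (\<forall>X Y. \<forall>f \<in> hom C X Y.
        j Y \<cdot> (ident C (dual C Y) \<otimes>\<^sub>m f) = j X \<cdot> (dual_mor C X Y f \<otimes>\<^sub>m ident C X))"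

definition is_coend :: "'o \<Rightarrow> ('o \<Rightarrow> 'm) \<Rightarrow> bool" where
  "is_coend L \<iota> \<longleftrightarrow>
     dinatural L \<iota> \<and>
     (\<forall>T j. dinatural T j \<longrightarrow> (\<exists>!h. h \<in> hom C L T \<and> (\<forall>X. h \<cdot> \<iota> X = j X)))"

definition coend_mult :: "'o \<Rightarrow> ('o \<Rightarrow> 'm) \<Rightarrow> 'm" where
  "coend_mult L \<iota> =
     (THE \<mu>. \<mu> \<in> hom C (L \<otimes>\<^sub>o L) L \<and>
        (\<forall>X Y. \<mu> \<cdot> (\<iota> X \<otimes>\<^sub>m \<iota> Y) =
           \<iota> (X \<otimes>\<^sub>o Y) \<cdot> (braid C (dual C X \<otimes>\<^sub>o X) (dual C Y) \<otimes>\<^sub>m ident C Y)))"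

definition hopf_pairing :: "'o \<Rightarrow> ('o \<Rightarrow> 'm) \<Rightarrow> 'm" where
  "hopf_pairing L \<iota> =
     (THE \<omega>. \<omega> \<in> hom C (L \<otimes>\<^sub>o L) \<one>\<^sub>o \<and>
        (\<forall>X Y. \<omega> \<cdot> (\<iota> X \<otimes>\<^sub>m \<iota> Y) =
           (ev C X \<otimes>\<^sub>m ev C Y) \<cdot>
           (ident C (dual C X) \<otimes>\<^sub>m (braid C (dual C Y) X \<cdot> braid C X (dual C Y)) \<otimes>\<^sub>m ident C Y)))"

definition nondegenerate_pairing :: "'o \<Rightarrow> 'm \<Rightarrow> bool" where
  "nondegenerate_pairing L \<omega> \<longleftrightarrow>
     is_iso C L (dual C L) ((\<omega> \<otimes>\<^sub>m ident C (dual C L)) \<cdot> (ident C L \<otimes>\<^sub>m coev C L))"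

definition internal_cocharacter :: "('o \<Rightarrow> 'm) \<Rightarrow> 'o \<Rightarrow> 'm" where
  "internal_cocharacter \<iota> D = \<iota> D \<cdot> coev C (dual C D)"

definition defect_operator :: "'o \<Rightarrow> ('o \<Rightarrow> 'm) \<Rightarrow> 'o \<Rightarrow> 'm" where
  "defect_operator L \<iota> D =
     coend_mult L \<iota> \<cdot> (internal_cocharacter \<iota> D \<otimes>\<^sub>m ident C L)"

text \<open>The algebra of endomorphisms of the regular right module of the coend.\<close>

definition End_coend :: "'o \<Rightarrow> ('o \<Rightarrow> 'm) \<Rightarrow> ('k, 'm) module" where
  "End_coend L \<iota> =
     \<lparr>carrier = {f \<in> hom C L L.
        f \<cdot> coend_mult L \<iota> = coend_mult L \<iota> \<cdot> (f \<otimes>\<^sub>m ident C L)},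
      monoid.mult = (\<lambda>f g. f \<cdot> g), one = ident C L,
      zero = 0, add = (+), smult = scale C\<rparr>"

end

text \<open>By finiteness a coend exists, and it is unique up to unique isomorphism compatible with
  the pairing, so it is irrelevant which one is used to state modularity.\<close>

locale modular_tensor_category = finite_ribbon_tensor_category +
  assumes hopf_pairing_nondegenerate:
    "is_coend C L \<iota> \<Longrightarrow> nondegenerate_pairing C L (hopf_pairing C L \<iota>)"


section \<open>Algebras over a field\<close>

text \<open>An algebra over a field, given as a type, is represented by the record type
  \<open>module\<close> of HOL-Algebra, which extends rings by a scalar multiplication.\<close>

definition is_subalgebra :: "('k, 'a) module \<Rightarrow> 'a set \<Rightarrow> bool" where
  "is_subalgebra A B \<longleftrightarrow>
     B \<subseteq> carrier A \<and> \<one>\<^bsub>A\<^esub> \<in> B \<and> \<zero>\<^bsub>A\<^esub> \<in> B \<and>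
     (\<forall>x \<in> B. \<forall>y \<in> B. x \<oplus>\<^bsub>A\<^esub> y \<in> B \<and> x \<otimes>\<^bsub>A\<^esub> y \<in> B) \<and>
     (\<forall>c. \<forall>x \<in> B. c \<odot>\<^bsub>A\<^esub> x \<in> B)"

definition generated_subalgebra :: "('k, 'a) module \<Rightarrow> 'a set \<Rightarrow> ('k, 'a) module" where
  "generated_subalgebra A S = A\<lparr>carrier := \<Inter> {B. is_subalgebra A B \<and> S \<subseteq> B}\<rparr>"

definition algebra_iso :: "('k, 'a) module \<Rightarrow> ('k, 'b) module \<Rightarrow> ('a \<Rightarrow> 'b) set" where
  "algebra_iso A B =
     {\<phi> \<in> ring_iso A B. \<forall>c. \<forall>x \<in> carrier A. \<phi> (c \<odot>\<^bsub>A\<^esub> x) = c \<odot>\<^bsub>B\<^esub> \<phi> x}"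


section \<open>The linearised Grothendieck ring\<close>

text \<open>The free abelian group on a monoid, with the biadditive extension of the product.\<close>

definition monoid_ring :: "('a, 'b) monoid_scheme \<Rightarrow> ('a \<Rightarrow>\<^sub>0 int) ring" where
  "monoid_ring M =
     \<lparr>carrier = {u. Poly_Mapping.keys u \<subseteq> carrier M},
      monoid.mult = (\<lambda>u v. \<Sum>x \<in> Poly_Mapping.keys u. \<Sum>y \<in> Poly_Mapping.keys v.
        Poly_Mapping.single (x \<otimes>\<^bsub>M\<^esub> y) (Poly_Mapping.lookup u x * Poly_Mapping.lookup v y)),
      one = Poly_Mapping.single \<one>\<^bsub>M\<^esub> 1,
      zero = 0, add = (+)\<rparr>"

text \<open>The Grothendieck ring: the free abelian group on the objects, modulo the subgroup generated
  by \<open>[Y] - [X] - [Z]\<close> for all short exact sequences \<open>0 \<rightarrow> X \<rightarrow> Y \<rightarrow> Z \<rightarrow> 0\<close>, with the product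
  induced by the tensor product. Isomorphic objects have equal classes
  (take \<open>Z\<close> to be a zero object).\<close>

definition object_monoid :: "('k, 'o, 'm) ribbon_data \<Rightarrow> 'o monoid" where
  "object_monoid C = \<lparr>carrier = UNIV, monoid.mult = tensor_ob C, one = unit C\<rparr>"

definition grothendieck_relations ::
  "('k::field, 'o, 'm::ab_group_add) ribbon_data \<Rightarrow> ('o \<Rightarrow>\<^sub>0 int) set" where
  "grothendieck_relations C =
     {Poly_Mapping.single Y 1 - Poly_Mapping.single X 1 - Poly_Mapping.single Z 1
       | X Y Z. \<exists>f g. short_exact C X Y Z f g}"

definition Gr :: "('k::field, 'o, 'm::ab_group_add) ribbon_data \<Rightarrow> ('o \<Rightarrow>\<^sub>0 int) set ring" where
  "Gr C = monoid_ring (object_monoid C) Quot group_closure (grothendieck_relations C)"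

text \<open>The tensor product over the integers of a field with a ring \<open>R\<close>: the free abelian group on
  pairs \<open>(c, x)\<close> modulo biadditivity, with \<open>(c \<otimes> x) (c' \<otimes> x') = c c' \<otimes> x x'\<close>. The scalar
  \<open>c\<close> acts as multiplication by \<open>c \<otimes> 1\<close>.\<close>

definition field_monoid :: "'k::field monoid" where
  "field_monoid = \<lparr>carrier = UNIV, monoid.mult = (*), one = 1\<rparr>"

definition tensor_relations :: "('a, 'b) ring_scheme \<Rightarrow> (('k::field \<times> 'a) \<Rightarrow>\<^sub>0 int) set" where
  "tensor_relations R =
     {Poly_Mapping.single (c + c', x) 1
        - Poly_Mapping.single (c, x) 1 - Poly_Mapping.single (c', x) 1
       | c c' x. x \<in> carrier R} \<union>
     {Poly_Mapping.single (c, x \<oplus>\<^bsub>R\<^esub> y) 1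
        - Poly_Mapping.single (c, x) 1 - Poly_Mapping.single (c, y) 1
       | c x y. x \<in> carrier R \<and> y \<in> carrier R}"

definition base_change_ring ::
  "('a, 'b) ring_scheme \<Rightarrow> (('k::field \<times> 'a) \<Rightarrow>\<^sub>0 int) set ring" where
  "base_change_ring R = monoid_ring (field_monoid \<times>\<times> R) Quot group_closure (tensor_relations R)"

definition pure_tensor ::
  "('a, 'b) ring_scheme \<Rightarrow> 'k::field \<Rightarrow> 'a \<Rightarrow> (('k \<times> 'a) \<Rightarrow>\<^sub>0 int) set" where
  "pure_tensor R c x =
     group_closure (tensor_relations R)
       +>\<^bsub>monoid_ring (field_monoid \<times>\<times> R)\<^esub> Poly_Mapping.single (c, x) 1"

definition base_change ::
  "('a, 'b) ring_scheme \<Rightarrow> ('k::field, (('k \<times> 'a) \<Rightarrow>\<^sub>0 int) set) module" where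
  "base_change R = ring.extend (base_change_ring R)
     \<lparr>smult = (\<lambda>c t. pure_tensor R c \<one>\<^bsub>R\<^esub> \<otimes>\<^bsub>base_change_ring R\<^esub> t)\<rparr>"

definition linearised_Gr ::
  "('k::field, 'o, 'm::ab_group_add) ribbon_data
    \<Rightarrow> ('k, (('k \<times> ('o \<Rightarrow>\<^sub>0 int) set) \<Rightarrow>\<^sub>0 int) set) module" where
  "linearised_Gr C = base_change (Gr C)"

end

theory Submission
  imports Defs
begin

text \<open>
  Since \<open>\<O> D\<close> is left multiplication by the point \<open>\<chi> D\<close> of \<open>L\<close>, the rule \<open>D \<mapsto> \<O> D\<close> is multiplicative
  because \<open>\<mu> \<circ> (\<chi> D \<otimes> \<chi> E) = \<chi> (D \<otimes> E)\<close>, and it is additive on short exact sequences: after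
  composition with an epimorphism from a projective object onto the unit, the cocharacter becomes a
  trace with values in \<open>L\<close>, and traces are additive along filtrations. This gives a map from the
  linearised Grothendieck ring onto the generated algebra, and the classes of simple objects span
  its source. What remains is the linear independence of the cocharacters of pairwise inequivalent
  simple objects. Let \<open>G\<close> be a projective generator. Every endomorphism \<open>b\<close> of \<open>G\<close> lifts through
  \<open>G \<otimes> r\<close>, with \<open>r : G \<rightarrow> 1\<close> epi, to some \<open>w : G \<rightarrow> G \<otimes> G\<close>; the traces over
  \<open>Hom(G, X)\<close> defined by \<open>w\<close> are cyclic in \<open>X\<close>, hence form a dinatural family and factor through
  the coend \<open>L\<close>. So a linear relation between cocharacters is a linear relation between the
  characters of the \<open>End(G)\<close>-modules \<open>Hom(G, S)\<close>. In characteristic zero an idempotent of \<open>End(G)\<close>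
  that kills all but one of these simple modules shows that the relation is trivial.
\<close>

section \<open>Finite linear categories\<close>

text \<open>Finiteness supplies only an equivalence with matrix modules, so kernels, quotients,
  images and projectivity have to be rebuilt from the one object \<open>G\<close>;
  \<open>submodule_short_exact\<close> is the tool for this. Precomposition with \<open>r\<close> is
  what makes traces additive: a short exact sequence need not split, so the identity of its middle
  object has no block form, but the tensor product of any object with \<open>G\<close> is
  projective, so \<open>id \<otimes> r\<close> lifts from the quotient. As \<open>r\<close> is epi,
  nothing about \<open>\<chi> D\<close> is lost. Simple objects are compared by their class in the
  Grothendieck group: different classes already exclude nonzero maps by Schur's lemma, and equal
  ones can be identified at once. Operators inherit independence from cocharacters because composing
  \<open>\<O> D\<close> with the unit of \<open>L\<close> returns \<open>\<chi> D\<close>.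
  Independence is then used twice, with integer and with scalar coefficients. It identifies the
  subgroups of relations as kernels of ring homomorphisms, which is also why the two quotients are
  rings.\<close>

definition linear_map_on ::
  "('k \<Rightarrow> 'a::plus \<Rightarrow> 'a) \<Rightarrow> ('k \<Rightarrow> 'b::plus \<Rightarrow> 'b) \<Rightarrow> 'a set \<Rightarrow> ('a \<Rightarrow> 'b) \<Rightarrow> bool" where
  "linear_map_on s t V f \<longleftrightarrow>
     (\<forall>x\<in>V. \<forall>y\<in>V. f (x + y) = f x + f y) \<and> (\<forall>c. \<forall>x\<in>V. f (s c x) = t c (f x))"

lemma linear_map_onI:
  "(\<And>x y. x \<in> V \<Longrightarrow> y \<in> V \<Longrightarrow> f (x + y) = f x + f y) \<Longrightarrow>
   (\<And>c x. x \<in> V \<Longrightarrow> f (s c x) = t c (f x)) \<Longrightarrow> linear_map_on s t V f"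
  by (simp add: linear_map_on_def)

lemma linear_map_onD:
  assumes "linear_map_on s t V f"
  shows "x \<in> V \<Longrightarrow> y \<in> V \<Longrightarrow> f (x + y) = f x + f y" "x \<in> V \<Longrightarrow> f (s c x) = t c (f x)"
  using assms by (auto simp: linear_map_on_def)

section \<open>Matrices and coordinates of linear maps\<close>

lemma mat_eq_if_mult_vec_eq:
  fixes A B :: "'k::field mat"
  assumes A: "A \<in> carrier_mat nr nc" and B: "B \<in> carrier_mat nr nc"
    and eq: "\<And>x. x \<in> carrier_vec nc \<Longrightarrow> A *\<^sub>v x = B *\<^sub>v x"
  shows "A = B"
proof (rule eq_matI)
  fix i j assume ij: "i < dim_row B" "j < dim_col B"
  have "(A *\<^sub>v unit_vec nc j) $ i = (B *\<^sub>v unit_vec nc j) $ i" by (simp add: eq)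
  then show "A $$ (i, j) = B $$ (i, j)" using A B ij by simp
qed (use A B in auto)

lemma smult_mat_mult_vec:
  fixes A :: "'k::field mat"
  assumes "A \<in> carrier_mat nr nc" "x \<in> carrier_vec nc"
  shows "(c \<cdot>\<^sub>m A) *\<^sub>v x = c \<cdot>\<^sub>v (A *\<^sub>v x)"
  using assms by auto

text \<open>Gives matrices for maps that are only known to be linear on
  \<open>carrier_vec nc\<close>, so that the matrix modules of \<open>finite_category\<close> can be
  compared with abstract ones.\<close>

lemma mat_of_linear_map:
  fixes \<phi> :: "'k::field vec \<Rightarrow> 'k vec"
  assumes lin: "linear_map_on (\<cdot>\<^sub>v) (\<cdot>\<^sub>v) (carrier_vec nc) \<phi>"
    and car: "\<And>x. x \<in> carrier_vec nc \<Longrightarrow> \<phi> x \<in> carrier_vec nr"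
  obtains M where "M \<in> carrier_mat nr nc" "\<And>x. x \<in> carrier_vec nc \<Longrightarrow> M *\<^sub>v x = \<phi> x"
proof -
  let ?M = "mat nr nc (\<lambda>(i, j). \<phi> (unit_vec nc j) $ i)"
  have "?M *\<^sub>v x = \<phi> x" if x: "x \<in> carrier_vec nc" for x
  proof -
    \<comment> \<open>\<open>?t k\<close> is \<open>x\<close> truncated to its first
      \<open>k\<close> entries; linearity then adds one unit vector at a time.\<close>
    let ?t = "\<lambda>k. vec nc (\<lambda>i. if i < k then x $ i else 0)"
    have z: "\<phi> (0\<^sub>v nc) = 0\<^sub>v nr"
    proof -
      have "\<phi> (0 \<cdot>\<^sub>v 0\<^sub>v nc) = 0 \<cdot>\<^sub>v \<phi> (0\<^sub>v nc)" by (rule linear_map_onD(2)[OF lin]) simp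
      moreover have "0 \<cdot>\<^sub>v 0\<^sub>v nc = (0\<^sub>v nc :: 'k vec)" "0 \<cdot>\<^sub>v \<phi> (0\<^sub>v nc) = 0\<^sub>v nr"
        using car[of "0\<^sub>v nc"] by auto
      ultimately show ?thesis by simp
    qed
    have "k \<le> nc \<Longrightarrow> i < nr \<Longrightarrow> \<phi> (?t k) $ i = (\<Sum>j<k. \<phi> (unit_vec nc j) $ i * x $ j)" for k i
    proof (induction k)
      case 0
      have "?t 0 = 0\<^sub>v nc" by auto
      then show ?case using z 0 by simp
    next
      case (Suc k)
      have "?t (Suc k) = ?t k + x $ k \<cdot>\<^sub>v unit_vec nc k"
        using Suc.prems x by (intro eq_vecI) (auto simp: less_Suc_eq)
      then have "\<phi> (?t (Suc k)) = \<phi> (?t k) + x $ k \<cdot>\<^sub>v \<phi> (unit_vec nc k)"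
        using linear_map_onD[OF lin] by simp
      then show ?case using Suc car[of "?t k"] car[of "unit_vec nc k"] by auto
    qed
    from this[of nc] have "\<phi> (?t nc) $ i = (\<Sum>j<nc. \<phi> (unit_vec nc j) $ i * x $ j)" if "i < nr" for i
      using that by simp
    moreover have "?t nc = x" using x by auto
    ultimately show ?thesis
      using car[OF x] x by (intro eq_vecI) (auto simp: scalar_prod_def lessThan_atLeast0)
  qed
  then show thesis by (intro that[of ?M]) auto
qed

context vector_space
begin

text \<open>\<open>finite_category\<close> knows modules only as matrix representations, so a module
  given on an abstract subspace \<open>V\<close> is carried over along these coordinates.\<close>

lemma coordinate_isomorphism:
  assumes V: "subspace V" "V \<subseteq> span B" "finite B"
  obtains n and \<kappa> :: "'b \<Rightarrow> 'a vec" where "linear_map_on scale (\<cdot>\<^sub>v) V \<kappa>" "bij_betw \<kappa> V (carrier_vec n)"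
proof -
  obtain B' where B': "B' \<subseteq> V" "independent B'" "V \<subseteq> span B'"
    using maximal_independent_subset by blast
  have finB': "finite B'" using independent_span_bound[of B B'] B' V by blast
  have span: "span B' = V" using B' V(1) span_minimal by blast
  obtain b where b: "bij_betw b {0..<card B'} B'" using ex_bij_betw_nat_finite[OF finB'] by blast
  let ?\<kappa> = "\<lambda>v. vec (card B') (\<lambda>i. representation B' v (b i))"
  have lin: "linear_map_on scale (\<cdot>\<^sub>v) V ?\<kappa>"
  proof (rule linear_map_onI)
    fix x y assume "x \<in> V" "y \<in> V"
    then have xy: "x \<in> span B'" "y \<in> span B'" using span by auto
    show "?\<kappa> (x + y) = ?\<kappa> x + ?\<kappa> y"
      by (intro eq_vecI) (simp_all add: representation_add[OF B'(2) xy(2) xy(1)])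
    show "?\<kappa> (scale c x) = c \<cdot>\<^sub>v ?\<kappa> x" for c
      by (intro eq_vecI) (simp_all add: representation_scale[OF B'(2) xy(1)])
  qed
  have rep: "(\<Sum>i<card B'. scale (representation B' v (b i)) (b i)) = v" if "v \<in> V" for v
  proof -
    have "(\<Sum>i<card B'. scale (representation B' v (b i)) (b i)) = (\<Sum>x\<in>B'. scale (representation B' v x) x)"
      using sum.reindex_bij_betw[OF b, of "\<lambda>x. scale (representation B' v x) x"]
        by (simp add: lessThan_atLeast0)
    then show ?thesis using sum_representation_eq[of B' v B'] B' that finB' by auto
  qed
  have "bij_betw ?\<kappa> V (carrier_vec (card B'))"
  proof (rule bij_betw_imageI)
    show "inj_on ?\<kappa> V"
    proof (rule inj_onI)
      fix v w assume vw: "v \<in> V" "w \<in> V" "?\<kappa> v = ?\<kappa> w"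
      have "representation B' v (b i) = representation B' w (b i)" if "i < card B'" for i
        using arg_cong[OF vw(3), of "\<lambda>u. u $ i"] that by simp
      then have "(\<Sum>i<card B'. scale (representation B' v (b i)) (b i)) =
          (\<Sum>i<card B'. scale (representation B' w (b i)) (b i))" by simp
      then show "v = w" unfolding rep[OF vw(1)] rep[OF vw(2)] .
    qed
    show "?\<kappa> ` V = carrier_vec (card B')"
    proof (intro equalityI subsetI)
      fix x :: "'a vec" assume x: "x \<in> carrier_vec (card B')"
      let ?v = "\<Sum>i<card B'. scale (x $ i) (b i)"
      have bV: "b i \<in> V" "b i \<in> B'" if "i < card B'" for i using b B' that by (auto simp: bij_betw_def)
      have vV: "?v \<in> V" using V(1) bV by (intro subspace_sum subspace_scale) auto
      let ?f = "\<lambda>c. if c \<in> B' then x $ the_inv_into {0..<card B'} b c else 0"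
      have inv: "the_inv_into {0..<card B'} b (b i) = i" if "i < card B'" for i
        using b that by (auto simp: bij_betw_def the_inv_into_f_f)
      have "representation B' ?v = ?f"
      proof (rule representation_eqI)
        have "(\<Sum>c | ?f c \<noteq> 0. scale (?f c) c) = (\<Sum>c\<in>B'. scale (?f c) c)"
          by (rule sum.mono_neutral_left) (auto simp: finB')
        also have "\<dots> = (\<Sum>i<card B'. scale (?f (b i)) (b i))"
          using sum.reindex_bij_betw[OF b, of "\<lambda>c. scale (?f c) c"] by (simp add: lessThan_atLeast0)
        also have "\<dots> = ?v" using bV inv by (intro sum.cong) auto
        finally show "(\<Sum>c | ?f c \<noteq> 0. scale (?f c) c) = ?v" .
        show "finite {c. ?f c \<noteq> 0}" using finB' by (auto intro: finite_subset[of _ B'])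
      qed (use B' vV in \<open>auto split: if_splits\<close>)
      then have "?\<kappa> ?v = x" using bV inv x by (intro eq_vecI) auto
      then show "x \<in> ?\<kappa> ` V" using imageI[OF vV, of ?\<kappa>] by (simp only:)
    qed auto
  qed
  then show thesis using lin that by blast
qed

end

text \<open>An object \<open>G\<close> such that \<open>X \<mapsto> Hom(G, X)\<close> is an equivalence to the finite-dimensional right
  modules over \<open>End(G)\<close>.\<close>

locale progenerated_category = linear_category C
  for C :: "('k::field, 'o, 'm::ab_group_add) ribbon_data" (structure) and G :: 'o +
  assumes hom_finite_dim: "\<exists>B. finite B \<and> hom C G X \<subseteq> span B"
    and faithful: "f \<in> hom C X Y \<Longrightarrow> (\<And>k. k \<in> hom C G X \<Longrightarrow> f \<cdot> k = 0) \<Longrightarrow> f = 0"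
    and full: "linear_map_on (scale C) (scale C) (hom C G X) l \<Longrightarrow>
       (\<And>k. k \<in> hom C G X \<Longrightarrow> l k \<in> hom C G Y) \<Longrightarrow>
       (\<And>k a. k \<in> hom C G X \<Longrightarrow> a \<in> hom C G G \<Longrightarrow> l (k \<cdot> a) = l k \<cdot> a) \<Longrightarrow>
       \<exists>f\<in>hom C X Y. \<forall>k\<in>hom C G X. f \<cdot> k = l k"
    and realize: "subspace V \<Longrightarrow> V \<subseteq> span B \<Longrightarrow> finite B \<Longrightarrow>
       (\<And>v a. v \<in> V \<Longrightarrow> a \<in> hom C G G \<Longrightarrow> \<alpha> v a \<in> V) \<Longrightarrow>
       (\<And>a. a \<in> hom C G G \<Longrightarrow> linear_map_on (scale C) (scale C) V (\<lambda>v. \<alpha> v a)) \<Longrightarrow>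
       (\<And>v. v \<in> V \<Longrightarrow> linear_map_on (scale C) (scale C) (hom C G G) (\<alpha> v)) \<Longrightarrow>
       (\<And>v. v \<in> V \<Longrightarrow> \<alpha> v (ident C G) = v) \<Longrightarrow>
       (\<And>v a b. v \<in> V \<Longrightarrow> a \<in> hom C G G \<Longrightarrow> b \<in> hom C G G \<Longrightarrow> \<alpha> (\<alpha> v a) b = \<alpha> v (a \<cdot> b)) \<Longrightarrow>
       \<exists>Z \<Psi>. linear_map_on (scale C) (scale C) (hom C G Z) \<Psi> \<and> bij_betw \<Psi> (hom C G Z) V \<and>
         (\<forall>k\<in>hom C G Z. \<forall>a\<in>hom C G G. \<Psi> (k \<cdot> a) = \<alpha> (\<Psi> k) a)"

section \<open>Existence of a progenerator\<close>

lemma linear_map_on_inv_into: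
  assumes f: "linear_map_on s t V f" "bij_betw f V W"
    and V: "\<And>x y. x \<in> V \<Longrightarrow> y \<in> V \<Longrightarrow> x + y \<in> V" "\<And>c x. x \<in> V \<Longrightarrow> s c x \<in> V"
  shows "linear_map_on t s W (inv_into V f)"
proof -
  have *: "inv_into V f (f x) = x" if "x \<in> V" for x
    using f(2) that by (simp add: bij_betw_def)
  show ?thesis
  proof (rule linear_map_onI)
    fix x y assume "x \<in> W" "y \<in> W"
    then obtain a b where "a \<in> V" "b \<in> V" "x = f a" "y = f b" using f(2) by (auto simp: bij_betw_def)
    then show "inv_into V f (x + y) = inv_into V f x + inv_into V f y"
      by (simp add: * V linear_map_onD(1)[OF f(1), symmetric])
  next
    fix c x assume "x \<in> W"
    then obtain a where "a \<in> V" "x = f a" using f(2) by (auto simp: bij_betw_def)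
    then show "inv_into V f (t c x) = s c (inv_into V f x)"
      by (simp add: * V linear_map_onD(2)[OF f(1), symmetric])
  qed
qed

text \<open>Left multiplication of the algebra on itself, written in matrices. Essential
  surjectivity turns this module into the object \<open>G\<close>.\<close>

lemma regular_module:
  fixes m :: "'k::field vec \<Rightarrow> 'k vec \<Rightarrow> 'k vec"
  assumes A: "fd_algebra n m e"
  obtains \<rho> where "fd_module n m e n \<rho>"
    and "\<And>a x. a \<in> carrier_vec n \<Longrightarrow> x \<in> carrier_vec n \<Longrightarrow> \<rho> a *\<^sub>v x = m a x"
proof -
  have "\<exists>M. M \<in> carrier_mat n n \<and> (\<forall>x\<in>carrier_vec n. M *\<^sub>v x = m a x)" if "a \<in> carrier_vec n" for a
  proof -
    have "linear_map_on (\<cdot>\<^sub>v) (\<cdot>\<^sub>v) (carrier_vec n) (m a)"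
      using A that by (auto simp: fd_algebra_def intro!: linear_map_onI)
    moreover have "m a x \<in> carrier_vec n" if "x \<in> carrier_vec n" for x
      using A that \<open>a \<in> carrier_vec n\<close> by (simp add: fd_algebra_def)
    ultimately show ?thesis using mat_of_linear_map[of n "m a" n] by metis
  qed
  then obtain \<rho> where \<rho>: "\<And>a. a \<in> carrier_vec n \<Longrightarrow> \<rho> a \<in> carrier_mat n n"
      "\<And>a x. a \<in> carrier_vec n \<Longrightarrow> x \<in> carrier_vec n \<Longrightarrow> \<rho> a *\<^sub>v x = m a x"
    by metis
  have e: "e \<in> carrier_vec n" and mc: "\<And>a b. a \<in> carrier_vec n \<Longrightarrow> b \<in> carrier_vec n \<Longrightarrow> m a b \<in> carrier_vec n"
    using A by (auto simp: fd_algebra_def)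
  have "fd_module n m e n \<rho>"
    unfolding fd_module_def
  proof (intro conjI ballI allI)
    show "\<rho> e = 1\<^sub>m n"
      by (rule mat_eq_if_mult_vec_eq[of _ n n]) (use A \<rho> e in \<open>auto simp: fd_algebra_def\<close>)
    fix a :: "'k vec" assume a: "a \<in> carrier_vec n"
    then show "\<rho> a \<in> carrier_mat n n" by (rule \<rho>)
    show "\<rho> (c \<cdot>\<^sub>v a) = c \<cdot>\<^sub>m \<rho> a" for c
    proof (rule mat_eq_if_mult_vec_eq[of _ n n])
      fix x :: "'k vec" assume x: "x \<in> carrier_vec n"
      have "(c \<cdot>\<^sub>m \<rho> a) *\<^sub>v x = c \<cdot>\<^sub>v (\<rho> a *\<^sub>v x)"
        using \<rho>(1)[OF a] x by auto
      then show "\<rho> (c \<cdot>\<^sub>v a) *\<^sub>v x = (c \<cdot>\<^sub>m \<rho> a) *\<^sub>v x"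
        using \<rho> a x A by (simp add: fd_algebra_def)
    qed (use \<rho> a in auto)
    fix b :: "'k vec" assume b: "b \<in> carrier_vec n"
    show "\<rho> (a + b) = \<rho> a + \<rho> b"
    proof (rule mat_eq_if_mult_vec_eq[of _ n n])
      fix x :: "'k vec" assume x: "x \<in> carrier_vec n"
      show "\<rho> (a + b) *\<^sub>v x = (\<rho> a + \<rho> b) *\<^sub>v x"
        using \<rho> a b x A by (simp add: fd_algebra_def add_mult_distrib_mat_vec[of _ n n])
    qed (use \<rho> a b in auto)
    show "\<rho> (m a b) = \<rho> a * \<rho> b"
    proof (rule mat_eq_if_mult_vec_eq[of _ n n])
      fix x :: "'k vec" assume x: "x \<in> carrier_vec n"
      have "(\<rho> a * \<rho> b) *\<^sub>v x = \<rho> a *\<^sub>v (\<rho> b *\<^sub>v x)"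
        using \<rho>(1)[OF a] \<rho>(1)[OF b] x by (rule assoc_mult_mat_vec)
      then show "\<rho> (m a b) *\<^sub>v x = (\<rho> a * \<rho> b) *\<^sub>v x"
        using \<rho> a b x A mc by (simp add: fd_algebra_def)
    next
      show "\<rho> a * \<rho> b \<in> carrier_mat n n" using \<rho>(1)[OF a] \<rho>(1)[OF b] by simp
    qed (use \<rho> a b mc in auto)
  qed
  then show thesis using that \<rho> by blast
qed

text \<open>\<open>f 0 = 0\<close> is a premise because the target is only a monoid with an
  arbitrary scaling \<open>t\<close>, so it does not follow from linearity. It settles the empty sum
  and infinite \<open>J\<close>.\<close>

lemma (in vector_space) linear_map_on_sum:
  fixes f :: "'b \<Rightarrow> 'c::comm_monoid_add"
  assumes V: "subspace V" and f: "linear_map_on scale t V f" and f0: "f 0 = 0"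
    and x: "\<And>j. j \<in> J \<Longrightarrow> x j \<in> V"
  shows "f (\<Sum>j\<in>J. scale (c j) (x j)) = (\<Sum>j\<in>J. t (c j) (f (x j)))"
  using x
proof (induction J rule: infinite_finite_induct)
  case (insert j J)
  have "(\<Sum>j\<in>J. scale (c j) (x j)) \<in> V" using V insert by (intro subspace_sum subspace_scale) auto
  then show ?case using insert V linear_map_onD[OF f] by (simp add: subspace_scale)
qed (simp_all add: f0)

context linear_category
begin

lemma hom_zero: "0 \<in> hom C X Y"
  using hom_subspace by (rule subspace_0)

lemma hom_add: "f \<in> hom C X Y \<Longrightarrow> g \<in> hom C X Y \<Longrightarrow> f + g \<in> hom C X Y"
  using hom_subspace by (rule subspace_add)

lemma hom_diff: "f \<in> hom C X Y \<Longrightarrow> g \<in> hom C X Y \<Longrightarrow> f - g \<in> hom C X Y"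
  using hom_subspace by (rule subspace_diff)

lemma hom_scale: "f \<in> hom C X Y \<Longrightarrow> scale C c f \<in> hom C X Y"
  using hom_subspace by (rule subspace_scale)

lemma hom_sum: "(\<And>i. i \<in> I \<Longrightarrow> f i \<in> hom C X Y) \<Longrightarrow> sum f I \<in> hom C X Y"
  using hom_subspace by (rule subspace_sum)

lemma comp_zero_right: "g \<in> hom C Y Z \<Longrightarrow> g \<cdot> 0 = 0"
  using comp_scale_right[OF hom_zero, of g _ _ 0] by simp

lemma comp_zero_left: "f \<in> hom C X Y \<Longrightarrow> 0 \<cdot> f = 0"
  using comp_scale_left[OF _ hom_zero, of f _ _ 0] by simp

lemma comp_linear_right: "g \<in> hom C Y Z \<Longrightarrow> linear_map_on (scale C) (scale C) (hom C X Y) (\<lambda>f. g \<cdot> f)"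
  by (intro linear_map_onI comp_add_right comp_scale_right)

lemma comp_linear_left: "f \<in> hom C X Y \<Longrightarrow> linear_map_on (scale C) (scale C) (hom C Y Z) (\<lambda>g. g \<cdot> f)"
  by (intro linear_map_onI comp_add_left comp_scale_left)

lemma comp_diff_right:
  assumes "f \<in> hom C X Y" "f' \<in> hom C X Y" "g \<in> hom C Y Z"
  shows "g \<cdot> (f - f') = g \<cdot> f - g \<cdot> f'"
  using comp_add_right[OF hom_diff[OF assms(1,2)] assms(2,3)] by (simp add: eq_diff_eq)

lemma comp_diff_left:
  assumes "f \<in> hom C X Y" "g \<in> hom C Y Z" "g' \<in> hom C Y Z"
  shows "(g - g') \<cdot> f = g \<cdot> f - g' \<cdot> f"
  using comp_add_left[OF assms(1) hom_diff[OF assms(2,3)] assms(3)] by (simp add: eq_diff_eq)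

lemma comp_sum_left:
  assumes "\<And>i. i \<in> I \<Longrightarrow> g i \<in> hom C Y Z" "f \<in> hom C X Y"
  shows "(\<Sum>i\<in>I. scale C (c i) (g i)) \<cdot> f = (\<Sum>i\<in>I. scale C (c i) (g i \<cdot> f))"
  using assms by (intro linear_map_on_sum[OF hom_subspace comp_linear_left]) (auto simp: comp_zero_left)

end

text \<open>\<open>G\<close> is the object of the regular module. A homomorphism from the regular
  module is determined by the image of the unit \<open>e\<close>, and this image is arbitrary, so
  \<open>Hom(G, X)\<close> becomes the underlying vector space of the module of \<open>X\<close>;
  composition with endomorphisms of \<open>G\<close> becomes the module action.\<close>

theorem (in linear_category) progenerated_if_finite:
  assumes "finite_category C"
  obtains G where "progenerated_category C G"
proof -
  obtain n m e d \<rho> and F :: "'o \<Rightarrow> 'o \<Rightarrow> 'm \<Rightarrow> 'k mat" where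
    A: "fd_algebra n m e" and
    mod: "\<forall>X. fd_module n m e (d X) (\<rho> X)" and
    Fid: "\<forall>X. F X X (ident C X) = 1\<^sub>m (d X)" and
    Fcomp: "\<forall>X Y Z. \<forall>f \<in> hom C X Y. \<forall>g \<in> hom C Y Z. F X Z (g \<cdot> f) = F Y Z g * F X Y f" and
    Flin: "\<forall>X Y. \<forall>f \<in> hom C X Y. (\<forall>g \<in> hom C X Y. F X Y (f + g) = F X Y f + F X Y g) \<and>
       (\<forall>c. F X Y (scale C c f) = c \<cdot>\<^sub>m F X Y f)" and
    Fbij: "\<forall>X Y. bij_betw (F X Y) (hom C X Y) (fd_module_hom n (d X) (\<rho> X) (d Y) (\<rho> Y))" and
    Fess: "\<forall>d' \<rho>'. fd_module n m e d' \<rho>' \<longrightarrow>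
       (\<exists>X. \<exists>S \<in> fd_module_hom n (d X) (\<rho> X) d' \<rho>'. \<exists>T \<in> fd_module_hom n d' \<rho>' (d X) (\<rho> X).
          T * S = 1\<^sub>m (d X) \<and> S * T = 1\<^sub>m d')"
    using assms unfolding finite_category_def by (elim exE conjE) rule
  note mod = mod[rule_format] and Fid = Fid[rule_format] and Fcomp = Fcomp[rule_format]
    and Fbij = Fbij[rule_format] and Fess = Fess[rule_format]
  have Fadd: "F X Y (f + g) = F X Y f + F X Y g" if "f \<in> hom C X Y" "g \<in> hom C X Y" for X Y f g
    using Flin that by blast
  have Fscale: "F X Y (scale C c f) = c \<cdot>\<^sub>m F X Y f" if "f \<in> hom C X Y" for X Y f c
    using Flin that by blast
  obtain \<rho>0 where mod0: "fd_module n m e n \<rho>0"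
    and \<rho>0: "\<And>a x. a \<in> carrier_vec n \<Longrightarrow> x \<in> carrier_vec n \<Longrightarrow> \<rho>0 a *\<^sub>v x = m a x"
    using regular_module[OF A] by blast
  have e: "e \<in> carrier_vec n" and me: "\<And>x. x \<in> carrier_vec n \<Longrightarrow> m x e = x"
    and mc: "\<And>a b. a \<in> carrier_vec n \<Longrightarrow> b \<in> carrier_vec n \<Longrightarrow> m a b \<in> carrier_vec n"
    using A by (auto simp: fd_algebra_def)
  obtain G S T where S: "S \<in> fd_module_hom n (d G) (\<rho> G) n \<rho>0"
    and T: "T \<in> fd_module_hom n n \<rho>0 (d G) (\<rho> G)" and TS: "T * S = 1\<^sub>m (d G)" and ST: "S * T = 1\<^sub>m n"
    using Fess[OF mod0] by blast
  have Sc: "S \<in> carrier_mat n (d G)" and Tc: "T \<in> carrier_mat (d G) n"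
    using S T by (auto simp: fd_module_hom_def)
  have \<rho>c: "\<rho> X a \<in> carrier_mat (d X) (d X)" if "a \<in> carrier_vec n" for X a
    using mod[of X] that by (simp add: fd_module_def)
  have \<rho>0c: "\<rho>0 a \<in> carrier_mat n n" if "a \<in> carrier_vec n" for a
    using mod0 that by (simp add: fd_module_def)
  have \<rho>e: "\<rho> X e = 1\<^sub>m (d X)" for X using mod[of X] by (simp add: fd_module_def)
  have Fhom: "F X Y f \<in> fd_module_hom n (d X) (\<rho> X) (d Y) (\<rho> Y)" if "f \<in> hom C X Y" for X Y f
    using Fbij that by (auto simp: bij_betw_def)
  have Fc: "F X Y f \<in> carrier_mat (d Y) (d X)" if "f \<in> hom C X Y" for X Y f
    using Fhom[OF that] by (simp add: fd_module_hom_def)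
  have Finj: "f = g" if "f \<in> hom C X Y" "g \<in> hom C X Y" "F X Y f = F X Y g" for X Y f g
    using Fbij[of X Y] that by (auto simp: bij_betw_def inj_on_def)
  have Fsurj: "\<exists>f\<in>hom C X Y. F X Y f = M" if "M \<in> fd_module_hom n (d X) (\<rho> X) (d Y) (\<rho> Y)" for X Y M
  proof -
    have "M \<in> F X Y ` hom C X Y" using Fbij[of X Y] that by (simp add: bij_betw_def)
    then show ?thesis by blast
  qed
  \<comment> \<open>Evaluation at the generator: \<open>T *\<^sub>v e\<close> is the unit of the
    algebra seen inside the module of \<open>G\<close>.\<close>
  define v where "v X k = F G X k *\<^sub>v (T *\<^sub>v e)" for X k
  \<comment> \<open>The identification of \<open>End(G)\<close> with the algebra. It reverses
    products, so left modules over the algebra are right modules over \<open>End(G)\<close>.\<close>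
  define \<alpha> where "\<alpha> a = S *\<^sub>v v G a" for a
  have Te: "T *\<^sub>v e \<in> carrier_vec (d G)" using Tc e by simp
  have vc: "v X k \<in> carrier_vec (d X)" if "k \<in> hom C G X" for X k
    using Fc[OF that] Te by (simp add: v_def)
  have \<alpha>c: "\<alpha> a \<in> carrier_vec n" if "a \<in> hom C G G" for a
    using Sc vc[OF that] by (simp add: \<alpha>_def)
  have FT: "(F G X k * T) *\<^sub>v x = \<rho> X x *\<^sub>v v X k" if k: "k \<in> hom C G X" and x: "x \<in> carrier_vec n" for X k x
  proof -
    have "(F G X k * T) *\<^sub>v x = F G X k *\<^sub>v (T *\<^sub>v (\<rho>0 x *\<^sub>v e))"
      using \<rho>0 e x me Fc[OF k] Tc by simp
    also have "\<dots> = F G X k *\<^sub>v ((T * \<rho>0 x) *\<^sub>v e)"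
      using Tc \<rho>0c[OF x] e by (simp add: assoc_mult_mat_vec[of T _ n _ n])
    also have "T * \<rho>0 x = \<rho> G x * T" using T x by (simp add: fd_module_hom_def)
    also have "F G X k *\<^sub>v ((\<rho> G x * T) *\<^sub>v e) = (F G X k * \<rho> G x) *\<^sub>v (T *\<^sub>v e)"
      using Tc \<rho>c[OF x, of G] e Fc[OF k] Te by (simp add: assoc_mult_mat_vec[of _ "d G" "d G" _ n]
        assoc_mult_mat_vec[of _ "d X" "d G" _ "d G"])
    also have "F G X k * \<rho> G x = \<rho> X x * F G X k" using Fhom[OF k] x by (simp add: fd_module_hom_def)
    also have "(\<rho> X x * F G X k) *\<^sub>v (T *\<^sub>v e) = \<rho> X x *\<^sub>v v X k"
      using \<rho>c[OF x, of X] Fc[OF k] Te by (simp add: v_def assoc_mult_mat_vec[of _ "d X" "d X" _ "d G"])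
    finally show ?thesis .
  qed
  have vinj: "k = k'" if k: "k \<in> hom C G X" and k': "k' \<in> hom C G X" and eq: "v X k = v X k'" for X k k'
  proof -
    have "F G X k * T = F G X k' * T"
    proof (rule mat_eq_if_mult_vec_eq[of _ "d X" n])
      show "(F G X k * T) *\<^sub>v x = (F G X k' * T) *\<^sub>v x" if "x \<in> carrier_vec n" for x
        unfolding FT[OF k that] FT[OF k' that] eq ..
    qed (use Fc[OF k] Fc[OF k'] Tc in auto)
    then have "(F G X k * T) * S = (F G X k' * T) * S" by simp
    then have "F G X k = F G X k'" using Fc[OF k] Fc[OF k'] Tc Sc TS
      by (simp add: assoc_mult_mat[of _ "d X" "d G" _ n _ "d G"])
    then show ?thesis using Finj k k' by blast
  qed
  \<comment> \<open>A vector \<open>y\<close> extends to the homomorphism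
    \<open>x \<mapsto> \<rho> X x y\<close> from the regular module, which \<open>S\<close>
    transports to \<open>G\<close>.\<close>
  have vsurj: "\<exists>k\<in>hom C G X. v X k = y" if y: "y \<in> carrier_vec (d X)" for X y
  proof -
    have "linear_map_on (\<cdot>\<^sub>v) (\<cdot>\<^sub>v) (carrier_vec n) (\<lambda>x. \<rho> X x *\<^sub>v y)"
    proof (rule linear_map_onI)
      fix x x' :: "'k vec" assume x: "x \<in> carrier_vec n" "x' \<in> carrier_vec n"
      then have "\<rho> X (x + x') = \<rho> X x + \<rho> X x'" using mod[of X] by (simp add: fd_module_def)
      then show "\<rho> X (x + x') *\<^sub>v y = \<rho> X x *\<^sub>v y + \<rho> X x' *\<^sub>v y"
        using \<rho>c[OF x(1), of X] \<rho>c[OF x(2), of X] y by (simp add: add_mult_distrib_mat_vec)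
    next
      fix c and x :: "'k vec" assume x: "x \<in> carrier_vec n"
      then have "\<rho> X (c \<cdot>\<^sub>v x) = c \<cdot>\<^sub>m \<rho> X x" using mod[of X] by (simp add: fd_module_def)
      then show "\<rho> X (c \<cdot>\<^sub>v x) *\<^sub>v y = c \<cdot>\<^sub>v (\<rho> X x *\<^sub>v y)"
        using \<rho>c[OF x(1), of X] y by auto
    qed
    then obtain M where M: "M \<in> carrier_mat (d X) n" "\<And>x. x \<in> carrier_vec n \<Longrightarrow> M *\<^sub>v x = \<rho> X x *\<^sub>v y"
      using mat_of_linear_map[of n "\<lambda>x. \<rho> X x *\<^sub>v y" "d X"] \<rho>c y by (metis mult_mat_vec_carrier)
    have comm: "M * \<rho>0 a = \<rho> X a * M" if a: "a \<in> carrier_vec n" for a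
    proof (rule mat_eq_if_mult_vec_eq[of _ "d X" n])
      fix x :: "'k vec" assume x: "x \<in> carrier_vec n"
      have "\<rho> X (m a x) = \<rho> X a * \<rho> X x" using mod[of X] a x by (simp add: fd_module_def)
      then have "(M * \<rho>0 a) *\<^sub>v x = (\<rho> X a * \<rho> X x) *\<^sub>v y"
        using assoc_mult_mat_vec[OF M(1) \<rho>0c[OF a] x] \<rho>0[OF a x] M(2)[OF mc[OF a x]] by simp
      also have "\<dots> = \<rho> X a *\<^sub>v (M *\<^sub>v x)"
        using assoc_mult_mat_vec[OF \<rho>c[OF a] \<rho>c[OF x] y] M(2)[OF x] by simp
      also have "\<dots> = (\<rho> X a * M) *\<^sub>v x"
        using assoc_mult_mat_vec[OF \<rho>c[OF a] M(1) x] by simp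
      finally show "(M * \<rho>0 a) *\<^sub>v x = (\<rho> X a * M) *\<^sub>v x" .
    next
      show "M * \<rho>0 a \<in> carrier_mat (d X) n" "\<rho> X a * M \<in> carrier_mat (d X) n"
        using M(1) \<rho>0c[OF a] \<rho>c[OF a, of X] by auto
    qed
    have "(M * S) * \<rho> G a = \<rho> X a * (M * S)" if a: "a \<in> carrier_vec n" for a
    proof -
      have "S * \<rho> G a = \<rho>0 a * S" using S a by (simp add: fd_module_hom_def)
      then have "(M * S) * \<rho> G a = (M * \<rho>0 a) * S"
        using assoc_mult_mat[OF M(1) Sc \<rho>c[OF a]] assoc_mult_mat[OF M(1) \<rho>0c[OF a] Sc] by simp
      then show ?thesis using comm[OF a] assoc_mult_mat[OF \<rho>c[OF a] M(1) Sc] by simp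
    qed
    then have "M * S \<in> fd_module_hom n (d G) (\<rho> G) (d X) (\<rho> X)"
      using M(1) Sc by (auto simp: fd_module_hom_def)
    then obtain k where k: "k \<in> hom C G X" "F G X k = M * S"
      using Fsurj by blast
    have "v X k = M *\<^sub>v (S *\<^sub>v (T *\<^sub>v e))"
      using k M(1) Sc Te by (simp add: v_def assoc_mult_mat_vec[of M "d X" n S "d G"])
    also have "S *\<^sub>v (T *\<^sub>v e) = e" using assoc_mult_mat_vec[OF Sc Tc e] ST e by simp
    also have "M *\<^sub>v e = y" using M(2)[OF e] \<rho>e y by simp
    finally show ?thesis using k by blast
  qed
  have vlin: "linear_map_on (scale C) (\<cdot>\<^sub>v) (hom C G X) (v X)" for X
  proof (rule linear_map_onI)
    fix k k' assume k: "k \<in> hom C G X" and k': "k' \<in> hom C G X"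
    show "v X (k + k') = v X k + v X k'"
      using Fc[OF k] Fc[OF k'] Te by (simp add: v_def Fadd k k' add_mult_distrib_mat_vec)
    show "v X (scale C c k) = c \<cdot>\<^sub>v v X k" for c
      unfolding v_def Fscale[OF k] by (rule smult_mat_mult_vec[OF Fc[OF k] Te])
  qed
  have vbij: "bij_betw (v X) (hom C G X) (carrier_vec (d X))" for X
  proof (rule bij_betw_imageI)
    show "inj_on (v X) (hom C G X)" using vinj by (auto intro: inj_onI)
    show "v X ` hom C G X = carrier_vec (d X)" using vsurj vc by blast
  qed
  have vcomp: "v Y (f \<cdot> k) = F X Y f *\<^sub>v v X k" if f: "f \<in> hom C X Y" and k: "k \<in> hom C G X" for X Y f k
    using Fcomp[OF k f] assoc_mult_mat_vec[OF Fc[OF f] Fc[OF k] Te] by (simp add: v_def)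
  have vact: "v X (k \<cdot> a) = \<rho> X (\<alpha> a) *\<^sub>v v X k" if k: "k \<in> hom C G X" and a: "a \<in> hom C G G" for X k a
  proof -
    have "v X (k \<cdot> a) = F G X k *\<^sub>v ((T * S) *\<^sub>v v G a)"
      using vcomp[OF k a] TS vc[OF a] by simp
    also have "\<dots> = (F G X k * T) *\<^sub>v \<alpha> a"
      using assoc_mult_mat_vec[OF Tc Sc vc[OF a]] assoc_mult_mat_vec[OF Fc[OF k] Tc \<alpha>c[OF a]]
        by (simp add: \<alpha>_def)
    finally show ?thesis using FT[OF k \<alpha>c[OF a]] by simp
  qed
  have \<alpha>lin: "linear_map_on (scale C) (\<cdot>\<^sub>v) (hom C G G) \<alpha>"
  proof (rule linear_map_onI)
    fix k k' assume k: "k \<in> hom C G G" and k': "k' \<in> hom C G G"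
    show "\<alpha> (k + k') = \<alpha> k + \<alpha> k'"
      using linear_map_onD(1)[OF vlin k k'] mult_add_distrib_mat_vec[OF Sc vc[OF k] vc[OF k']]
        by (simp add: \<alpha>_def)
    show "\<alpha> (scale C c k) = c \<cdot>\<^sub>v \<alpha> k" for c
      using linear_map_onD(2)[OF vlin k] mult_mat_vec[OF Sc vc[OF k]] by (simp add: \<alpha>_def)
  qed
  have "bij_betw (\<lambda>x. S *\<^sub>v x) (carrier_vec (d G)) (carrier_vec n)"
    by (rule bij_betw_byWitness[where f' = "\<lambda>x. T *\<^sub>v x"])
      (use Sc Tc assoc_mult_mat_vec[OF Tc Sc, symmetric] assoc_mult_mat_vec[OF Sc Tc, symmetric] TS ST in auto)
  from bij_betw_trans[OF vbij this] have \<alpha>bij: "bij_betw \<alpha> (hom C G G) (carrier_vec n)"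
    by (rule bij_betw_cong[THEN iffD1, rotated]) (simp add: \<alpha>_def)
  have \<alpha>mult: "\<alpha> (a \<cdot> b) = m (\<alpha> b) (\<alpha> a)" if a: "a \<in> hom C G G" and b: "b \<in> hom C G G" for a b
  proof -
    have "\<alpha> (a \<cdot> b) = (S * \<rho> G (\<alpha> b)) *\<^sub>v v G a"
      using vact[OF a b] assoc_mult_mat_vec[OF Sc \<rho>c[OF \<alpha>c[OF b]] vc[OF a]] by (simp add: \<alpha>_def)
    also have "S * \<rho> G (\<alpha> b) = \<rho>0 (\<alpha> b) * S" using S \<alpha>c[OF b] by (simp add: fd_module_hom_def)
    also have "(\<rho>0 (\<alpha> b) * S) *\<^sub>v v G a = m (\<alpha> b) (\<alpha> a)"
      using assoc_mult_mat_vec[OF \<rho>0c[OF \<alpha>c[OF b]] Sc vc[OF a]] \<rho>0[OF \<alpha>c[OF b] \<alpha>c[OF a]] by (simp add: \<alpha>_def)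
    finally show ?thesis .
  qed
  have \<alpha>id: "\<alpha> (ident C G) = e"
    using assoc_mult_mat_vec[OF Sc Tc e] Te ST e by (simp add: \<alpha>_def v_def Fid)
  have "progenerated_category C G"
  proof (unfold_locales)
    fix X
    obtain z where z: "\<And>j. z j \<in> hom C G X" "\<And>j. v X (z j) = unit_vec (d X) j"
      using vsurj[OF unit_vec_carrier] by metis
    have "k \<in> span (z ` {..<d X})" if k: "k \<in> hom C G X" for k
    proof -
      let ?s = "\<Sum>j<d X. scale C (v X k $ j) (z j)"
      have s: "?s \<in> hom C G X" using z hom_subspace by (intro subspace_sum subspace_scale)
      have "v X ?s $ i = v X k $ i" if i: "i < d X" for i
      proof -
        have lin: "linear_map_on (scale C) (*) (hom C G X) (\<lambda>k. v X k $ i)"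
          using i vc by (intro linear_map_onI) (auto simp: linear_map_onD[OF vlin] dest!: vc)
        have "v X 0 $ i = 0" using linear_map_onD(2)[OF lin hom_zero, of 0] by simp
        then have "v X ?s $ i = (\<Sum>j<d X. v X k $ j * v X (z j) $ i)"
          using z by (intro linear_map_on_sum[OF hom_subspace lin])
        then show ?thesis using z i by (simp add: if_distrib[of "\<lambda>x. _ * x"] cong: if_cong)
      qed
      then have "v X ?s = v X k" using vc[OF s] vc[OF k] by (intro eq_vecI) auto
      then have "?s = k" using vinj s k by blast
      moreover have "?s \<in> span (z ` {..<d X})" by (intro span_sum span_scale span_base) auto
      ultimately show ?thesis by simp
    qed
    then show "\<exists>B. finite B \<and> hom C G X \<subseteq> span B" by (intro exI[of _ "z ` {..<d X}"]) auto
  next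
    fix f X Y assume f: "f \<in> hom C X Y" and 0: "\<And>k. k \<in> hom C G X \<Longrightarrow> f \<cdot> k = 0"
    have hom0: "0 \<in> hom C X' Y'" for X' Y' using hom_subspace subspace_0 by blast
    have "F X Y f = F X Y 0"
    proof (rule mat_eq_if_mult_vec_eq[OF Fc[OF f] Fc[OF hom0]])
      fix y :: "'k vec" assume y: "y \<in> carrier_vec (d X)"
      then obtain k where k: "k \<in> hom C G X" "v X k = y" using vsurj by blast
      have "scale C 0 0 \<cdot> k = scale C 0 (0 \<cdot> k)" by (rule comp_scale_left[OF k(1) hom0])
      then have "0 \<cdot> k = 0" by simp
      then show "F X Y f *\<^sub>v y = F X Y 0 *\<^sub>v y"
        using vcomp[OF f k(1)] vcomp[OF hom0 k(1)] k(2) 0[OF k(1)] by simp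
    qed
    then show "f = 0" using Finj f hom0 by blast
  next
    fix X Y l
    assume l: "linear_map_on (scale C) (scale C) (hom C G X) l" "\<And>k. k \<in> hom C G X \<Longrightarrow> l k \<in> hom C G Y"
      "\<And>k a. k \<in> hom C G X \<Longrightarrow> a \<in> hom C G G \<Longrightarrow> l (k \<cdot> a) = l k \<cdot> a"
    \<comment> \<open>In coordinates \<open>l\<close> is a matrix \<open>M\<close>; compatibility
      with \<open>End(G)\<close> makes \<open>M\<close> a module homomorphism, hence the image of a
      morphism.\<close>
    let ?i = "inv_into (hom C G X) (v X)"
    have i: "?i y \<in> hom C G X" "v X (?i y) = y" if "y \<in> carrier_vec (d X)" for y
      using vbij[of X] that by (auto simp: bij_betw_def inv_into_into f_inv_into_f)
    have iv: "?i (v X k) = k" if "k \<in> hom C G X" for k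
      using vbij[of X] that by (auto simp: bij_betw_def)
    have "linear_map_on (\<cdot>\<^sub>v) (scale C) (carrier_vec (d X)) ?i"
      using hom_subspace by (intro linear_map_on_inv_into vlin vbij) (auto intro: subspace_add subspace_scale)
    then have "linear_map_on (\<cdot>\<^sub>v) (\<cdot>\<^sub>v) (carrier_vec (d X)) (\<lambda>y. v Y (l (?i y)))"
      using i l(2) by (intro linear_map_onI) (simp_all add: linear_map_onD linear_map_onD[OF l(1)]
        linear_map_onD[OF vlin])
    then obtain M where M: "M \<in> carrier_mat (d Y) (d X)"
       "\<And>y. y \<in> carrier_vec (d X) \<Longrightarrow> M *\<^sub>v y = v Y (l (?i y))"
      by (rule mat_of_linear_map[of "d X" _ "d Y"]) (use i vc l(2) in auto)
    have Mv: "M *\<^sub>v v X k = v Y (l k)" if "k \<in> hom C G X" for k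
      using M(2) vc iv that by simp
    have "M * \<rho> X x = \<rho> Y x * M" if x: "x \<in> carrier_vec n" for x
    proof (rule mat_eq_if_mult_vec_eq[of _ "d Y" "d X"])
      fix y :: "'k vec" assume y: "y \<in> carrier_vec (d X)"
      obtain k where k: "k \<in> hom C G X" "v X k = y" using vsurj y by blast
      obtain a where a: "a \<in> hom C G G" "\<alpha> a = x"
        using x unfolding bij_betw_imp_surj_on[OF \<alpha>bij, symmetric] by (elim imageE) simp
      have "(M * \<rho> X x) *\<^sub>v y = M *\<^sub>v v X (k \<cdot> a)"
        using assoc_mult_mat_vec[OF M(1) \<rho>c[OF x] y] vact[OF k(1) a(1)] k a by simp
      also have "\<dots> = \<rho> Y x *\<^sub>v (M *\<^sub>v y)"
        using Mv[OF comp_in_hom[OF a(1) k(1)]] l(3)[OF k(1) a(1)] vact[OF l(2)[OF k(1)] a(1)] a k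
          Mv[OF k(1)] by simp
      also have "\<dots> = (\<rho> Y x * M) *\<^sub>v y" using assoc_mult_mat_vec[OF \<rho>c[OF x] M(1) y] by simp
      finally show "(M * \<rho> X x) *\<^sub>v y = (\<rho> Y x * M) *\<^sub>v y" .
    next
      show "M * \<rho> X x \<in> carrier_mat (d Y) (d X)" "\<rho> Y x * M \<in> carrier_mat (d Y) (d X)"
        using M(1) \<rho>c[OF x] by (auto intro: mult_carrier_mat)
    qed
    then have "M \<in> fd_module_hom n (d X) (\<rho> X) (d Y) (\<rho> Y)" using M(1) by (simp add: fd_module_hom_def)
    then obtain f where f: "f \<in> hom C X Y" "F X Y f = M"
      using Fsurj by blast
    have "f \<cdot> k = l k" if k: "k \<in> hom C G X" for k
      using vinj[OF comp_in_hom[OF k f(1)] l(2)[OF k]] vcomp[OF f(1) k] Mv[OF k] f(2) by simp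
    then show "\<exists>f\<in>hom C X Y. \<forall>k\<in>hom C G X. f \<cdot> k = l k" using f by blast
  next
    fix V B \<beta>
    assume V: "subspace V" "V \<subseteq> span B" "finite B"
      and \<beta>V: "\<And>v a. v \<in> V \<Longrightarrow> a \<in> hom C G G \<Longrightarrow> \<beta> v a \<in> V"
      and \<beta>lin1: "\<And>a. a \<in> hom C G G \<Longrightarrow> linear_map_on (scale C) (scale C) V (\<lambda>v. \<beta> v a)"
      and \<beta>lin2: "\<And>v. v \<in> V \<Longrightarrow> linear_map_on (scale C) (scale C) (hom C G G) (\<beta> v)"
      and \<beta>id: "\<And>v. v \<in> V \<Longrightarrow> \<beta> v (ident C G) = v"
      and \<beta>assoc: "\<And>v a b. v \<in> V \<Longrightarrow> a \<in> hom C G G \<Longrightarrow> b \<in> hom C G G \<Longrightarrow> \<beta> (\<beta> v a) b = \<beta> v (a \<cdot> b)"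
    obtain N \<kappa> where \<kappa>: "linear_map_on (scale C) (\<cdot>\<^sub>v) V \<kappa>" "bij_betw \<kappa> V (carrier_vec N)"
      using coordinate_isomorphism[OF V] by blast
    let ?i = "inv_into V \<kappa>"
    have i: "?i y \<in> V" "\<kappa> (?i y) = y" if "y \<in> carrier_vec N" for y
      using \<kappa>(2) that by (auto simp: bij_betw_def inv_into_into f_inv_into_f)
    have i\<kappa>: "?i (\<kappa> x) = x" "\<kappa> x \<in> carrier_vec N" if "x \<in> V" for x
      using \<kappa>(2) that by (auto simp: bij_betw_def)
    have ilin: "linear_map_on (\<cdot>\<^sub>v) (scale C) (carrier_vec N) ?i"
      using V by (intro linear_map_on_inv_into \<kappa>) (auto intro: subspace_add subspace_scale)
    have "\<exists>M. M \<in> carrier_mat N N \<and> (\<forall>y\<in>carrier_vec N. M *\<^sub>v y = \<kappa> (\<beta> (?i y) a))" if a: "a \<in> hom C G G" for a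
    proof -
      have "linear_map_on (\<cdot>\<^sub>v) (\<cdot>\<^sub>v) (carrier_vec N) (\<lambda>y. \<kappa> (\<beta> (?i y) a))"
        using i \<beta>V a by (intro linear_map_onI)
          (simp_all add: linear_map_onD[OF ilin] linear_map_onD[OF \<beta>lin1[OF a]] linear_map_onD[OF \<kappa>(1)])
      then obtain M where "M \<in> carrier_mat N N" "\<And>y. y \<in> carrier_vec N \<Longrightarrow> M *\<^sub>v y = \<kappa> (\<beta> (?i y) a)"
        by (rule mat_of_linear_map[of N _ N]) (use i i\<kappa> \<beta>V a in auto)
      then show ?thesis by blast
    qed
    then obtain M where Mc: "\<And>a. a \<in> hom C G G \<Longrightarrow> M a \<in> carrier_mat N N"
       and M: "\<And>a y. a \<in> hom C G G \<Longrightarrow> y \<in> carrier_vec N \<Longrightarrow> M a *\<^sub>v y = \<kappa> (\<beta> (?i y) a)" by metis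
    have hadd: "a + b \<in> hom C X Y" if "a \<in> hom C X Y" "b \<in> hom C X Y" for a b X Y
      using that hom_subspace subspace_add by blast
    have hscale: "scale C c a \<in> hom C X Y" if "a \<in> hom C X Y" for a c X Y
      using that hom_subspace subspace_scale by blast
    have Madd: "M (a + b) = M a + M b" if a: "a \<in> hom C G G" and b: "b \<in> hom C G G" for a b
    proof (rule mat_eq_if_mult_vec_eq[of _ N N])
      fix y :: "'k vec" assume y: "y \<in> carrier_vec N"
      show "M (a + b) *\<^sub>v y = (M a + M b) *\<^sub>v y"
        using y i[OF y] \<beta>V a b hadd[OF a b] Mc[OF a] Mc[OF b]
        by (simp add: add_mult_distrib_mat_vec[of _ N N] M linear_map_onD[OF \<beta>lin2] linear_map_onD[OF \<kappa>(1)])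
    qed (use Mc a b hadd in auto)
    have Mscale: "M (scale C c a) = c \<cdot>\<^sub>m M a" if a: "a \<in> hom C G G" for a c
    proof (rule mat_eq_if_mult_vec_eq[of _ N N])
      fix y :: "'k vec" assume y: "y \<in> carrier_vec N"
      have "(c \<cdot>\<^sub>m M a) *\<^sub>v y = c \<cdot>\<^sub>v (M a *\<^sub>v y)" by (rule smult_mat_mult_vec[OF Mc[OF a] y])
      then show "M (scale C c a) *\<^sub>v y = (c \<cdot>\<^sub>m M a) *\<^sub>v y"
        using y i[OF y] \<beta>V a hscale[OF a]
        by (simp add: M linear_map_onD[OF \<beta>lin2] linear_map_onD[OF \<kappa>(1)])
    qed (use Mc a hscale in auto)
    have Mid: "M (ident C G) = 1\<^sub>m N"
      by (rule mat_eq_if_mult_vec_eq[of _ N N]) (use Mc M ident_in_hom \<beta>id i in auto)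
    have Mmult: "M (b \<cdot> a) = M a * M b" if a: "a \<in> hom C G G" and b: "b \<in> hom C G G" for a b
    proof (rule mat_eq_if_mult_vec_eq[of _ N N])
      fix y :: "'k vec" assume y: "y \<in> carrier_vec N"
      have "M a *\<^sub>v (M b *\<^sub>v y) = \<kappa> (\<beta> (?i y) (b \<cdot> a))"
        using y i[OF y] \<beta>V a b i\<kappa> \<beta>assoc by (simp add: M)
      then show "M (b \<cdot> a) *\<^sub>v y = (M a * M b) *\<^sub>v y"
        using y comp_in_hom[OF a b] assoc_mult_mat_vec[OF Mc[OF a] Mc[OF b] y] by (simp add: M)
    qed (use Mc[OF a] Mc[OF b] Mc[OF comp_in_hom[OF a b]] in auto)
    define \<alpha>' where "\<alpha>' = inv_into (hom C G G) \<alpha>"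
    have \<alpha>': "\<alpha>' x \<in> hom C G G" "\<alpha> (\<alpha>' x) = x" if "x \<in> carrier_vec n" for x
      using \<alpha>bij that by (auto simp: \<alpha>'_def bij_betw_def inv_into_into f_inv_into_f)
    have \<alpha>'\<alpha>: "\<alpha>' (\<alpha> a) = a" if "a \<in> hom C G G" for a
      using \<alpha>bij that by (auto simp: \<alpha>'_def bij_betw_def)
    have \<alpha>'lin: "linear_map_on (\<cdot>\<^sub>v) (scale C) (carrier_vec n) \<alpha>'"
      unfolding \<alpha>'_def by (intro linear_map_on_inv_into \<alpha>lin \<alpha>bij hadd hscale)
    have \<alpha>'mult: "\<alpha>' (m x y) = \<alpha>' y \<cdot> \<alpha>' x" if "x \<in> carrier_vec n" "y \<in> carrier_vec n" for x y
      using \<alpha>'\<alpha>[OF comp_in_hom[OF \<alpha>'(1)[OF that(1)] \<alpha>'(1)[OF that(2)]]]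
        \<alpha>mult[OF \<alpha>'(1)[OF that(2)] \<alpha>'(1)[OF that(1)]] \<alpha>' that by simp
    \<comment> \<open>Both \<open>M\<close> and \<open>\<alpha>'\<close> reverse products, so their
      composite is a left module over the algebra.\<close>
    have "fd_module n m e N (\<lambda>x. M (\<alpha>' x))"
      unfolding fd_module_def
      using \<alpha>' Mc Madd Mscale Mmult \<alpha>'mult \<alpha>'\<alpha>[OF ident_in_hom] \<alpha>id Mid
      by (simp add: linear_map_onD[OF \<alpha>'lin])
    from Fess[OF this] obtain Z S' T' where
      S': "S' \<in> fd_module_hom n (d Z) (\<rho> Z) N (\<lambda>x. M (\<alpha>' x))" and
      T': "T' \<in> fd_module_hom n N (\<lambda>x. M (\<alpha>' x)) (d Z) (\<rho> Z)" and
      TS': "T' * S' = 1\<^sub>m (d Z)" and ST': "S' * T' = 1\<^sub>m N" by blast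
    have S'c: "S' \<in> carrier_mat N (d Z)" and T'c: "T' \<in> carrier_mat (d Z) N"
      using S' T' by (auto simp: fd_module_hom_def)
    define \<Psi> where "\<Psi> k = ?i (S' *\<^sub>v v Z k)" for k
    have Sv: "S' *\<^sub>v v Z k \<in> carrier_vec N" if "k \<in> hom C G Z" for k using S'c vc[OF that] by simp
    have "linear_map_on (scale C) (scale C) (hom C G Z) \<Psi>"
    proof (rule linear_map_onI)
      fix k k' assume k: "k \<in> hom C G Z" and k': "k' \<in> hom C G Z"
      show "\<Psi> (k + k') = \<Psi> k + \<Psi> k'"
        using linear_map_onD(1)[OF vlin k k'] mult_add_distrib_mat_vec[OF S'c vc[OF k] vc[OF k']] Sv[OF k]
          Sv[OF k']
        by (simp add: \<Psi>_def linear_map_onD[OF ilin])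
      show "\<Psi> (scale C c k) = scale C c (\<Psi> k)" for c
        using linear_map_onD(2)[OF vlin k] mult_mat_vec[OF S'c vc[OF k]] Sv[OF k]
        by (simp add: \<Psi>_def linear_map_onD[OF ilin])
    qed
    moreover have "bij_betw \<Psi> (hom C G Z) V"
    proof -
      have 1: "bij_betw (\<lambda>x. S' *\<^sub>v x) (carrier_vec (d Z)) (carrier_vec N)"
        by (rule bij_betw_byWitness[where f' = "\<lambda>x. T' *\<^sub>v x"])
          (use S'c T'c assoc_mult_mat_vec[OF T'c S'c, symmetric] assoc_mult_mat_vec[OF S'c T'c, symmetric]
            TS' ST' in auto)
      have 2: "bij_betw ?i (carrier_vec N) V" using \<kappa>(2) by (rule bij_betw_inv_into)
      show ?thesis using bij_betw_trans[OF bij_betw_trans[OF vbij 1] 2]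
        by (rule bij_betw_cong[THEN iffD1, rotated]) (simp add: \<Psi>_def)
    qed
    moreover have "\<Psi> (k \<cdot> a) = \<beta> (\<Psi> k) a" if k: "k \<in> hom C G Z" and a: "a \<in> hom C G G" for k a
    proof -
      have "\<Psi> (k \<cdot> a) = ?i ((S' * \<rho> Z (\<alpha> a)) *\<^sub>v v Z k)"
        using vact[OF k a] assoc_mult_mat_vec[OF S'c \<rho>c[OF \<alpha>c[OF a]] vc[OF k]] by (simp add: \<Psi>_def)
      also have "S' * \<rho> Z (\<alpha> a) = M a * S'" using S' \<alpha>c[OF a] \<alpha>'\<alpha>[OF a] by (simp add: fd_module_hom_def)
      also have "?i ((M a * S') *\<^sub>v v Z k) = \<beta> (\<Psi> k) a"
        using assoc_mult_mat_vec[OF Mc[OF a] S'c vc[OF k]] M[OF a Sv[OF k]] i\<kappa> \<beta>V i Sv[OF k] a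
          by (simp add: \<Psi>_def)
      finally show ?thesis .
    qed
    ultimately show "\<exists>Z \<Psi>. linear_map_on (scale C) (scale C) (hom C G Z) \<Psi> \<and> bij_betw \<Psi> (hom C G Z) V \<and>
         (\<forall>k\<in>hom C G Z. \<forall>a\<in>hom C G G. \<Psi> (k \<cdot> a) = \<beta> (\<Psi> k) a)" by blast
  qed
  then show thesis using that by blast
qed

section \<open>Dimensions, projections and traces on finite-dimensional subspaces\<close>

lemma linear_map_on_subset: "linear_map_on s t V f \<Longrightarrow> U \<subseteq> V \<Longrightarrow> linear_map_on s t U f"
  unfolding linear_map_on_def by blast

lemma linear_map_on_comp:
  assumes "linear_map_on s t V f" "\<And>x. x \<in> V \<Longrightarrow> f x \<in> W" "linear_map_on t u W g"
  shows "linear_map_on s u V (\<lambda>x. g (f x))"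
  using assms(2) by (simp add: linear_map_on_def linear_map_onD[OF assms(1)] linear_map_onD[OF assms(3)])

context linear_category
begin

lemma subspace_linear_image:
  assumes "subspace V" and f: "linear_map_on (scale C) (scale C) V f"
  shows "subspace (f ` V)"
proof (rule subspaceI)
  have "f 0 = 0" using linear_map_onD(2)[OF f subspace_0, of 0] assms by simp
  then show "0 \<in> f ` V" using subspace_0[OF assms(1)] by (metis imageI)
  fix x y assume "x \<in> f ` V" "y \<in> f ` V"
  then obtain a b where ab: "a \<in> V" "b \<in> V" "x = f a" "y = f b" by auto
  then have "x + y = f (a + b)" using linear_map_onD(1)[OF f] by simp
  then show "x + y \<in> f ` V" using ab assms(1) subspace_add by blast
next
  fix c x assume "x \<in> f ` V"
  then obtain a where a: "a \<in> V" "x = f a" by auto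
  then have "scale C c x = f (scale C c a)" using linear_map_onD(2)[OF f] by simp
  then show "scale C c x \<in> f ` V" using a assms(1) subspace_scale by blast
qed

lemma linear_map_on_0: "subspace V \<Longrightarrow> linear_map_on (scale C) (scale C) V f \<Longrightarrow> f 0 = 0"
  using linear_map_onD(2)[of "scale C" "scale C" V f 0 0] subspace_0 by simp

lemma independent_card_le_dim_fd:
  assumes "independent S" "S \<subseteq> V" "V \<subseteq> span B" "finite B"
  shows "finite S" "card S \<le> dim V"
proof -
  obtain B' where B': "B' \<subseteq> V" "independent B'" "V \<subseteq> span B'" "card B' = dim V" by (rule basis_exists)
  have "finite B'" using independent_span_bound[OF assms(4) B'(2)] B'(1) assms(3) by auto
  from independent_span_bound[OF this assms(1)] B' assms(2)
  show "finite S" "card S \<le> dim V" by auto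
qed

lemma dim_psubset_fd:
  assumes "subspace U" "U \<subseteq> V" "w \<in> V" "w \<notin> U" "V \<subseteq> span B" "finite B"
  shows "dim U < dim V"
proof -
  obtain B' where B': "B' \<subseteq> U" "independent B'" "U \<subseteq> span B'" "card B' = dim U" by (rule basis_exists)
  have "span B' = U" using B' assms(1) span_minimal by blast
  then have wB: "w \<notin> span B'" using assms(4) by simp
  have "independent (insert w B')" by (rule local.independent_insertI[OF wB B'(2)])
  moreover have "w \<notin> B'" using wB local.span_base by blast
  moreover have "insert w B' \<subseteq> V" using B'(1) assms by auto
  ultimately show ?thesis using independent_card_le_dim_fd[of "insert w B'" V B] B' assms by auto
qed

text \<open>Preimages of a basis of the image stay independent when the kernel vector
  \<open>v\<close> is added, so \<open>V\<close> has at least one dimension more than the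
  image.\<close>

lemma dim_image_less:
  assumes V: "subspace V" "V \<subseteq> span B" "finite B" and f: "linear_map_on (scale C) (scale C) V f"
    and v: "v \<in> V" "v \<noteq> 0" "f v = 0"
  shows "dim (f ` V) < dim V"
proof -
  obtain D where D: "D \<subseteq> f ` V" "independent D" "f ` V \<subseteq> span D" "card D = dim (f ` V)" by (rule basis_exists)
  have "\<forall>c\<in>D. \<exists>a. a \<in> V \<and> f a = c" using D(1) by auto
  from bchoice[OF this] obtain s where s: "\<And>c. c \<in> D \<Longrightarrow> s c \<in> V" "\<And>c. c \<in> D \<Longrightarrow> f (s c) = c" by auto
  have inj: "inj_on s D" by (rule inj_on_inverseI[of _ f]) (rule s(2))
  have f0: "f 0 = 0" using linear_map_on_0 V f by blast
  have vs: "v \<notin> s ` D" using s(2) v(3) D(2) dependent_zero by (metis imageE)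
  have ind: "independent (insert v (s ` D))"
    unfolding independent_explicit_finite_subsets
  proof (intro allI impI ballI)
    fix S u x assume S: "S \<subseteq> insert v (s ` D)" "finite S" and 0: "(\<Sum>x\<in>S. scale C (u x) x) = 0" and x: "x \<in> S"
    have SV: "y \<in> V" if "y \<in> S" for y using that S s v by auto
    have zero: "u y = 0" if y: "y \<in> S" "y \<noteq> v" for y
    proof -
      \<comment> \<open>Applying \<open>f\<close> removes \<open>v\<close> and turns the relation
        into one between elements of the basis \<open>D\<close> of the image.\<close>
      have "(\<Sum>x\<in>S. scale C (u x) (f x)) = 0"
        using linear_map_on_sum[OF V(1) f f0, of S "\<lambda>x. x" u] SV 0 f0 by simp
      then have "(\<Sum>x\<in>S - {v}. scale C (u x) (f x)) = 0"
        using v(3) S(2) by (subst (asm) sum.mono_neutral_right[of S "S - {v}"]) auto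
      moreover have inv: "s (f x) = x" if "x \<in> S - {v}" for x using that S s by auto
      moreover have "inj_on f (S - {v})" by (rule inj_on_inverseI[of _ s]) (rule inv)
      ultimately have "(\<Sum>c\<in>f ` (S - {v}). scale C (u (s c)) c) = 0"
        by (simp add: sum.reindex)
      moreover have "f ` (S - {v}) \<subseteq> D" "finite (f ` (S - {v}))" using S s by auto
      ultimately have "\<forall>c\<in>f ` (S - {v}). u (s c) = 0"
        using D(2)[unfolded local.independent_explicit_finite_subsets, rule_format, of "f ` (S - {v})"
          "\<lambda>c. u (s c)"] by auto
      then have "u (s (f y)) = 0" using y by simp
      then show ?thesis using inv y by simp
    qed
    show "u x = 0"
    proof (cases "x = v")
      case True
      have "(\<Sum>x\<in>S. scale C (u x) x) = scale C (u v) v"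
        using zero x True S(2) by (subst sum.mono_neutral_right[of S "{v}"]) auto
      then show ?thesis using 0 v(2) True by simp
    qed (use zero x in auto)
  qed
  have "finite (insert v (s ` D))" "card (insert v (s ` D)) \<le> dim V"
    using independent_card_le_dim_fd[OF ind, of V B] V v s by auto
  then show ?thesis using D(4) vs card_image[OF inj] by simp
qed

text \<open>Replaces the quotient of \<open>V\<close> by \<open>U\<close>: \<open>p\<close> is a
  projection with kernel exactly \<open>U\<close>, so its image is a complement that serves as the
  quotient space inside the same type.\<close>

lemma projection_along:
  assumes U: "subspace U" "U \<subseteq> V" and V: "subspace V"
  obtains p where "linear_map_on (scale C) (scale C) V p" "\<And>x. x \<in> V \<Longrightarrow> p x \<in> V"
    "\<And>x. x \<in> V \<Longrightarrow> x - p x \<in> U" "\<And>u. u \<in> U \<Longrightarrow> p u = 0" "\<And>x. x \<in> V \<Longrightarrow> p (p x) = p x"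
proof -
  obtain B1 where B1: "B1 \<subseteq> U" "independent B1" "U \<subseteq> span B1" using maximal_independent_subset by blast
  obtain B where B: "B1 \<subseteq> B" "B \<subseteq> V" "independent B" "V \<subseteq> span B"
    using maximal_independent_subset_extend[of B1 V] B1 U by blast
  interpret vp: vector_space_pair "scale C" "scale C" by unfold_locales
  obtain p where p: "Vector_Spaces.linear (scale C) (scale C) p" and pB:
    "\<And>x. x \<in> B \<Longrightarrow> p x = (if x \<in> B1 then 0 else x)"
    using vp.linear_independent_extend[OF B(3), of "\<lambda>x. if x \<in> B1 then 0 else x"] by blast
  note padd = vp.linear_add[OF p] and pscale = vp.linear_scale[OF p]
  have Bs: "span B = V" "span B1 = U" using B B1 U V span_minimal by blast+
  have *: "x - p x \<in> U \<and> p x \<in> V" if "x \<in> V" for x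
  proof -
    have "x \<in> span B" using that Bs by simp
    then show ?thesis
    proof (induction rule: span_induct_alt)
      case base
      then show ?case using U V vp.linear_0[OF p] by (simp add: subspace_0)
    next
      case (step c x y)
      have "x - p x \<in> U" "p x \<in> V" using pB[OF step(1)] B B1 U V step(1) by (auto simp: subspace_0)
      then have "scale C c (x - p x) + (y - p y) \<in> U" "scale C c (p x) + p y \<in> V"
        using step U V by (auto intro: subspace_add subspace_scale)
      then show ?case by (simp add: padd pscale scale_right_diff_distrib algebra_simps)
    qed
  qed
  have pU: "p u = 0" if "u \<in> U" for u
  proof -
    have "u \<in> span B1" using that Bs by simp
    then show ?thesis
      by (induction rule: span_induct_alt) (use B pB padd pscale vp.linear_0[OF p] in auto)
  qed
  have "p (p x) = p x" if "x \<in> V" for x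
    using pU[of "x - p x"] * that by (simp add: vp.linear_diff[OF p])
  with * pU show thesis using padd pscale by (intro that[of p] linear_map_onI) auto
qed

definition chosen_basis :: "'m set \<Rightarrow> 'm set" where
  "chosen_basis V = (SOME B. B \<subseteq> V \<and> independent B \<and> V \<subseteq> span B)"

lemma chosen_basis:
  "chosen_basis V \<subseteq> V" "independent (chosen_basis V)" "V \<subseteq> span (chosen_basis V)"
proof -
  have "\<exists>B. B \<subseteq> V \<and> independent B \<and> V \<subseteq> span B" using maximal_independent_subset by metis
  then have "chosen_basis V \<subseteq> V \<and> independent (chosen_basis V) \<and> V \<subseteq> span (chosen_basis V)"
    unfolding chosen_basis_def by (rule someI_ex)
  then show "chosen_basis V \<subseteq> V" "independent (chosen_basis V)" "V \<subseteq> span (chosen_basis V)" by auto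
qed

text \<open>Taken relative to one fixed basis of \<open>V\<close>. Only the values of
  \<open>f\<close> on \<open>V\<close> enter, which matters because all hom-spaces lie in one
  type.\<close>

definition linear_trace :: "'m set \<Rightarrow> ('m \<Rightarrow> 'm) \<Rightarrow> 'k" where
  "linear_trace V f = (\<Sum>b\<in>chosen_basis V. representation (chosen_basis V) (f b) b)"

lemma linear_trace_cong: "(\<And>x. x \<in> V \<Longrightarrow> f x = g x) \<Longrightarrow> linear_trace V f = linear_trace V g"
  unfolding linear_trace_def using chosen_basis(1)[of V] by (intro sum.cong) auto

lemma chosen_basis_finite: "V \<subseteq> span B \<Longrightarrow> finite B \<Longrightarrow> finite (chosen_basis V)"
  using independent_span_bound[of B "chosen_basis V"] chosen_basis[of V] by auto

lemma representation_chosen_basis_linear: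
  assumes V: "subspace V"
  shows "linear_map_on (scale C) (*) V (\<lambda>v. representation (chosen_basis V) v b)"
proof -
  have "span (chosen_basis V) = V" using chosen_basis V span_minimal by blast
  then show ?thesis using chosen_basis(2)[of V]
    by (intro linear_map_onI) (simp_all add: representation_add representation_scale)
qed

lemma linear_trace_sum:
  assumes V: "subspace V" and f: "\<And>i x. i \<in> I \<Longrightarrow> x \<in> V \<Longrightarrow> f i x \<in> V"
  shows "linear_trace V (\<lambda>x. \<Sum>i\<in>I. scale C (c i) (f i x)) = (\<Sum>i\<in>I. c i * linear_trace V (f i))"
proof -
  have "representation (chosen_basis V) (\<Sum>i\<in>I. scale C (c i) (f i b)) b =
      (\<Sum>i\<in>I. c i * representation (chosen_basis V) (f i b) b)" if b: "b \<in> chosen_basis V" for b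
    using f b chosen_basis(1)[of V]
    by (intro linear_map_on_sum[OF V representation_chosen_basis_linear[OF V]]) (auto simp: representation_zero)
  then show ?thesis
    unfolding linear_trace_def by (simp add: sum.swap[of _ I] sum_distrib_left)
qed

text \<open>Both sides are the sum of all products of matrix entries of \<open>f\<close> and
  \<open>g\<close> in the chosen bases. The two spaces may differ; this is what later makes traces
  over hom-spaces a dinatural family.\<close>

lemma linear_trace_cyclic:
  assumes V: "subspace V" "V \<subseteq> span B" "finite B" and W: "subspace W" "W \<subseteq> span B'" "finite B'"
    and f: "linear_map_on (scale C) (scale C) V f" "\<And>x. x \<in> V \<Longrightarrow> f x \<in> W"
    and g: "linear_map_on (scale C) (scale C) W g" "\<And>x. x \<in> W \<Longrightarrow> g x \<in> V"
  shows "linear_trace V (\<lambda>x. g (f x)) = linear_trace W (\<lambda>x. f (g x))"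
proof -
  have *: "linear_trace V (\<lambda>x. g (f x)) =
     (\<Sum>b\<in>chosen_basis V. \<Sum>c\<in>chosen_basis W. representation (chosen_basis W) (f b) c * representation
       (chosen_basis V) (g c) b)"
    if V: "subspace V" "V \<subseteq> span B" "finite B" and W: "subspace W" "W \<subseteq> span B'" "finite B'"
    and f: "linear_map_on (scale C) (scale C) V f" "\<And>x. x \<in> V \<Longrightarrow> f x \<in> W"
    and g: "linear_map_on (scale C) (scale C) W g" "\<And>x. x \<in> W \<Longrightarrow> g x \<in> V" for V W B B' f g
    unfolding linear_trace_def
  proof (rule sum.cong)
    fix b assume b: "b \<in> chosen_basis V"
    have fb: "f b \<in> W" using f(2) b chosen_basis(1) by auto
    have fin: "finite (chosen_basis W)" using chosen_basis_finite W by blast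
    have "(\<Sum>c\<in>chosen_basis W. scale C (representation (chosen_basis W) (f b) c) c) = f b"
      using fb chosen_basis[of W] fin by (intro sum_representation_eq) auto
    then have "g (f b) = (\<Sum>c\<in>chosen_basis W. scale C (representation (chosen_basis W) (f b) c) (g c))"
      using linear_map_on_sum[OF W(1) g(1) linear_map_on_0[OF W(1) g(1)], of "chosen_basis W" "\<lambda>c. c"
        "representation (chosen_basis W) (f b)"] chosen_basis(1)[of W] by auto
    also have "representation (chosen_basis V) \<dots> b =
       (\<Sum>c\<in>chosen_basis W. representation (chosen_basis W) (f b) c * representation (chosen_basis V) (g c) b)"
      using g(2) chosen_basis(1)[of W]
      by (intro linear_map_on_sum[OF V(1) representation_chosen_basis_linear[OF V(1)]]) (auto simp:
        representation_zero)
    finally show "representation (chosen_basis V) (g (f b)) b =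
       (\<Sum>c\<in>chosen_basis W. representation (chosen_basis W) (f b) c * representation (chosen_basis V) (g c) b)" .
  qed simp
  have "linear_trace V (\<lambda>x. g (f x)) =
     (\<Sum>b\<in>chosen_basis V. \<Sum>c\<in>chosen_basis W. representation (chosen_basis W) (f b) c * representation
       (chosen_basis V) (g c) b)"
    by (rule *[OF V W f g])
  also have "\<dots> = (\<Sum>c\<in>chosen_basis W. \<Sum>b\<in>chosen_basis V. representation (chosen_basis V) (g c) b *
    representation (chosen_basis W) (f b) c)"
    by (subst sum.swap) (simp add: mult.commute)
  also have "\<dots> = linear_trace W (\<lambda>x. f (g x))"
    by (rule *[OF W V g f, symmetric])
  finally show ?thesis .
qed

text \<open>Cyclicity, applied to \<open>e\<close> as a map onto \<open>e V\<close> and to the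
  inclusion of \<open>e V\<close>, reduces the trace to that of the identity on \<open>e V\<close>.
  This is the dimension of \<open>e V\<close> as an element of the field, and characteristic zero
  keeps it nonzero.\<close>

lemma linear_trace_idempotent_nonzero:
  fixes e :: "'m \<Rightarrow> 'm"
  assumes char0: "\<And>n. of_nat n = (0::'k) \<Longrightarrow> n = 0"
    and V: "subspace V" "V \<subseteq> span B" "finite B"
    and e: "linear_map_on (scale C) (scale C) V e" "\<And>x. x \<in> V \<Longrightarrow> e x \<in> V" "\<And>x. x \<in> V \<Longrightarrow> e (e x) = e x"
    and v: "v \<in> V" "e v = v" "v \<noteq> 0"
  shows "linear_trace V e \<noteq> 0"
proof -
  have W: "subspace (e ` V)" "e ` V \<subseteq> V" using subspace_linear_image V e by auto
  have idW: "linear_map_on (scale C) (scale C) (e ` V) (\<lambda>x. x)" by (auto intro: linear_map_onI)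
  have "linear_trace V (\<lambda>x. e x) = linear_trace (e ` V) (\<lambda>x. e x)"
    using linear_trace_cyclic[OF V W(1) _ V(3) e(1) _ idW] W V by auto
  also have "\<dots> = linear_trace (e ` V) (\<lambda>x. x)" using e by (intro linear_trace_cong) auto
  also have "\<dots> = of_nat (card (chosen_basis (e ` V)))"
    using chosen_basis(2) by (simp add: linear_trace_def representation_basis)
  finally have "linear_trace V e = of_nat (card (chosen_basis (e ` V)))" .
  moreover have "card (chosen_basis (e ` V)) \<noteq> 0"
  proof
    assume "card (chosen_basis (e ` V)) = 0"
    then have "chosen_basis (e ` V) = {}" using chosen_basis_finite[of "e ` V" B] W V by auto
    then have "e ` V \<subseteq> {0}" using chosen_basis(3)[of "e ` V"] by simp
    then show False using v by (metis imageI singletonD subsetD)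
  qed
  ultimately show ?thesis using char0 by metis
qed

end

section \<open>Subobjects as submodules of \<open>Hom(G, X)\<close>\<close>

context progenerated_category
begin

lemma faithful_eq:
  assumes "f \<in> hom C X Y" "g \<in> hom C X Y" "\<And>k. k \<in> hom C G X \<Longrightarrow> f \<cdot> k = g \<cdot> k"
  shows "f = g"
proof -
  have "f - g = 0"
    using assms by (intro faithful[OF hom_diff[OF assms(1,2)]]) (simp add: comp_diff_left)
  then show ?thesis by simp
qed

text \<open>The inverse bijection is again linear and compatible with \<open>End(G)\<close>, so
  \<open>full\<close> produces a morphism from it, and faithfulness makes this a two-sided
  inverse.\<close>

lemma iso_if_bij:
  assumes f: "f \<in> hom C X Y" and bij: "bij_betw (\<lambda>k. f \<cdot> k) (hom C G X) (hom C G Y)"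
  shows "is_iso C X Y f"
proof -
  let ?l = "inv_into (hom C G X) (\<lambda>k. f \<cdot> k)"
  have l: "?l y \<in> hom C G X" "f \<cdot> ?l y = y" if "y \<in> hom C G Y" for y
    using bij that by (auto simp: bij_betw_def inv_into_into f_inv_into_f[of y "\<lambda>k. f \<cdot> k"])
  have inj: "k = k'" if "k \<in> hom C G X" "k' \<in> hom C G X" "f \<cdot> k = f \<cdot> k'" for k k'
    using bij that by (auto simp: bij_betw_def inj_on_def)
  have "linear_map_on (scale C) (scale C) (hom C G Y) ?l"
    by (intro linear_map_on_inv_into[OF comp_linear_right[OF f] bij] hom_add hom_scale)
  moreover have "?l (y \<cdot> a) = ?l y \<cdot> a" if y: "y \<in> hom C G Y" and a: "a \<in> hom C G G" for y a
  proof (rule inj)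
    show "f \<cdot> ?l (y \<cdot> a) = f \<cdot> (?l y \<cdot> a)"
      using l(2)[OF comp_in_hom[OF a y]] comp_assoc[OF a l(1)[OF y] f] l(2)[OF y] by simp
  qed (use l y a comp_in_hom in auto)
  ultimately obtain g where g: "g \<in> hom C Y X" "\<And>k. k \<in> hom C G Y \<Longrightarrow> g \<cdot> k = ?l k"
    using full[of Y ?l X] l(1) by blast
  have "f \<cdot> g = ident C Y"
    using g f l by (intro faithful_eq[OF _ ident_in_hom]) (auto simp: comp_in_hom comp_ident_left
      comp_assoc[symmetric])
  moreover have "g \<cdot> f = ident C X"
  proof (intro faithful_eq[OF _ ident_in_hom])
    fix k assume k: "k \<in> hom C G X"
    then show "g \<cdot> f \<cdot> k = ident C X \<cdot> k"
      using g f l comp_in_hom[OF k f] bij by (simp add: comp_ident_left comp_assoc[OF k f g(1), symmetric]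
        bij_betw_def)
  qed (use f g comp_in_hom in auto)
  ultimately show ?thesis using f g by (auto simp: is_iso_def)
qed

text \<open>A right \<open>End(G)\<close>-submodule; under the equivalence this is a subobject of
  \<open>X\<close>.\<close>

definition hom_submodule :: "'o \<Rightarrow> 'm set \<Rightarrow> bool" where
  "hom_submodule X U \<longleftrightarrow> subspace U \<and> U \<subseteq> hom C G X \<and> (\<forall>u\<in>U. \<forall>a\<in>hom C G G. u \<cdot> a \<in> U)"

lemma hom_submodule_range:
  assumes "f \<in> hom C X Y"
  shows "hom_submodule Y ((\<lambda>k. f \<cdot> k) ` hom C G X)"
proof -
  have "f \<cdot> k \<cdot> a \<in> (\<lambda>k. f \<cdot> k) ` hom C G X" if "k \<in> hom C G X" "a \<in> hom C G G" for k a
    using that comp_assoc[OF that(2,1) assms] comp_in_hom[OF that(2,1)] by (metis imageI)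
  then show ?thesis
    unfolding hom_submodule_def
    using subspace_linear_image[OF hom_subspace comp_linear_right[OF assms]] assms comp_in_hom by auto
qed

lemma hom_submodule_kernel:
  assumes "f \<in> hom C X Y"
  shows "hom_submodule X {k \<in> hom C G X. f \<cdot> k = 0}"
proof -
  have "subspace {k \<in> hom C G X. f \<cdot> k = 0}"
    by (rule subspaceI) (use assms in \<open>auto simp: hom_zero hom_add hom_scale comp_zero_right
      comp_add_right comp_scale_right\<close>)
  then show ?thesis
    unfolding hom_submodule_def
    using assms comp_in_hom by (auto simp: comp_assoc comp_zero_left)
qed

text \<open>Source of the kernels, quotients and images constructed later. \<open>realize\<close>
  turns the submodule \<open>U\<close> and its quotient into objects, and \<open>full\<close> turns
  inclusion and projection into morphisms. The linear map \<open>\<pi>\<close> is a retraction onto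
  \<open>U\<close> transported to \<open>Hom(G, Y)\<close>; it serves to compare dimensions.\<close>

lemma submodule_short_exact:
  assumes "hom_submodule X U"
  obtains Y f Z g \<pi> where "short_exact C Y X Z f g" "(\<lambda>k. f \<cdot> k) ` hom C G Y = U"
    "{k \<in> hom C G X. g \<cdot> k = 0} = U" "(\<lambda>k. g \<cdot> k) ` hom C G X = hom C G Z"
    "linear_map_on (scale C) (scale C) (hom C G X) \<pi>" "\<pi> ` hom C G X = hom C G Y"
    "\<And>k. k \<in> hom C G X \<Longrightarrow> \<exists>u\<in>U. \<pi> k = \<pi> u"
proof -
  have U: "subspace U" "U \<subseteq> hom C G X" "\<And>u a. u \<in> U \<Longrightarrow> a \<in> hom C G G \<Longrightarrow> u \<cdot> a \<in> U"
    using assms by (auto simp: hom_submodule_def)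
  obtain B where B: "finite B" "hom C G X \<subseteq> span B" using hom_finite_dim by blast
  have "\<exists>Y \<Psi>. linear_map_on (scale C) (scale C) (hom C G Y) \<Psi> \<and> bij_betw \<Psi> (hom C G Y) U \<and>
         (\<forall>k\<in>hom C G Y. \<forall>a\<in>hom C G G. \<Psi> (k \<cdot> a) = \<Psi> k \<cdot> a)"
  proof (rule realize[OF U(1) _ B(1)])
    show "linear_map_on (scale C) (scale C) U (\<lambda>v. v \<cdot> a)" if "a \<in> hom C G G" for a
      using comp_linear_left[OF that] U(2) by (rule linear_map_on_subset)
    show "linear_map_on (scale C) (scale C) (hom C G G) ((\<cdot>) v)" if "v \<in> U" for v
      using comp_linear_right[of v G X G] that U(2) by auto
    show "v \<cdot> a \<cdot> b = v \<cdot> (a \<cdot> b)" if "v \<in> U" "a \<in> hom C G G" "b \<in> hom C G G" for v a b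
      using comp_assoc[OF that(3,2), of v X] that U(2) by auto
    show "v \<cdot> ident C G = v" if "v \<in> U" for v using comp_ident_right[of v G X] that U(2) by auto
  qed (use B U in auto)
  then obtain Y \<Psi> where \<Psi>: "linear_map_on (scale C) (scale C) (hom C G Y) \<Psi>" "bij_betw \<Psi> (hom C G Y) U"
    "\<And>k a. k \<in> hom C G Y \<Longrightarrow> a \<in> hom C G G \<Longrightarrow> \<Psi> (k \<cdot> a) = \<Psi> k \<cdot> a" by blast
  have \<Psi>U: "\<Psi> k \<in> U" if "k \<in> hom C G Y" for k using \<Psi>(2) that by (auto simp: bij_betw_def)
  let ?i = "inv_into (hom C G Y) \<Psi>"
  have i: "?i u \<in> hom C G Y" "\<Psi> (?i u) = u" if "u \<in> U" for u
    using \<Psi>(2) that by (auto simp: bij_betw_def inv_into_into f_inv_into_f)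
  have i\<Psi>: "?i (\<Psi> k) = k" if "k \<in> hom C G Y" for k using \<Psi>(2) that by (auto simp: bij_betw_def)
  have ilin: "linear_map_on (scale C) (scale C) U ?i"
    by (intro linear_map_on_inv_into \<Psi> hom_add hom_scale)
  have iact: "?i (u \<cdot> a) = ?i u \<cdot> a" if "u \<in> U" "a \<in> hom C G G" for u a
    using i\<Psi>[OF comp_in_hom[OF that(2) i(1)[OF that(1)]]] \<Psi>(3)[OF i(1)[OF that(1)] that(2)]
      i(2)[OF that(1)] by simp
  obtain f where f: "f \<in> hom C Y X" and f\<Psi>: "\<And>k. k \<in> hom C G Y \<Longrightarrow> f \<cdot> k = \<Psi> k"
    using full[OF \<Psi>(1) _ \<Psi>(3)] \<Psi>U U(2) by blast
  obtain p where p: "linear_map_on (scale C) (scale C) (hom C G X) p" "\<And>x. x \<in> hom C G X \<Longrightarrow> p x \<in> hom C G X"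
    "\<And>x. x \<in> hom C G X \<Longrightarrow> x - p x \<in> U" "\<And>u. u \<in> U \<Longrightarrow> p u = 0" "\<And>x. x \<in> hom C G X \<Longrightarrow> p (p x) = p x"
    using projection_along[OF U(1,2) hom_subspace] by blast
  have pdiff: "p x = p y" if "x \<in> hom C G X" "y \<in> hom C G X" "x - y \<in> U" for x y
  proof -
    have "p (y + (x - y)) = p y + p (x - y)" using that U by (intro linear_map_onD(1)[OF p(1)]) auto
    then show ?thesis using p(4)[OF that(3)] by simp
  qed
  \<comment> \<open>The complement \<open>W\<close> stands for the quotient by \<open>U\<close>; the
    action on it is composition followed by \<open>p\<close>.\<close>
  define W where "W = p ` hom C G X"
  have Wp: "W \<subseteq> hom C G X" "\<And>w. w \<in> W \<Longrightarrow> p w = w" using p by (auto simp: W_def)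
  have Wsub: "subspace W" unfolding W_def by (rule subspace_linear_image[OF hom_subspace p(1)])
  \<comment> \<open>Composition preserves \<open>U\<close>, so the projected action does not depend
    on the representative. This gives associativity of the action on \<open>W\<close>.\<close>
  have pact: "p (p x \<cdot> a) = p (x \<cdot> a)" if x: "x \<in> hom C G X" and a: "a \<in> hom C G G" for x a
  proof -
    have "(x - p x) \<cdot> a \<in> U" using U(3)[OF p(3)[OF x] a] .
    then have "x \<cdot> a - p x \<cdot> a \<in> U" using comp_diff_left[OF a x p(2)[OF x]] by simp
    from pdiff[OF _ _ this] show ?thesis using comp_in_hom[OF a] x p(2) by auto
  qed
  have "\<exists>Z \<Phi>. linear_map_on (scale C) (scale C) (hom C G Z) \<Phi> \<and> bij_betw \<Phi> (hom C G Z) W \<and>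
         (\<forall>k\<in>hom C G Z. \<forall>a\<in>hom C G G. \<Phi> (k \<cdot> a) = p (\<Phi> k \<cdot> a))"
  proof (rule realize[OF Wsub _ B(1)])
    show "p (v \<cdot> a) \<in> W" if "v \<in> W" "a \<in> hom C G G" for v a
      unfolding W_def using that Wp comp_in_hom by (intro imageI) blast
    show "linear_map_on (scale C) (scale C) W (\<lambda>v. p (v \<cdot> a))" if a: "a \<in> hom C G G" for a
    proof (rule linear_map_onI)
      fix x y assume "x \<in> W" "y \<in> W"
      then have xy: "x \<in> hom C G X" "y \<in> hom C G X" using Wp by auto
      then show "p ((x + y) \<cdot> a) = p (x \<cdot> a) + p (y \<cdot> a)"
        using comp_in_hom[OF a] by (simp add: comp_add_left[OF a xy] linear_map_onD(1)[OF p(1)])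
      show "p (scale C c x \<cdot> a) = scale C c (p (x \<cdot> a))" for c
        using comp_in_hom[OF a] xy by (simp add: comp_scale_left[OF a xy(1)] linear_map_onD(2)[OF p(1)])
    qed
    show "linear_map_on (scale C) (scale C) (hom C G G) (\<lambda>a. p (v \<cdot> a))" if "v \<in> W" for v
    proof (rule linear_map_onI)
      have v: "v \<in> hom C G X" using Wp that by auto
      fix x y assume xy: "x \<in> hom C G G" "y \<in> hom C G G"
      show "p (v \<cdot> (x + y)) = p (v \<cdot> x) + p (v \<cdot> y)"
        using comp_in_hom[OF _ v] xy by (simp add: comp_add_right[OF xy v] linear_map_onD(1)[OF p(1)])
      show "p (v \<cdot> scale C c x) = scale C c (p (v \<cdot> x))" for c
        using comp_in_hom[OF _ v] xy by (simp add: comp_scale_right[OF xy(1) v] linear_map_onD(2)[OF p(1)])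
    qed
    show "p (v \<cdot> ident C G) = v" if "v \<in> W" for v
      using Wp that comp_ident_right[of v G X] by auto
    show "p (p (v \<cdot> a) \<cdot> b) = p (v \<cdot> (a \<cdot> b))" if "v \<in> W" "a \<in> hom C G G" "b \<in> hom C G G" for v a b
      using pact[OF comp_in_hom[OF that(2)] that(3), of v] comp_assoc[OF that(3,2), of v X] that Wp by auto
  qed (use B Wp in auto)
  then obtain Z \<Phi> where \<Phi>: "linear_map_on (scale C) (scale C) (hom C G Z) \<Phi>" "bij_betw \<Phi> (hom C G Z) W"
    "\<And>k a. k \<in> hom C G Z \<Longrightarrow> a \<in> hom C G G \<Longrightarrow> \<Phi> (k \<cdot> a) = p (\<Phi> k \<cdot> a)" by blast
  have \<Phi>W: "\<Phi> k \<in> W" if "k \<in> hom C G Z" for k using \<Phi>(2) that by (auto simp: bij_betw_def)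
  have \<Phi>X: "\<Phi> k \<in> hom C G X" if "k \<in> hom C G Z" for k using \<Phi>W[OF that] Wp by auto
  let ?j = "inv_into (hom C G Z) \<Phi>"
  have j: "?j w \<in> hom C G Z" "\<Phi> (?j w) = w" if "w \<in> W" for w
    using \<Phi>(2) that by (auto simp: bij_betw_def inv_into_into f_inv_into_f)
  have j\<Phi>: "?j (\<Phi> k) = k" if "k \<in> hom C G Z" for k using \<Phi>(2) that by (auto simp: bij_betw_def)
  have jlin: "linear_map_on (scale C) (scale C) W ?j"
    by (intro linear_map_on_inv_into \<Phi> hom_add hom_scale)
  have pW: "p x \<in> W" if "x \<in> hom C G X" for x using that by (simp add: W_def)
  have "linear_map_on (scale C) (scale C) (hom C G X) (\<lambda>x. ?j (p x))"
    using pW by (intro linear_map_onI) (simp_all add: linear_map_onD[OF p(1)] linear_map_onD[OF jlin])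
  moreover have "?j (p (k \<cdot> a)) = ?j (p k) \<cdot> a" if k: "k \<in> hom C G X" and a: "a \<in> hom C G G" for k a
  proof -
    have "\<Phi> (?j (p k) \<cdot> a) = p (k \<cdot> a)"
      using \<Phi>(3)[OF j(1)[OF pW[OF k]] a] j(2)[OF pW[OF k]] pact[OF k a] by simp
    then show ?thesis using j\<Phi>[OF comp_in_hom[OF a j(1)[OF pW[OF k]]]] by simp
  qed
  ultimately obtain g where g: "g \<in> hom C X Z" and gj: "\<And>k. k \<in> hom C G X \<Longrightarrow> g \<cdot> k = ?j (p k)"
    using full[of X "\<lambda>x. ?j (p x)" Z] pW j(1) by blast
  have ker: "g \<cdot> k = 0 \<longleftrightarrow> k \<in> U" if k: "k \<in> hom C G X" for k
  proof -
    have "?j 0 = 0" "\<Phi> 0 = 0" using linear_map_on_0 Wsub jlin hom_subspace \<Phi>(1) by blast+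
    then have "g \<cdot> k = 0 \<longleftrightarrow> p k = 0" using gj[OF k] j(2)[OF pW[OF k]] by auto
    also have "p k = 0 \<longleftrightarrow> k \<in> U" using p(3)[OF k] p(4) by auto
    finally show ?thesis .
  qed
  have gsurj: "g \<cdot> \<Phi> z = z" if "z \<in> hom C G Z" for z
    using gj[OF \<Phi>X[OF that]] Wp(2)[OF \<Phi>W[OF that]] j\<Phi>[OF that] by simp
  have fU: "(\<lambda>k. f \<cdot> k) ` hom C G Y = U"
    using \<Psi>(2) f\<Psi> by (simp add: bij_betw_def cong: image_cong)
  have gf: "g \<cdot> f = 0"
    using f g f\<Psi> \<Psi>U U(2) ker by (intro faithful[OF comp_in_hom[OF f g]]) (simp add: comp_assoc[symmetric]
      subset_iff)
  have fmono: "h = h'" if "h \<in> hom C V Y" "h' \<in> hom C V Y" "f \<cdot> h = f \<cdot> h'" for V h h'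
  proof (rule faithful_eq[OF that(1,2)])
    fix k assume k: "k \<in> hom C G V"
    have "f \<cdot> (h \<cdot> k) = f \<cdot> (h' \<cdot> k)" using comp_assoc[OF k that(1) f] comp_assoc[OF k that(2) f] that(3)
      by simp
    then show "h \<cdot> k = h' \<cdot> k"
      using f\<Psi>[OF comp_in_hom[OF k that(1)]] f\<Psi>[OF comp_in_hom[OF k that(2)]]
        i\<Psi>[OF comp_in_hom[OF k that(1)]] i\<Psi>[OF comp_in_hom[OF k that(2)]] by metis
  qed
  have kernel: "is_kernel C Y X Z f g"
    unfolding is_kernel_def
  proof (intro conjI allI ballI impI f g gf)
    fix V h assume h: "h \<in> hom C V X" and gh: "g \<cdot> h = 0"
    have hU: "h \<cdot> k \<in> U" if "k \<in> hom C G V" for k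
      using ker[OF comp_in_hom[OF that h]] comp_assoc[OF that h g] gh comp_zero_left[OF that] by simp
    have "linear_map_on (scale C) (scale C) (hom C G V) (\<lambda>k. ?i (h \<cdot> k))"
      using hU by (intro linear_map_onI)
       (simp_all add: linear_map_onD[OF comp_linear_right[OF h, of G]] linear_map_onD[OF ilin])
    moreover have "?i (h \<cdot> (k \<cdot> a)) = ?i (h \<cdot> k) \<cdot> a" if "k \<in> hom C G V" "a \<in> hom C G G" for k a
      using iact[OF hU[OF that(1)] that(2)] comp_assoc[OF that(2,1) h] by simp
    ultimately obtain h' where h': "h' \<in> hom C V Y" "\<And>k. k \<in> hom C G V \<Longrightarrow> h' \<cdot> k = ?i (h \<cdot> k)"
      using full[of V "\<lambda>k. ?i (h \<cdot> k)" Y] hU i(1) by blast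
    have "f \<cdot> h' = h"
      using h' hU i f\<Psi> by (intro faithful_eq[OF comp_in_hom[OF h'(1) f] h]) (simp add: comp_assoc[OF _
        h'(1) f, symmetric])
    then show "\<exists>!h'. h' \<in> hom C V Y \<and> f \<cdot> h' = h" using h'(1) fmono by blast
  qed
  have cokernel: "is_cokernel C Y X Z f g"
    unfolding is_cokernel_def
  proof (intro conjI allI ballI impI f g gf)
    fix V h assume h: "h \<in> hom C X V" and hf: "h \<cdot> f = 0"
    have hU: "h \<cdot> u = 0" if "u \<in> U" for u
    proof -
      obtain k where k: "k \<in> hom C G Y" "u = f \<cdot> k" using \<open>u \<in> U\<close> fU by blast
      then show ?thesis using comp_assoc[OF k(1) f h] hf comp_zero_left[OF k(1)] by simp
    qed
    \<comment> \<open>\<open>h\<close> vanishes on \<open>U\<close>, so it does not distinguish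
      \<open>x\<close> from its representative \<open>p x\<close>; hence it descends to
      \<open>Z\<close>.\<close>
    have hp: "h \<cdot> p x = h \<cdot> x" if "x \<in> hom C G X" for x
      using hU[OF p(3)[OF that]] comp_diff_right[OF that p(2)[OF that] h] by simp
    have "linear_map_on (scale C) (scale C) (hom C G Z) (\<lambda>k. h \<cdot> \<Phi> k)"
      using \<Phi>X by (intro linear_map_onI)
       (simp_all add: linear_map_onD[OF comp_linear_right[OF h, of G]] linear_map_onD[OF \<Phi>(1)])
    moreover have "h \<cdot> \<Phi> (k \<cdot> a) = (h \<cdot> \<Phi> k) \<cdot> a" if "k \<in> hom C G Z" "a \<in> hom C G G" for k a
      using \<Phi>(3)[OF that] hp[OF comp_in_hom[OF that(2) \<Phi>X[OF that(1)]]] comp_assoc[OF that(2) \<Phi>X[OF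
        that(1)] h] by simp
    ultimately obtain h' where h': "h' \<in> hom C Z V" "\<And>k. k \<in> hom C G Z \<Longrightarrow> h' \<cdot> k = h \<cdot> \<Phi> k"
      using full[of Z "\<lambda>k. h \<cdot> \<Phi> k" V] \<Phi>X comp_in_hom[OF _ h] by blast
    have "h' \<cdot> g = h"
    proof (rule faithful_eq[OF comp_in_hom[OF g h'(1)] h])
      fix k assume k: "k \<in> hom C G X"
      show "h' \<cdot> g \<cdot> k = h \<cdot> k"
        using comp_assoc[OF k g h'(1)] gj[OF k] h'(2)[OF j(1)[OF pW[OF k]]] j(2)[OF pW[OF k]] hp[OF k] by simp
    qed
    moreover have "h'' = h'" if h'': "h'' \<in> hom C Z V" "h'' \<cdot> g = h" for h''
    proof (rule faithful_eq[OF h''(1) h'(1)])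
      fix z assume z: "z \<in> hom C G Z"
      show "h'' \<cdot> z = h' \<cdot> z"
        using gsurj[OF z] comp_assoc[OF \<Phi>X[OF z] g h''(1)] h''(2) h'(2)[OF z] by simp
    qed
    ultimately show "\<exists>!h'. h' \<in> hom C Z V \<and> h' \<cdot> g = h" using h'(1) by blast
  qed
  define \<pi> where "\<pi> x = ?i (x - p x)" for x
  have "linear_map_on (scale C) (scale C) (hom C G X) (\<lambda>x. x - p x)"
    by (intro linear_map_onI) (simp_all add: linear_map_onD[OF p(1)] scale_right_diff_distrib)
  then have \<pi>lin: "linear_map_on (scale C) (scale C) (hom C G X) \<pi>"
    unfolding \<pi>_def using p(3) ilin by (rule linear_map_on_comp)
  have \<pi>U: "\<pi> u = ?i u" if "u \<in> U" for u using p(4)[OF that] by (simp add: \<pi>_def)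
  show thesis
  proof (rule that[of Y Z f g \<pi>])
    show "short_exact C Y X Z f g" using kernel cokernel by (simp add: short_exact_def)
    show "{k \<in> hom C G X. g \<cdot> k = 0} = U" using ker U(2) by auto
    show "(\<lambda>k. g \<cdot> k) ` hom C G X = hom C G Z"
    proof (intro equalityI subsetI)
      fix z assume z: "z \<in> hom C G Z"
      show "z \<in> (\<lambda>k. g \<cdot> k) ` hom C G X" using gsurj[OF z] \<Phi>X[OF z] by (metis imageI)
    qed (use g comp_in_hom in auto)
    show "\<pi> ` hom C G X = hom C G Y"
    proof (intro equalityI subsetI)
      fix y assume y: "y \<in> hom C G Y"
      have "\<pi> (\<Psi> y) = y" using \<pi>U[OF \<Psi>U[OF y]] i\<Psi>[OF y] by simp
      then show "y \<in> \<pi> ` hom C G X" using \<Psi>U[OF y] U(2) by (metis imageI subsetD)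
    qed (use p(3) i(1) in \<open>auto simp: \<pi>_def\<close>)
    show "\<exists>u\<in>U. \<pi> k = \<pi> u" if "k \<in> hom C G X" for k
      using \<pi>U[OF p(3)[OF that]] p(3)[OF that] by (intro bexI[of _ "k - p k"]) (simp_all add: \<pi>_def)
  qed (use fU \<pi>lin in auto)
qed

end

section \<open>Short exact sequences and Grothendieck classes\<close>

context linear_category
begin

text \<open>The zero morphism factors through the cokernel in only one way.\<close>

lemma cokernel_epi:
  assumes "is_cokernel C X Y Z f g" "h \<in> hom C Z V" "h \<cdot> g = 0"
  shows "h = 0"
proof -
  have f: "f \<in> hom C X Y" and g: "g \<in> hom C Y Z" using assms(1) by (auto simp: is_cokernel_def)
  have "0 \<cdot> f = 0" using f by (rule comp_zero_left)
  then have "\<exists>!h'. h' \<in> hom C Z V \<and> h' \<cdot> g = 0"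
    using assms(1) hom_zero unfolding is_cokernel_def by blast
  then show ?thesis using assms(2,3) hom_zero comp_zero_left[OF g] by blast
qed

lemma kernel_mono:
  assumes "is_kernel C X Y Z f g"
  shows "is_mono C X Y f"
  unfolding is_mono_def
proof (intro conjI allI ballI impI)
  show f: "f \<in> hom C X Y" using assms by (simp add: is_kernel_def)
  have g: "g \<in> hom C Y Z" "g \<cdot> f = 0" using assms by (auto simp: is_kernel_def)
  fix W h h' assume h: "h \<in> hom C W X" "h' \<in> hom C W X" "f \<cdot> h = f \<cdot> h'"
  have "g \<cdot> (f \<cdot> h) = 0" using comp_assoc[OF h(1) f g(1)] g(2) comp_zero_left[OF h(1)] by simp
  then have "\<exists>!h'. h' \<in> hom C W X \<and> f \<cdot> h' = f \<cdot> h"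
    using assms comp_in_hom[OF h(1) f] unfolding is_kernel_def by blast
  then show "h = h'" using h by metis
qed

text \<open>With a zero object as third term, this sequence gives isomorphic objects the same
  Grothendieck class.\<close>

lemma iso_zero_short_exact:
  assumes h: "is_iso C X Y h" and Z: "ident C Z = 0"
  shows "short_exact C X Y Z h 0"
proof -
  obtain g where hg: "h \<in> hom C X Y" "g \<in> hom C Y X" "g \<cdot> h = ident C X" "h \<cdot> g = ident C Y"
    using h by (auto simp: is_iso_def)
  have Zhom: "f = 0" if "f \<in> hom C Z V" for f V
    using comp_ident_right[OF that] Z comp_zero_right[OF that] by simp
  have "\<exists>!k'. k' \<in> hom C V X \<and> h \<cdot> k' = k" if k: "k \<in> hom C V Y" for V k
  proof (intro ex1I conjI)
    show "g \<cdot> k \<in> hom C V X" "h \<cdot> (g \<cdot> k) = k"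
      using hg k comp_in_hom comp_assoc[OF k hg(2,1)] comp_ident_left by auto
    fix k' assume "k' \<in> hom C V X \<and> h \<cdot> k' = k"
    then show "k' = g \<cdot> k" using comp_assoc[of k' V X h Y g X] hg comp_ident_left by auto
  qed
  moreover have "\<exists>!k'. k' \<in> hom C Z V \<and> k' \<cdot> 0 = k" if k: "k \<in> hom C Y V" "k \<cdot> h = 0" for V k
  proof -
    have "k = (k \<cdot> h) \<cdot> g" using comp_assoc[OF hg(2,1) k(1)] hg(4) comp_ident_right[OF k(1)] by simp
    then have "k = 0" using k(2) comp_zero_left[OF hg(2)] by simp
    then show ?thesis using hom_zero Zhom comp_zero_right[OF hom_zero] by (intro ex1I[of _ 0]) auto
  qed
  ultimately show ?thesis
    using hg(1) hom_zero comp_zero_left[OF hg(1)] by (simp add: short_exact_def is_kernel_def is_cokernel_def)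
qed

text \<open>Equality of classes in the Grothendieck group, used in place of isomorphism: equivalent
  objects can be exchanged modulo the relations at once, and inequivalent ones are not
  isomorphic.\<close>

definition equiv_in_Gr :: "'o \<Rightarrow> 'o \<Rightarrow> bool" where
  "equiv_in_Gr X Y \<longleftrightarrow>
     frag_of X - frag_of Y \<in> group_closure (grothendieck_relations C)"

lemma short_exact_in_relations:
  "short_exact C X Y Z f g \<Longrightarrow>
     frag_of Y - frag_of X - frag_of Z
       \<in> group_closure (grothendieck_relations C)"
  by (rule group_closure.base) (auto simp: grothendieck_relations_def)

text \<open>The sequence with three copies of \<open>Z\<close> is exact, and its relation is minus
  the class of \<open>Z\<close>.\<close>

lemma zero_object_in_relations:
  assumes "ident C Z = 0"
  shows "frag_of Z \<in> group_closure (grothendieck_relations C)"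
proof -
  have "is_iso C Z Z (ident C Z)" using ident_in_hom comp_ident_left by (auto simp: is_iso_def)
  from short_exact_in_relations[OF iso_zero_short_exact[OF this assms]]
  have "- frag_of Z \<in> group_closure (grothendieck_relations C)" by simp
  then show ?thesis by simp
qed

end

section \<open>Projectivity, Schur's lemma and composition series\<close>

context progenerated_category
begin

text \<open>The zero submodule of \<open>Hom(G, G)\<close> gives a subobject of \<open>G\<close>
  whose inclusion is both zero and mono, so its identity vanishes.\<close>

lemma zero_object: "\<exists>Z. ident C Z = 0"
proof -
  have "hom_submodule G {0}"
    unfolding hom_submodule_def using hom_zero comp_zero_left by (auto simp: subspace_single_0)
  then obtain Y f Z g where se: "short_exact C Y G Z f g" and im: "(\<lambda>k. f \<cdot> k) ` hom C G Y = {0}"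
    by (rule submodule_short_exact)
  have f: "f \<in> hom C Y G" using se by (simp add: short_exact_def is_kernel_def)
  have "f = 0" using im by (intro faithful[OF f]) auto
  moreover have "is_mono C Y G f" using se kernel_mono by (auto simp: short_exact_def)
  ultimately have "ident C Y = 0"
    using ident_in_hom hom_zero comp_zero_left[OF ident_in_hom] comp_zero_right[OF f]
      unfolding is_mono_def by metis
  then show ?thesis by blast
qed

lemma iso_equiv_in_Gr:
  assumes "is_iso C X Y h"
  shows "equiv_in_Gr Y X"
proof -
  obtain Z where Z: "ident C Z = 0" using zero_object by blast
  show ?thesis
    using group_closure_add[OF short_exact_in_relations[OF iso_zero_short_exact[OF assms Z]]
      zero_object_in_relations[OF Z]]
    by (simp add: equiv_in_Gr_def)
qed

text \<open>This is the projectivity of \<open>G\<close>. The projection of \<open>Z\<close> to its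
  quotient by the image of \<open>g\<close> kills \<open>g\<close>, hence is zero, so the image was
  everything.\<close>

lemma epi_surjective:
  assumes g: "g \<in> hom C Y Z" and epi: "\<And>V h. h \<in> hom C Z V \<Longrightarrow> h \<cdot> g = 0 \<Longrightarrow> h = 0" and z: "z \<in> hom C G Z"
  shows "\<exists>k\<in>hom C G Y. g \<cdot> k = z"
proof -
  obtain A f Q q where se: "short_exact C A Z Q f q"
    and U: "{k \<in> hom C G Z. q \<cdot> k = 0} = (\<lambda>k. g \<cdot> k) ` hom C G Y"
    by (rule submodule_short_exact[OF hom_submodule_range[OF g]]) (rule that; assumption)
  have q: "q \<in> hom C Z Q" using se by (simp add: short_exact_def is_kernel_def)
  have "q \<cdot> g = 0"
  proof (rule faithful[OF comp_in_hom[OF g q]])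
    fix k assume k: "k \<in> hom C G Y"
    then have "g \<cdot> k \<in> {k \<in> hom C G Z. q \<cdot> k = 0}" unfolding U by simp
    then show "q \<cdot> g \<cdot> k = 0" using comp_assoc[OF k g q] by simp
  qed
  then have "q = 0" using epi q by blast
  then have "z \<in> {k \<in> hom C G Z. q \<cdot> k = 0}" using z comp_zero_left by simp
  then show ?thesis unfolding U by auto
qed

text \<open>The submodule generated by \<open>x\<close> is the image of a nonzero mono into
  \<open>S\<close>, which is an isomorphism by simplicity.\<close>

lemma simple_generated:
  assumes S: "simple_object C S" and x: "x \<in> hom C G S" "x \<noteq> 0" and y: "y \<in> hom C G S"
  shows "\<exists>a\<in>hom C G G. x \<cdot> a = y"
proof -
  obtain Y f Z g where se: "short_exact C Y S Z f g" and im: "(\<lambda>k. f \<cdot> k) ` hom C G Y = (\<lambda>a. x \<cdot> a) ` hom C G G"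
    by (rule submodule_short_exact[OF hom_submodule_range[OF x(1)]]) (rule that; assumption)
  have f: "f \<in> hom C Y S" "is_mono C Y S f" using se kernel_mono by (auto simp: short_exact_def is_kernel_def)
  have "x \<cdot> ident C G \<in> (\<lambda>k. f \<cdot> k) ` hom C G Y" using im ident_in_hom by blast
  then obtain k where "k \<in> hom C G Y" "x = f \<cdot> k" using comp_ident_right[OF x(1)] by auto
  then have "f \<noteq> 0" using x(2) comp_zero_left by auto
  then have "is_iso C Y S f" using S f(2) by (auto simp: simple_object_def)
  then obtain h where h: "h \<in> hom C S Y" "f \<cdot> h = ident C S" by (auto simp: is_iso_def)
  have "y = f \<cdot> (h \<cdot> y)" using comp_assoc[OF y h(1) f(1)] h(2) comp_ident_left[OF y] by simp
  then have "y \<in> (\<lambda>k. f \<cdot> k) ` hom C G Y" using comp_in_hom[OF y h(1)] by blast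
  then show ?thesis unfolding im by auto
qed

lemma hom_nonzero: "ident C X \<noteq> 0 \<Longrightarrow> \<exists>x\<in>hom C G X. x \<noteq> 0"
  using faithful[OF ident_in_hom, of X] comp_ident_left by metis

lemma mono_if_injective:
  assumes h: "h \<in> hom C X Y" and inj: "\<And>k. k \<in> hom C G X \<Longrightarrow> h \<cdot> k = 0 \<Longrightarrow> k = 0"
  shows "is_mono C X Y h"
  unfolding is_mono_def
proof (intro conjI allI ballI impI h)
  fix W f g assume f: "f \<in> hom C W X" and g: "g \<in> hom C W X" and eq: "h \<cdot> f = h \<cdot> g"
  have "f - g = 0"
  proof (rule faithful[OF hom_diff[OF f g]])
    fix k assume k: "k \<in> hom C G W"
    have "h \<cdot> ((f - g) \<cdot> k) = 0"
      using comp_assoc[OF k hom_diff[OF f g] h] comp_diff_right[OF f g h] eq comp_zero_left[OF k] by simp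
    then show "(f - g) \<cdot> k = 0" using inj comp_in_hom[OF k hom_diff[OF f g]] by blast
  qed
  then show "f = g" by simp
qed

text \<open>The kernel of \<open>h\<close> is a subobject of \<open>S\<close>; since
  \<open>h\<close> is not zero, it cannot be all of \<open>S\<close>, so it is zero. Then
  \<open>h\<close> is mono, and simplicity of \<open>S'\<close> makes it an isomorphism.\<close>

lemma schur:
  assumes S: "simple_object C S" and S': "simple_object C S'" and h: "h \<in> hom C S S'" "h \<noteq> 0"
  shows "is_iso C S S' h"
proof -
  obtain Y f Z g where se: "short_exact C Y S Z f g"
    and im: "(\<lambda>k. f \<cdot> k) ` hom C G Y = {k \<in> hom C G S. h \<cdot> k = 0}"
    by (rule submodule_short_exact[OF hom_submodule_kernel[OF h(1)]]) (rule that; assumption)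
  have f: "f \<in> hom C Y S" "is_mono C Y S f" using se kernel_mono by (auto simp: short_exact_def is_kernel_def)
  have hf: "h \<cdot> f = 0"
  proof (rule faithful[OF comp_in_hom[OF f(1) h(1)]])
    fix k assume k: "k \<in> hom C G Y"
    then have "f \<cdot> k \<in> {k \<in> hom C G S. h \<cdot> k = 0}" unfolding im[symmetric] by simp
    then show "h \<cdot> f \<cdot> k = 0" using comp_assoc[OF k f(1) h(1)] by simp
  qed
  have "f = 0"
  proof (rule ccontr)
    assume "f \<noteq> 0"
    then have "is_iso C Y S f" using S f(2) by (auto simp: simple_object_def)
    then obtain g where g: "g \<in> hom C S Y" "f \<cdot> g = ident C S" by (auto simp: is_iso_def)
    have "h = h \<cdot> f \<cdot> g" using comp_assoc[OF g(1) f(1) h(1)] g(2) comp_ident_right[OF h(1)] by simp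
    then show False using hf comp_zero_left[OF g(1)] h(2) by simp
  qed
  have "is_mono C S S' h"
  proof (rule mono_if_injective[OF h(1)])
    fix k assume "k \<in> hom C G S" "h \<cdot> k = 0"
    then have "k \<in> (\<lambda>k. f \<cdot> k) ` hom C G Y" unfolding im by simp
    then show "k = 0" using \<open>f = 0\<close> comp_zero_left by auto
  qed
  then show ?thesis using S' h(2) by (auto simp: simple_object_def)
qed

text \<open>Induction on the dimension of \<open>Hom(G, D)\<close>. A nonzero object that is not
  simple has a proper nonzero subobject; this subobject and its quotient both have smaller
  dimension, and their lists of simple factors are concatenated.\<close>

lemma composition_series:
  "\<exists>Ss. (\<forall>S\<in>set Ss. simple_object C S) \<and>
     frag_of D - (\<Sum>S\<leftarrow>Ss. frag_of S) \<in> group_closure (grothendieck_relations C)"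
proof (induction "dim (hom C G D)" arbitrary: D rule: less_induct)
  case less
  show ?case
  proof (cases "ident C D = 0")
    case True
    then show ?thesis using zero_object_in_relations by (intro exI[of _ "[]"]) simp
  next
    case nz: False
    show ?thesis
    proof (cases "simple_object C D")
      case True
      then show ?thesis by (intro exI[of _ "[D]"]) simp
    next
      case False
      then obtain Y0 f0 where f0: "is_mono C Y0 D f0" "f0 \<noteq> 0" "\<not> is_iso C Y0 D f0"
        using nz by (auto simp: simple_object_def)
      then have f0h: "f0 \<in> hom C Y0 D" by (simp add: is_mono_def)
      define U where "U = (\<lambda>k. f0 \<cdot> k) ` hom C G Y0"
      have sub: "hom_submodule D U" unfolding U_def by (rule hom_submodule_range[OF f0h])
      then have UD: "U \<subseteq> hom C G D" by (simp add: hom_submodule_def)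
      obtain u where u: "u \<in> U" "u \<noteq> 0"
        using faithful[OF f0h] f0(2) unfolding U_def by blast
      \<comment> \<open>A morphism that is bijective on \<open>Hom(G, -)\<close> would be an
        isomorphism, so the submodule \<open>U\<close> is proper.\<close>
      have "inj_on (\<lambda>k. f0 \<cdot> k) (hom C G Y0)" using f0(1) by (auto simp: is_mono_def inj_on_def)
      then have "U \<noteq> hom C G D" using iso_if_bij[OF f0h] f0(3) by (auto simp: U_def bij_betw_def)
      then obtain x where x: "x \<in> hom C G D" "x \<notin> U" using UD by blast
      obtain Y f Z g \<pi> where se: "short_exact C Y D Z f g"
        and ker: "{k \<in> hom C G D. g \<cdot> k = 0} = U" and gs: "(\<lambda>k. g \<cdot> k) ` hom C G D = hom C G Z"
        and \<pi>: "linear_map_on (scale C) (scale C) (hom C G D) \<pi>" "\<pi> ` hom C G D = hom C G Y"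
        and \<pi>U: "\<And>k. k \<in> hom C G D \<Longrightarrow> \<exists>u\<in>U. \<pi> k = \<pi> u"
        by (rule submodule_short_exact[OF sub]) (rule that; assumption)
      obtain B where B: "finite B" "hom C G D \<subseteq> span B" using hom_finite_dim by blast
      have g: "g \<in> hom C D Z" using se by (simp add: short_exact_def is_kernel_def)
      have dZ: "dim (hom C G Z) < dim (hom C G D)"
        unfolding gs[symmetric]
        using u ker by (intro dim_image_less[OF hom_subspace B(2,1) comp_linear_right[OF g], of u]) auto
      \<comment> \<open>\<open>x\<close> lies outside \<open>U\<close>, yet \<open>\<pi>\<close>
        does not separate it from some element of \<open>U\<close>; the difference is a nonzero
        vector in the kernel of \<open>\<pi>\<close>.\<close>
      have dY: "dim (hom C G Y) < dim (hom C G D)"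
      proof -
        obtain u' where u': "u' \<in> U" "\<pi> x = \<pi> u'" using \<pi>U x(1) by blast
        then have "\<pi> (u' + (x - u')) = \<pi> u' + \<pi> (x - u')"
          using x(1) UD hom_diff by (intro linear_map_onD(1)[OF \<pi>(1)]) auto
        then have "\<pi> (x - u') = 0" using u' by simp
        moreover have "x - u' \<noteq> 0" using u' x by auto
        ultimately show ?thesis
          unfolding \<pi>(2)[symmetric]
          using dim_image_less[OF hom_subspace B(2,1) \<pi>(1) hom_diff[OF x(1) subsetD[OF UD u'(1)]]] by simp
      qed
      obtain Ss where Ss: "\<forall>S\<in>set Ss. simple_object C S"
          "frag_of Y - (\<Sum>S\<leftarrow>Ss. frag_of S) \<in> group_closure (grothendieck_relations C)"
        using less[OF dY] by (elim exE conjE) rule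
      obtain Ts where Ts: "\<forall>S\<in>set Ts. simple_object C S"
          "frag_of Z - (\<Sum>S\<leftarrow>Ts. frag_of S) \<in> group_closure (grothendieck_relations C)"
        using less[OF dZ] by (elim exE conjE) rule
      have "(\<forall>S\<in>set (Ss @ Ts). simple_object C S) \<and>
         frag_of D - (\<Sum>S\<leftarrow>Ss @ Ts. frag_of S) \<in> group_closure (grothendieck_relations C)"
        using Ss(1) Ts(1) group_closure_add[OF short_exact_in_relations[OF se] group_closure_add[OF Ss(2)
          Ts(2)]]
        by (auto simp: algebra_simps)
      then show ?thesis by blast
    qed
  qed
qed

section \<open>Separating simple objects by endomorphisms of \<open>G\<close>\<close>

definition annihilates :: "'m \<Rightarrow> 'o \<Rightarrow> bool" where
  "annihilates a X \<longleftrightarrow> (\<forall>x\<in>hom C G X. x \<cdot> a = 0)"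

text \<open>As in the density theorem: if an element \<open>f\<close> of \<open>Hom(G, S1)\<close> were killed by every
  endomorphism of \<open>G\<close> killing a finite subset of \<open>Hom(G, S)\<close>, then \<open>g \<cdot> a0 \<cdot> b \<mapsto> f \<cdot> a0 \<cdot> b\<close> would
  be a nonzero module map \<open>Hom(G, S) \<rightarrow> Hom(G, S1)\<close> for suitable \<open>g\<close> and \<open>a0\<close>.\<close>

lemma annihilator_separates:
  assumes S: "simple_object C S" and S1: "simple_object C S1" and neq: "\<not> equiv_in_Gr S1 S"
  shows "\<exists>a\<in>hom C G G. annihilates a S \<and> (\<exists>f\<in>hom C G S1. f \<cdot> a \<noteq> 0)"
proof -
  have no_map: "h = 0" if "h \<in> hom C S S1" for h
    using schur[OF S S1 that] iso_equiv_in_Gr neq by blast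
  obtain f where f: "f \<in> hom C G S1" "f \<noteq> 0" using hom_nonzero[of S1] S1 by (auto simp: simple_object_def)
  \<comment> \<open>The finite set grows one element at a time; a basis of \<open>Hom(G, S)\<close>
    is inserted at the end.\<close>
  have step: "\<exists>a\<in>hom C G G. (\<forall>g\<in>D. g \<cdot> a = 0) \<and> f \<cdot> a \<noteq> 0" if "finite D" "D \<subseteq> hom C G S" for D
    using that
  proof (induction D)
    case empty
    show ?case using ident_in_hom comp_ident_right[OF f(1)] f(2) by (intro bexI[of _ "ident C G"]) auto
  next
    case (insert g D)
    obtain a0 where a0: "a0 \<in> hom C G G" "\<forall>g\<in>D. g \<cdot> a0 = 0" "f \<cdot> a0 \<noteq> 0" using insert by auto
    have g: "g \<in> hom C G S" and D: "\<And>h. h \<in> D \<Longrightarrow> h \<in> hom C G S" using insert by auto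
    show ?case
    proof (rule ccontr)
      assume contra: "\<not> ?case"
      have key: "f \<cdot> a = 0" if "a \<in> hom C G G" "\<forall>g\<in>D. g \<cdot> a = 0" "g \<cdot> a = 0" for a
        using contra that by auto
      have ga0: "g \<cdot> a0 \<in> hom C G S" "g \<cdot> a0 \<noteq> 0" using key[OF a0(1,2)] a0(1,3) g comp_in_hom by auto
      have fa0: "f \<cdot> a0 \<in> hom C G S1" using a0 f comp_in_hom by blast
      have "\<forall>y\<in>hom C G S. \<exists>b. b \<in> hom C G G \<and> g \<cdot> a0 \<cdot> b = y"
        using simple_generated[OF S ga0] by blast
      from bchoice[OF this] obtain b where b: "\<And>y. y \<in> hom C G S \<Longrightarrow> b y \<in> hom C G G"
        "\<And>y. y \<in> hom C G S \<Longrightarrow> g \<cdot> a0 \<cdot> b y = y" by blast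
      \<comment> \<open>For two choices, \<open>a0 \<cdot> (c - c')\<close> is killed by
        \<open>g\<close> and, through \<open>a0\<close>, by all of \<open>D\<close>, hence also by
        \<open>f\<close>. So the map \<open>?l\<close> below does not depend on the choices
        \<open>b y\<close>.\<close>
      have wd: "f \<cdot> a0 \<cdot> c = f \<cdot> a0 \<cdot> c'" if c: "c \<in> hom C G G" "c' \<in> hom C G G"
        "g \<cdot> a0 \<cdot> c = g \<cdot> a0 \<cdot> c'" for c c'
      proof -
        have d: "c - c' \<in> hom C G G" using c hom_diff by blast
        have "h \<cdot> (a0 \<cdot> (c - c')) = 0" if "h \<in> D" for h
          using comp_assoc[OF d a0(1) D[OF that]] a0(2) that comp_zero_left[OF d] by simp
        moreover have "g \<cdot> (a0 \<cdot> (c - c')) = 0"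
          using comp_assoc[OF d a0(1) g] comp_diff_right[OF c(1,2) ga0(1)] c(3) by simp
        ultimately have "f \<cdot> (a0 \<cdot> (c - c')) = 0" using key comp_in_hom[OF d a0(1)] by blast
        then show ?thesis using comp_assoc[OF d a0(1) f(1)] comp_diff_right[OF c(1,2) fa0] by simp
      qed
      let ?l = "\<lambda>y. f \<cdot> a0 \<cdot> b y"
      have "linear_map_on (scale C) (scale C) (hom C G S) ?l"
      proof (rule linear_map_onI)
        fix x y assume xy: "x \<in> hom C G S" "y \<in> hom C G S"
        have "g \<cdot> a0 \<cdot> (b x + b y) = g \<cdot> a0 \<cdot> b (x + y)"
          using comp_add_right[OF b(1)[OF xy(1)] b(1)[OF xy(2)] ga0(1)] b(2) xy hom_add by simp
        then show "?l (x + y) = ?l x + ?l y"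
          using wd[of "b (x + y)" "b x + b y"] comp_add_right[OF b(1)[OF xy(1)] b(1)[OF xy(2)] fa0] b(1)
            xy hom_add by simp
        have "g \<cdot> a0 \<cdot> (scale C c (b x)) = g \<cdot> a0 \<cdot> b (scale C c x)" for c
          using comp_scale_right[OF b(1)[OF xy(1)] ga0(1)] b(2) xy hom_scale by simp
        then show "?l (scale C c x) = scale C c (?l x)" for c
          using wd[of "b (scale C c x)" "scale C c (b x)"] comp_scale_right[OF b(1)[OF xy(1)] fa0] b(1) xy
            hom_scale by simp
      qed
      moreover have "?l y \<in> hom C G S1" if "y \<in> hom C G S" for y using b(1)[OF that] fa0 comp_in_hom by blast
      moreover have "?l (y \<cdot> a) = ?l y \<cdot> a" if y: "y \<in> hom C G S" and a: "a \<in> hom C G G" for y a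
      proof -
        have "g \<cdot> a0 \<cdot> (b y \<cdot> a) = g \<cdot> a0 \<cdot> b (y \<cdot> a)"
          using comp_assoc[OF a b(1)[OF y] ga0(1)] b(2) comp_in_hom[OF a y] y by simp
        then show ?thesis
          using wd[of "b (y \<cdot> a)" "b y \<cdot> a"] comp_assoc[OF a b(1)[OF y] fa0] b(1) y comp_in_hom[OF a] by simp
      qed
      ultimately obtain h where h: "h \<in> hom C S S1" "\<And>y. y \<in> hom C G S \<Longrightarrow> h \<cdot> y = ?l y"
        using full[of S ?l S1] by blast
      \<comment> \<open>The identity is an admissible choice at \<open>g \<cdot> a0\<close>, and it
        shows that the map is not zero.\<close>
      have "?l (g \<cdot> a0) = f \<cdot> a0 \<cdot> ident C G"
        using wd[OF b(1)[OF ga0(1)] ident_in_hom] b(2)[OF ga0(1)] comp_ident_right[OF ga0(1)] by simp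
      then have "h \<cdot> (g \<cdot> a0) \<noteq> 0" using h(2)[OF ga0(1)] comp_ident_right[OF fa0] a0(3) by simp
      then show False using no_map[OF h(1)] comp_zero_left[OF ga0(1)] by simp
    qed
  qed
  have fin: "finite (chosen_basis (hom C G S))" using chosen_basis_finite hom_finite_dim by blast
  then obtain a where a: "a \<in> hom C G G" "\<forall>g\<in>chosen_basis (hom C G S). g \<cdot> a = 0" "f \<cdot> a \<noteq> 0"
    using step chosen_basis(1) by blast
  have "annihilates a S"
    unfolding annihilates_def
  proof
    fix x assume "x \<in> hom C G S"
    then have "(\<Sum>b\<in>chosen_basis (hom C G S). scale C (representation (chosen_basis (hom C G S)) x b) b) = x"
      using chosen_basis[of "hom C G S"] fin by (intro sum_representation_eq) auto
    moreover have "(\<Sum>b\<in>chosen_basis (hom C G S). scale C (representation (chosen_basis (hom C G S)) x b)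
      b) \<cdot> a = 0"
      using chosen_basis(1)[of "hom C G S"] a by (subst comp_sum_left[OF _ a(1), of _ _ S]) auto
    ultimately show "x \<cdot> a = 0" by simp
  qed
  then show ?thesis using a f by blast
qed

text \<open>A product \<open>a \<cdot> y \<cdot> b\<close> annihilates whatever \<open>a\<close> or
  \<open>b\<close> annihilates. Simplicity of \<open>S1\<close> supplies the middle factor
  \<open>y\<close>, which sends \<open>f \<cdot> a\<close> to an element \<open>f'\<close> that
  \<open>b\<close> does not kill.\<close>

lemma annihilator_separates_finite:
  assumes "finite \<S>" and S: "\<And>S. S \<in> \<S> \<Longrightarrow> simple_object C S" "\<And>S. S \<in> \<S> \<Longrightarrow> \<not> equiv_in_Gr S1 S"
    and S1: "simple_object C S1"
  shows "\<exists>a\<in>hom C G G. (\<forall>S\<in>\<S>. annihilates a S) \<and> (\<exists>f\<in>hom C G S1. f \<cdot> a \<noteq> 0)"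
  using assms
proof (induction \<S>)
  case empty
  show ?case
  proof -
    obtain f where f: "f \<in> hom C G S1" "f \<noteq> 0" using hom_nonzero[of S1] S1 by (auto simp: simple_object_def)
    then have "f \<cdot> ident C G \<noteq> 0" using comp_ident_right by simp
    then show ?thesis using f(1) ident_in_hom by blast
  qed
next
  case (insert S \<S>)
  obtain a f where a: "a \<in> hom C G G" "\<And>T. T \<in> \<S> \<Longrightarrow> annihilates a T" and f: "f \<in> hom C G S1" "f \<cdot> a \<noteq> 0"
    using insert by auto
  obtain b f' where b: "b \<in> hom C G G" "annihilates b S" and f': "f' \<in> hom C G S1" "f' \<cdot> b \<noteq> 0"
    using annihilator_separates[of S S1] insert by auto
  have fa: "f \<cdot> a \<in> hom C G S1" using comp_in_hom[OF a(1) f(1)] .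
  obtain y where y: "y \<in> hom C G G" "f \<cdot> a \<cdot> y = f'" using simple_generated[OF S1 fa f(2) f'(1)] by blast
  have yb: "y \<cdot> b \<in> hom C G G" using comp_in_hom[OF b(1) y(1)] .
  let ?c = "a \<cdot> (y \<cdot> b)"
  have c: "?c \<in> hom C G G" using comp_in_hom[OF yb a(1)] .
  have *: "x \<cdot> ?c = x \<cdot> a \<cdot> y \<cdot> b" "x \<cdot> ?c = (x \<cdot> a \<cdot> y) \<cdot> b" "x \<cdot> a \<cdot> y \<in> hom C G X"
    if x: "x \<in> hom C G X" for x X
    using comp_assoc[OF yb a(1) x] comp_assoc[OF b(1) y(1) comp_in_hom[OF a(1) x]] comp_in_hom[OF y(1)
      comp_in_hom[OF a(1) x]] by auto
  have "annihilates ?c T" if "T \<in> \<S>" for T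
    unfolding annihilates_def
  proof
    fix x assume x: "x \<in> hom C G T"
    have "x \<cdot> a = 0" using a(2)[OF that] x by (simp add: annihilates_def)
    then show "x \<cdot> ?c = 0" using *(1)[OF x] comp_zero_left[OF y(1)] comp_zero_left[OF b(1)] by simp
  qed
  moreover have "annihilates ?c S" using * b(2) by (auto simp: annihilates_def)
  moreover have "f \<cdot> ?c \<noteq> 0" using *(1)[OF f(1)] y(2) f'(2) by simp
  ultimately show ?case using c f(1) by (intro bexI[of _ ?c]) auto
qed

text \<open>Among the endomorphisms \<open>b\<close> that annihilate \<open>\<S>\<close> and fix \<open>f\<close>, one of minimal rank is bijective on
  its image \<open>b \<cdot> Hom(G, G)\<close>, so it has a right unit there, which is the idempotent.\<close>

lemma separating_idempotent:
  assumes fin: "finite \<S>" and S: "\<And>S. S \<in> \<S> \<Longrightarrow> simple_object C S" "\<And>S. S \<in> \<S> \<Longrightarrow> \<not> equiv_in_Gr S1 S"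
    and S1: "simple_object C S1"
  obtains e f where "e \<in> hom C G G" "e \<cdot> e = e" "\<And>S. S \<in> \<S> \<Longrightarrow> annihilates e S"
    "f \<in> hom C G S1" "f \<noteq> 0" "f \<cdot> e = f"
proof -
  obtain a f where a: "a \<in> hom C G G" "\<And>S. S \<in> \<S> \<Longrightarrow> annihilates a S" and f: "f \<in> hom C G S1" "f \<cdot> a \<noteq> 0"
    using annihilator_separates_finite[OF assms] by blast
  have f0: "f \<noteq> 0" using f(2) comp_zero_left[OF a(1)] by auto
  \<comment> \<open>Correcting \<open>a\<close> by \<open>y\<close> gives an endomorphism that fixes
    \<open>f\<close>; in this form the property passes to products.\<close>
  obtain y where y: "y \<in> hom C G G" "f \<cdot> a \<cdot> y = f"
    using simple_generated[OF S1 comp_in_hom[OF a(1) f(1)] f(2) f(1)] by blast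
  define P where "P b \<longleftrightarrow> b \<in> hom C G G \<and> (\<forall>S\<in>\<S>. annihilates b S) \<and> f \<cdot> b = f" for b
  have ann: "annihilates (b \<cdot> c) S" if "annihilates b S" "b \<in> hom C G G" "c \<in> hom C G G" for b c S
    using that comp_assoc[OF that(3,2)] comp_zero_left[OF that(3)] by (auto simp: annihilates_def)
  have "P (a \<cdot> y)"
    using a y ann comp_in_hom[OF y(1) a(1)] comp_assoc[OF y(1) a(1) f(1)] by (simp add: P_def)
  then obtain b where b: "P b" and min:
    "\<And>c. P c \<Longrightarrow> dim ((\<lambda>x. b \<cdot> x) ` hom C G G) \<le> dim ((\<lambda>x. c \<cdot> x) ` hom C G G)"
    using ex_has_least_nat[of P "a \<cdot> y" "\<lambda>c. dim ((\<lambda>x. c \<cdot> x) ` hom C G G)"] by blast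
  have bG: "b \<in> hom C G G" and fb: "f \<cdot> b = f" using b by (auto simp: P_def)
  let ?V = "(\<lambda>x. b \<cdot> x) ` hom C G G"
  have V: "subspace ?V" "?V \<subseteq> hom C G G"
    using subspace_linear_image[OF hom_subspace comp_linear_right[OF bG]] comp_in_hom[OF _ bG] by auto
  have linV: "linear_map_on (scale C) (scale C) ?V (\<lambda>x. b \<cdot> x)"
    using comp_linear_right[OF bG] V(2) by (rule linear_map_on_subset)
  obtain B where B: "finite B" "hom C G G \<subseteq> span B" using hom_finite_dim by blast
  \<comment> \<open>The rank of \<open>b \<cdot> b\<close> cannot drop below the minimal rank of
    \<open>b\<close>, so \<open>b\<close> maps its own image bijectively onto itself.\<close>
  have "P (b \<cdot> b)"
    using b ann comp_in_hom[OF bG bG] comp_assoc[OF bG bG f(1)] by (simp add: P_def)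
  moreover have im: "(\<lambda>x. b \<cdot> b \<cdot> x) ` hom C G G = (\<lambda>x. b \<cdot> x) ` ?V"
    using comp_assoc[OF _ bG bG] by (auto simp: image_image intro!: image_cong)
  ultimately have le: "dim ?V \<le> dim ((\<lambda>x. b \<cdot> x) ` ?V)" using min[of "b \<cdot> b"] by simp
  have inj: "x = 0" if "x \<in> ?V" "b \<cdot> x = 0" for x
    using dim_image_less[OF V(1) _ B(1) linV that(1) _ that(2)] V(2) B(2) le by fastforce
  have "(\<lambda>x. b \<cdot> x) ` ?V \<subseteq> ?V" using V(2) by auto
  moreover have "\<not> (\<exists>w. w \<in> ?V \<and> w \<notin> (\<lambda>x. b \<cdot> x) ` ?V)"
    using dim_psubset_fd[OF subspace_linear_image[OF V(1) linV] calculation _ _ _ B(1)] V(2) B(2) le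
      by fastforce
  moreover have bV: "b \<in> ?V" by (rule image_eqI[where f = "\<lambda>x. b \<cdot> x", OF comp_ident_right[OF bG,
    symmetric] ident_in_hom])
  ultimately have "b \<in> (\<lambda>x. b \<cdot> x) ` ?V" by blast
  then obtain e where e: "e \<in> ?V" "b \<cdot> e = b" by (rule imageE) (rule that[OF _ sym])
  have eG: "e \<in> hom C G G" using e V by auto
  obtain x where x: "x \<in> hom C G G" "e = b \<cdot> x" using e(1) by auto
  have eeV: "e \<cdot> e \<in> ?V"
    by (rule image_eqI[where f = "\<lambda>x. b \<cdot> x", OF _ comp_in_hom[OF eG x(1)]]) (use comp_assoc[OF eG x(1)
      bG] x(2) in simp)
  \<comment> \<open>The equation \<open>b \<cdot> e = b\<close> gives idempotency only up to a
    factor \<open>b\<close> on the left; injectivity of \<open>b\<close> on its image removes this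
    factor.\<close>
  have "b \<cdot> (e \<cdot> e - e) = 0"
    using comp_diff_right[OF comp_in_hom[OF eG eG] eG bG] comp_assoc[OF eG eG bG] e(2) by simp
  moreover have "e \<cdot> e - e \<in> ?V" using V(1) eeV e(1) by (rule subspace_diff)
  ultimately have ee: "e \<cdot> e = e" using inj by fastforce
  have "f \<cdot> e = f"
    using comp_assoc[OF eG bG f(1)] fb e(2) by simp
  moreover have "annihilates e S" if "S \<in> \<S>" for S using ann[OF _ bG x(1)] b that x(2) by (simp add: P_def)
  ultimately show thesis using that eG ee f f0 by blast
qed

text \<open>Coregular module: \<open>Hom(G, T)\<close> is the linear dual of \<open>End(G)\<close>, so \<open>Hom(X, T)\<close> is the
  linear dual of \<open>Hom(G, X)\<close>.\<close>

lemma coregular_object: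
  obtains T \<epsilon> where
    "linear_map_on (scale C) (*) (hom C G T) \<epsilon>"
    "\<And>X \<theta>. linear_map_on (scale C) (*) (hom C G X) \<theta> \<Longrightarrow> \<exists>h\<in>hom C X T. \<forall>k\<in>hom C G X. \<epsilon> (h \<cdot> k) = \<theta> k"
    "\<And>X h. h \<in> hom C X T \<Longrightarrow> \<forall>k\<in>hom C G X. \<epsilon> (h \<cdot> k) = 0 \<Longrightarrow> h = 0"
proof -
  let ?E = "hom C G G" and ?B = "chosen_basis (hom C G G)"
  let ?r = "representation ?B"
  have finB: "finite ?B" using chosen_basis_finite hom_finite_dim by blast
  note rlin = representation_chosen_basis_linear[OF hom_subspace, of G G]
  have exp: "(\<Sum>b\<in>?B. scale C (?r x b) b) = x" if "x \<in> ?E" for x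
    using chosen_basis[of ?E] finB that by (intro sum_representation_eq) auto
  \<comment> \<open>The dot product in coordinates of the chosen basis. It identifies
    \<open>End(G)\<close> with its linear dual, so the coregular module can live on the same vector
    space.\<close>
  define \<beta> where "\<beta> v x = (\<Sum>b\<in>?B. ?r v b * ?r x b)" for v x
  have \<beta>lin1: "linear_map_on (scale C) (*) ?E (\<lambda>v. \<beta> v x)" for x
    by (intro linear_map_onI) (simp_all add: \<beta>_def linear_map_onD[OF rlin] distrib_right sum.distrib
      sum_distrib_left mult.assoc)
  have \<beta>lin2: "linear_map_on (scale C) (*) ?E (\<beta> v)" for v
  proof -
    have "\<beta> v = (\<lambda>x. \<beta> x v)" by (rule ext) (simp add: \<beta>_def mult.commute)
    then show ?thesis using \<beta>lin1[of v] by simp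
  qed
  \<comment> \<open>The vector that represents the functional \<open>\<theta>\<close> with respect
    to \<open>\<beta>\<close>.\<close>
  define w where "w \<theta> = (\<Sum>b\<in>?B. scale C (\<theta> b) b)" for \<theta> :: "'m \<Rightarrow> 'k"
  have BE: "b \<in> ?E" if "b \<in> ?B" for b using chosen_basis(1) that by auto
  have wE: "w \<theta> \<in> ?E" for \<theta> unfolding w_def using BE by (intro hom_sum hom_scale)
  have rB: "?r b c = (if c = b then 1 else 0)" if "b \<in> ?B" for b c
    using representation_basis[OF chosen_basis(2) that] by simp
  have rw: "?r (w \<theta>) c = \<theta> c" if c: "c \<in> ?B" for \<theta> c
  proof -
    have "?r (w \<theta>) c = (\<Sum>b\<in>?B. \<theta> b * ?r b c)"
      unfolding w_def using BE by (intro linear_map_on_sum[OF hom_subspace rlin]) (auto simp: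
        representation_zero)
    also have "\<dots> = (\<Sum>b\<in>?B. if c = b then \<theta> b else 0)" using rB by (intro sum.cong) auto
    finally show ?thesis using finB c by simp
  qed
  have \<beta>w: "\<beta> (w \<theta>) x = \<theta> x" if \<theta>: "linear_map_on (scale C) (*) ?E \<theta>" and x: "x \<in> ?E" for \<theta> x
  proof -
    have "\<theta> 0 = 0" using linear_map_onD(2)[OF \<theta> hom_zero, of 0] by simp
    then have "\<theta> (\<Sum>b\<in>?B. scale C (?r x b) b) = (\<Sum>b\<in>?B. ?r x b * \<theta> b)"
      using BE by (intro linear_map_on_sum[OF hom_subspace \<theta>])
    then show ?thesis using rw exp[OF x] by (simp add: \<beta>_def mult.commute)
  qed
  have \<beta>inj: "v = v'" if "v \<in> ?E" "v' \<in> ?E" "\<And>x. x \<in> ?E \<Longrightarrow> \<beta> v x = \<beta> v' x" for v v'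
  proof -
    have "?r u b = \<beta> u b" if b: "b \<in> ?B" for u b
    proof -
      have "\<beta> u b = (\<Sum>c\<in>?B. if c = b then ?r u c else 0)" unfolding \<beta>_def using rB[OF b]
        by (intro sum.cong) auto
      then show ?thesis using finB b by simp
    qed
    then have "(\<Sum>b\<in>?B. scale C (?r v b) b) = (\<Sum>b\<in>?B. scale C (?r v' b) b)"
      using that(3) BE by (intro sum.cong) auto
    then show ?thesis using exp that by simp
  qed
  \<comment> \<open>The transpose of left multiplication by \<open>a\<close>; transposition makes it
    a right action.\<close>
  define \<alpha> where "\<alpha> v a = w (\<lambda>x. \<beta> v (a \<cdot> x))" for v a
  have \<alpha>E: "\<alpha> v a \<in> ?E" for v a using wE by (simp add: \<alpha>_def)
  have \<beta>\<alpha>: "\<beta> (\<alpha> v a) x = \<beta> v (a \<cdot> x)" if "a \<in> ?E" "x \<in> ?E" for v a x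
    unfolding \<alpha>_def using that(2) comp_in_hom[OF _ that(1)]
    by (intro \<beta>w linear_map_on_comp[OF comp_linear_right[OF that(1)] _ \<beta>lin2]) auto
  obtain D where D: "finite D" "?E \<subseteq> span D" using hom_finite_dim by blast
  have "\<exists>Z \<Psi>. linear_map_on (scale C) (scale C) (hom C G Z) \<Psi> \<and> bij_betw \<Psi> (hom C G Z) ?E \<and>
         (\<forall>k\<in>hom C G Z. \<forall>a\<in>?E. \<Psi> (k \<cdot> a) = \<alpha> (\<Psi> k) a)"
  proof (rule realize[OF hom_subspace D(2,1)])
    show "linear_map_on (scale C) (scale C) ?E (\<lambda>v. \<alpha> v a)" if a: "a \<in> ?E" for a
    proof (rule linear_map_onI)
      fix u v assume uv: "u \<in> ?E" "v \<in> ?E"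
      show "\<alpha> (u + v) a = \<alpha> u a + \<alpha> v a"
        using uv a by (intro \<beta>inj) (simp_all add: \<alpha>E hom_add \<beta>\<alpha> linear_map_onD[OF \<beta>lin1])
      show "\<alpha> (scale C c u) a = scale C c (\<alpha> u a)" for c
        using uv a by (intro \<beta>inj) (simp_all add: \<alpha>E hom_scale \<beta>\<alpha> linear_map_onD[OF \<beta>lin1])
    qed
    show "linear_map_on (scale C) (scale C) ?E (\<alpha> v)" if v: "v \<in> ?E" for v
    proof (rule linear_map_onI)
      fix a b assume ab: "a \<in> ?E" "b \<in> ?E"
      show "\<alpha> v (a + b) = \<alpha> v a + \<alpha> v b"
        using ab v comp_in_hom by (intro \<beta>inj) (simp_all add: \<alpha>E hom_add \<beta>\<alpha> comp_add_left
          linear_map_onD[OF \<beta>lin1] linear_map_onD[OF \<beta>lin2])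
      show "\<alpha> v (scale C c a) = scale C c (\<alpha> v a)" for c
        using ab v comp_in_hom by (intro \<beta>inj) (simp_all add: \<alpha>E hom_scale \<beta>\<alpha> comp_scale_left
          linear_map_onD[OF \<beta>lin1] linear_map_onD[OF \<beta>lin2])
    qed
    show "\<alpha> v (ident C G) = v" if "v \<in> ?E" for v
      using that by (intro \<beta>inj) (simp_all add: \<alpha>E \<beta>\<alpha> ident_in_hom comp_ident_left)
    show "\<alpha> (\<alpha> v a) b = \<alpha> v (a \<cdot> b)" if "v \<in> ?E" "a \<in> ?E" "b \<in> ?E" for v a b
      using that comp_in_hom by (intro \<beta>inj) (simp_all add: \<alpha>E \<beta>\<alpha> comp_assoc)
  qed (rule \<alpha>E)
  then obtain T \<Psi> where \<Psi>: "linear_map_on (scale C) (scale C) (hom C G T) \<Psi>" "bij_betw \<Psi> (hom C G T) ?E"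
    "\<And>k a. k \<in> hom C G T \<Longrightarrow> a \<in> ?E \<Longrightarrow> \<Psi> (k \<cdot> a) = \<alpha> (\<Psi> k) a" by blast
  have \<Psi>E: "\<Psi> k \<in> ?E" if "k \<in> hom C G T" for k using \<Psi>(2) that by (auto simp: bij_betw_def)
  have \<Psi>inj: "k = k'" if "k \<in> hom C G T" "k' \<in> hom C G T" "\<Psi> k = \<Psi> k'" for k k'
    using \<Psi>(2) that by (auto simp: bij_betw_def inj_on_def)
  \<comment> \<open>Evaluation of a functional at the identity; its other values are recovered by
    acting with \<open>End(G)\<close>.\<close>
  let ?\<epsilon> = "\<lambda>k. \<beta> (\<Psi> k) (ident C G)"
  have \<epsilon>: "?\<epsilon> (k \<cdot> x) = \<beta> (\<Psi> k) x" if "k \<in> hom C G T" "x \<in> ?E" for k x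
    using \<Psi>(3)[OF that] \<beta>\<alpha>[OF that(2) ident_in_hom] comp_ident_right[OF that(2)] by simp
  show thesis
  proof (rule that[of T ?\<epsilon>])
    show "linear_map_on (scale C) (*) (hom C G T) ?\<epsilon>"
      by (rule linear_map_on_comp[OF \<Psi>(1) _ \<beta>lin1]) (rule \<Psi>E)
  next
    fix X \<theta> assume \<theta>: "linear_map_on (scale C) (*) (hom C G X) \<theta>"
    let ?\<theta> = "\<lambda>k x. \<theta> (k \<cdot> x)"
    have \<theta>lin: "linear_map_on (scale C) (*) ?E (?\<theta> k)" if "k \<in> hom C G X" for k
      using comp_in_hom[OF _ that] by (intro linear_map_on_comp[OF comp_linear_right[OF that] _ \<theta>])
    let ?i = "inv_into (hom C G T) \<Psi>"
    have i: "?i v \<in> hom C G T" "\<Psi> (?i v) = v" if "v \<in> ?E" for v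
      using \<Psi>(2) that by (auto simp: bij_betw_def inv_into_into f_inv_into_f)
    \<comment> \<open>\<open>k\<close> is sent to the functional
      \<open>x \<mapsto> \<theta> (k \<cdot> x)\<close> on \<open>End(G)\<close>, read as an element
      of \<open>Hom(G, T)\<close>.\<close>
    define l where "l k = ?i (w (?\<theta> k))" for k
    have l: "l k \<in> hom C G T" "\<Psi> (l k) = w (?\<theta> k)" for k using i[OF wE] by (auto simp: l_def)
    have \<beta>l: "\<beta> (\<Psi> (l k)) x = \<theta> (k \<cdot> x)" if "k \<in> hom C G X" "x \<in> ?E" for k x
      using \<beta>w[OF \<theta>lin[OF that(1)] that(2)] l by simp
    have "linear_map_on (scale C) (scale C) (hom C G X) l"
    proof (rule linear_map_onI)
      fix x y assume xy: "x \<in> hom C G X" "y \<in> hom C G X"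
      have "\<Psi> (l (x + y)) = \<Psi> (l x + l y)"
        using xy l(1) comp_in_hom by (intro \<beta>inj \<Psi>E)
          (simp_all add: hom_add \<beta>l linear_map_onD[OF \<Psi>(1)] linear_map_onD[OF \<beta>lin1] \<Psi>E comp_add_left
            linear_map_onD[OF \<theta>])
      then show "l (x + y) = l x + l y" using \<Psi>inj l(1) hom_add by blast
      have "\<Psi> (l (scale C c x)) = \<Psi> (scale C c (l x))" for c
        using xy l(1) comp_in_hom by (intro \<beta>inj \<Psi>E)
          (simp_all add: hom_scale \<beta>l linear_map_onD[OF \<Psi>(1)] linear_map_onD[OF \<beta>lin1] \<Psi>E comp_scale_left
            linear_map_onD[OF \<theta>])
      then show "l (scale C c x) = scale C c (l x)" for c using \<Psi>inj l(1) hom_scale by blast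
    qed
    moreover have "l (k \<cdot> a) = l k \<cdot> a" if k: "k \<in> hom C G X" and a: "a \<in> ?E" for k a
    proof -
      have "\<Psi> (l (k \<cdot> a)) = \<Psi> (l k \<cdot> a)"
      proof (rule \<beta>inj)
        fix x assume x: "x \<in> ?E"
        show "\<beta> (\<Psi> (l (k \<cdot> a))) x = \<beta> (\<Psi> (l k \<cdot> a)) x"
          using \<beta>l[OF comp_in_hom[OF a k] x] \<beta>l[OF k comp_in_hom[OF x a]] \<Psi>(3)[OF l(1) a] \<beta>\<alpha>[OF a x]
            comp_assoc[OF x a k] by simp
      qed (use \<Psi>E l(1) comp_in_hom[OF a l(1)] in auto)
      then show ?thesis using \<Psi>inj l(1) comp_in_hom[OF a l(1)] by blast
    qed
    ultimately obtain h where h: "h \<in> hom C X T" "\<And>k. k \<in> hom C G X \<Longrightarrow> h \<cdot> k = l k"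
      using full[of X l T] l(1) by blast
    have "?\<epsilon> (h \<cdot> k) = \<theta> k" if "k \<in> hom C G X" for k
      using h(2)[OF that] \<beta>l[OF that ident_in_hom] comp_ident_right[OF that] by simp
    then show "\<exists>h\<in>hom C X T. \<forall>k\<in>hom C G X. ?\<epsilon> (h \<cdot> k) = \<theta> k" using h(1) by blast
  next
    fix X h assume h: "h \<in> hom C X T" and "\<forall>k\<in>hom C G X. ?\<epsilon> (h \<cdot> k) = 0"
    then have 0: "\<And>k. k \<in> hom C G X \<Longrightarrow> ?\<epsilon> (h \<cdot> k) = 0" by blast
    show "h = 0"
    proof (rule faithful[OF h])
      fix k assume k: "k \<in> hom C G X"
      have hk: "h \<cdot> k \<in> hom C G T" using comp_in_hom[OF k h] .
      have "\<Psi> (h \<cdot> k) = 0"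
      proof (rule \<beta>inj[OF \<Psi>E[OF hk] hom_zero])
        fix x assume x: "x \<in> ?E"
        have "\<beta> 0 x = 0" using linear_map_onD(2)[OF \<beta>lin1 hom_zero, of 0] by simp
        then show "\<beta> (\<Psi> (h \<cdot> k)) x = \<beta> 0 x"
          using \<epsilon>[OF hk x] 0[OF comp_in_hom[OF x k]] comp_assoc[OF x k h] by simp
      qed
      then show "h \<cdot> k = 0" using \<Psi>inj[OF hk hom_zero] linear_map_on_0[OF hom_subspace \<Psi>(1)] by simp
    qed
  qed
qed

end

section \<open>Duality calculus in strict pivotal categories\<close>

context strict_monoidal_category
begin

text \<open>The object equations are separate premises because strict associativity lets the same
  object appear with different bracketings.\<close>

lemma tensor_typed:
  "f \<in> hom C X Y \<Longrightarrow> g \<in> hom C X' Y' \<Longrightarrow> X \<otimes>\<^sub>o X' = A \<Longrightarrow> Y \<otimes>\<^sub>o Y' = B \<Longrightarrow> f \<otimes>\<^sub>m g \<in> hom C A B"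
  using tensor_in_hom by blast

lemma comp_typed: "f \<in> hom C X Y \<Longrightarrow> g \<in> hom C Y' Z \<Longrightarrow> Y = Y' \<Longrightarrow> g \<cdot> f \<in> hom C X Z"
  using comp_in_hom by blast

lemma ident_typed: "X = A \<Longrightarrow> X = B \<Longrightarrow> ident C X \<in> hom C A B"
  using ident_in_hom by blast

lemma hom_typed: "f \<in> hom C X Y \<Longrightarrow> X = A \<Longrightarrow> Y = B \<Longrightarrow> f \<in> hom C A B"
  by blast

lemmas typing = tensor_typed ident_typed comp_typed refl
lemmas ob_simps = tensor_ob_assoc tensor_ob_unit_left tensor_ob_unit_right

lemma tensor_interchange_left:
  assumes "f \<in> hom C X Y" "g \<in> hom C X' Y'"
  shows "(f \<otimes>\<^sub>m ident C Y') \<cdot> (ident C X \<otimes>\<^sub>m g) = f \<otimes>\<^sub>m g"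
  using tensor_comp[OF ident_in_hom assms(1) assms(2) ident_in_hom] assms
  by (simp add: comp_ident_left comp_ident_right)

lemma tensor_interchange_right:
  assumes "f \<in> hom C X Y" "g \<in> hom C X' Y'"
  shows "(ident C Y \<otimes>\<^sub>m g) \<cdot> (f \<otimes>\<^sub>m ident C X') = f \<otimes>\<^sub>m g"
  using tensor_comp[OF assms(1) ident_in_hom ident_in_hom assms(2)] assms
  by (simp add: comp_ident_left comp_ident_right)

lemma tensor_slide:
  assumes "f \<in> hom C X Y" "g \<in> hom C X' Y'"
  shows "(f \<otimes>\<^sub>m ident C Y') \<cdot> (ident C X \<otimes>\<^sub>m g) = (ident C Y \<otimes>\<^sub>m g) \<cdot> (f \<otimes>\<^sub>m ident C X')"
  unfolding tensor_interchange_left[OF assms] tensor_interchange_right[OF assms] ..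

lemma comp_tensor_ident:
  assumes "f \<in> hom C X Y" "g \<in> hom C Y Z"
  shows "(g \<cdot> f) \<otimes>\<^sub>m ident C W = (g \<otimes>\<^sub>m ident C W) \<cdot> (f \<otimes>\<^sub>m ident C W)"
  using tensor_comp[OF assms ident_in_hom ident_in_hom, of W] by (simp add: comp_ident_left[OF ident_in_hom])

lemma ident_tensor_comp:
  assumes "f \<in> hom C X Y" "g \<in> hom C Y Z"
  shows "ident C W \<otimes>\<^sub>m (g \<cdot> f) = (ident C W \<otimes>\<^sub>m g) \<cdot> (ident C W \<otimes>\<^sub>m f)"
  using tensor_comp[OF ident_in_hom ident_in_hom assms, of W] by (simp add: comp_ident_left[OF ident_in_hom])

lemma tensor_ident_ob: "f \<in> hom C X Y \<Longrightarrow> f \<otimes>\<^sub>m ident C (A \<otimes>\<^sub>o B) = (f \<otimes>\<^sub>m ident C A) \<otimes>\<^sub>m ident C B"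
  by (simp add: tensor_ident[symmetric] tensor_assoc[OF _ ident_in_hom ident_in_hom])

lemma ident_ob_tensor: "f \<in> hom C X Y \<Longrightarrow> ident C (A \<otimes>\<^sub>o B) \<otimes>\<^sub>m f = ident C A \<otimes>\<^sub>m (ident C B \<otimes>\<^sub>m f)"
  by (simp add: tensor_ident[symmetric] tensor_assoc[OF ident_in_hom ident_in_hom])

lemma tensor_middle: "f \<in> hom C X Y \<Longrightarrow> (ident C A \<otimes>\<^sub>m f) \<otimes>\<^sub>m ident C B = ident C A \<otimes>\<^sub>m (f \<otimes>\<^sub>m ident C B)"
  by (rule tensor_assoc[OF ident_in_hom _ ident_in_hom])

end

context strict_pivotal_category
begin

text \<open>The adjunctions \<open>Hom(A \<otimes> Z, T) = Hom(A, T \<otimes> Z\<^sup>*)\<close> and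
  \<open>Hom(Z \<otimes> A, T) = Hom(A, Z\<^sup>* \<otimes> T)\<close>.\<close>

definition curry_right :: "'b \<Rightarrow> 'b \<Rightarrow> 'c \<Rightarrow> 'c" where
  "curry_right A Z m = (m \<otimes>\<^sub>m ident C (dual C Z)) \<cdot> (ident C A \<otimes>\<^sub>m coev C Z)"

definition uncurry_right :: "'b \<Rightarrow> 'b \<Rightarrow> 'c \<Rightarrow> 'c" where
  "uncurry_right T Z n = (ident C T \<otimes>\<^sub>m ev C Z) \<cdot> (n \<otimes>\<^sub>m ident C Z)"

definition curry_left :: "'b \<Rightarrow> 'b \<Rightarrow> 'c \<Rightarrow> 'c" where
  "curry_left Z A m = (ident C (dual C Z) \<otimes>\<^sub>m m) \<cdot> (coev C (dual C Z) \<otimes>\<^sub>m ident C A)"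

definition uncurry_left :: "'b \<Rightarrow> 'b \<Rightarrow> 'c \<Rightarrow> 'c" where
  "uncurry_left Z T n = (ev C (dual C Z) \<otimes>\<^sub>m ident C T) \<cdot> (ident C Z \<otimes>\<^sub>m n)"

lemma coev_dual_in_hom: "coev C (dual C X) \<in> hom C \<one>\<^sub>o (dual C X \<otimes>\<^sub>o X)"
  using coev_in_hom[of "dual C X"] by (simp add: dual_dual)

lemma ev_dual_in_hom: "ev C (dual C X) \<in> hom C (X \<otimes>\<^sub>o dual C X) \<one>\<^sub>o"
  using ev_in_hom[of "dual C X"] by (simp add: dual_dual)

lemmas duality_typed = hom_typed[OF coev_in_hom] hom_typed[OF ev_in_hom]
  hom_typed[OF coev_dual_in_hom] hom_typed[OF ev_dual_in_hom]

lemma curry_right_in_hom: "m \<in> hom C (A \<otimes>\<^sub>o Z) T \<Longrightarrow> curry_right A Z m \<in> hom C A (T \<otimes>\<^sub>o dual C Z)"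
  unfolding curry_right_def
  by (assumption | rule typing duality_typed | simp only: ob_simps)+

lemma uncurry_right_in_hom: "n \<in> hom C A (T \<otimes>\<^sub>o dual C Z) \<Longrightarrow> uncurry_right T Z n \<in> hom C (A \<otimes>\<^sub>o Z) T"
  unfolding uncurry_right_def
  by (assumption | rule typing duality_typed | simp only: ob_simps)+

lemma curry_left_in_hom: "m \<in> hom C (Z \<otimes>\<^sub>o A) T \<Longrightarrow> curry_left Z A m \<in> hom C A (dual C Z \<otimes>\<^sub>o T)"
  unfolding curry_left_def
  by (assumption | rule typing duality_typed | simp only: ob_simps)+

lemma uncurry_left_in_hom: "n \<in> hom C A (dual C Z \<otimes>\<^sub>o T) \<Longrightarrow> uncurry_left Z T n \<in> hom C (Z \<otimes>\<^sub>o A) T"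
  unfolding uncurry_left_def
  by (assumption | rule typing duality_typed | simp only: ob_simps)+

text \<open>A zigzag remains once \<open>m\<close> has been slid past the evaluation. The identity
  makes currying injective, which carries uniqueness for the coend over to
  \<open>L \<otimes> Z\<close>.\<close>

lemma uncurry_curry_right:
  assumes m: "m \<in> hom C (A \<otimes>\<^sub>o Z) T"
  shows "uncurry_right T Z (curry_right A Z m) = m"
proof -
  let ?K = "coev C Z" and ?e = "ev C Z" and ?D = "dual C Z"
  have K1: "?K \<otimes>\<^sub>m ident C Z \<in> hom C Z (Z \<otimes>\<^sub>o ?D \<otimes>\<^sub>o Z)"
    by (insert assms, (assumption | rule typing duality_typed | simp only: ob_simps)+)
  have AK1: "ident C A \<otimes>\<^sub>m (?K \<otimes>\<^sub>m ident C Z) \<in> hom C (A \<otimes>\<^sub>o Z) (A \<otimes>\<^sub>o Z \<otimes>\<^sub>o ?D \<otimes>\<^sub>o Z)"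
    by (insert assms, (assumption | rule typing duality_typed | simp only: ob_simps)+)
  have e1: "ident C Z \<otimes>\<^sub>m ?e \<in> hom C (Z \<otimes>\<^sub>o ?D \<otimes>\<^sub>o Z) Z"
    by (insert assms, (assumption | rule typing duality_typed | simp only: ob_simps)+)
  have m1: "m \<otimes>\<^sub>m ident C (?D \<otimes>\<^sub>o Z) \<in> hom C (A \<otimes>\<^sub>o Z \<otimes>\<^sub>o ?D \<otimes>\<^sub>o Z) (T \<otimes>\<^sub>o ?D \<otimes>\<^sub>o Z)"
    by (insert assms, (assumption | rule typing duality_typed | simp only: ob_simps)+)
  have Te: "ident C T \<otimes>\<^sub>m ?e \<in> hom C (T \<otimes>\<^sub>o ?D \<otimes>\<^sub>o Z) T"
    by (insert assms, (assumption | rule typing duality_typed | simp only: ob_simps)+)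
  have Ae: "ident C A \<otimes>\<^sub>m (ident C Z \<otimes>\<^sub>m ?e) \<in> hom C (A \<otimes>\<^sub>o Z \<otimes>\<^sub>o ?D \<otimes>\<^sub>o Z) (A \<otimes>\<^sub>o Z)"
    by (insert assms, (assumption | rule typing duality_typed | simp only: ob_simps)+)
  have AK: "ident C A \<otimes>\<^sub>m ?K \<in> hom C A (A \<otimes>\<^sub>o Z \<otimes>\<^sub>o ?D)"
    by (insert assms, (assumption | rule typing duality_typed | simp only: ob_simps)+)
  have mD: "m \<otimes>\<^sub>m ident C ?D \<in> hom C (A \<otimes>\<^sub>o Z \<otimes>\<^sub>o ?D) (T \<otimes>\<^sub>o ?D)"
    by (insert assms, (assumption | rule typing duality_typed | simp only: ob_simps)+)
  have "uncurry_right T Z (curry_right A Z m) =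
      (ident C T \<otimes>\<^sub>m ?e) \<cdot> ((m \<otimes>\<^sub>m ident C (?D \<otimes>\<^sub>o Z)) \<cdot> (ident C A \<otimes>\<^sub>m (?K \<otimes>\<^sub>m ident C Z)))"
    unfolding uncurry_right_def curry_right_def comp_tensor_ident[OF AK mD]
      tensor_ident_ob[OF m] tensor_middle[OF coev_in_hom] ..
  also have "\<dots> = ((ident C T \<otimes>\<^sub>m ?e) \<cdot> (m \<otimes>\<^sub>m ident C (?D \<otimes>\<^sub>o Z))) \<cdot> (ident C A \<otimes>\<^sub>m (?K \<otimes>\<^sub>m ident C Z))"
    by (rule comp_assoc[OF AK1 m1 Te])
  also have "(ident C T \<otimes>\<^sub>m ?e) \<cdot> (m \<otimes>\<^sub>m ident C (?D \<otimes>\<^sub>o Z)) = m \<cdot> (ident C A \<otimes>\<^sub>m (ident C Z \<otimes>\<^sub>m ?e))"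
    unfolding tensor_slide[OF m ev_in_hom, symmetric] tensor_unit_right[OF m] ident_ob_tensor[OF ev_in_hom] ..
  also have "(m \<cdot> (ident C A \<otimes>\<^sub>m (ident C Z \<otimes>\<^sub>m ?e))) \<cdot> (ident C A \<otimes>\<^sub>m (?K \<otimes>\<^sub>m ident C Z)) =
      m \<cdot> (ident C A \<otimes>\<^sub>m ((ident C Z \<otimes>\<^sub>m ?e) \<cdot> (?K \<otimes>\<^sub>m ident C Z)))"
    unfolding ident_tensor_comp[OF K1 e1] by (rule comp_assoc[OF AK1 Ae m, symmetric])
  also have "\<dots> = m" unfolding zigzag tensor_ident by (rule comp_ident_right[OF m])
  finally show ?thesis .
qed

lemma curry_right_comp:
  assumes m: "m \<in> hom C (A \<otimes>\<^sub>o Z) T" and a: "a \<in> hom C A' A"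
  shows "curry_right A' Z (m \<cdot> (a \<otimes>\<^sub>m ident C Z)) = curry_right A Z m \<cdot> a"
proof -
  let ?K = "coev C Z" and ?D = "dual C Z"
  have aZ: "a \<otimes>\<^sub>m ident C Z \<in> hom C (A' \<otimes>\<^sub>o Z) (A \<otimes>\<^sub>o Z)"
    by (insert assms, (assumption | rule typing duality_typed | simp only: ob_simps)+)
  have aZD: "a \<otimes>\<^sub>m ident C (Z \<otimes>\<^sub>o ?D) \<in> hom C (A' \<otimes>\<^sub>o Z \<otimes>\<^sub>o ?D) (A \<otimes>\<^sub>o Z \<otimes>\<^sub>o ?D)"
    by (insert assms, (assumption | rule typing duality_typed | simp only: ob_simps)+)
  have AK: "ident C A \<otimes>\<^sub>m ?K \<in> hom C A (A \<otimes>\<^sub>o Z \<otimes>\<^sub>o ?D)"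
    by (insert assms, (assumption | rule typing duality_typed | simp only: ob_simps)+)
  have AK': "ident C A' \<otimes>\<^sub>m ?K \<in> hom C A' (A' \<otimes>\<^sub>o Z \<otimes>\<^sub>o ?D)"
    by (insert assms, (assumption | rule typing duality_typed | simp only: ob_simps)+)
  have mD: "m \<otimes>\<^sub>m ident C ?D \<in> hom C (A \<otimes>\<^sub>o Z \<otimes>\<^sub>o ?D) (T \<otimes>\<^sub>o ?D)"
    by (insert assms, (assumption | rule typing duality_typed | simp only: ob_simps)+)
  have "curry_right A' Z (m \<cdot> (a \<otimes>\<^sub>m ident C Z)) =
      ((m \<otimes>\<^sub>m ident C ?D) \<cdot> (a \<otimes>\<^sub>m ident C (Z \<otimes>\<^sub>o ?D))) \<cdot> (ident C A' \<otimes>\<^sub>m ?K)"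
    unfolding curry_right_def comp_tensor_ident[OF aZ m] tensor_ident_ob[OF a] ..
  also have "\<dots> = (m \<otimes>\<^sub>m ident C ?D) \<cdot> ((a \<otimes>\<^sub>m ident C (Z \<otimes>\<^sub>o ?D)) \<cdot> (ident C A' \<otimes>\<^sub>m ?K))"
    by (rule comp_assoc[OF AK' aZD mD, symmetric])
  also have "(a \<otimes>\<^sub>m ident C (Z \<otimes>\<^sub>o ?D)) \<cdot> (ident C A' \<otimes>\<^sub>m ?K) = (ident C A \<otimes>\<^sub>m ?K) \<cdot> a"
    unfolding tensor_slide[OF a coev_in_hom] tensor_unit_right[OF a] ..
  also have "(m \<otimes>\<^sub>m ident C ?D) \<cdot> ((ident C A \<otimes>\<^sub>m ?K) \<cdot> a) = curry_right A Z m \<cdot> a"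
    unfolding curry_right_def by (rule comp_assoc[OF a AK mD])
  finally show ?thesis .
qed

lemma uncurry_right_comp:
  assumes n: "n \<in> hom C A (T \<otimes>\<^sub>o dual C Z)" and a: "a \<in> hom C A' A"
  shows "uncurry_right T Z (n \<cdot> a) = uncurry_right T Z n \<cdot> (a \<otimes>\<^sub>m ident C Z)"
proof -
  have aZ: "a \<otimes>\<^sub>m ident C Z \<in> hom C (A' \<otimes>\<^sub>o Z) (A \<otimes>\<^sub>o Z)"
    by (insert assms, (assumption | rule typing duality_typed | simp only: ob_simps)+)
  have nZ: "n \<otimes>\<^sub>m ident C Z \<in> hom C (A \<otimes>\<^sub>o Z) (T \<otimes>\<^sub>o dual C Z \<otimes>\<^sub>o Z)"
    by (insert assms, (assumption | rule typing duality_typed | simp only: ob_simps)+)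
  have Te: "ident C T \<otimes>\<^sub>m ev C Z \<in> hom C (T \<otimes>\<^sub>o dual C Z \<otimes>\<^sub>o Z) T"
    by (insert assms, (assumption | rule typing duality_typed | simp only: ob_simps)+)
  show ?thesis
    unfolding uncurry_right_def comp_tensor_ident[OF a n] by (rule comp_assoc[OF aZ nZ Te])
qed

text \<open>The zigzag of the dual object, read through \<open>dual_dual\<close>: the right duality
  of \<open>Z\<close> is the left duality of its dual.\<close>

lemma zigzag_flip: "(ev C (dual C Z) \<otimes>\<^sub>m ident C Z) \<cdot> (ident C Z \<otimes>\<^sub>m coev C (dual C Z)) = ident C Z"
  using zigzag_dual[of "dual C Z"] by (simp add: dual_dual)

lemma uncurry_curry_left:
  assumes m: "m \<in> hom C (Z \<otimes>\<^sub>o A) T"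
  shows "uncurry_left Z T (curry_left Z A m) = m"
proof -
  let ?K = "coev C (dual C Z)" and ?e = "ev C (dual C Z)" and ?D = "dual C Z"
  have KA: "?K \<otimes>\<^sub>m ident C A \<in> hom C A (?D \<otimes>\<^sub>o Z \<otimes>\<^sub>o A)"
    by (insert assms, (assumption | rule typing duality_typed | simp only: ob_simps)+)
  have ZK: "ident C Z \<otimes>\<^sub>m ?K \<in> hom C Z (Z \<otimes>\<^sub>o ?D \<otimes>\<^sub>o Z)"
    by (insert assms, (assumption | rule typing duality_typed | simp only: ob_simps)+)
  have eZ: "?e \<otimes>\<^sub>m ident C Z \<in> hom C (Z \<otimes>\<^sub>o ?D \<otimes>\<^sub>o Z) Z"
    by (insert assms, (assumption | rule typing duality_typed | simp only: ob_simps)+)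
  have ZKA: "(ident C Z \<otimes>\<^sub>m ?K) \<otimes>\<^sub>m ident C A \<in> hom C (Z \<otimes>\<^sub>o A) (Z \<otimes>\<^sub>o ?D \<otimes>\<^sub>o Z \<otimes>\<^sub>o A)"
    by (insert assms, (assumption | rule typing duality_typed | simp only: ob_simps)+)
  have eZA: "(?e \<otimes>\<^sub>m ident C Z) \<otimes>\<^sub>m ident C A \<in> hom C (Z \<otimes>\<^sub>o ?D \<otimes>\<^sub>o Z \<otimes>\<^sub>o A) (Z \<otimes>\<^sub>o A)"
    by (insert assms, (assumption | rule typing duality_typed | simp only: ob_simps)+)
  have Dm: "ident C ?D \<otimes>\<^sub>m m \<in> hom C (?D \<otimes>\<^sub>o Z \<otimes>\<^sub>o A) (?D \<otimes>\<^sub>o T)"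
    by (insert assms, (assumption | rule typing duality_typed | simp only: ob_simps)+)
  have ZDm: "ident C (Z \<otimes>\<^sub>o ?D) \<otimes>\<^sub>m m \<in> hom C (Z \<otimes>\<^sub>o ?D \<otimes>\<^sub>o Z \<otimes>\<^sub>o A) (Z \<otimes>\<^sub>o ?D \<otimes>\<^sub>o T)"
    by (insert assms, (assumption | rule typing duality_typed | simp only: ob_simps)+)
  have eT: "?e \<otimes>\<^sub>m ident C T \<in> hom C (Z \<otimes>\<^sub>o ?D \<otimes>\<^sub>o T) T"
    by (insert assms, (assumption | rule typing duality_typed | simp only: ob_simps)+)
  have "uncurry_left Z T (curry_left Z A m) =
      (?e \<otimes>\<^sub>m ident C T) \<cdot> ((ident C (Z \<otimes>\<^sub>o ?D) \<otimes>\<^sub>m m) \<cdot> ((ident C Z \<otimes>\<^sub>m ?K) \<otimes>\<^sub>m ident C A))"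
    unfolding uncurry_left_def curry_left_def ident_tensor_comp[OF KA Dm]
      ident_ob_tensor[OF m] tensor_middle[OF coev_dual_in_hom] ..
  also have "\<dots> = ((?e \<otimes>\<^sub>m ident C T) \<cdot> (ident C (Z \<otimes>\<^sub>o ?D) \<otimes>\<^sub>m m)) \<cdot> ((ident C Z \<otimes>\<^sub>m ?K) \<otimes>\<^sub>m ident C A)"
    by (rule comp_assoc[OF ZKA ZDm eT])
  also have "(?e \<otimes>\<^sub>m ident C T) \<cdot> (ident C (Z \<otimes>\<^sub>o ?D) \<otimes>\<^sub>m m) = m \<cdot> ((?e \<otimes>\<^sub>m ident C Z) \<otimes>\<^sub>m ident C A)"
    unfolding tensor_slide[OF ev_dual_in_hom m] tensor_unit_left[OF m] tensor_ident_ob[OF ev_dual_in_hom] ..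
  also have "(m \<cdot> ((?e \<otimes>\<^sub>m ident C Z) \<otimes>\<^sub>m ident C A)) \<cdot> ((ident C Z \<otimes>\<^sub>m ?K) \<otimes>\<^sub>m ident C A) =
      m \<cdot> (((?e \<otimes>\<^sub>m ident C Z) \<cdot> (ident C Z \<otimes>\<^sub>m ?K)) \<otimes>\<^sub>m ident C A)"
    unfolding comp_tensor_ident[OF ZK eZ] by (rule comp_assoc[OF ZKA eZA m, symmetric])
  also have "\<dots> = m" unfolding zigzag_flip tensor_ident by (rule comp_ident_right[OF m])
  finally show ?thesis .
qed

lemma curry_left_comp:
  assumes m: "m \<in> hom C (Z \<otimes>\<^sub>o A) T" and a: "a \<in> hom C A' A"
  shows "curry_left Z A' (m \<cdot> (ident C Z \<otimes>\<^sub>m a)) = curry_left Z A m \<cdot> a"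
proof -
  let ?K = "coev C (dual C Z)" and ?D = "dual C Z"
  have Za: "ident C Z \<otimes>\<^sub>m a \<in> hom C (Z \<otimes>\<^sub>o A') (Z \<otimes>\<^sub>o A)"
    by (insert assms, (assumption | rule typing duality_typed | simp only: ob_simps)+)
  have DZa: "ident C (?D \<otimes>\<^sub>o Z) \<otimes>\<^sub>m a \<in> hom C (?D \<otimes>\<^sub>o Z \<otimes>\<^sub>o A') (?D \<otimes>\<^sub>o Z \<otimes>\<^sub>o A)"
    by (insert assms, (assumption | rule typing duality_typed | simp only: ob_simps)+)
  have KA: "?K \<otimes>\<^sub>m ident C A \<in> hom C A (?D \<otimes>\<^sub>o Z \<otimes>\<^sub>o A)"
    by (insert assms, (assumption | rule typing duality_typed | simp only: ob_simps)+)
  have KA': "?K \<otimes>\<^sub>m ident C A' \<in> hom C A' (?D \<otimes>\<^sub>o Z \<otimes>\<^sub>o A')"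
    by (insert assms, (assumption | rule typing duality_typed | simp only: ob_simps)+)
  have Dm: "ident C ?D \<otimes>\<^sub>m m \<in> hom C (?D \<otimes>\<^sub>o Z \<otimes>\<^sub>o A) (?D \<otimes>\<^sub>o T)"
    by (insert assms, (assumption | rule typing duality_typed | simp only: ob_simps)+)
  have "curry_left Z A' (m \<cdot> (ident C Z \<otimes>\<^sub>m a)) =
      ((ident C ?D \<otimes>\<^sub>m m) \<cdot> (ident C (?D \<otimes>\<^sub>o Z) \<otimes>\<^sub>m a)) \<cdot> (?K \<otimes>\<^sub>m ident C A')"
    unfolding curry_left_def ident_tensor_comp[OF Za m] ident_ob_tensor[OF a] ..
  also have "\<dots> = (ident C ?D \<otimes>\<^sub>m m) \<cdot> ((ident C (?D \<otimes>\<^sub>o Z) \<otimes>\<^sub>m a) \<cdot> (?K \<otimes>\<^sub>m ident C A'))"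
    by (rule comp_assoc[OF KA' DZa Dm, symmetric])
  also have "(ident C (?D \<otimes>\<^sub>o Z) \<otimes>\<^sub>m a) \<cdot> (?K \<otimes>\<^sub>m ident C A') = (?K \<otimes>\<^sub>m ident C A) \<cdot> a"
    unfolding tensor_slide[OF coev_dual_in_hom a, symmetric] tensor_unit_left[OF a] ..
  also have "(ident C ?D \<otimes>\<^sub>m m) \<cdot> ((?K \<otimes>\<^sub>m ident C A) \<cdot> a) = curry_left Z A m \<cdot> a"
    unfolding curry_left_def by (rule comp_assoc[OF a KA Dm])
  finally show ?thesis .
qed

lemma curry_left_post:
  assumes m: "m \<in> hom C (Z \<otimes>\<^sub>o A) T" and t: "t \<in> hom C T T'"
  shows "curry_left Z A (t \<cdot> m) = (ident C (dual C Z) \<otimes>\<^sub>m t) \<cdot> curry_left Z A m"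
proof -
  let ?K = "coev C (dual C Z)" and ?D = "dual C Z"
  have KA: "?K \<otimes>\<^sub>m ident C A \<in> hom C A (?D \<otimes>\<^sub>o Z \<otimes>\<^sub>o A)"
    by (insert assms, (assumption | rule typing duality_typed | simp only: ob_simps)+)
  have Dm: "ident C ?D \<otimes>\<^sub>m m \<in> hom C (?D \<otimes>\<^sub>o Z \<otimes>\<^sub>o A) (?D \<otimes>\<^sub>o T)"
    by (insert assms, (assumption | rule typing duality_typed | simp only: ob_simps)+)
  have Dt: "ident C ?D \<otimes>\<^sub>m t \<in> hom C (?D \<otimes>\<^sub>o T) (?D \<otimes>\<^sub>o T')"
    by (insert assms, (assumption | rule typing duality_typed | simp only: ob_simps)+)
  show ?thesis
    unfolding curry_left_def ident_tensor_comp[OF m t] by (rule comp_assoc[OF KA Dm Dt, symmetric])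
qed

lemma uncurry_left_post:
  assumes n: "n \<in> hom C A (dual C Z \<otimes>\<^sub>o T)" and t: "t \<in> hom C T T'"
  shows "uncurry_left Z T' ((ident C (dual C Z) \<otimes>\<^sub>m t) \<cdot> n) = t \<cdot> uncurry_left Z T n"
proof -
  let ?e = "ev C (dual C Z)" and ?D = "dual C Z"
  have Dt: "ident C ?D \<otimes>\<^sub>m t \<in> hom C (?D \<otimes>\<^sub>o T) (?D \<otimes>\<^sub>o T')"
    by (insert assms, (assumption | rule typing duality_typed | simp only: ob_simps)+)
  have Zn: "ident C Z \<otimes>\<^sub>m n \<in> hom C (Z \<otimes>\<^sub>o A) (Z \<otimes>\<^sub>o ?D \<otimes>\<^sub>o T)"
    by (insert assms, (assumption | rule typing duality_typed | simp only: ob_simps)+)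
  have ZDt: "ident C (Z \<otimes>\<^sub>o ?D) \<otimes>\<^sub>m t \<in> hom C (Z \<otimes>\<^sub>o ?D \<otimes>\<^sub>o T) (Z \<otimes>\<^sub>o ?D \<otimes>\<^sub>o T')"
    by (insert assms, (assumption | rule typing duality_typed | simp only: ob_simps)+)
  have eT': "?e \<otimes>\<^sub>m ident C T' \<in> hom C (Z \<otimes>\<^sub>o ?D \<otimes>\<^sub>o T') T'"
    by (insert assms, (assumption | rule typing duality_typed | simp only: ob_simps)+)
  have eT: "?e \<otimes>\<^sub>m ident C T \<in> hom C (Z \<otimes>\<^sub>o ?D \<otimes>\<^sub>o T) T"
    by (insert assms, (assumption | rule typing duality_typed | simp only: ob_simps)+)
  have "uncurry_left Z T' ((ident C ?D \<otimes>\<^sub>m t) \<cdot> n) =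
      ((?e \<otimes>\<^sub>m ident C T') \<cdot> (ident C (Z \<otimes>\<^sub>o ?D) \<otimes>\<^sub>m t)) \<cdot> (ident C Z \<otimes>\<^sub>m n)"
    unfolding uncurry_left_def ident_tensor_comp[OF n Dt] ident_ob_tensor[OF t, symmetric]
    by (rule comp_assoc[OF Zn ZDt eT'])
  also have "(?e \<otimes>\<^sub>m ident C T') \<cdot> (ident C (Z \<otimes>\<^sub>o ?D) \<otimes>\<^sub>m t) = t \<cdot> (?e \<otimes>\<^sub>m ident C T)"
    unfolding tensor_slide[OF ev_dual_in_hom t] tensor_unit_left[OF t] ..
  also have "(t \<cdot> (?e \<otimes>\<^sub>m ident C T)) \<cdot> (ident C Z \<otimes>\<^sub>m n) = t \<cdot> uncurry_left Z T n"
    unfolding uncurry_left_def by (rule comp_assoc[OF Zn eT t, symmetric])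
  finally show ?thesis .
qed

text \<open>The curried morphism is the name of \<open>g\<close>, a morphism out of the unit object.
  In this form \<open>g\<close> moves past other factors by \<open>tensor_slide\<close>.\<close>

lemma dual_mor_eq_curry:
  assumes g: "g \<in> hom C A B"
  shows "dual_mor C A B g =
    (ev C B \<otimes>\<^sub>m ident C (dual C A)) \<cdot> (ident C (dual C B) \<otimes>\<^sub>m curry_right \<one>\<^sub>o A g)"
proof -
  have K: "curry_right \<one>\<^sub>o A g = (g \<otimes>\<^sub>m ident C (dual C A)) \<cdot> coev C A"
    unfolding curry_right_def tensor_unit_left[OF coev_in_hom] ..
  have gA: "g \<otimes>\<^sub>m ident C (dual C A) \<in> hom C (A \<otimes>\<^sub>o dual C A) (B \<otimes>\<^sub>o dual C A)"
    by (insert assms, (assumption | rule typing duality_typed | simp only: ob_simps)+)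
  have 1: "ident C (dual C B) \<otimes>\<^sub>m (g \<otimes>\<^sub>m ident C (dual C A)) \<in>
     hom C (dual C B \<otimes>\<^sub>o A \<otimes>\<^sub>o dual C A) (dual C B \<otimes>\<^sub>o B \<otimes>\<^sub>o dual C
       A)" by (insert assms, (assumption | rule typing duality_typed | simp only: ob_simps)+)
  have 2: "ident C (dual C B) \<otimes>\<^sub>m coev C A \<in> hom C (dual C B) (dual C B \<otimes>\<^sub>o A \<otimes>\<^sub>o dual C A)"
    by (insert assms, (assumption | rule typing duality_typed | simp only: ob_simps)+)
  have 3: "ev C B \<otimes>\<^sub>m ident C (dual C A) \<in> hom C (dual C B \<otimes>\<^sub>o B \<otimes>\<^sub>o dual C A) (dual C A)"
    by (insert assms, (assumption | rule typing duality_typed | simp only: ob_simps)+)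
  show ?thesis
    unfolding dual_mor_def K ident_tensor_comp[OF coev_in_hom gA] tensor_middle[OF g]
    by (rule comp_assoc[OF 2 1 3, symmetric])
qed

lemma curry_unit_in_hom: "g \<in> hom C A B \<Longrightarrow> curry_right \<one>\<^sub>o A g \<in> hom C \<one>\<^sub>o (B \<otimes>\<^sub>o dual C A)"
  by (rule curry_right_in_hom) (simp add: tensor_ob_unit_left)

lemma dual_mor_in_hom: "g \<in> hom C A B \<Longrightarrow> dual_mor C A B g \<in> hom C (dual C B) (dual C A)"
  unfolding dual_mor_def
  by ((assumption | rule typing duality_typed | simp only: ob_simps)+)

text \<open>Moving the name of \<open>g\<close> past the coevaluation of \<open>B\<close> leaves a
  zigzag on \<open>B\<close>, which straightens.\<close>

lemma coev_dual_mor: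
  assumes g: "g \<in> hom C A B"
  shows "(ident C B \<otimes>\<^sub>m dual_mor C A B g) \<cdot> coev C B = (g \<otimes>\<^sub>m ident C (dual C A)) \<cdot> coev C A"
proof -
  let ?c = "curry_right \<one>\<^sub>o A g" and ?A = "dual C A" and ?B = "dual C B"
  note c = curry_unit_in_hom[OF g]
  have Bc: "ident C ?B \<otimes>\<^sub>m ?c \<in> hom C ?B (?B \<otimes>\<^sub>o B \<otimes>\<^sub>o ?A)"
    by (insert assms, (assumption | rule typing duality_typed hom_typed[OF c] | simp only: ob_simps)+)
  have BBc: "ident C (B \<otimes>\<^sub>o ?B) \<otimes>\<^sub>m ?c \<in> hom C (B \<otimes>\<^sub>o ?B) (B \<otimes>\<^sub>o ?B \<otimes>\<^sub>o B \<otimes>\<^sub>o ?A)"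
    by (insert assms, (assumption | rule typing duality_typed hom_typed[OF c] | simp only: ob_simps)+)
  have eA: "ev C B \<otimes>\<^sub>m ident C ?A \<in> hom C (?B \<otimes>\<^sub>o B \<otimes>\<^sub>o ?A) ?A"
    by (insert assms, (assumption | rule typing duality_typed | simp only: ob_simps)+)
  have BeA: "(ident C B \<otimes>\<^sub>m ev C B) \<otimes>\<^sub>m ident C ?A \<in> hom C (B \<otimes>\<^sub>o ?B \<otimes>\<^sub>o B \<otimes>\<^sub>o ?A) (B \<otimes>\<^sub>o ?A)"
    by (insert assms, (assumption | rule typing duality_typed | simp only: ob_simps)+)
  have Be: "ident C B \<otimes>\<^sub>m ev C B \<in> hom C (B \<otimes>\<^sub>o ?B \<otimes>\<^sub>o B) B"
    by (insert assms, (assumption | rule typing duality_typed | simp only: ob_simps)+)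
  have KB: "coev C B \<otimes>\<^sub>m ident C B \<in> hom C B (B \<otimes>\<^sub>o ?B \<otimes>\<^sub>o B)"
    by (insert assms, (assumption | rule typing duality_typed | simp only: ob_simps)+)
  have KBA: "(coev C B \<otimes>\<^sub>m ident C B) \<otimes>\<^sub>m ident C ?A \<in> hom C (B \<otimes>\<^sub>o ?A) (B \<otimes>\<^sub>o ?B \<otimes>\<^sub>o B \<otimes>\<^sub>o ?A)"
    by (insert assms, (assumption | rule typing duality_typed | simp only: ob_simps)+)
  have "(ident C B \<otimes>\<^sub>m dual_mor C A B g) \<cdot> coev C B =
      (((ident C B \<otimes>\<^sub>m ev C B) \<otimes>\<^sub>m ident C ?A) \<cdot> (ident C (B \<otimes>\<^sub>o ?B) \<otimes>\<^sub>m ?c)) \<cdot> coev C B"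
    unfolding dual_mor_eq_curry[OF g] ident_tensor_comp[OF Bc eA] ident_ob_tensor[OF c] tensor_middle[OF
      ev_in_hom] ..
  also have "\<dots> = ((ident C B \<otimes>\<^sub>m ev C B) \<otimes>\<^sub>m ident C ?A) \<cdot> ((ident C (B \<otimes>\<^sub>o ?B) \<otimes>\<^sub>m ?c) \<cdot> coev C B)"
    by (rule comp_assoc[OF coev_in_hom BBc BeA, symmetric])
  also have "(ident C (B \<otimes>\<^sub>o ?B) \<otimes>\<^sub>m ?c) \<cdot> coev C B = ((coev C B \<otimes>\<^sub>m ident C B) \<otimes>\<^sub>m ident C ?A) \<cdot> ?c"
    using tensor_slide[OF coev_in_hom c, of B]
    unfolding tensor_unit_left[OF c] tensor_unit_right[OF coev_in_hom] tensor_ident_ob[OF coev_in_hom] by simp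
  also have "((ident C B \<otimes>\<^sub>m ev C B) \<otimes>\<^sub>m ident C ?A) \<cdot> (((coev C B \<otimes>\<^sub>m ident C B) \<otimes>\<^sub>m ident C ?A) \<cdot> ?c) =
     (((ident C B \<otimes>\<^sub>m ev C B) \<cdot> (coev C B \<otimes>\<^sub>m ident C B)) \<otimes>\<^sub>m ident C ?A) \<cdot> ?c"
    unfolding comp_tensor_ident[OF KB Be] by (rule comp_assoc[OF c KBA BeA])
  also have "\<dots> = ?c" unfolding zigzag tensor_ident by (rule comp_ident_left[OF c])
  finally show ?thesis unfolding curry_right_def tensor_unit_left[OF coev_in_hom] .
qed

lemma ev_dual_mor:
  assumes g: "g \<in> hom C A B"
  shows "ev C A \<cdot> (dual_mor C A B g \<otimes>\<^sub>m ident C A) = ev C B \<cdot> (ident C (dual C B) \<otimes>\<^sub>m g)"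
proof -
  let ?c = "curry_right \<one>\<^sub>o A g" and ?A = "dual C A" and ?B = "dual C B"
  note c = curry_unit_in_hom[OF g]
  have g': "g \<in> hom C (\<one>\<^sub>o \<otimes>\<^sub>o A) B" using g by (simp add: tensor_ob_unit_left)
  have Bc: "ident C ?B \<otimes>\<^sub>m ?c \<in> hom C ?B (?B \<otimes>\<^sub>o B \<otimes>\<^sub>o ?A)"
    by (insert assms, (assumption | rule typing duality_typed hom_typed[OF c] | simp only: ob_simps)+)
  have cA: "?c \<otimes>\<^sub>m ident C A \<in> hom C A (B \<otimes>\<^sub>o ?A \<otimes>\<^sub>o A)"
    by (insert assms, (assumption | rule typing duality_typed hom_typed[OF c] | simp only: ob_simps)+)
  have BcA: "ident C ?B \<otimes>\<^sub>m (?c \<otimes>\<^sub>m ident C A) \<in> hom C (?B \<otimes>\<^sub>o A) (?B \<otimes>\<^sub>o B \<otimes>\<^sub>o ?A \<otimes>\<^sub>o A)"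
    by (insert assms, (assumption | rule typing duality_typed hom_typed[OF c] | simp only: ob_simps)+)
  have eA: "ev C B \<otimes>\<^sub>m ident C ?A \<in> hom C (?B \<otimes>\<^sub>o B \<otimes>\<^sub>o ?A) ?A"
    by (insert assms, (assumption | rule typing duality_typed | simp only: ob_simps)+)
  have eAA: "ev C B \<otimes>\<^sub>m ident C (?A \<otimes>\<^sub>o A) \<in> hom C (?B \<otimes>\<^sub>o B \<otimes>\<^sub>o ?A \<otimes>\<^sub>o A) (?A \<otimes>\<^sub>o A)"
    by (insert assms, (assumption | rule typing duality_typed | simp only: ob_simps)+)
  have Be: "ident C B \<otimes>\<^sub>m ev C A \<in> hom C (B \<otimes>\<^sub>o ?A \<otimes>\<^sub>o A) B"
    by (insert assms, (assumption | rule typing duality_typed | simp only: ob_simps)+)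
  have BBe: "ident C (?B \<otimes>\<^sub>o B) \<otimes>\<^sub>m ev C A \<in> hom C (?B \<otimes>\<^sub>o B \<otimes>\<^sub>o ?A \<otimes>\<^sub>o A) (?B \<otimes>\<^sub>o B)"
    by (insert assms, (assumption | rule typing duality_typed | simp only: ob_simps)+)
  have "ev C A \<cdot> (dual_mor C A B g \<otimes>\<^sub>m ident C A) =
      ev C A \<cdot> ((ev C B \<otimes>\<^sub>m ident C (?A \<otimes>\<^sub>o A)) \<cdot> (ident C ?B \<otimes>\<^sub>m (?c \<otimes>\<^sub>m ident C A)))"
    unfolding dual_mor_eq_curry[OF g] comp_tensor_ident[OF Bc eA] tensor_ident_ob[OF ev_in_hom]
      tensor_middle[OF c] ..
  also have "\<dots> = (ev C A \<cdot> (ev C B \<otimes>\<^sub>m ident C (?A \<otimes>\<^sub>o A))) \<cdot> (ident C ?B \<otimes>\<^sub>m (?c \<otimes>\<^sub>m ident C A))"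
    by (rule comp_assoc[OF BcA eAA ev_in_hom])
  also have "ev C A \<cdot> (ev C B \<otimes>\<^sub>m ident C (?A \<otimes>\<^sub>o A)) = ev C B \<cdot> (ident C (?B \<otimes>\<^sub>o B) \<otimes>\<^sub>m ev C A)"
    using tensor_slide[OF ev_in_hom ev_in_hom, of B A]
    unfolding tensor_unit_left[OF ev_in_hom] tensor_unit_right[OF ev_in_hom] by simp
  also have "(ev C B \<cdot> (ident C (?B \<otimes>\<^sub>o B) \<otimes>\<^sub>m ev C A)) \<cdot> (ident C ?B \<otimes>\<^sub>m (?c \<otimes>\<^sub>m ident C A)) =
      ev C B \<cdot> ((ident C (?B \<otimes>\<^sub>o B) \<otimes>\<^sub>m ev C A) \<cdot> (ident C ?B \<otimes>\<^sub>m (?c \<otimes>\<^sub>m ident C A)))"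
    by (rule comp_assoc[OF BcA BBe ev_in_hom, symmetric])
  also have "(ident C (?B \<otimes>\<^sub>o B) \<otimes>\<^sub>m ev C A) \<cdot> (ident C ?B \<otimes>\<^sub>m (?c \<otimes>\<^sub>m ident C A)) =
      ident C ?B \<otimes>\<^sub>m uncurry_right B A ?c"
    unfolding uncurry_right_def ident_tensor_comp[OF cA Be] ident_ob_tensor[OF ev_in_hom] ..
  also have "uncurry_right B A ?c = g" by (rule uncurry_curry_right[OF g'])
  finally show ?thesis .
qed

text \<open>A zigzag recovers \<open>h\<close> from its evaluation, so one equation identifies a
  dual morphism. It is used to compute the duals of \<open>g \<otimes> id\<close> and
  \<open>id \<otimes> g\<close>.\<close>

lemma dual_mor_unique:
  assumes g: "g \<in> hom C A B" and h: "h \<in> hom C (dual C B) (dual C A)"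
    and eq: "ev C A \<cdot> (h \<otimes>\<^sub>m ident C A) = ev C B \<cdot> (ident C (dual C B) \<otimes>\<^sub>m g)"
  shows "dual_mor C A B g = h"
proof -
  have *: "((ev C A \<cdot> (k \<otimes>\<^sub>m ident C A)) \<otimes>\<^sub>m ident C (dual C A)) \<cdot> (ident C (dual C B) \<otimes>\<^sub>m coev C A) = k"
    if k: "k \<in> hom C (dual C B) (dual C A)" for k
  proof -
    let ?A = "dual C A" and ?B = "dual C B"
    have kA: "k \<otimes>\<^sub>m ident C A \<in> hom C (?B \<otimes>\<^sub>o A) (?A \<otimes>\<^sub>o A)"
      by (insert k, (assumption | rule typing duality_typed | simp only: ob_simps)+)
    have kAA: "k \<otimes>\<^sub>m ident C (A \<otimes>\<^sub>o ?A) \<in> hom C (?B \<otimes>\<^sub>o A \<otimes>\<^sub>o ?A) (?A \<otimes>\<^sub>o A \<otimes>\<^sub>o ?A)"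
      by (insert k, (assumption | rule typing duality_typed | simp only: ob_simps)+)
    have eA: "ev C A \<otimes>\<^sub>m ident C ?A \<in> hom C (?A \<otimes>\<^sub>o A \<otimes>\<^sub>o ?A) ?A"
      by (insert k, (assumption | rule typing duality_typed | simp only: ob_simps)+)
    have BK: "ident C ?B \<otimes>\<^sub>m coev C A \<in> hom C ?B (?B \<otimes>\<^sub>o A \<otimes>\<^sub>o ?A)"
      by (insert k, (assumption | rule typing duality_typed | simp only: ob_simps)+)
    have AK: "ident C ?A \<otimes>\<^sub>m coev C A \<in> hom C ?A (?A \<otimes>\<^sub>o A \<otimes>\<^sub>o ?A)"
      by (insert k, (assumption | rule typing duality_typed | simp only: ob_simps)+)
    have "((ev C A \<cdot> (k \<otimes>\<^sub>m ident C A)) \<otimes>\<^sub>m ident C ?A) \<cdot> (ident C ?B \<otimes>\<^sub>m coev C A) =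
       (ev C A \<otimes>\<^sub>m ident C ?A) \<cdot> ((k \<otimes>\<^sub>m ident C (A \<otimes>\<^sub>o ?A)) \<cdot> (ident C ?B \<otimes>\<^sub>m coev C A))"
      unfolding comp_tensor_ident[OF kA ev_in_hom] tensor_ident_ob[OF k, symmetric]
      by (rule comp_assoc[OF BK kAA eA, symmetric])
    also have "(k \<otimes>\<^sub>m ident C (A \<otimes>\<^sub>o ?A)) \<cdot> (ident C ?B \<otimes>\<^sub>m coev C A) = (ident C ?A \<otimes>\<^sub>m coev C A) \<cdot> k"
      unfolding tensor_slide[OF k coev_in_hom] tensor_unit_right[OF k] ..
    also have "(ev C A \<otimes>\<^sub>m ident C ?A) \<cdot> ((ident C ?A \<otimes>\<^sub>m coev C A) \<cdot> k) = k"
      unfolding comp_assoc[OF k AK eA] zigzag_dual by (rule comp_ident_left[OF k])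
    finally show ?thesis .
  qed
  show ?thesis
    using *[OF h] *[OF dual_mor_in_hom[OF g]] unfolding ev_dual_mor[OF g] eq by simp
qed

lemma dual_mor_tensor_ident:
  assumes g: "g \<in> hom C A B"
  shows "dual_mor C (A \<otimes>\<^sub>o Y) (B \<otimes>\<^sub>o Y) (g \<otimes>\<^sub>m ident C Y) = ident C (dual C Y) \<otimes>\<^sub>m dual_mor C A B g"
proof (rule dual_mor_unique)
  let ?A = "dual C A" and ?B = "dual C B" and ?Y = "dual C Y" and ?g = "dual_mor C A B g"
  note d = dual_mor_in_hom[OF g]
  show "g \<otimes>\<^sub>m ident C Y \<in> hom C (A \<otimes>\<^sub>o Y) (B \<otimes>\<^sub>o Y)"
    by (insert assms, (assumption | rule typing duality_typed | simp only: ob_simps)+)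
  show "ident C ?Y \<otimes>\<^sub>m ?g \<in> hom C (dual C (B \<otimes>\<^sub>o Y)) (dual C (A \<otimes>\<^sub>o Y))"
    unfolding dual_tensor by (insert assms, (assumption | rule typing duality_typed hom_typed[OF d] | simp
      only: ob_simps)+)
  have YeY: "ident C ?Y \<otimes>\<^sub>m (ev C Z \<otimes>\<^sub>m ident C Y) \<in> hom C (?Y \<otimes>\<^sub>o dual C Z \<otimes>\<^sub>o Z \<otimes>\<^sub>o Y) (?Y \<otimes>\<^sub>o Y)" for Z
    by (insert assms, (assumption | rule typing duality_typed | simp only: ob_simps)+)
  have eY: "ev C Z \<otimes>\<^sub>m ident C Y \<in> hom C (dual C Z \<otimes>\<^sub>o Z \<otimes>\<^sub>o Y) Y" for Z
    by (insert assms, (assumption | rule typing duality_typed | simp only: ob_simps)+)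
  have gA: "?g \<otimes>\<^sub>m ident C A \<in> hom C (?B \<otimes>\<^sub>o A) (?A \<otimes>\<^sub>o A)"
    by (insert assms, (assumption | rule typing duality_typed hom_typed[OF d] | simp only: ob_simps)+)
  have Bg: "ident C ?B \<otimes>\<^sub>m g \<in> hom C (?B \<otimes>\<^sub>o A) (?B \<otimes>\<^sub>o B)"
    by (insert assms, (assumption | rule typing duality_typed | simp only: ob_simps)+)
  have gAY: "(?g \<otimes>\<^sub>m ident C A) \<otimes>\<^sub>m ident C Y \<in> hom C (?B \<otimes>\<^sub>o A \<otimes>\<^sub>o Y) (?A \<otimes>\<^sub>o A \<otimes>\<^sub>o Y)"
    by (insert assms, (assumption | rule typing duality_typed hom_typed[OF d] | simp only: ob_simps)+)
  have BgY: "(ident C ?B \<otimes>\<^sub>m g) \<otimes>\<^sub>m ident C Y \<in> hom C (?B \<otimes>\<^sub>o A \<otimes>\<^sub>o Y) (?B \<otimes>\<^sub>o B \<otimes>\<^sub>o Y)"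
    by (insert assms, (assumption | rule typing duality_typed | simp only: ob_simps)+)
  have YgAY: "ident C ?Y \<otimes>\<^sub>m ((?g \<otimes>\<^sub>m ident C A) \<otimes>\<^sub>m ident C Y) \<in> hom C (?Y \<otimes>\<^sub>o ?B \<otimes>\<^sub>o A \<otimes>\<^sub>o Y) (?Y \<otimes>\<^sub>o ?A \<otimes>\<^sub>o A \<otimes>\<^sub>o Y)"
    by (insert assms, (assumption | rule typing duality_typed hom_typed[OF d] | simp only: ob_simps)+)
  have YBgY: "ident C ?Y \<otimes>\<^sub>m ((ident C ?B \<otimes>\<^sub>m g) \<otimes>\<^sub>m ident C Y) \<in> hom C (?Y \<otimes>\<^sub>o ?B \<otimes>\<^sub>o A \<otimes>\<^sub>o Y) (?Y \<otimes>\<^sub>o ?B \<otimes>\<^sub>o B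
    \<otimes>\<^sub>o Y)" by (insert assms, (assumption | rule typing duality_typed | simp only: ob_simps)+)
  have 1: "(ident C ?Y \<otimes>\<^sub>m ?g) \<otimes>\<^sub>m ident C (A \<otimes>\<^sub>o Y) = ident C ?Y \<otimes>\<^sub>m ((?g \<otimes>\<^sub>m ident C A) \<otimes>\<^sub>m ident C Y)"
    unfolding tensor_middle[OF d] tensor_ident_ob[OF d] ..
  have gY: "g \<otimes>\<^sub>m ident C Y \<in> hom C (A \<otimes>\<^sub>o Y) (B \<otimes>\<^sub>o Y)"
    by (insert assms, (assumption | rule typing duality_typed | simp only: ob_simps)+)
  have 2: "ident C (dual C (B \<otimes>\<^sub>o Y)) \<otimes>\<^sub>m (g \<otimes>\<^sub>m ident C Y) = ident C ?Y \<otimes>\<^sub>m ((ident C ?B \<otimes>\<^sub>m g) \<otimes>\<^sub>m ident C Y)"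
    unfolding dual_tensor ident_ob_tensor[OF gY] tensor_middle[OF g] ..
  have 3: "ev C (Z \<otimes>\<^sub>o Y) = ev C Y \<cdot> (ident C ?Y \<otimes>\<^sub>m (ev C Z \<otimes>\<^sub>m ident C Y))" for Z
    unfolding ev_tensor tensor_middle[OF ev_in_hom] ..
  have "ev C (A \<otimes>\<^sub>o Y) \<cdot> ((ident C ?Y \<otimes>\<^sub>m ?g) \<otimes>\<^sub>m ident C (A \<otimes>\<^sub>o Y)) =
     ev C Y \<cdot> (ident C ?Y \<otimes>\<^sub>m ((ev C A \<cdot> (?g \<otimes>\<^sub>m ident C A)) \<otimes>\<^sub>m ident C Y))"
    unfolding 1 3 comp_tensor_ident[OF gA ev_in_hom] ident_tensor_comp[OF gAY eY]
    by (rule comp_assoc[OF YgAY YeY ev_in_hom, symmetric])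
  also have "\<dots> = ev C (B \<otimes>\<^sub>o Y) \<cdot> (ident C (dual C (B \<otimes>\<^sub>o Y)) \<otimes>\<^sub>m (g \<otimes>\<^sub>m ident C Y))"
    unfolding ev_dual_mor[OF g] 2 3 comp_tensor_ident[OF Bg ev_in_hom] ident_tensor_comp[OF BgY eY]
    by (rule comp_assoc[OF YBgY YeY ev_in_hom])
  finally show "ev C (A \<otimes>\<^sub>o Y) \<cdot> ((ident C ?Y \<otimes>\<^sub>m ?g) \<otimes>\<^sub>m ident C (A \<otimes>\<^sub>o Y)) =
    ev C (B \<otimes>\<^sub>o Y) \<cdot> (ident C (dual C (B \<otimes>\<^sub>o Y)) \<otimes>\<^sub>m (g \<otimes>\<^sub>m ident C Y))" .
qed

lemma dual_mor_ident_tensor: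
  assumes g: "g \<in> hom C A B"
  shows "dual_mor C (X \<otimes>\<^sub>o A) (X \<otimes>\<^sub>o B) (ident C X \<otimes>\<^sub>m g) = dual_mor C A B g \<otimes>\<^sub>m ident C (dual C X)"
proof (rule dual_mor_unique)
  let ?A = "dual C A" and ?B = "dual C B" and ?X = "dual C X" and ?g = "dual_mor C A B g"
  note d = dual_mor_in_hom[OF g]
  show "ident C X \<otimes>\<^sub>m g \<in> hom C (X \<otimes>\<^sub>o A) (X \<otimes>\<^sub>o B)"
    by (insert assms, (assumption | rule typing duality_typed | simp only: ob_simps)+)
  show "?g \<otimes>\<^sub>m ident C ?X \<in> hom C (dual C (X \<otimes>\<^sub>o B)) (dual C (X \<otimes>\<^sub>o A))"
    unfolding dual_tensor by (insert assms, (assumption | rule typing duality_typed hom_typed[OF d] | simp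
      only: ob_simps)+)
  have eA: "ev C X \<otimes>\<^sub>m ident C A \<in> hom C (?X \<otimes>\<^sub>o X \<otimes>\<^sub>o A) A"
    by (insert assms, (assumption | rule typing duality_typed | simp only: ob_simps)+)
  have eB: "ev C X \<otimes>\<^sub>m ident C B \<in> hom C (?X \<otimes>\<^sub>o X \<otimes>\<^sub>o B) B"
    by (insert assms, (assumption | rule typing duality_typed | simp only: ob_simps)+)
  have AeA: "ident C ?A \<otimes>\<^sub>m (ev C X \<otimes>\<^sub>m ident C A) \<in> hom C (?A \<otimes>\<^sub>o ?X \<otimes>\<^sub>o X \<otimes>\<^sub>o A) (?A \<otimes>\<^sub>o A)"
    by (insert assms, (assumption | rule typing duality_typed | simp only: ob_simps)+)
  have BeB: "ident C ?B \<otimes>\<^sub>m (ev C X \<otimes>\<^sub>m ident C B) \<in> hom C (?B \<otimes>\<^sub>o ?X \<otimes>\<^sub>o X \<otimes>\<^sub>o B) (?B \<otimes>\<^sub>o B)"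
    by (insert assms, (assumption | rule typing duality_typed | simp only: ob_simps)+)
  have BeA: "ident C ?B \<otimes>\<^sub>m (ev C X \<otimes>\<^sub>m ident C A) \<in> hom C (?B \<otimes>\<^sub>o ?X \<otimes>\<^sub>o X \<otimes>\<^sub>o A) (?B \<otimes>\<^sub>o A)"
    by (insert assms, (assumption | rule typing duality_typed | simp only: ob_simps)+)
  have gA: "?g \<otimes>\<^sub>m ident C A \<in> hom C (?B \<otimes>\<^sub>o A) (?A \<otimes>\<^sub>o A)"
    by (insert assms, (assumption | rule typing duality_typed hom_typed[OF d] | simp only: ob_simps)+)
  have gXXA: "?g \<otimes>\<^sub>m ident C (?X \<otimes>\<^sub>o X \<otimes>\<^sub>o A) \<in> hom C (?B \<otimes>\<^sub>o ?X \<otimes>\<^sub>o X \<otimes>\<^sub>o A) (?A \<otimes>\<^sub>o ?X \<otimes>\<^sub>o X \<otimes>\<^sub>o A)"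
    by (insert assms, (assumption | rule typing duality_typed hom_typed[OF d] | simp only: ob_simps)+)
  have Bg: "ident C ?B \<otimes>\<^sub>m g \<in> hom C (?B \<otimes>\<^sub>o A) (?B \<otimes>\<^sub>o B)"
    by (insert assms, (assumption | rule typing duality_typed | simp only: ob_simps)+)
  have XXg: "ident C (?X \<otimes>\<^sub>o X) \<otimes>\<^sub>m g \<in> hom C (?X \<otimes>\<^sub>o X \<otimes>\<^sub>o A) (?X \<otimes>\<^sub>o X \<otimes>\<^sub>o B)"
    by (insert assms, (assumption | rule typing duality_typed | simp only: ob_simps)+)
  have BXXg: "ident C ?B \<otimes>\<^sub>m (ident C (?X \<otimes>\<^sub>o X) \<otimes>\<^sub>m g) \<in> hom C (?B \<otimes>\<^sub>o ?X \<otimes>\<^sub>o X \<otimes>\<^sub>o A) (?B \<otimes>\<^sub>o ?X \<otimes>\<^sub>o X \<otimes>\<^sub>o B)"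
    by (insert assms, (assumption | rule typing duality_typed | simp only: ob_simps)+)
  have Xg: "ident C X \<otimes>\<^sub>m g \<in> hom C (X \<otimes>\<^sub>o A) (X \<otimes>\<^sub>o B)"
    by (insert assms, (assumption | rule typing duality_typed | simp only: ob_simps)+)
  have 1: "(?g \<otimes>\<^sub>m ident C ?X) \<otimes>\<^sub>m ident C (X \<otimes>\<^sub>o A) = ?g \<otimes>\<^sub>m ident C (?X \<otimes>\<^sub>o X \<otimes>\<^sub>o A)"
    unfolding tensor_assoc[OF d ident_in_hom ident_in_hom] tensor_ident tensor_ob_assoc ..
  have 2: "ident C (dual C (X \<otimes>\<^sub>o B)) \<otimes>\<^sub>m (ident C X \<otimes>\<^sub>m g) = ident C ?B \<otimes>\<^sub>m (ident C (?X \<otimes>\<^sub>o X) \<otimes>\<^sub>m g)"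
    unfolding dual_tensor ident_ob_tensor[OF Xg] ident_ob_tensor[OF g] ..
  have 3: "ev C (X \<otimes>\<^sub>o Z) = ev C Z \<cdot> (ident C (dual C Z) \<otimes>\<^sub>m (ev C X \<otimes>\<^sub>m ident C Z))" for Z
    unfolding ev_tensor tensor_middle[OF ev_in_hom] ..
  have s1: "(ident C ?A \<otimes>\<^sub>m (ev C X \<otimes>\<^sub>m ident C A)) \<cdot> (?g \<otimes>\<^sub>m ident C (?X \<otimes>\<^sub>o X \<otimes>\<^sub>o A)) =
      (?g \<otimes>\<^sub>m ident C A) \<cdot> (ident C ?B \<otimes>\<^sub>m (ev C X \<otimes>\<^sub>m ident C A))"
    by (rule tensor_slide[OF d eA, symmetric])
  have s2: "(ev C X \<otimes>\<^sub>m ident C B) \<cdot> (ident C (?X \<otimes>\<^sub>o X) \<otimes>\<^sub>m g) = g \<cdot> (ev C X \<otimes>\<^sub>m ident C A)"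
    unfolding tensor_slide[OF ev_in_hom g] tensor_unit_left[OF g] ..
  have "ev C (X \<otimes>\<^sub>o A) \<cdot> ((?g \<otimes>\<^sub>m ident C ?X) \<otimes>\<^sub>m ident C (X \<otimes>\<^sub>o A)) =
     ev C A \<cdot> ((?g \<otimes>\<^sub>m ident C A) \<cdot> (ident C ?B \<otimes>\<^sub>m (ev C X \<otimes>\<^sub>m ident C A)))"
    unfolding 1 3 s1[symmetric] by (rule comp_assoc[OF gXXA AeA ev_in_hom, symmetric])
  also have "\<dots> = (ev C B \<cdot> (ident C ?B \<otimes>\<^sub>m g)) \<cdot> (ident C ?B \<otimes>\<^sub>m (ev C X \<otimes>\<^sub>m ident C A))"
    unfolding ev_dual_mor[OF g, symmetric] by (rule comp_assoc[OF BeA gA ev_in_hom])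
  also have "\<dots> = ev C B \<cdot> ((ident C ?B \<otimes>\<^sub>m g) \<cdot> (ident C ?B \<otimes>\<^sub>m (ev C X \<otimes>\<^sub>m ident C A)))"
    by (rule comp_assoc[OF BeA Bg ev_in_hom, symmetric])
  also have "\<dots> = ev C B \<cdot> ((ident C ?B \<otimes>\<^sub>m (ev C X \<otimes>\<^sub>m ident C B)) \<cdot> (ident C ?B \<otimes>\<^sub>m (ident C (?X \<otimes>\<^sub>o X) \<otimes>\<^sub>m g)))"
    unfolding ident_tensor_comp[OF eA g, symmetric] ident_tensor_comp[OF XXg eB, symmetric] s2 ..
  also have "\<dots> = ev C (X \<otimes>\<^sub>o B) \<cdot> (ident C (dual C (X \<otimes>\<^sub>o B)) \<otimes>\<^sub>m (ident C X \<otimes>\<^sub>m g))"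
    unfolding 2 3 by (rule comp_assoc[OF BXXg BeB ev_in_hom])
  finally show "ev C (X \<otimes>\<^sub>o A) \<cdot> ((?g \<otimes>\<^sub>m ident C ?X) \<otimes>\<^sub>m ident C (X \<otimes>\<^sub>o A)) =
    ev C (X \<otimes>\<^sub>o B) \<cdot> (ident C (dual C (X \<otimes>\<^sub>o B)) \<otimes>\<^sub>m (ident C X \<otimes>\<^sub>m g))" .
qed

text \<open>Naturality of the pivotal structure enters here: the rule for the left coevaluation is
  applied to the dual morphism, whose dual is \<open>f\<close> again. So left and right duality have
  the same dual morphisms.\<close>

lemma coev_flip_dual_mor:
  assumes f: "f \<in> hom C X Y"
  shows "(ident C (dual C X) \<otimes>\<^sub>m f) \<cdot> coev C (dual C X) = (dual_mor C X Y f \<otimes>\<^sub>m ident C Y) \<cdot> coev C (dual C Y)"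
  using coev_dual_mor[OF dual_mor_in_hom[OF f]] by (simp add: dual_mor_dual_mor[OF f] dual_dual)

lemma ev_flip_dual_mor:
  assumes f: "f \<in> hom C X Y"
  shows "ev C (dual C X) \<cdot> (ident C X \<otimes>\<^sub>m dual_mor C X Y f) = ev C (dual C Y) \<cdot> (f \<otimes>\<^sub>m ident C (dual C Y))"
  using ev_dual_mor[OF dual_mor_in_hom[OF f]] by (simp add: dual_mor_dual_mor[OF f] dual_dual)

text \<open>Moves \<open>f\<close> around the right coevaluation; this is the half of the cyclicity
  of traces that involves the dual object.\<close>

lemma curry_left_dual_mor:
  assumes m: "m \<in> hom C (Y \<otimes>\<^sub>o A) T" and f: "f \<in> hom C X Y"
  shows "curry_left X A (m \<cdot> (f \<otimes>\<^sub>m ident C A)) = (dual_mor C X Y f \<otimes>\<^sub>m ident C T) \<cdot> curry_left Y A m"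
proof -
  let ?X = "dual C X" and ?Y = "dual C Y" and ?f = "dual_mor C X Y f"
  note d = dual_mor_in_hom[OF f]
  have fA: "f \<otimes>\<^sub>m ident C A \<in> hom C (X \<otimes>\<^sub>o A) (Y \<otimes>\<^sub>o A)"
    by (insert assms, (assumption | rule typing duality_typed | simp only: ob_simps)+)
  have XfA: "ident C ?X \<otimes>\<^sub>m (f \<otimes>\<^sub>m ident C A) \<in> hom C (?X \<otimes>\<^sub>o X \<otimes>\<^sub>o A) (?X \<otimes>\<^sub>o Y \<otimes>\<^sub>o A)"
    by (insert assms, (assumption | rule typing duality_typed | simp only: ob_simps)+)
  have Xf: "ident C ?X \<otimes>\<^sub>m f \<in> hom C (?X \<otimes>\<^sub>o X) (?X \<otimes>\<^sub>o Y)"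
    by (insert assms, (assumption | rule typing duality_typed | simp only: ob_simps)+)
  have Xm: "ident C ?X \<otimes>\<^sub>m m \<in> hom C (?X \<otimes>\<^sub>o Y \<otimes>\<^sub>o A) (?X \<otimes>\<^sub>o T)"
    by (insert assms, (assumption | rule typing duality_typed | simp only: ob_simps)+)
  have Ym: "ident C ?Y \<otimes>\<^sub>m m \<in> hom C (?Y \<otimes>\<^sub>o Y \<otimes>\<^sub>o A) (?Y \<otimes>\<^sub>o T)"
    by (insert assms, (assumption | rule typing duality_typed | simp only: ob_simps)+)
  have KX: "coev C ?X \<otimes>\<^sub>m ident C A \<in> hom C A (?X \<otimes>\<^sub>o X \<otimes>\<^sub>o A)"
    by (insert assms, (assumption | rule typing duality_typed | simp only: ob_simps)+)
  have KY: "coev C ?Y \<otimes>\<^sub>m ident C A \<in> hom C A (?Y \<otimes>\<^sub>o Y \<otimes>\<^sub>o A)"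
    by (insert assms, (assumption | rule typing duality_typed | simp only: ob_simps)+)
  have fY: "?f \<otimes>\<^sub>m ident C Y \<in> hom C (?Y \<otimes>\<^sub>o Y) (?X \<otimes>\<^sub>o Y)"
    by (insert assms, (assumption | rule typing duality_typed hom_typed[OF d] | simp only: ob_simps)+)
  have fYA: "?f \<otimes>\<^sub>m ident C (Y \<otimes>\<^sub>o A) \<in> hom C (?Y \<otimes>\<^sub>o Y \<otimes>\<^sub>o A) (?X \<otimes>\<^sub>o Y \<otimes>\<^sub>o A)"
    by (insert assms, (assumption | rule typing duality_typed hom_typed[OF d] | simp only: ob_simps)+)
  have fT: "?f \<otimes>\<^sub>m ident C T \<in> hom C (?Y \<otimes>\<^sub>o T) (?X \<otimes>\<^sub>o T)"
    by (insert assms, (assumption | rule typing duality_typed hom_typed[OF d] | simp only: ob_simps)+)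
  have "curry_left X A (m \<cdot> (f \<otimes>\<^sub>m ident C A)) =
      (ident C ?X \<otimes>\<^sub>m m) \<cdot> ((ident C ?X \<otimes>\<^sub>m (f \<otimes>\<^sub>m ident C A)) \<cdot> (coev C ?X \<otimes>\<^sub>m ident C A))"
    unfolding curry_left_def ident_tensor_comp[OF fA m] by (rule comp_assoc[OF KX XfA Xm, symmetric])
  also have "(ident C ?X \<otimes>\<^sub>m (f \<otimes>\<^sub>m ident C A)) \<cdot> (coev C ?X \<otimes>\<^sub>m ident C A) =
      (?f \<otimes>\<^sub>m ident C (Y \<otimes>\<^sub>o A)) \<cdot> (coev C ?Y \<otimes>\<^sub>m ident C A)"
    unfolding tensor_middle[OF f, symmetric] comp_tensor_ident[OF coev_dual_in_hom Xf, symmetric]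
      coev_flip_dual_mor[OF f] comp_tensor_ident[OF coev_dual_in_hom fY] tensor_ident_ob[OF d] ..
  also have "(ident C ?X \<otimes>\<^sub>m m) \<cdot> ((?f \<otimes>\<^sub>m ident C (Y \<otimes>\<^sub>o A)) \<cdot> (coev C ?Y \<otimes>\<^sub>m ident C A)) =
      ((ident C ?X \<otimes>\<^sub>m m) \<cdot> (?f \<otimes>\<^sub>m ident C (Y \<otimes>\<^sub>o A))) \<cdot> (coev C ?Y \<otimes>\<^sub>m ident C A)"
    by (rule comp_assoc[OF KY fYA Xm])
  also have "\<dots> = ((?f \<otimes>\<^sub>m ident C T) \<cdot> (ident C ?Y \<otimes>\<^sub>m m)) \<cdot> (coev C ?Y \<otimes>\<^sub>m ident C A)"
    unfolding tensor_slide[OF d m] ..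
  also have "\<dots> = (?f \<otimes>\<^sub>m ident C T) \<cdot> curry_left Y A m"
    unfolding curry_left_def by (rule comp_assoc[OF KY Ym fT, symmetric])
  finally show ?thesis .
qed

lemma uncurry_left_dual_mor:
  assumes n: "n \<in> hom C A (dual C Y \<otimes>\<^sub>o T)" and f: "f \<in> hom C X Y"
  shows "uncurry_left X T ((dual_mor C X Y f \<otimes>\<^sub>m ident C T) \<cdot> n) = uncurry_left Y T n \<cdot> (f \<otimes>\<^sub>m ident C A)"
proof -
  let ?X = "dual C X" and ?Y = "dual C Y" and ?f = "dual_mor C X Y f"
  note d = dual_mor_in_hom[OF f]
  have fT: "?f \<otimes>\<^sub>m ident C T \<in> hom C (?Y \<otimes>\<^sub>o T) (?X \<otimes>\<^sub>o T)"
    by (insert assms, (assumption | rule typing duality_typed hom_typed[OF d] | simp only: ob_simps)+)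
  have Xf: "ident C X \<otimes>\<^sub>m ?f \<in> hom C (X \<otimes>\<^sub>o ?Y) (X \<otimes>\<^sub>o ?X)"
    by (insert assms, (assumption | rule typing duality_typed hom_typed[OF d] | simp only: ob_simps)+)
  have XfT: "(ident C X \<otimes>\<^sub>m ?f) \<otimes>\<^sub>m ident C T \<in> hom C (X \<otimes>\<^sub>o ?Y \<otimes>\<^sub>o T) (X \<otimes>\<^sub>o ?X \<otimes>\<^sub>o T)"
    by (insert assms, (assumption | rule typing duality_typed hom_typed[OF d] | simp only: ob_simps)+)
  have Xn: "ident C X \<otimes>\<^sub>m n \<in> hom C (X \<otimes>\<^sub>o A) (X \<otimes>\<^sub>o ?Y \<otimes>\<^sub>o T)"
    by (insert assms, (assumption | rule typing duality_typed | simp only: ob_simps)+)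
  have Yn: "ident C Y \<otimes>\<^sub>m n \<in> hom C (Y \<otimes>\<^sub>o A) (Y \<otimes>\<^sub>o ?Y \<otimes>\<^sub>o T)"
    by (insert assms, (assumption | rule typing duality_typed | simp only: ob_simps)+)
  have eX: "ev C ?X \<otimes>\<^sub>m ident C T \<in> hom C (X \<otimes>\<^sub>o ?X \<otimes>\<^sub>o T) T"
    by (insert assms, (assumption | rule typing duality_typed | simp only: ob_simps)+)
  have eY: "ev C ?Y \<otimes>\<^sub>m ident C T \<in> hom C (Y \<otimes>\<^sub>o ?Y \<otimes>\<^sub>o T) T"
    by (insert assms, (assumption | rule typing duality_typed | simp only: ob_simps)+)
  have fYT: "f \<otimes>\<^sub>m ident C (?Y \<otimes>\<^sub>o T) \<in> hom C (X \<otimes>\<^sub>o ?Y \<otimes>\<^sub>o T) (Y \<otimes>\<^sub>o ?Y \<otimes>\<^sub>o T)"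
    by (insert assms, (assumption | rule typing duality_typed | simp only: ob_simps)+)
  have fY: "f \<otimes>\<^sub>m ident C ?Y \<in> hom C (X \<otimes>\<^sub>o ?Y) (Y \<otimes>\<^sub>o ?Y)"
    by (insert assms, (assumption | rule typing duality_typed | simp only: ob_simps)+)
  have fA: "f \<otimes>\<^sub>m ident C A \<in> hom C (X \<otimes>\<^sub>o A) (Y \<otimes>\<^sub>o A)"
    by (insert assms, (assumption | rule typing duality_typed | simp only: ob_simps)+)
  have "uncurry_left X T ((?f \<otimes>\<^sub>m ident C T) \<cdot> n) =
      ((ev C ?X \<otimes>\<^sub>m ident C T) \<cdot> ((ident C X \<otimes>\<^sub>m ?f) \<otimes>\<^sub>m ident C T)) \<cdot> (ident C X \<otimes>\<^sub>m n)"
    unfolding uncurry_left_def ident_tensor_comp[OF n fT] tensor_middle[OF d, symmetric]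
    by (rule comp_assoc[OF Xn XfT eX])
  also have "(ev C ?X \<otimes>\<^sub>m ident C T) \<cdot> ((ident C X \<otimes>\<^sub>m ?f) \<otimes>\<^sub>m ident C T) =
      (ev C ?Y \<otimes>\<^sub>m ident C T) \<cdot> (f \<otimes>\<^sub>m ident C (?Y \<otimes>\<^sub>o T))"
    unfolding comp_tensor_ident[OF Xf ev_dual_in_hom, symmetric] ev_flip_dual_mor[OF f]
      comp_tensor_ident[OF fY ev_dual_in_hom] tensor_ident_ob[OF f] ..
  also have "((ev C ?Y \<otimes>\<^sub>m ident C T) \<cdot> (f \<otimes>\<^sub>m ident C (?Y \<otimes>\<^sub>o T))) \<cdot> (ident C X \<otimes>\<^sub>m n) =
      (ev C ?Y \<otimes>\<^sub>m ident C T) \<cdot> ((f \<otimes>\<^sub>m ident C (?Y \<otimes>\<^sub>o T)) \<cdot> (ident C X \<otimes>\<^sub>m n))"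
    by (rule comp_assoc[OF Xn fYT eY, symmetric])
  also have "(f \<otimes>\<^sub>m ident C (?Y \<otimes>\<^sub>o T)) \<cdot> (ident C X \<otimes>\<^sub>m n) = (ident C Y \<otimes>\<^sub>m n) \<cdot> (f \<otimes>\<^sub>m ident C A)"
    by (rule tensor_slide[OF f n])
  also have "(ev C ?Y \<otimes>\<^sub>m ident C T) \<cdot> ((ident C Y \<otimes>\<^sub>m n) \<cdot> (f \<otimes>\<^sub>m ident C A)) = uncurry_left Y T n \<cdot> (f \<otimes>\<^sub>m
    ident C A)"
    unfolding uncurry_left_def by (rule comp_assoc[OF fA Yn eY])
  finally show ?thesis .
qed

end

section \<open>The coend and its product\<close>

context strict_monoidal_category
begin

lemma tensor_zero_right: "f \<in> hom C X Y \<Longrightarrow> f \<otimes>\<^sub>m 0 = 0"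
  using tensor_scale_right[OF _ hom_zero, of f X Y 0] by simp

end

locale coend_category = ribbon_category C
  for C :: "('k::field, 'o, 'm::ab_group_add) ribbon_data" (structure) +
  fixes L :: 'o and \<iota> :: "'o \<Rightarrow> 'm"
  assumes coend: "is_coend C L \<iota>"
begin

lemma \<iota>_in_hom: "\<iota> X \<in> hom C (dual C X \<otimes>\<^sub>o X) L"
  using coend by (simp add: is_coend_def dinatural_def)

lemma \<iota>_dinatural:
  "f \<in> hom C X Y \<Longrightarrow> \<iota> Y \<cdot> (ident C (dual C Y) \<otimes>\<^sub>m f) = \<iota> X \<cdot> (dual_mor C X Y f \<otimes>\<^sub>m ident C X)"
  using coend by (simp add: is_coend_def dinatural_def)

lemma coend_exists: "dinatural C T j \<Longrightarrow> \<exists>h\<in>hom C L T. \<forall>X. h \<cdot> \<iota> X = j X"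
  using coend unfolding is_coend_def by blast

text \<open>The family \<open>h \<cdot> \<iota> X\<close> is itself dinatural, so the uniqueness
  clause of the coend applies to it: the morphisms \<open>\<iota> X\<close> are jointly epi.\<close>

lemma coend_ext:
  assumes h: "h \<in> hom C L T" "h' \<in> hom C L T" and eq: "\<And>X. h \<cdot> \<iota> X = h' \<cdot> \<iota> X"
  shows "h = h'"
proof -
  have "dinatural C T (\<lambda>X. h \<cdot> \<iota> X)"
    unfolding dinatural_def
  proof (intro conjI allI ballI)
    show "h \<cdot> \<iota> X \<in> hom C (dual C X \<otimes>\<^sub>o X) T" for X by (rule comp_in_hom[OF \<iota>_in_hom h(1)])
    fix X Y f assume f: "f \<in> hom C X Y"
    note d = dual_mor_in_hom[OF f]
    note typed = hom_typed[OF d] hom_typed[OF f]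
    have 1: "ident C (dual C Y) \<otimes>\<^sub>m f \<in> hom C (dual C Y \<otimes>\<^sub>o X) (dual C Y \<otimes>\<^sub>o Y)"
      by ((assumption | rule typing duality_typed typed | simp only: ob_simps)+)
    have 2: "dual_mor C X Y f \<otimes>\<^sub>m ident C X \<in> hom C (dual C Y \<otimes>\<^sub>o X) (dual C X \<otimes>\<^sub>o X)"
      by ((assumption | rule typing duality_typed typed | simp only: ob_simps)+)
    show "h \<cdot> \<iota> Y \<cdot> (ident C (dual C Y) \<otimes>\<^sub>m f) = h \<cdot> \<iota> X \<cdot> (dual_mor C X Y f \<otimes>\<^sub>m ident C X)"
      unfolding comp_assoc[OF 1 \<iota>_in_hom h(1), symmetric] comp_assoc[OF 2 \<iota>_in_hom h(1), symmetric]
        \<iota>_dinatural[OF f] ..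
  qed
  then have "\<exists>!k. k \<in> hom C L T \<and> (\<forall>X. k \<cdot> \<iota> X = h \<cdot> \<iota> X)"
    using coend by (simp add: is_coend_def)
  then show ?thesis using h eq by metis
qed

text \<open>Tensoring with \<open>Z\<close> has a right adjoint and so preserves the coend; currying
  reduces the claim to \<open>L\<close> itself.\<close>

lemma coend_right_ext:
  assumes h: "h \<in> hom C (L \<otimes>\<^sub>o Z) T" "h' \<in> hom C (L \<otimes>\<^sub>o Z) T"
    and eq: "\<And>X. h \<cdot> (\<iota> X \<otimes>\<^sub>m ident C Z) = h' \<cdot> (\<iota> X \<otimes>\<^sub>m ident C Z)"
  shows "h = h'"
proof -
  have "curry_right L Z h = curry_right L Z h'"
  proof (rule coend_ext[OF curry_right_in_hom[OF h(1)] curry_right_in_hom[OF h(2)]])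
    fix X
    show "curry_right L Z h \<cdot> \<iota> X = curry_right L Z h' \<cdot> \<iota> X"
      using curry_right_comp[OF h(1) \<iota>_in_hom, of X] curry_right_comp[OF h(2) \<iota>_in_hom, of X] eq[of X] by simp
  qed
  from arg_cong[OF this, of "uncurry_right T Z"] show ?thesis
    unfolding uncurry_curry_right[OF h(1)] uncurry_curry_right[OF h(2)] .
qed

lemma coend_left_ext:
  assumes h: "h \<in> hom C (Z \<otimes>\<^sub>o L) T" "h' \<in> hom C (Z \<otimes>\<^sub>o L) T"
    and eq: "\<And>X. h \<cdot> (ident C Z \<otimes>\<^sub>m \<iota> X) = h' \<cdot> (ident C Z \<otimes>\<^sub>m \<iota> X)"
  shows "h = h'"
proof -
  have "curry_left Z L h = curry_left Z L h'"
  proof (rule coend_ext[OF curry_left_in_hom[OF h(1)] curry_left_in_hom[OF h(2)]])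
    fix X
    show "curry_left Z L h \<cdot> \<iota> X = curry_left Z L h' \<cdot> \<iota> X"
      using curry_left_comp[OF h(1) \<iota>_in_hom, of X] curry_left_comp[OF h(2) \<iota>_in_hom, of X] eq[of X] by simp
  qed
  from arg_cong[OF this, of "uncurry_left Z T"] show ?thesis
    unfolding uncurry_curry_left[OF h(1)] uncurry_curry_left[OF h(2)] .
qed

text \<open>The existence half of the universal property of \<open>L \<otimes> Z\<close>: the family
  is curried, factored through \<open>L\<close> and uncurried.\<close>

lemma coend_right_exists:
  assumes \<phi>: "\<And>X. \<phi> X \<in> hom C ((dual C X \<otimes>\<^sub>o X) \<otimes>\<^sub>o Z) T"
    and dinat: "\<And>X Y f. f \<in> hom C X Y \<Longrightarrow>
      \<phi> Y \<cdot> ((ident C (dual C Y) \<otimes>\<^sub>m f) \<otimes>\<^sub>m ident C Z) = \<phi> X \<cdot> ((dual_mor C X Y f \<otimes>\<^sub>m ident C X) \<otimes>\<^sub>m ident C Z)"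
  shows "\<exists>h\<in>hom C (L \<otimes>\<^sub>o Z) T. \<forall>X. h \<cdot> (\<iota> X \<otimes>\<^sub>m ident C Z) = \<phi> X"
proof -
  let ?j = "\<lambda>X. curry_right (dual C X \<otimes>\<^sub>o X) Z (\<phi> X)"
  have "dinatural C (T \<otimes>\<^sub>o dual C Z) ?j"
    unfolding dinatural_def
  proof (intro conjI allI ballI)
    show "?j X \<in> hom C (dual C X \<otimes>\<^sub>o X) (T \<otimes>\<^sub>o dual C Z)" for X by (rule curry_right_in_hom[OF \<phi>])
    fix X Y f assume f: "f \<in> hom C X Y"
    note d = dual_mor_in_hom[OF f]
    note typed = hom_typed[OF d] hom_typed[OF f]
    have 1: "ident C (dual C Y) \<otimes>\<^sub>m f \<in> hom C (dual C Y \<otimes>\<^sub>o X) (dual C Y \<otimes>\<^sub>o Y)"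
      by ((assumption | rule typing duality_typed typed | simp only: ob_simps)+)
    have 2: "dual_mor C X Y f \<otimes>\<^sub>m ident C X \<in> hom C (dual C Y \<otimes>\<^sub>o X) (dual C X \<otimes>\<^sub>o X)"
      by ((assumption | rule typing duality_typed typed | simp only: ob_simps)+)
    show "?j Y \<cdot> (ident C (dual C Y) \<otimes>\<^sub>m f) = ?j X \<cdot> (dual_mor C X Y f \<otimes>\<^sub>m ident C X)"
      unfolding curry_right_comp[OF \<phi> 1, symmetric] curry_right_comp[OF \<phi> 2, symmetric] dinat[OF f] ..
  qed
  from coend_exists[OF this] obtain k where k: "k \<in> hom C L (T \<otimes>\<^sub>o dual C Z)" "\<And>X. k \<cdot> \<iota> X = ?j X" by blast
  have "uncurry_right T Z k \<cdot> (\<iota> X \<otimes>\<^sub>m ident C Z) = \<phi> X" for X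
    unfolding uncurry_right_comp[OF k(1) \<iota>_in_hom, symmetric] k(2) by (rule uncurry_curry_right[OF \<phi>])
  then show ?thesis using uncurry_right_in_hom[OF k(1)] by blast
qed

lemma coend_left_exists:
  assumes \<phi>: "\<And>X. \<phi> X \<in> hom C (Z \<otimes>\<^sub>o (dual C X \<otimes>\<^sub>o X)) T"
    and dinat: "\<And>X Y f. f \<in> hom C X Y \<Longrightarrow>
      \<phi> Y \<cdot> (ident C Z \<otimes>\<^sub>m (ident C (dual C Y) \<otimes>\<^sub>m f)) = \<phi> X \<cdot> (ident C Z \<otimes>\<^sub>m (dual_mor C X Y f \<otimes>\<^sub>m ident C X))"
  shows "\<exists>h\<in>hom C (Z \<otimes>\<^sub>o L) T. \<forall>X. h \<cdot> (ident C Z \<otimes>\<^sub>m \<iota> X) = \<phi> X"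
proof -
  let ?j = "\<lambda>X. curry_left Z (dual C X \<otimes>\<^sub>o X) (\<phi> X)"
  have "dinatural C (dual C Z \<otimes>\<^sub>o T) ?j"
    unfolding dinatural_def
  proof (intro conjI allI ballI)
    show "?j X \<in> hom C (dual C X \<otimes>\<^sub>o X) (dual C Z \<otimes>\<^sub>o T)" for X by (rule curry_left_in_hom[OF \<phi>])
    fix X Y f assume f: "f \<in> hom C X Y"
    note d = dual_mor_in_hom[OF f]
    note typed = hom_typed[OF d] hom_typed[OF f]
    have 1: "ident C (dual C Y) \<otimes>\<^sub>m f \<in> hom C (dual C Y \<otimes>\<^sub>o X) (dual C Y \<otimes>\<^sub>o Y)"
      by ((assumption | rule typing duality_typed typed | simp only: ob_simps)+)
    have 2: "dual_mor C X Y f \<otimes>\<^sub>m ident C X \<in> hom C (dual C Y \<otimes>\<^sub>o X) (dual C X \<otimes>\<^sub>o X)"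
      by ((assumption | rule typing duality_typed typed | simp only: ob_simps)+)
    show "?j Y \<cdot> (ident C (dual C Y) \<otimes>\<^sub>m f) = ?j X \<cdot> (dual_mor C X Y f \<otimes>\<^sub>m ident C X)"
      unfolding curry_left_comp[OF \<phi> 1, symmetric] curry_left_comp[OF \<phi> 2, symmetric] dinat[OF f] ..
  qed
  from coend_exists[OF this] obtain k where k: "k \<in> hom C L (dual C Z \<otimes>\<^sub>o T)" "\<And>X. k \<cdot> \<iota> X = ?j X" by blast
  have Z\<iota>: "ident C Z \<otimes>\<^sub>m \<iota> X \<in> hom C (Z \<otimes>\<^sub>o (dual C X \<otimes>\<^sub>o X)) (Z \<otimes>\<^sub>o L)" for X
    by (rule tensor_in_hom[OF ident_in_hom \<iota>_in_hom])
  have "uncurry_left Z T k \<cdot> (ident C Z \<otimes>\<^sub>m \<iota> X) = \<phi> X" for X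
  proof -
    let ?e = "ev C (dual C Z) \<otimes>\<^sub>m ident C T"
    have e: "?e \<in> hom C (Z \<otimes>\<^sub>o (dual C Z \<otimes>\<^sub>o T)) T"
      by ((assumption | rule typing duality_typed | simp only: ob_simps)+)
    have Zk: "ident C Z \<otimes>\<^sub>m k \<in> hom C (Z \<otimes>\<^sub>o L) (Z \<otimes>\<^sub>o (dual C Z \<otimes>\<^sub>o T))"
      by (rule tensor_in_hom[OF ident_in_hom k(1)])
    have "uncurry_left Z T k \<cdot> (ident C Z \<otimes>\<^sub>m \<iota> X) = ?e \<cdot> ((ident C Z \<otimes>\<^sub>m k) \<cdot> (ident C Z \<otimes>\<^sub>m \<iota> X))"
      unfolding uncurry_left_def by (rule comp_assoc[OF Z\<iota> Zk e, symmetric])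
    also have "\<dots> = uncurry_left Z T (curry_left Z (dual C X \<otimes>\<^sub>o X) (\<phi> X))"
      unfolding ident_tensor_comp[OF \<iota>_in_hom k(1), symmetric] k(2) uncurry_left_def ..
    finally show ?thesis unfolding uncurry_curry_left[OF \<phi>] .
  qed
  then show ?thesis using uncurry_left_in_hom[OF k(1)] by blast
qed

lemma braid_in_hom: "braid C X Y \<in> hom C (X \<otimes>\<^sub>o Y) (Y \<otimes>\<^sub>o X)"
  using braid_iso by (simp add: is_iso_def)

lemmas coend_typed = hom_typed[OF braid_in_hom] hom_typed[OF \<iota>_in_hom]

lemma braid_slide_left:
  assumes a: "a \<in> hom C A A'"
  shows "(braid C A' W \<otimes>\<^sub>m ident C Y) \<cdot> (a \<otimes>\<^sub>m ident C (W \<otimes>\<^sub>o Y)) =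
    ((ident C W \<otimes>\<^sub>m a) \<otimes>\<^sub>m ident C Y) \<cdot> (braid C A W \<otimes>\<^sub>m ident C Y)"
proof -
  have 1: "a \<otimes>\<^sub>m ident C W \<in> hom C (A \<otimes>\<^sub>o W) (A' \<otimes>\<^sub>o W)" by (rule tensor_in_hom[OF a ident_in_hom])
  have 2: "ident C W \<otimes>\<^sub>m a \<in> hom C (W \<otimes>\<^sub>o A) (W \<otimes>\<^sub>o A')" by (rule tensor_in_hom[OF ident_in_hom a])
  show ?thesis
    unfolding tensor_ident_ob[OF a] comp_tensor_ident[OF 1 braid_in_hom, symmetric]
      comp_tensor_ident[OF braid_in_hom 2, symmetric] braid_natural[OF a ident_in_hom] ..
qed

lemma braid_slide_right:
  assumes w: "w \<in> hom C W W'"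
  shows "(braid C A W' \<otimes>\<^sub>m ident C Y) \<cdot> ((ident C A \<otimes>\<^sub>m w) \<otimes>\<^sub>m ident C Y) =
    ((w \<otimes>\<^sub>m ident C A) \<otimes>\<^sub>m ident C Y) \<cdot> (braid C A W \<otimes>\<^sub>m ident C Y)"
proof -
  have 1: "w \<otimes>\<^sub>m ident C A \<in> hom C (W \<otimes>\<^sub>o A) (W' \<otimes>\<^sub>o A)" by (rule tensor_in_hom[OF w ident_in_hom])
  have 2: "ident C A \<otimes>\<^sub>m w \<in> hom C (A \<otimes>\<^sub>o W) (A \<otimes>\<^sub>o W')" by (rule tensor_in_hom[OF ident_in_hom w])
  show ?thesis
    unfolding comp_tensor_ident[OF 2 braid_in_hom, symmetric]
      comp_tensor_ident[OF braid_in_hom 1, symmetric] braid_natural[OF ident_in_hom w] ..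
qed

text \<open>The prescribed value of the product on \<open>\<iota> X \<otimes> \<iota> Y\<close>,
  named so that dinaturality can be stated in each variable separately.\<close>

definition mult_family :: "'o \<Rightarrow> 'o \<Rightarrow> 'm" where
  "mult_family X Y = \<iota> (X \<otimes>\<^sub>o Y) \<cdot> (braid C (dual C X \<otimes>\<^sub>o X) (dual C Y) \<otimes>\<^sub>m ident C Y)"

lemma \<iota>_tensor_in_hom: "\<iota> (X \<otimes>\<^sub>o Y) \<in> hom C (dual C Y \<otimes>\<^sub>o dual C X \<otimes>\<^sub>o X \<otimes>\<^sub>o Y) L"
  using \<iota>_in_hom[of "X \<otimes>\<^sub>o Y"] by (simp add: dual_tensor tensor_ob_assoc)

lemma braid_mult_in_hom:
  "braid C (dual C X \<otimes>\<^sub>o X) (dual C Y) \<otimes>\<^sub>m ident C Y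
     \<in> hom C (dual C X \<otimes>\<^sub>o X \<otimes>\<^sub>o dual C Y \<otimes>\<^sub>o Y) (dual C Y \<otimes>\<^sub>o dual C X \<otimes>\<^sub>o X \<otimes>\<^sub>o Y)"
  by ((assumption | rule typing coend_typed | simp only: ob_simps)+)

lemma mult_family_in_hom: "mult_family X Y \<in> hom C (dual C X \<otimes>\<^sub>o X \<otimes>\<^sub>o dual C Y \<otimes>\<^sub>o Y) L"
  unfolding mult_family_def by (rule comp_in_hom[OF braid_mult_in_hom \<iota>_tensor_in_hom])

text \<open>Naturality moves both morphisms across the braiding. What remains is dinaturality of
  \<open>\<iota>\<close> for \<open>f \<otimes> id\<close>, whose dual is given by
  \<open>dual_mor_tensor_ident\<close>.\<close>

lemma mult_family_dinatural_left:
  assumes f: "f \<in> hom C X X'"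
  shows "mult_family X' Y \<cdot> ((ident C (dual C X') \<otimes>\<^sub>m f) \<otimes>\<^sub>m ident C (dual C Y \<otimes>\<^sub>o Y)) =
    mult_family X Y \<cdot> ((dual_mor C X X' f \<otimes>\<^sub>m ident C X) \<otimes>\<^sub>m ident C (dual C Y \<otimes>\<^sub>o Y))"
proof -
  note d = dual_mor_in_hom[OF f]
  note typed = hom_typed[OF d] hom_typed[OF f] coend_typed
  let ?Y = "dual C Y" and ?X = "dual C X" and ?X' = "dual C X'" and ?f = "dual_mor C X X' f"
  have a: "ident C ?X' \<otimes>\<^sub>m f \<in> hom C (?X' \<otimes>\<^sub>o X) (?X' \<otimes>\<^sub>o X')"
    by ((assumption | rule typing duality_typed typed | simp only: ob_simps)+)
  have b: "?f \<otimes>\<^sub>m ident C X \<in> hom C (?X' \<otimes>\<^sub>o X) (?X \<otimes>\<^sub>o X)" by ((assumption | rule typing duality_typed typed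
    | simp only: ob_simps)+)
  have a1: "(ident C ?X' \<otimes>\<^sub>m f) \<otimes>\<^sub>m ident C (?Y \<otimes>\<^sub>o Y) \<in> hom C (?X' \<otimes>\<^sub>o X \<otimes>\<^sub>o ?Y \<otimes>\<^sub>o Y) (?X' \<otimes>\<^sub>o X' \<otimes>\<^sub>o ?Y \<otimes>\<^sub>o Y)"
    by ((assumption | rule typing duality_typed typed | simp only: ob_simps)+)
  have b1: "(?f \<otimes>\<^sub>m ident C X) \<otimes>\<^sub>m ident C (?Y \<otimes>\<^sub>o Y) \<in> hom C (?X' \<otimes>\<^sub>o X \<otimes>\<^sub>o ?Y \<otimes>\<^sub>o Y) (?X \<otimes>\<^sub>o X \<otimes>\<^sub>o ?Y \<otimes>\<^sub>o Y)"
    by ((assumption | rule typing duality_typed typed | simp only: ob_simps)+)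
  have a2: "(ident C ?Y \<otimes>\<^sub>m (ident C ?X' \<otimes>\<^sub>m f)) \<otimes>\<^sub>m ident C Y \<in> hom C (?Y \<otimes>\<^sub>o ?X' \<otimes>\<^sub>o X \<otimes>\<^sub>o Y) (?Y \<otimes>\<^sub>o ?X' \<otimes>\<^sub>o X'
    \<otimes>\<^sub>o Y)" by ((assumption | rule typing duality_typed typed | simp only: ob_simps)+)
  have b2: "(ident C ?Y \<otimes>\<^sub>m (?f \<otimes>\<^sub>m ident C X)) \<otimes>\<^sub>m ident C Y \<in> hom C (?Y \<otimes>\<^sub>o ?X' \<otimes>\<^sub>o X \<otimes>\<^sub>o Y) (?Y \<otimes>\<^sub>o ?X \<otimes>\<^sub>o X \<otimes>\<^sub>o
    Y)" by ((assumption | rule typing duality_typed typed | simp only: ob_simps)+)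
  have \<beta>: "braid C (?X' \<otimes>\<^sub>o X) ?Y \<otimes>\<^sub>m ident C Y \<in> hom C (?X' \<otimes>\<^sub>o X \<otimes>\<^sub>o ?Y \<otimes>\<^sub>o Y) (?Y \<otimes>\<^sub>o ?X' \<otimes>\<^sub>o X \<otimes>\<^sub>o Y)"
    by ((assumption | rule typing duality_typed typed | simp only: ob_simps)+)
  have fY: "f \<otimes>\<^sub>m ident C Y \<in> hom C (X \<otimes>\<^sub>o Y) (X' \<otimes>\<^sub>o Y)" by ((assumption | rule typing duality_typed typed |
    simp only: ob_simps)+)
  have 1: "(ident C ?Y \<otimes>\<^sub>m (ident C ?X' \<otimes>\<^sub>m f)) \<otimes>\<^sub>m ident C Y = ident C (dual C (X' \<otimes>\<^sub>o Y)) \<otimes>\<^sub>m (f \<otimes>\<^sub>m ident C Y)"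
    unfolding tensor_middle[OF a] tensor_middle[OF f] dual_tensor ident_ob_tensor[OF fY] ..
  have 2: "(ident C ?Y \<otimes>\<^sub>m (?f \<otimes>\<^sub>m ident C X)) \<otimes>\<^sub>m ident C Y = dual_mor C (X \<otimes>\<^sub>o Y) (X' \<otimes>\<^sub>o Y) (f \<otimes>\<^sub>m ident C Y)
    \<otimes>\<^sub>m ident C (X \<otimes>\<^sub>o Y)"
    unfolding dual_mor_tensor_ident[OF f] tensor_middle[OF b] tensor_middle[OF d]
      tensor_ident_ob[OF d] ..
  have "mult_family X' Y \<cdot> ((ident C ?X' \<otimes>\<^sub>m f) \<otimes>\<^sub>m ident C (?Y \<otimes>\<^sub>o Y)) =
      \<iota> (X' \<otimes>\<^sub>o Y) \<cdot> (((ident C ?Y \<otimes>\<^sub>m (ident C ?X' \<otimes>\<^sub>m f)) \<otimes>\<^sub>m ident C Y) \<cdot> (braid C (?X' \<otimes>\<^sub>o X) ?Y \<otimes>\<^sub>m ident C Y))"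
    unfolding mult_family_def braid_slide_left[OF a, symmetric]
    by (rule comp_assoc[OF a1 braid_mult_in_hom \<iota>_tensor_in_hom, symmetric])
  also have "\<dots> = (\<iota> (X' \<otimes>\<^sub>o Y) \<cdot> (ident C (dual C (X' \<otimes>\<^sub>o Y)) \<otimes>\<^sub>m (f \<otimes>\<^sub>m ident C Y))) \<cdot> (braid C (?X' \<otimes>\<^sub>o X) ?Y
    \<otimes>\<^sub>m ident C Y)"
    unfolding 1[symmetric] by (rule comp_assoc[OF \<beta> a2 \<iota>_tensor_in_hom])
  also have "\<dots> = (\<iota> (X \<otimes>\<^sub>o Y) \<cdot> ((ident C ?Y \<otimes>\<^sub>m (?f \<otimes>\<^sub>m ident C X)) \<otimes>\<^sub>m ident C Y)) \<cdot> (braid C (?X' \<otimes>\<^sub>o X) ?Y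
    \<otimes>\<^sub>m ident C Y)"
    unfolding \<iota>_dinatural[OF fY] 2 ..
  also have "\<dots> = \<iota> (X \<otimes>\<^sub>o Y) \<cdot> (((ident C ?Y \<otimes>\<^sub>m (?f \<otimes>\<^sub>m ident C X)) \<otimes>\<^sub>m ident C Y) \<cdot> (braid C (?X' \<otimes>\<^sub>o X) ?Y
    \<otimes>\<^sub>m ident C Y))"
    by (rule comp_assoc[OF \<beta> b2 \<iota>_tensor_in_hom, symmetric])
  also have "\<dots> = mult_family X Y \<cdot> ((?f \<otimes>\<^sub>m ident C X) \<otimes>\<^sub>m ident C (?Y \<otimes>\<^sub>o Y))"
    unfolding mult_family_def braid_slide_left[OF b, symmetric]
    by (rule comp_assoc[OF b1 braid_mult_in_hom \<iota>_tensor_in_hom])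
  finally show ?thesis .
qed

text \<open>Here \<open>g\<close> does not meet the braiding, while its dual is carried through it;
  then dinaturality of \<open>\<iota>\<close> for \<open>id \<otimes> g\<close> applies.\<close>

lemma mult_family_dinatural_right:
  assumes g: "g \<in> hom C Y Y'"
  shows "mult_family X Y' \<cdot> (ident C (dual C X \<otimes>\<^sub>o X) \<otimes>\<^sub>m (ident C (dual C Y') \<otimes>\<^sub>m g)) =
    mult_family X Y \<cdot> (ident C (dual C X \<otimes>\<^sub>o X) \<otimes>\<^sub>m (dual_mor C Y Y' g \<otimes>\<^sub>m ident C Y))"
proof -
  note d = dual_mor_in_hom[OF g]
  note typed = hom_typed[OF d] hom_typed[OF g] coend_typed
  let ?X = "dual C X" and ?Y = "dual C Y" and ?Y' = "dual C Y'" and ?g = "dual_mor C Y Y' g"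
  let ?A = "?X \<otimes>\<^sub>o X"
  have a: "ident C ?A \<otimes>\<^sub>m (ident C ?Y' \<otimes>\<^sub>m g) \<in> hom C (?X \<otimes>\<^sub>o X \<otimes>\<^sub>o ?Y' \<otimes>\<^sub>o Y) (?X \<otimes>\<^sub>o X \<otimes>\<^sub>o ?Y' \<otimes>\<^sub>o Y')"
    by ((assumption | rule typing duality_typed typed | simp only: ob_simps)+)
  have b: "ident C ?A \<otimes>\<^sub>m (?g \<otimes>\<^sub>m ident C Y) \<in> hom C (?X \<otimes>\<^sub>o X \<otimes>\<^sub>o ?Y' \<otimes>\<^sub>o Y) (?X \<otimes>\<^sub>o X \<otimes>\<^sub>o ?Y \<otimes>\<^sub>o Y)"
    by ((assumption | rule typing duality_typed typed | simp only: ob_simps)+)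
  have \<beta>: "braid C ?A ?Y' \<otimes>\<^sub>m ident C Y \<in> hom C (?X \<otimes>\<^sub>o X \<otimes>\<^sub>o ?Y' \<otimes>\<^sub>o Y) (?Y' \<otimes>\<^sub>o ?X \<otimes>\<^sub>o X \<otimes>\<^sub>o Y)"
    by ((assumption | rule typing duality_typed typed | simp only: ob_simps)+)
  have a2: "ident C (?Y' \<otimes>\<^sub>o ?A) \<otimes>\<^sub>m g \<in> hom C (?Y' \<otimes>\<^sub>o ?X \<otimes>\<^sub>o X \<otimes>\<^sub>o Y) (?Y' \<otimes>\<^sub>o ?X \<otimes>\<^sub>o X \<otimes>\<^sub>o Y')"
    by ((assumption | rule typing duality_typed typed | simp only: ob_simps)+)
  have b2: "(?g \<otimes>\<^sub>m ident C ?A) \<otimes>\<^sub>m ident C Y \<in> hom C (?Y' \<otimes>\<^sub>o ?X \<otimes>\<^sub>o X \<otimes>\<^sub>o Y) (?Y \<otimes>\<^sub>o ?X \<otimes>\<^sub>o X \<otimes>\<^sub>o Y)"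
    by ((assumption | rule typing duality_typed typed | simp only: ob_simps)+)
  have Xg: "ident C X \<otimes>\<^sub>m g \<in> hom C (X \<otimes>\<^sub>o Y) (X \<otimes>\<^sub>o Y')" by ((assumption | rule typing duality_typed typed |
    simp only: ob_simps)+)
  have 1: "ident C (?Y' \<otimes>\<^sub>o ?A) \<otimes>\<^sub>m g = ident C (dual C (X \<otimes>\<^sub>o Y')) \<otimes>\<^sub>m (ident C X \<otimes>\<^sub>m g)"
    unfolding dual_tensor ident_ob_tensor[OF g, symmetric] tensor_ob_assoc ..
  have 2: "(?g \<otimes>\<^sub>m ident C ?A) \<otimes>\<^sub>m ident C Y = dual_mor C (X \<otimes>\<^sub>o Y) (X \<otimes>\<^sub>o Y') (ident C X \<otimes>\<^sub>m g) \<otimes>\<^sub>m ident C (X \<otimes>\<^sub>o Y)"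
    unfolding dual_mor_ident_tensor[OF g] tensor_ident_ob[OF d, symmetric] tensor_ob_assoc ..
  have s1: "(braid C ?A ?Y' \<otimes>\<^sub>m ident C Y') \<cdot> (ident C ?A \<otimes>\<^sub>m (ident C ?Y' \<otimes>\<^sub>m g)) =
      (ident C (?Y' \<otimes>\<^sub>o ?A) \<otimes>\<^sub>m g) \<cdot> (braid C ?A ?Y' \<otimes>\<^sub>m ident C Y)"
    unfolding ident_ob_tensor[OF g, symmetric] by (rule tensor_slide[OF braid_in_hom g])
  have s2: "(braid C ?A ?Y \<otimes>\<^sub>m ident C Y) \<cdot> (ident C ?A \<otimes>\<^sub>m (?g \<otimes>\<^sub>m ident C Y)) =
      ((?g \<otimes>\<^sub>m ident C ?A) \<otimes>\<^sub>m ident C Y) \<cdot> (braid C ?A ?Y' \<otimes>\<^sub>m ident C Y)"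
    unfolding tensor_middle[OF d, symmetric] by (rule braid_slide_right[OF d])
  have "mult_family X Y' \<cdot> (ident C ?A \<otimes>\<^sub>m (ident C ?Y' \<otimes>\<^sub>m g)) =
      \<iota> (X \<otimes>\<^sub>o Y') \<cdot> ((ident C (?Y' \<otimes>\<^sub>o ?A) \<otimes>\<^sub>m g) \<cdot> (braid C ?A ?Y' \<otimes>\<^sub>m ident C Y))"
    unfolding mult_family_def s1[symmetric]
    by (rule comp_assoc[OF a braid_mult_in_hom \<iota>_tensor_in_hom, symmetric])
  also have "\<dots> = (\<iota> (X \<otimes>\<^sub>o Y') \<cdot> (ident C (dual C (X \<otimes>\<^sub>o Y')) \<otimes>\<^sub>m (ident C X \<otimes>\<^sub>m g))) \<cdot> (braid C ?A ?Y' \<otimes>\<^sub>m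
    ident C Y)"
    unfolding 1[symmetric] by (rule comp_assoc[OF \<beta> a2 \<iota>_tensor_in_hom])
  also have "\<dots> = (\<iota> (X \<otimes>\<^sub>o Y) \<cdot> ((?g \<otimes>\<^sub>m ident C ?A) \<otimes>\<^sub>m ident C Y)) \<cdot> (braid C ?A ?Y' \<otimes>\<^sub>m ident C Y)"
    unfolding \<iota>_dinatural[OF Xg] 2 ..
  also have "\<dots> = \<iota> (X \<otimes>\<^sub>o Y) \<cdot> (((?g \<otimes>\<^sub>m ident C ?A) \<otimes>\<^sub>m ident C Y) \<cdot> (braid C ?A ?Y' \<otimes>\<^sub>m ident C Y))"
    by (rule comp_assoc[OF \<beta> b2 \<iota>_tensor_in_hom, symmetric])
  also have "\<dots> = mult_family X Y \<cdot> (ident C ?A \<otimes>\<^sub>m (?g \<otimes>\<^sub>m ident C Y))"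
    unfolding mult_family_def s2[symmetric]
    by (rule comp_assoc[OF b braid_mult_in_hom \<iota>_tensor_in_hom])
  finally show ?thesis .
qed

abbreviation \<mu> :: 'm where "\<mu> \<equiv> coend_mult C L \<iota>"

lemma \<iota>_pair_split:
  "\<iota> X \<otimes>\<^sub>m \<iota> Y = (ident C L \<otimes>\<^sub>m \<iota> Y) \<cdot> (\<iota> X \<otimes>\<^sub>m ident C (dual C Y \<otimes>\<^sub>o Y))"
  by (rule tensor_interchange_right[OF \<iota>_in_hom \<iota>_in_hom, symmetric])

lemma coend_pair_ext:
  assumes h: "h \<in> hom C (L \<otimes>\<^sub>o L) T" "h' \<in> hom C (L \<otimes>\<^sub>o L) T"
    and eq: "\<And>X Y. h \<cdot> (\<iota> X \<otimes>\<^sub>m \<iota> Y) = h' \<cdot> (\<iota> X \<otimes>\<^sub>m \<iota> Y)"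
  shows "h = h'"
proof (rule coend_left_ext[OF h], rule coend_right_ext)
  have L\<iota>: "ident C L \<otimes>\<^sub>m \<iota> Y \<in> hom C (L \<otimes>\<^sub>o (dual C Y \<otimes>\<^sub>o Y)) (L \<otimes>\<^sub>o L)" for Y
    by (rule tensor_in_hom[OF ident_in_hom \<iota>_in_hom])
  have \<iota>1: "\<iota> X \<otimes>\<^sub>m ident C Z \<in> hom C ((dual C X \<otimes>\<^sub>o X) \<otimes>\<^sub>o Z) (L \<otimes>\<^sub>o Z)" for X Z
    by (rule tensor_in_hom[OF \<iota>_in_hom ident_in_hom])
  show "h \<cdot> (ident C L \<otimes>\<^sub>m \<iota> Y) \<in> hom C (L \<otimes>\<^sub>o (dual C Y \<otimes>\<^sub>o Y)) T"
    "h' \<cdot> (ident C L \<otimes>\<^sub>m \<iota> Y) \<in> hom C (L \<otimes>\<^sub>o (dual C Y \<otimes>\<^sub>o Y)) T" for Y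
    by (rule comp_in_hom[OF L\<iota> h(1)]) (rule comp_in_hom[OF L\<iota> h(2)])
  show "h \<cdot> (ident C L \<otimes>\<^sub>m \<iota> Y) \<cdot> (\<iota> X \<otimes>\<^sub>m ident C (dual C Y \<otimes>\<^sub>o Y)) =
     h' \<cdot> (ident C L \<otimes>\<^sub>m \<iota> Y) \<cdot> (\<iota> X \<otimes>\<^sub>m ident C (dual C Y \<otimes>\<^sub>o Y))" for X Y
    unfolding comp_assoc[OF \<iota>1 L\<iota> h(1), symmetric] comp_assoc[OF \<iota>1 L\<iota> h(2), symmetric] \<iota>_pair_split[symmetric]
    by (rule eq)
qed

text \<open>The coend is taken in one variable at a time. For fixed \<open>Y\<close> the family
  factors through \<open>L\<close> as \<open>\<psi> Y\<close>; dinaturality of \<open>\<psi>\<close>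
  in \<open>Y\<close> is then tested on the morphisms \<open>\<iota> X\<close>.\<close>

lemma coend_mult_exists:
  "\<exists>m\<in>hom C (L \<otimes>\<^sub>o L) L. \<forall>X Y. m \<cdot> (\<iota> X \<otimes>\<^sub>m \<iota> Y) = mult_family X Y"
proof -
  have "\<exists>h\<in>hom C (L \<otimes>\<^sub>o (dual C Y \<otimes>\<^sub>o Y)) L. \<forall>X. h \<cdot> (\<iota> X \<otimes>\<^sub>m ident C (dual C Y \<otimes>\<^sub>o Y)) = mult_family X Y" for Y
  proof (rule coend_right_exists)
    show "mult_family X Y \<in> hom C ((dual C X \<otimes>\<^sub>o X) \<otimes>\<^sub>o (dual C Y \<otimes>\<^sub>o Y)) L" for X
      using mult_family_in_hom by (simp add: tensor_ob_assoc)
  qed (rule mult_family_dinatural_left)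
  then obtain \<psi> where \<psi>: "\<And>Y. \<psi> Y \<in> hom C (L \<otimes>\<^sub>o (dual C Y \<otimes>\<^sub>o Y)) L"
    "\<And>X Y. \<psi> Y \<cdot> (\<iota> X \<otimes>\<^sub>m ident C (dual C Y \<otimes>\<^sub>o Y)) = mult_family X Y" by metis
  have \<iota>1: "\<iota> X \<otimes>\<^sub>m ident C Z \<in> hom C ((dual C X \<otimes>\<^sub>o X) \<otimes>\<^sub>o Z) (L \<otimes>\<^sub>o Z)" for X Z
    by (rule tensor_in_hom[OF \<iota>_in_hom ident_in_hom])
  have "\<exists>m\<in>hom C (L \<otimes>\<^sub>o L) L. \<forall>Y. m \<cdot> (ident C L \<otimes>\<^sub>m \<iota> Y) = \<psi> Y"
  proof (rule coend_left_exists[OF \<psi>(1)])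
    fix Y Y' g assume g: "g \<in> hom C Y Y'"
    note d = dual_mor_in_hom[OF g]
    let ?a = "ident C (dual C Y') \<otimes>\<^sub>m g" and ?b = "dual_mor C Y Y' g \<otimes>\<^sub>m ident C Y"
    have a: "?a \<in> hom C (dual C Y' \<otimes>\<^sub>o Y) (dual C Y' \<otimes>\<^sub>o Y')" by (rule tensor_in_hom[OF ident_in_hom g])
    have b: "?b \<in> hom C (dual C Y' \<otimes>\<^sub>o Y) (dual C Y \<otimes>\<^sub>o Y)" by (rule tensor_in_hom[OF d ident_in_hom])
    have slide: "\<psi> V \<cdot> (ident C L \<otimes>\<^sub>m c) \<cdot> (\<iota> X \<otimes>\<^sub>m ident C W) =
        mult_family X V \<cdot> (ident C (dual C X \<otimes>\<^sub>o X) \<otimes>\<^sub>m c)" if c: "c \<in> hom C W (dual C V \<otimes>\<^sub>o V)" for c V W X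
    proof -
      have Lc: "ident C L \<otimes>\<^sub>m c \<in> hom C (L \<otimes>\<^sub>o W) (L \<otimes>\<^sub>o (dual C V \<otimes>\<^sub>o V))"
        by (rule tensor_in_hom[OF ident_in_hom c])
      have Ac: "ident C (dual C X \<otimes>\<^sub>o X) \<otimes>\<^sub>m c \<in> hom C ((dual C X \<otimes>\<^sub>o X) \<otimes>\<^sub>o W) ((dual C X \<otimes>\<^sub>o X) \<otimes>\<^sub>o (dual C V
        \<otimes>\<^sub>o V))"
        by (rule tensor_in_hom[OF ident_in_hom c])
      show ?thesis
        unfolding comp_assoc[OF \<iota>1 Lc \<psi>(1), symmetric] tensor_slide[OF \<iota>_in_hom c, symmetric]
          comp_assoc[OF Ac \<iota>1 \<psi>(1)] \<psi>(2) ..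
    qed
    show "\<psi> Y' \<cdot> (ident C L \<otimes>\<^sub>m ?a) = \<psi> Y \<cdot> (ident C L \<otimes>\<^sub>m ?b)"
    proof (rule coend_right_ext)
      show "\<psi> Y' \<cdot> (ident C L \<otimes>\<^sub>m ?a) \<in> hom C (L \<otimes>\<^sub>o (dual C Y' \<otimes>\<^sub>o Y)) L"
        "\<psi> Y \<cdot> (ident C L \<otimes>\<^sub>m ?b) \<in> hom C (L \<otimes>\<^sub>o (dual C Y' \<otimes>\<^sub>o Y)) L"
        by (rule comp_in_hom[OF tensor_in_hom[OF ident_in_hom a] \<psi>(1)])
          (rule comp_in_hom[OF tensor_in_hom[OF ident_in_hom b] \<psi>(1)])
      show "\<psi> Y' \<cdot> (ident C L \<otimes>\<^sub>m ?a) \<cdot> (\<iota> X \<otimes>\<^sub>m ident C (dual C Y' \<otimes>\<^sub>o Y)) =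
          \<psi> Y \<cdot> (ident C L \<otimes>\<^sub>m ?b) \<cdot> (\<iota> X \<otimes>\<^sub>m ident C (dual C Y' \<otimes>\<^sub>o Y))" for X
        unfolding slide[OF a] slide[OF b] by (rule mult_family_dinatural_right[OF g])
    qed
  qed
  then obtain m where m: "m \<in> hom C (L \<otimes>\<^sub>o L) L" "\<And>Y. m \<cdot> (ident C L \<otimes>\<^sub>m \<iota> Y) = \<psi> Y" by blast
  have "m \<cdot> (\<iota> X \<otimes>\<^sub>m \<iota> Y) = mult_family X Y" for X Y
    unfolding \<iota>_pair_split comp_assoc[OF \<iota>1 tensor_in_hom[OF ident_in_hom \<iota>_in_hom] m(1)] m(2) by (rule \<psi>(2))
  then show ?thesis using m(1) by blast
qed

text \<open>Existence and joint epimorphy resolve the definite description in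
  \<open>coend_mult\<close>.\<close>

lemma mult_in_hom: "\<mu> \<in> hom C (L \<otimes>\<^sub>o L) L" and mult_\<iota>: "\<mu> \<cdot> (\<iota> X \<otimes>\<^sub>m \<iota> Y) = mult_family X Y"
proof -
  obtain m where m: "m \<in> hom C (L \<otimes>\<^sub>o L) L" "\<forall>X Y. m \<cdot> (\<iota> X \<otimes>\<^sub>m \<iota> Y) = mult_family X Y"
    using coend_mult_exists by blast
  have "\<mu> \<in> hom C (L \<otimes>\<^sub>o L) L \<and> (\<forall>X Y. \<mu> \<cdot> (\<iota> X \<otimes>\<^sub>m \<iota> Y) = mult_family X Y)"
    unfolding coend_mult_def mult_family_def
  proof (rule theI)
    show "m \<in> hom C (L \<otimes>\<^sub>o L) L \<and> (\<forall>X Y. m \<cdot> (\<iota> X \<otimes>\<^sub>m \<iota> Y) =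
        \<iota> (X \<otimes>\<^sub>o Y) \<cdot> (braid C (dual C X \<otimes>\<^sub>o X) (dual C Y) \<otimes>\<^sub>m ident C Y))"
      using m by (simp add: mult_family_def)
    fix m' assume m': "m' \<in> hom C (L \<otimes>\<^sub>o L) L \<and> (\<forall>X Y. m' \<cdot> (\<iota> X \<otimes>\<^sub>m \<iota> Y) =
        \<iota> (X \<otimes>\<^sub>o Y) \<cdot> (braid C (dual C X \<otimes>\<^sub>o X) (dual C Y) \<otimes>\<^sub>m ident C Y))"
    show "m' = m" by (rule coend_pair_ext) (use m m' in \<open>simp_all add: mult_family_def\<close>)
  qed
  then show "\<mu> \<in> hom C (L \<otimes>\<^sub>o L) L" "\<mu> \<cdot> (\<iota> X \<otimes>\<^sub>m \<iota> Y) = mult_family X Y" by auto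
qed

end

section \<open>Associativity and unit of the coend\<close>

context coend_category
begin

lemma coend_triple_ext:
  assumes h: "h \<in> hom C (L \<otimes>\<^sub>o (L \<otimes>\<^sub>o L)) T" "h' \<in> hom C (L \<otimes>\<^sub>o (L \<otimes>\<^sub>o L)) T"
    and eq: "\<And>X Y Z. h \<cdot> (\<iota> X \<otimes>\<^sub>m (\<iota> Y \<otimes>\<^sub>m \<iota> Z)) = h' \<cdot> (\<iota> X \<otimes>\<^sub>m (\<iota> Y \<otimes>\<^sub>m \<iota> Z))"
  shows "h = h'"
proof (rule coend_right_ext[OF h])
  fix X
  let ?A = "dual C X \<otimes>\<^sub>o X"
  have \<iota>L: "\<iota> X \<otimes>\<^sub>m ident C (L \<otimes>\<^sub>o L) \<in> hom C (?A \<otimes>\<^sub>o (L \<otimes>\<^sub>o L)) (L \<otimes>\<^sub>o (L \<otimes>\<^sub>o L))"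
    by (rule tensor_in_hom[OF \<iota>_in_hom ident_in_hom])
  have curry: "curry_left ?A (L \<otimes>\<^sub>o L) (k \<cdot> (\<iota> X \<otimes>\<^sub>m ident C (L \<otimes>\<^sub>o L))) \<cdot> (\<iota> Y \<otimes>\<^sub>m \<iota> Z) =
     curry_left ?A ((dual C Y \<otimes>\<^sub>o Y) \<otimes>\<^sub>o (dual C Z \<otimes>\<^sub>o Z)) (k \<cdot> (\<iota> X \<otimes>\<^sub>m (\<iota> Y \<otimes>\<^sub>m \<iota> Z)))"
    if k: "k \<in> hom C (L \<otimes>\<^sub>o (L \<otimes>\<^sub>o L)) T" for k Y Z
  proof -
    have p: "\<iota> Y \<otimes>\<^sub>m \<iota> Z \<in> hom C ((dual C Y \<otimes>\<^sub>o Y) \<otimes>\<^sub>o (dual C Z \<otimes>\<^sub>o Z)) (L \<otimes>\<^sub>o L)"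
      by (rule tensor_in_hom[OF \<iota>_in_hom \<iota>_in_hom])
    have Ap: "ident C ?A \<otimes>\<^sub>m (\<iota> Y \<otimes>\<^sub>m \<iota> Z) \<in> hom C (?A \<otimes>\<^sub>o ((dual C Y \<otimes>\<^sub>o Y) \<otimes>\<^sub>o (dual C Z \<otimes>\<^sub>o Z))) (?A \<otimes>\<^sub>o (L \<otimes>\<^sub>o L))"
      by (rule tensor_in_hom[OF ident_in_hom p])
    show ?thesis
      unfolding curry_left_comp[OF comp_in_hom[OF \<iota>L k] p, symmetric] comp_assoc[OF Ap \<iota>L k, symmetric]
        tensor_interchange_left[OF \<iota>_in_hom p] ..
  qed
  let ?k = "h \<cdot> (\<iota> X \<otimes>\<^sub>m ident C (L \<otimes>\<^sub>o L))" and ?k' = "h' \<cdot> (\<iota> X \<otimes>\<^sub>m ident C (L \<otimes>\<^sub>o L))"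
  have k: "?k \<in> hom C (?A \<otimes>\<^sub>o (L \<otimes>\<^sub>o L)) T" "?k' \<in> hom C (?A \<otimes>\<^sub>o (L \<otimes>\<^sub>o L)) T"
    by (rule comp_in_hom[OF \<iota>L h(1)]) (rule comp_in_hom[OF \<iota>L h(2)])
  have "curry_left ?A (L \<otimes>\<^sub>o L) ?k = curry_left ?A (L \<otimes>\<^sub>o L) ?k'"
    by (rule coend_pair_ext[OF curry_left_in_hom[OF k(1)] curry_left_in_hom[OF k(2)]])
      (simp only: curry[OF h(1)] curry[OF h(2)] eq)
  from arg_cong[OF this, of "uncurry_left ?A T"] show "?k = ?k'"
    unfolding uncurry_curry_left[OF k(1)] uncurry_curry_left[OF k(2)] .
qed

text \<open>Tested on three components of \<open>\<iota>\<close>, both sides become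
  \<open>\<iota> (X \<otimes> Y \<otimes> Z)\<close> after a braid in which the dual of
  \<open>Z\<close> passes the factors of \<open>X\<close> and \<open>Y\<close>, and the dual of
  \<open>Y\<close> those of \<open>X\<close>. The left hexagon splits the braiding of a product, and
  the right hexagon reassembles it for the dual of \<open>Y \<otimes> Z\<close>.\<close>

lemma mult_assoc: "\<mu> \<cdot> (\<mu> \<otimes>\<^sub>m ident C L) = \<mu> \<cdot> (ident C L \<otimes>\<^sub>m \<mu>)"
proof (rule coend_triple_ext)
  note typed = coend_typed hom_typed[OF mult_in_hom]
  have \<mu>L: "\<mu> \<otimes>\<^sub>m ident C L \<in> hom C (L \<otimes>\<^sub>o (L \<otimes>\<^sub>o L)) (L \<otimes>\<^sub>o L)"
    by ((assumption | rule typing duality_typed typed | simp only: ob_simps)+)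
  have L\<mu>: "ident C L \<otimes>\<^sub>m \<mu> \<in> hom C (L \<otimes>\<^sub>o (L \<otimes>\<^sub>o L)) (L \<otimes>\<^sub>o L)"
    by ((assumption | rule typing duality_typed typed | simp only: ob_simps)+)
  show "\<mu> \<cdot> (\<mu> \<otimes>\<^sub>m ident C L) \<in> hom C (L \<otimes>\<^sub>o (L \<otimes>\<^sub>o L)) L"
    "\<mu> \<cdot> (ident C L \<otimes>\<^sub>m \<mu>) \<in> hom C (L \<otimes>\<^sub>o (L \<otimes>\<^sub>o L)) L"
    by (rule comp_in_hom[OF \<mu>L mult_in_hom]) (rule comp_in_hom[OF L\<mu> mult_in_hom])
  fix X Y Z
  let ?X = "dual C X" and ?Y = "dual C Y" and ?Z = "dual C Z"
  let ?A = "?X \<otimes>\<^sub>o X"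
  let ?b = "braid C ?A ?Y \<otimes>\<^sub>m ident C Y" and ?c = "braid C (?Y \<otimes>\<^sub>o Y) ?Z \<otimes>\<^sub>m ident C Z"
  let ?D = "?X \<otimes>\<^sub>o X \<otimes>\<^sub>o ?Y \<otimes>\<^sub>o Y \<otimes>\<^sub>o ?Z \<otimes>\<^sub>o Z"
  have \<iota>\<iota>\<iota>: "\<iota> X \<otimes>\<^sub>m (\<iota> Y \<otimes>\<^sub>m \<iota> Z) \<in> hom C ?D (L \<otimes>\<^sub>o (L \<otimes>\<^sub>o L))"
    by ((assumption | rule typing duality_typed typed | simp only: ob_simps)+)
  have b: "?b \<in> hom C (?A \<otimes>\<^sub>o ?Y \<otimes>\<^sub>o Y) (dual C (X \<otimes>\<^sub>o Y) \<otimes>\<^sub>o (X \<otimes>\<^sub>o Y))"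
    unfolding dual_tensor by ((assumption | rule typing duality_typed typed | simp only: ob_simps)+)
  have c: "?c \<in> hom C ((?Y \<otimes>\<^sub>o Y) \<otimes>\<^sub>o ?Z \<otimes>\<^sub>o Z) (dual C (Y \<otimes>\<^sub>o Z) \<otimes>\<^sub>o (Y \<otimes>\<^sub>o Z))"
    unfolding dual_tensor by ((assumption | rule typing duality_typed typed | simp only: ob_simps)+)
  have ZbZ: "(ident C ?Z \<otimes>\<^sub>m ?b) \<otimes>\<^sub>m ident C Z \<in> hom C (?Z \<otimes>\<^sub>o ?X \<otimes>\<^sub>o X \<otimes>\<^sub>o ?Y \<otimes>\<^sub>o Y \<otimes>\<^sub>o Z) (?Z \<otimes>\<^sub>o ?Y \<otimes>\<^sub>o ?X \<otimes>\<^sub>o X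
    \<otimes>\<^sub>o Y \<otimes>\<^sub>o Z)" by ((assumption | rule typing duality_typed typed | simp only: ob_simps)+)
  have \<beta>1: "braid C ?A ?Z \<otimes>\<^sub>m ident C (?Y \<otimes>\<^sub>o Y) \<in> hom C (?X \<otimes>\<^sub>o X \<otimes>\<^sub>o ?Z \<otimes>\<^sub>o ?Y \<otimes>\<^sub>o Y) (?Z \<otimes>\<^sub>o ?X \<otimes>\<^sub>o X \<otimes>\<^sub>o ?Y \<otimes>\<^sub>o
    Y)" by ((assumption | rule typing duality_typed typed | simp only: ob_simps)+)
  have \<beta>1Z: "(braid C ?A ?Z \<otimes>\<^sub>m ident C (?Y \<otimes>\<^sub>o Y)) \<otimes>\<^sub>m ident C Z \<in> hom C (?X \<otimes>\<^sub>o X \<otimes>\<^sub>o ?Z \<otimes>\<^sub>o ?Y \<otimes>\<^sub>o Y \<otimes>\<^sub>o Z) (?Z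
    \<otimes>\<^sub>o ?X \<otimes>\<^sub>o X \<otimes>\<^sub>o ?Y \<otimes>\<^sub>o Y \<otimes>\<^sub>o Z)" by ((assumption | rule typing duality_typed typed | simp only: ob_simps)+)
  have \<beta>2: "ident C ?A \<otimes>\<^sub>m braid C (?Y \<otimes>\<^sub>o Y) ?Z \<in> hom C (?X \<otimes>\<^sub>o X \<otimes>\<^sub>o ?Y \<otimes>\<^sub>o Y \<otimes>\<^sub>o ?Z) (?X \<otimes>\<^sub>o X \<otimes>\<^sub>o ?Z \<otimes>\<^sub>o ?Y \<otimes>\<^sub>o
    Y)" by ((assumption | rule typing duality_typed typed | simp only: ob_simps)+)
  have Ac: "ident C ?A \<otimes>\<^sub>m ?c \<in> hom C ?D (?X \<otimes>\<^sub>o X \<otimes>\<^sub>o ?Z \<otimes>\<^sub>o ?Y \<otimes>\<^sub>o Y \<otimes>\<^sub>o Z)"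
    by ((assumption | rule typing duality_typed typed | simp only: ob_simps)+)
  have \<beta>12: "braid C (?A \<otimes>\<^sub>o (?Y \<otimes>\<^sub>o Y)) ?Z \<otimes>\<^sub>m ident C Z \<in> hom C ?D (?Z \<otimes>\<^sub>o ?X \<otimes>\<^sub>o X \<otimes>\<^sub>o ?Y \<otimes>\<^sub>o Y \<otimes>\<^sub>o Z)"
    by ((assumption | rule typing duality_typed typed | simp only: ob_simps)+)
  have \<iota>3: "\<iota> (X \<otimes>\<^sub>o Y \<otimes>\<^sub>o Z) \<in> hom C (?Z \<otimes>\<^sub>o ?Y \<otimes>\<^sub>o ?X \<otimes>\<^sub>o X \<otimes>\<^sub>o Y \<otimes>\<^sub>o Z) L"
    using \<iota>_in_hom[of "X \<otimes>\<^sub>o Y \<otimes>\<^sub>o Z"] by (simp add: dual_tensor tensor_ob_assoc)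
  have ZbetaZ: "(ident C ?Z \<otimes>\<^sub>m braid C ?A ?Y) \<otimes>\<^sub>m ident C (Y \<otimes>\<^sub>o Z) = (ident C ?Z \<otimes>\<^sub>m ?b) \<otimes>\<^sub>m ident C Z"
  proof -
    have 1: "ident C ?Z \<otimes>\<^sub>m braid C ?A ?Y \<in> hom C (?Z \<otimes>\<^sub>o (?A \<otimes>\<^sub>o ?Y)) (?Z \<otimes>\<^sub>o (?Y \<otimes>\<^sub>o ?A))"
      by (rule tensor_in_hom[OF ident_in_hom braid_in_hom])
    show ?thesis
      using tensor_ident_ob[OF 1, of Y Z] unfolding tensor_middle[OF braid_in_hom, where B = Y] .
  qed
  have "\<mu> \<cdot> (\<mu> \<otimes>\<^sub>m ident C L) \<cdot> (\<iota> X \<otimes>\<^sub>m (\<iota> Y \<otimes>\<^sub>m \<iota> Z)) = \<mu> \<cdot> (mult_family X Y \<otimes>\<^sub>m \<iota> Z)"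
  proof -
    have "(\<mu> \<otimes>\<^sub>m ident C L) \<cdot> (\<iota> X \<otimes>\<^sub>m (\<iota> Y \<otimes>\<^sub>m \<iota> Z)) = (\<mu> \<cdot> (\<iota> X \<otimes>\<^sub>m \<iota> Y)) \<otimes>\<^sub>m (ident C L \<cdot> \<iota> Z)"
      unfolding tensor_assoc[OF \<iota>_in_hom \<iota>_in_hom \<iota>_in_hom, symmetric]
      by (rule tensor_comp[OF tensor_in_hom[OF \<iota>_in_hom \<iota>_in_hom] mult_in_hom \<iota>_in_hom ident_in_hom, symmetric])
    then show ?thesis
      unfolding comp_assoc[OF \<iota>\<iota>\<iota> \<mu>L mult_in_hom, symmetric] mult_\<iota> comp_ident_left[OF \<iota>_in_hom] by simp
  qed
  also have "mult_family X Y \<otimes>\<^sub>m \<iota> Z = (\<iota> (X \<otimes>\<^sub>o Y) \<otimes>\<^sub>m \<iota> Z) \<cdot> (?b \<otimes>\<^sub>m ident C (?Z \<otimes>\<^sub>o Z))"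
    unfolding mult_family_def
    using tensor_comp[OF b \<iota>_in_hom ident_in_hom \<iota>_in_hom] by (simp add: comp_ident_right[OF \<iota>_in_hom])
  also have "\<mu> \<cdot> ((\<iota> (X \<otimes>\<^sub>o Y) \<otimes>\<^sub>m \<iota> Z) \<cdot> (?b \<otimes>\<^sub>m ident C (?Z \<otimes>\<^sub>o Z))) = mult_family (X \<otimes>\<^sub>o Y) Z \<cdot> (?b \<otimes>\<^sub>m ident
    C (?Z \<otimes>\<^sub>o Z))"
    unfolding mult_\<iota>[symmetric]
    by (rule comp_assoc[OF tensor_in_hom[OF b ident_in_hom] tensor_in_hom[OF \<iota>_in_hom \<iota>_in_hom] mult_in_hom])
  also have "\<dots> = \<iota> (X \<otimes>\<^sub>o Y \<otimes>\<^sub>o Z) \<cdot> ((braid C (dual C (X \<otimes>\<^sub>o Y) \<otimes>\<^sub>o (X \<otimes>\<^sub>o Y)) ?Z \<otimes>\<^sub>m ident C Z) \<cdot> (?b \<otimes>\<^sub>m ident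
    C (?Z \<otimes>\<^sub>o Z)))"
  proof -
    have 1: "?b \<otimes>\<^sub>m ident C (?Z \<otimes>\<^sub>o Z) \<in> hom C ((?A \<otimes>\<^sub>o ?Y \<otimes>\<^sub>o Y) \<otimes>\<^sub>o (?Z \<otimes>\<^sub>o Z)) ((dual C (X \<otimes>\<^sub>o Y) \<otimes>\<^sub>o (X \<otimes>\<^sub>o Y))
      \<otimes>\<^sub>o (?Z \<otimes>\<^sub>o Z))"
      by (rule tensor_in_hom[OF b ident_in_hom])
    have 2: "braid C (dual C (X \<otimes>\<^sub>o Y) \<otimes>\<^sub>o (X \<otimes>\<^sub>o Y)) ?Z \<otimes>\<^sub>m ident C Z \<in>
       hom C ((dual C (X \<otimes>\<^sub>o Y) \<otimes>\<^sub>o (X \<otimes>\<^sub>o Y)) \<otimes>\<^sub>o (?Z \<otimes>\<^sub>o Z)) (?Z \<otimes>\<^sub>o ?Y \<otimes>\<^sub>o ?X \<otimes>\<^sub>o X \<otimes>\<^sub>o Y \<otimes>\<^sub>o Z)"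
      unfolding dual_tensor by ((assumption | rule typing duality_typed typed | simp only: ob_simps)+)
    show ?thesis
      unfolding mult_family_def by (rule comp_assoc[OF 1 2 \<iota>3, symmetric])
  qed
  \<comment> \<open>Naturality of the outer braiding moves the inner one, \<open>?b\<close>, behind
    it, where the hexagons can act.\<close>
  also have "(braid C (dual C (X \<otimes>\<^sub>o Y) \<otimes>\<^sub>o (X \<otimes>\<^sub>o Y)) ?Z \<otimes>\<^sub>m ident C Z) \<cdot> (?b \<otimes>\<^sub>m ident C (?Z \<otimes>\<^sub>o Z)) =
      ((ident C ?Z \<otimes>\<^sub>m ?b) \<otimes>\<^sub>m ident C Z) \<cdot> (braid C (?A \<otimes>\<^sub>o (?Y \<otimes>\<^sub>o Y)) ?Z \<otimes>\<^sub>m ident C Z)"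
    using braid_slide_left[OF b, of ?Z Z] by (simp only: tensor_ob_assoc)
  also have "braid C (?A \<otimes>\<^sub>o (?Y \<otimes>\<^sub>o Y)) ?Z \<otimes>\<^sub>m ident C Z =
      ((braid C ?A ?Z \<otimes>\<^sub>m ident C (?Y \<otimes>\<^sub>o Y)) \<otimes>\<^sub>m ident C Z) \<cdot> (ident C ?A \<otimes>\<^sub>m ?c)"
    unfolding hexagon_left[of ?A "?Y \<otimes>\<^sub>o Y" ?Z] comp_tensor_ident[OF \<beta>2 \<beta>1] tensor_middle[OF braid_in_hom] ..
  also have "((ident C ?Z \<otimes>\<^sub>m ?b) \<otimes>\<^sub>m ident C Z) \<cdot> (((braid C ?A ?Z \<otimes>\<^sub>m ident C (?Y \<otimes>\<^sub>o Y)) \<otimes>\<^sub>m ident C Z) \<cdot>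
    (ident C ?A \<otimes>\<^sub>m ?c)) =
      (((ident C ?Z \<otimes>\<^sub>m ?b) \<otimes>\<^sub>m ident C Z) \<cdot> ((braid C ?A ?Z \<otimes>\<^sub>m ident C (?Y \<otimes>\<^sub>o Y)) \<otimes>\<^sub>m ident C Z)) \<cdot>
        (ident C ?A \<otimes>\<^sub>m ?c)"
    by (rule comp_assoc[OF Ac \<beta>1Z ZbZ])
  also have "((ident C ?Z \<otimes>\<^sub>m ?b) \<otimes>\<^sub>m ident C Z) \<cdot> ((braid C ?A ?Z \<otimes>\<^sub>m ident C (?Y \<otimes>\<^sub>o Y)) \<otimes>\<^sub>m ident C Z) =
      braid C ?A (dual C (Y \<otimes>\<^sub>o Z)) \<otimes>\<^sub>m ident C (Y \<otimes>\<^sub>o Z)"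
  proof -
    have 1: "braid C ?A ?Z \<otimes>\<^sub>m ident C ?Y \<in> hom C (?X \<otimes>\<^sub>o X \<otimes>\<^sub>o ?Z \<otimes>\<^sub>o ?Y) (?Z \<otimes>\<^sub>o ?X \<otimes>\<^sub>o X \<otimes>\<^sub>o ?Y)"
      by ((assumption | rule typing duality_typed typed | simp only: ob_simps)+)
    have 2: "ident C ?Z \<otimes>\<^sub>m braid C ?A ?Y \<in> hom C (?Z \<otimes>\<^sub>o ?X \<otimes>\<^sub>o X \<otimes>\<^sub>o ?Y) (?Z \<otimes>\<^sub>o ?Y \<otimes>\<^sub>o ?X \<otimes>\<^sub>o X)"
      by ((assumption | rule typing duality_typed typed | simp only: ob_simps)+)
    have 3: "(braid C ?A ?Z \<otimes>\<^sub>m ident C ?Y) \<otimes>\<^sub>m ident C (Y \<otimes>\<^sub>o Z) = (braid C ?A ?Z \<otimes>\<^sub>m ident C (?Y \<otimes>\<^sub>o Y)) \<otimes>\<^sub>m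
      ident C Z"
      unfolding tensor_ident_ob[OF braid_in_hom, symmetric] tensor_ob_assoc ..
    show ?thesis
      unfolding dual_tensor hexagon_right[of ?A ?Z ?Y] comp_tensor_ident[OF 1 2] ZbetaZ 3 ..
  qed
  also have "\<iota> (X \<otimes>\<^sub>o Y \<otimes>\<^sub>o Z) \<cdot> ((braid C ?A (dual C (Y \<otimes>\<^sub>o Z)) \<otimes>\<^sub>m ident C (Y \<otimes>\<^sub>o Z)) \<cdot> (ident C ?A \<otimes>\<^sub>m ?c)) =
      mult_family X (Y \<otimes>\<^sub>o Z) \<cdot> (ident C ?A \<otimes>\<^sub>m ?c)"
  proof -
    have 1: "braid C ?A (dual C (Y \<otimes>\<^sub>o Z)) \<otimes>\<^sub>m ident C (Y \<otimes>\<^sub>o Z) \<in> hom C (?X \<otimes>\<^sub>o X \<otimes>\<^sub>o ?Z \<otimes>\<^sub>o ?Y \<otimes>\<^sub>o Y \<otimes>\<^sub>o Z) (?Z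
      \<otimes>\<^sub>o ?Y \<otimes>\<^sub>o ?X \<otimes>\<^sub>o X \<otimes>\<^sub>o Y \<otimes>\<^sub>o Z)"
      unfolding dual_tensor by ((assumption | rule typing duality_typed typed | simp only: ob_simps)+)
    show ?thesis unfolding mult_family_def tensor_ob_assoc[of X Y Z]
      by (rule comp_assoc[OF Ac 1 \<iota>3[unfolded tensor_ob_assoc[of X Y Z]]])
  qed
  also have "\<dots> = \<mu> \<cdot> ((\<iota> X \<otimes>\<^sub>m \<iota> (Y \<otimes>\<^sub>o Z)) \<cdot> (ident C ?A \<otimes>\<^sub>m ?c))"
    unfolding mult_\<iota>[symmetric]
    by (rule comp_assoc[OF tensor_in_hom[OF ident_in_hom c] tensor_in_hom[OF \<iota>_in_hom \<iota>_in_hom]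
      mult_in_hom, symmetric])
  also have "(\<iota> X \<otimes>\<^sub>m \<iota> (Y \<otimes>\<^sub>o Z)) \<cdot> (ident C ?A \<otimes>\<^sub>m ?c) = \<iota> X \<otimes>\<^sub>m mult_family Y Z"
    unfolding mult_family_def
    using tensor_comp[OF ident_in_hom \<iota>_in_hom c \<iota>_in_hom, of X] by (simp add: comp_ident_right[OF \<iota>_in_hom])
  also have "\<mu> \<cdot> (\<iota> X \<otimes>\<^sub>m mult_family Y Z) = \<mu> \<cdot> (ident C L \<otimes>\<^sub>m \<mu>) \<cdot> (\<iota> X \<otimes>\<^sub>m (\<iota> Y \<otimes>\<^sub>m \<iota> Z))"
  proof -
    have "(ident C L \<otimes>\<^sub>m \<mu>) \<cdot> (\<iota> X \<otimes>\<^sub>m (\<iota> Y \<otimes>\<^sub>m \<iota> Z)) = (ident C L \<cdot> \<iota> X) \<otimes>\<^sub>m (\<mu> \<cdot> (\<iota> Y \<otimes>\<^sub>m \<iota> Z))"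
      by (rule tensor_comp[OF \<iota>_in_hom ident_in_hom tensor_in_hom[OF \<iota>_in_hom \<iota>_in_hom] mult_in_hom, symmetric])
    then show ?thesis
      unfolding comp_assoc[OF \<iota>\<iota>\<iota> L\<mu> mult_in_hom, symmetric] mult_\<iota> comp_ident_left[OF \<iota>_in_hom] by simp
  qed
  finally show "\<mu> \<cdot> (\<mu> \<otimes>\<^sub>m ident C L) \<cdot> (\<iota> X \<otimes>\<^sub>m (\<iota> Y \<otimes>\<^sub>m \<iota> Z)) =
    \<mu> \<cdot> (ident C L \<otimes>\<^sub>m \<mu>) \<cdot> (\<iota> X \<otimes>\<^sub>m (\<iota> Y \<otimes>\<^sub>m \<iota> Z))" .
qed

lemma iso_idempotent_ident: "is_iso C X X f \<Longrightarrow> f \<cdot> f = f \<Longrightarrow> f = ident C X"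
  unfolding is_iso_def by (metis comp_assoc comp_ident_left)

text \<open>The hexagon with two unit objects makes this braiding idempotent, and an idempotent
  isomorphism is an identity.\<close>

lemma braid_unit_right: "braid C X \<one>\<^sub>o = ident C X"
  using hexagon_right[of X "\<one>\<^sub>o" "\<one>\<^sub>o"] braid_iso[of X "\<one>\<^sub>o"] tensor_unit_left[OF braid_in_hom]
    tensor_unit_right[OF braid_in_hom]
  by (intro iso_idempotent_ident) (simp_all add: tensor_ob_unit_left tensor_ob_unit_right)

lemma braid_unit_left: "braid C \<one>\<^sub>o X = ident C X"
  using hexagon_left[of "\<one>\<^sub>o" "\<one>\<^sub>o" X] braid_iso[of "\<one>\<^sub>o" X] tensor_unit_left[OF braid_in_hom]
    tensor_unit_right[OF braid_in_hom]
  by (intro iso_idempotent_ident) (simp_all add: tensor_ob_unit_left tensor_ob_unit_right)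

lemma \<iota>_unit_in_hom: "\<iota> \<one>\<^sub>o \<in> hom C \<one>\<^sub>o L"
  using \<iota>_in_hom[of "\<one>\<^sub>o"] by (simp add: dual_unit tensor_ob_unit_left)

lemma mult_unit_left: "\<mu> \<cdot> (\<iota> \<one>\<^sub>o \<otimes>\<^sub>m ident C L) = ident C L"
proof (rule coend_ext)
  have u: "\<iota> \<one>\<^sub>o \<otimes>\<^sub>m ident C L \<in> hom C L (L \<otimes>\<^sub>o L)"
    using tensor_in_hom[OF \<iota>_unit_in_hom ident_in_hom, of L] by (simp add: tensor_ob_unit_left)
  show "\<mu> \<cdot> (\<iota> \<one>\<^sub>o \<otimes>\<^sub>m ident C L) \<in> hom C L L" by (rule comp_in_hom[OF u mult_in_hom])
  show "ident C L \<in> hom C L L" by (rule ident_in_hom)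
  fix X
  have "\<mu> \<cdot> (\<iota> \<one>\<^sub>o \<otimes>\<^sub>m ident C L) \<cdot> \<iota> X = \<mu> \<cdot> ((\<iota> \<one>\<^sub>o \<otimes>\<^sub>m ident C L) \<cdot> (ident C \<one>\<^sub>o \<otimes>\<^sub>m \<iota> X))"
    unfolding tensor_unit_left[OF \<iota>_in_hom] by (rule comp_assoc[OF \<iota>_in_hom u mult_in_hom, symmetric])
  also have "\<dots> = mult_family \<one>\<^sub>o X" unfolding tensor_interchange_left[OF \<iota>_unit_in_hom \<iota>_in_hom] mult_\<iota> ..
  also have "\<dots> = \<iota> X"
    unfolding mult_family_def dual_unit tensor_ob_unit_left braid_unit_left tensor_ident
      by (rule comp_ident_right[OF \<iota>_in_hom])
  finally show "\<mu> \<cdot> (\<iota> \<one>\<^sub>o \<otimes>\<^sub>m ident C L) \<cdot> \<iota> X = ident C L \<cdot> \<iota> X" unfolding comp_ident_left[OF \<iota>_in_hom] .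
qed

lemma mult_unit_right: "\<mu> \<cdot> (ident C L \<otimes>\<^sub>m \<iota> \<one>\<^sub>o) = ident C L"
proof (rule coend_ext)
  have u: "ident C L \<otimes>\<^sub>m \<iota> \<one>\<^sub>o \<in> hom C L (L \<otimes>\<^sub>o L)"
    using tensor_in_hom[OF ident_in_hom \<iota>_unit_in_hom, of L] by (simp add: tensor_ob_unit_right)
  show "\<mu> \<cdot> (ident C L \<otimes>\<^sub>m \<iota> \<one>\<^sub>o) \<in> hom C L L" by (rule comp_in_hom[OF u mult_in_hom])
  show "ident C L \<in> hom C L L" by (rule ident_in_hom)
  fix X
  have "\<mu> \<cdot> (ident C L \<otimes>\<^sub>m \<iota> \<one>\<^sub>o) \<cdot> \<iota> X = \<mu> \<cdot> ((ident C L \<otimes>\<^sub>m \<iota> \<one>\<^sub>o) \<cdot> (\<iota> X \<otimes>\<^sub>m ident C \<one>\<^sub>o))"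
    unfolding tensor_unit_right[OF \<iota>_in_hom] by (rule comp_assoc[OF \<iota>_in_hom u mult_in_hom, symmetric])
  also have "\<dots> = mult_family X \<one>\<^sub>o" unfolding tensor_interchange_right[OF \<iota>_in_hom \<iota>_unit_in_hom] mult_\<iota> ..
  also have "\<dots> = \<iota> X"
    unfolding mult_family_def dual_unit tensor_ob_unit_right braid_unit_right tensor_ident
      by (rule comp_ident_right[OF \<iota>_in_hom])
  finally show "\<mu> \<cdot> (ident C L \<otimes>\<^sub>m \<iota> \<one>\<^sub>o) \<cdot> \<iota> X = ident C L \<cdot> \<iota> X" unfolding comp_ident_left[OF \<iota>_in_hom] .
qed

section \<open>Cocharacters and defect operators\<close>

abbreviation \<chi> :: "'o \<Rightarrow> 'm" where "\<chi> \<equiv> internal_cocharacter C \<iota>"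
abbreviation \<O> :: "'o \<Rightarrow> 'm" where "\<O> \<equiv> defect_operator C L \<iota>"

lemma cocharacter_in_hom: "\<chi> D \<in> hom C \<one>\<^sub>o L"
  unfolding internal_cocharacter_def by (rule comp_in_hom[OF coev_dual_in_hom \<iota>_in_hom])

text \<open>In the zigzag at the unit object the evaluation is the identity, which leaves only the
  coevaluation.\<close>

lemma coev_unit: "coev C \<one>\<^sub>o = ident C \<one>\<^sub>o"
  using zigzag_dual[of "\<one>\<^sub>o"] coev_in_hom[of "\<one>\<^sub>o"]
  by (simp add: dual_unit ev_unit tensor_ident tensor_ob_unit_left tensor_unit_left comp_ident_left)

lemma cocharacter_unit: "\<chi> \<one>\<^sub>o = \<iota> \<one>\<^sub>o"
  unfolding internal_cocharacter_def dual_unit coev_unit by (rule comp_ident_right[OF \<iota>_unit_in_hom])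

text \<open>The coevaluation of \<open>D\<close> starts at the unit object, so the braiding becomes
  trivial when the coevaluation is slid through it. The two nested coevaluations that remain are the
  coevaluation of \<open>D \<otimes> E\<close>.\<close>

lemma mult_cocharacter: "\<mu> \<cdot> (\<chi> D \<otimes>\<^sub>m \<chi> E) = \<chi> (D \<otimes>\<^sub>o E)"
proof -
  note typed = coend_typed
  let ?D = "dual C D" and ?E = "dual C E"
  let ?k = "\<lambda>X. coev C (dual C X)"
  have kE: "?k D \<otimes>\<^sub>m ident C (?E \<otimes>\<^sub>o E) \<in> hom C (?E \<otimes>\<^sub>o E) (?D \<otimes>\<^sub>o D \<otimes>\<^sub>o ?E \<otimes>\<^sub>o E)"
    by ((assumption | rule typing duality_typed typed | simp only: ob_simps)+)
  have EkE: "(ident C ?E \<otimes>\<^sub>m ?k D) \<otimes>\<^sub>m ident C E \<in> hom C (?E \<otimes>\<^sub>o E) (?E \<otimes>\<^sub>o ?D \<otimes>\<^sub>o D \<otimes>\<^sub>o E)"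
    by ((assumption | rule typing duality_typed typed | simp only: ob_simps)+)
  have "\<chi> D \<otimes>\<^sub>m \<chi> E = (\<iota> D \<otimes>\<^sub>m \<iota> E) \<cdot> (?k D \<otimes>\<^sub>m ?k E)"
    unfolding internal_cocharacter_def by (rule tensor_comp[OF coev_dual_in_hom \<iota>_in_hom coev_dual_in_hom
      \<iota>_in_hom])
  then have "\<mu> \<cdot> (\<chi> D \<otimes>\<^sub>m \<chi> E) = mult_family D E \<cdot> (?k D \<otimes>\<^sub>m ?k E)"
    using comp_assoc[OF tensor_in_hom[OF coev_dual_in_hom coev_dual_in_hom] tensor_in_hom[OF \<iota>_in_hom
      \<iota>_in_hom] mult_in_hom, of D E]
    unfolding mult_\<iota> by simp
  also have "?k D \<otimes>\<^sub>m ?k E = (?k D \<otimes>\<^sub>m ident C (?E \<otimes>\<^sub>o E)) \<cdot> ?k E"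
    using tensor_interchange_left[OF coev_dual_in_hom coev_dual_in_hom, of D E]
    unfolding tensor_unit_left[OF coev_dual_in_hom] by simp
  also have "mult_family D E \<cdot> ((?k D \<otimes>\<^sub>m ident C (?E \<otimes>\<^sub>o E)) \<cdot> ?k E) =
      (mult_family D E \<cdot> (?k D \<otimes>\<^sub>m ident C (?E \<otimes>\<^sub>o E))) \<cdot> ?k E"
    by (rule comp_assoc[OF coev_dual_in_hom kE mult_family_in_hom])
  also have "mult_family D E \<cdot> (?k D \<otimes>\<^sub>m ident C (?E \<otimes>\<^sub>o E)) = \<iota> (D \<otimes>\<^sub>o E) \<cdot> ((ident C ?E \<otimes>\<^sub>m ?k D) \<otimes>\<^sub>m ident C E)"
  proof -
    have "mult_family D E \<cdot> (?k D \<otimes>\<^sub>m ident C (?E \<otimes>\<^sub>o E)) =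
        \<iota> (D \<otimes>\<^sub>o E) \<cdot> ((braid C (?D \<otimes>\<^sub>o D) ?E \<otimes>\<^sub>m ident C E) \<cdot> (?k D \<otimes>\<^sub>m ident C (?E \<otimes>\<^sub>o E)))"
      unfolding mult_family_def by (rule comp_assoc[OF kE braid_mult_in_hom \<iota>_tensor_in_hom, symmetric])
    then show ?thesis
      unfolding braid_slide_left[OF coev_dual_in_hom] braid_unit_left tensor_ident comp_ident_right[OF EkE] .
  qed
  also have "(\<iota> (D \<otimes>\<^sub>o E) \<cdot> ((ident C ?E \<otimes>\<^sub>m ?k D) \<otimes>\<^sub>m ident C E)) \<cdot> ?k E =
      \<iota> (D \<otimes>\<^sub>o E) \<cdot> (((ident C ?E \<otimes>\<^sub>m ?k D) \<otimes>\<^sub>m ident C E) \<cdot> ?k E)"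
    by (rule comp_assoc[OF coev_dual_in_hom EkE \<iota>_tensor_in_hom, symmetric])
  also have "((ident C ?E \<otimes>\<^sub>m ?k D) \<otimes>\<^sub>m ident C E) \<cdot> ?k E = coev C (dual C (D \<otimes>\<^sub>o E))"
    unfolding dual_tensor coev_tensor dual_dual ..
  finally show ?thesis unfolding internal_cocharacter_def .
qed

lemma cocharacter_tensor_in_hom: "\<chi> D \<otimes>\<^sub>m ident C L \<in> hom C L (L \<otimes>\<^sub>o L)"
  using tensor_in_hom[OF cocharacter_in_hom ident_in_hom, of D L] by (simp add: tensor_ob_unit_left)

lemma defect_in_hom: "\<O> D \<in> hom C L L"
  unfolding defect_operator_def by (rule comp_in_hom[OF cocharacter_tensor_in_hom mult_in_hom])

lemma defect_unit: "\<O> \<one>\<^sub>o = ident C L"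
  unfolding defect_operator_def cocharacter_unit by (rule mult_unit_left)

text \<open>Evaluation at the unit of \<open>L\<close> recovers the cocharacter, so every linear
  relation between defect operators is one between cocharacters.\<close>

lemma defect_comp_unit: "\<O> D \<cdot> \<iota> \<one>\<^sub>o = \<chi> D"
proof -
  have "\<O> D \<cdot> \<iota> \<one>\<^sub>o = \<mu> \<cdot> ((\<chi> D \<otimes>\<^sub>m ident C L) \<cdot> (ident C \<one>\<^sub>o \<otimes>\<^sub>m \<iota> \<one>\<^sub>o))"
    unfolding defect_operator_def tensor_unit_left[OF \<iota>_unit_in_hom]
    by (rule comp_assoc[OF \<iota>_unit_in_hom cocharacter_tensor_in_hom mult_in_hom, symmetric])
  also have "\<dots> = \<mu> \<cdot> ((ident C L \<otimes>\<^sub>m \<iota> \<one>\<^sub>o) \<cdot> \<chi> D)"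
    unfolding tensor_slide[OF cocharacter_in_hom \<iota>_unit_in_hom] tensor_unit_right[OF cocharacter_in_hom] ..
  also have "\<dots> = \<mu> \<cdot> (ident C L \<otimes>\<^sub>m \<iota> \<one>\<^sub>o) \<cdot> \<chi> D"
    by (rule comp_assoc[OF cocharacter_in_hom _ mult_in_hom])
      (use tensor_in_hom[OF ident_in_hom \<iota>_unit_in_hom, of L] in \<open>simp add: tensor_ob_unit_right\<close>)
  finally show ?thesis unfolding mult_unit_right comp_ident_left[OF cocharacter_in_hom] .
qed

lemma cocharacter_mult_slide:
  "(\<chi> D \<otimes>\<^sub>m ident C L) \<cdot> \<mu> = (ident C L \<otimes>\<^sub>m \<mu>) \<cdot> (\<chi> D \<otimes>\<^sub>m ident C (L \<otimes>\<^sub>o L))"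
  using tensor_slide[OF cocharacter_in_hom mult_in_hom, of D] unfolding tensor_unit_left[OF mult_in_hom] .

text \<open>Left and right multiplication commute by associativity.\<close>

lemma defect_mult: "\<O> D \<cdot> \<mu> = \<mu> \<cdot> (\<O> D \<otimes>\<^sub>m ident C L)"
proof -
  note typed = hom_typed[OF cocharacter_in_hom] hom_typed[OF mult_in_hom]
  have \<chi>LL: "\<chi> D \<otimes>\<^sub>m ident C (L \<otimes>\<^sub>o L) \<in> hom C (L \<otimes>\<^sub>o L) (L \<otimes>\<^sub>o L \<otimes>\<^sub>o L)"
    by ((assumption | rule typing duality_typed typed | simp only: ob_simps)+)
  have L\<mu>: "ident C L \<otimes>\<^sub>m \<mu> \<in> hom C (L \<otimes>\<^sub>o L \<otimes>\<^sub>o L) (L \<otimes>\<^sub>o L)"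
    by ((assumption | rule typing duality_typed typed | simp only: ob_simps)+)
  have \<mu>L: "\<mu> \<otimes>\<^sub>m ident C L \<in> hom C (L \<otimes>\<^sub>o L \<otimes>\<^sub>o L) (L \<otimes>\<^sub>o L)"
    by ((assumption | rule typing duality_typed typed | simp only: ob_simps)+)
  have "\<O> D \<cdot> \<mu> = \<mu> \<cdot> ((\<chi> D \<otimes>\<^sub>m ident C L) \<cdot> \<mu>)"
    unfolding defect_operator_def by (rule comp_assoc[OF mult_in_hom cocharacter_tensor_in_hom
      mult_in_hom, symmetric])
  also have "\<dots> = \<mu> \<cdot> (ident C L \<otimes>\<^sub>m \<mu>) \<cdot> (\<chi> D \<otimes>\<^sub>m ident C (L \<otimes>\<^sub>o L))"
    unfolding cocharacter_mult_slide by (rule comp_assoc[OF \<chi>LL L\<mu> mult_in_hom])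
  also have "\<dots> = \<mu> \<cdot> ((\<mu> \<otimes>\<^sub>m ident C L) \<cdot> (\<chi> D \<otimes>\<^sub>m ident C (L \<otimes>\<^sub>o L)))"
    unfolding mult_assoc[symmetric] by (rule comp_assoc[OF \<chi>LL \<mu>L mult_in_hom, symmetric])
  also have "(\<mu> \<otimes>\<^sub>m ident C L) \<cdot> (\<chi> D \<otimes>\<^sub>m ident C (L \<otimes>\<^sub>o L)) = \<O> D \<otimes>\<^sub>m ident C L"
    unfolding defect_operator_def comp_tensor_ident[OF cocharacter_tensor_in_hom mult_in_hom]
      tensor_ident_ob[OF cocharacter_in_hom] ..
  finally show ?thesis .
qed

text \<open>As a module map, \<open>\<O> D\<close> acts on the point \<open>\<chi> E\<close> inside
  \<open>\<O> E\<close>; by \<open>mult_cocharacter\<close> the result is the cocharacter of the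
  product.\<close>

lemma defect_comp: "\<O> D \<cdot> \<O> E = \<O> (D \<otimes>\<^sub>o E)"
proof -
  have 1: "\<O> D \<otimes>\<^sub>m ident C L \<in> hom C (L \<otimes>\<^sub>o L) (L \<otimes>\<^sub>o L)" by (rule tensor_in_hom[OF defect_in_hom ident_in_hom])
  have "\<O> D \<cdot> \<O> E = \<O> D \<cdot> \<mu> \<cdot> (\<chi> E \<otimes>\<^sub>m ident C L)"
    unfolding defect_operator_def[of C L \<iota> E] by (rule comp_assoc[OF cocharacter_tensor_in_hom mult_in_hom
      defect_in_hom])
  also have "\<dots> = \<mu> \<cdot> ((\<O> D \<otimes>\<^sub>m ident C L) \<cdot> (\<chi> E \<otimes>\<^sub>m ident C L))"
    unfolding defect_mult by (rule comp_assoc[OF cocharacter_tensor_in_hom 1 mult_in_hom, symmetric])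
  also have "(\<O> D \<otimes>\<^sub>m ident C L) \<cdot> (\<chi> E \<otimes>\<^sub>m ident C L) = (\<O> D \<cdot> \<chi> E) \<otimes>\<^sub>m ident C L"
    by (rule comp_tensor_ident[OF cocharacter_in_hom defect_in_hom, symmetric])
  also have "\<O> D \<cdot> \<chi> E = \<chi> (D \<otimes>\<^sub>o E)"
  proof -
    have "\<O> D \<cdot> \<chi> E = \<mu> \<cdot> ((\<chi> D \<otimes>\<^sub>m ident C L) \<cdot> (ident C \<one>\<^sub>o \<otimes>\<^sub>m \<chi> E))"
      unfolding defect_operator_def tensor_unit_left[OF cocharacter_in_hom]
      by (rule comp_assoc[OF cocharacter_in_hom cocharacter_tensor_in_hom mult_in_hom, symmetric])
    then show ?thesis
      unfolding tensor_interchange_left[OF cocharacter_in_hom cocharacter_in_hom] mult_cocharacter .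
  qed
  finally show ?thesis unfolding defect_operator_def .
qed

end

section \<open>Cocharacters as traces: additivity and independence\<close>

context strict_pivotal_category
begin

text \<open>If \<open>j Y \<circ> curry_left Y A m\<close> is read as a partial trace of \<open>m\<close> over \<open>Y\<close>, this is
  \<open>tr (a m) = tr (m a)\<close>.\<close>

lemma dinatural_cyclic:
  assumes j: "dinatural C T j" and m: "m \<in> hom C (Y \<otimes>\<^sub>o A) X" and a: "a \<in> hom C X Y"
  shows "j Y \<cdot> curry_left Y A (a \<cdot> m) = j X \<cdot> curry_left X A (m \<cdot> (a \<otimes>\<^sub>m ident C A))"
proof -
  have jin: "j Z \<in> hom C (dual C Z \<otimes>\<^sub>o Z) T" for Z using j by (simp add: dinatural_def)
  have Ya: "ident C (dual C Y) \<otimes>\<^sub>m a \<in> hom C (dual C Y \<otimes>\<^sub>o X) (dual C Y \<otimes>\<^sub>o Y)"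
    by (rule tensor_in_hom[OF ident_in_hom a])
  have aX: "dual_mor C X Y a \<otimes>\<^sub>m ident C X \<in> hom C (dual C Y \<otimes>\<^sub>o X) (dual C X \<otimes>\<^sub>o X)"
    by (rule tensor_in_hom[OF dual_mor_in_hom[OF a] ident_in_hom])
  have "j Y \<cdot> (ident C (dual C Y) \<otimes>\<^sub>m a) = j X \<cdot> (dual_mor C X Y a \<otimes>\<^sub>m ident C X)"
    using j a by (simp add: dinatural_def)
  then show ?thesis
    unfolding curry_left_post[OF m a] curry_left_dual_mor[OF m a]
      comp_assoc[OF curry_left_in_hom[OF m] Ya jin] comp_assoc[OF curry_left_in_hom[OF m] aX jin] by simp
qed

text \<open>Tensoring with \<open>W\<close> from the left has a right adjoint, so it preserves
  epimorphisms; the adjunction is used in the form of \<open>curry_left\<close>.\<close>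

lemma tensor_epi:
  assumes g: "g \<in> hom C Y Z" and epi: "\<And>T h. h \<in> hom C Z T \<Longrightarrow> h \<cdot> g = 0 \<Longrightarrow> h = 0"
    and h: "h \<in> hom C (W \<otimes>\<^sub>o Z) T" and 0: "h \<cdot> (ident C W \<otimes>\<^sub>m g) = 0"
  shows "h = 0"
proof -
  have "curry_left W Z h \<cdot> g = 0"
  proof -
    have "coev C (dual C W) \<otimes>\<^sub>m ident C Y \<in> hom C Y (dual C W \<otimes>\<^sub>o (W \<otimes>\<^sub>o Y))"
      by ((assumption | rule typing duality_typed | simp only: ob_simps)+)
    then have "curry_left W Y 0 = 0"
      unfolding curry_left_def tensor_zero_right[OF ident_in_hom] by (rule comp_zero_left)
    then show ?thesis using curry_left_comp[OF h g] 0 by simp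
  qed
  then have "curry_left W Z h = 0" using epi curry_left_in_hom[OF h] by blast
  then have "h = uncurry_left W T 0" using uncurry_curry_left[OF h] by simp
  moreover have "ev C (dual C W) \<otimes>\<^sub>m ident C T \<in> hom C (W \<otimes>\<^sub>o (dual C W \<otimes>\<^sub>o T)) T"
    by ((assumption | rule typing duality_typed | simp only: ob_simps)+)
  ultimately show ?thesis
    unfolding uncurry_left_def tensor_zero_right[OF ident_in_hom] by (simp add: comp_zero_right)
qed

lemma curry_left_point:
  assumes r: "r \<in> hom C A \<one>\<^sub>o"
  shows "curry_left D A (ident C D \<otimes>\<^sub>m r) = coev C (dual C D) \<cdot> r"
  unfolding curry_left_def ident_ob_tensor[OF r, symmetric]
  using tensor_slide[OF coev_dual_in_hom r, of D]
  unfolding tensor_unit_left[OF r] tensor_unit_right[OF coev_dual_in_hom] by simp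

end

locale coend_progenerated_category = coend_category C L \<iota> + progenerated_category C G
  for C :: "('k::field, 'o, 'm::ab_group_add) ribbon_data" (structure) and L \<iota> G +
  assumes unit_simple: "simple_object C \<one>\<^sub>o"
begin

text \<open>\<open>Z \<otimes> G\<close> is projective: a morphism out of it is a morphism from
  \<open>G\<close> into \<open>dual C Z \<otimes> X\<close>, where tensoring has kept
  \<open>g\<close> epi and \<open>G\<close> lifts through epimorphisms.\<close>

lemma lift_through_epi:
  assumes g: "g \<in> hom C Y X" and epi: "\<And>T h. h \<in> hom C X T \<Longrightarrow> h \<cdot> g = 0 \<Longrightarrow> h = 0"
    and m: "m \<in> hom C (Z \<otimes>\<^sub>o G) X"
  shows "\<exists>k\<in>hom C (Z \<otimes>\<^sub>o G) Y. g \<cdot> k = m"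
proof -
  let ?Z = "dual C Z"
  have Zg: "ident C ?Z \<otimes>\<^sub>m g \<in> hom C (?Z \<otimes>\<^sub>o Y) (?Z \<otimes>\<^sub>o X)" by (rule tensor_in_hom[OF ident_in_hom g])
  have "h = 0" if "h \<in> hom C (?Z \<otimes>\<^sub>o X) V" "h \<cdot> (ident C ?Z \<otimes>\<^sub>m g) = 0" for V h
    using tensor_epi[OF g _ that] epi by blast
  then obtain n where n: "n \<in> hom C G (?Z \<otimes>\<^sub>o Y)" "(ident C ?Z \<otimes>\<^sub>m g) \<cdot> n = curry_left Z G m"
    using epi_surjective[OF Zg _ curry_left_in_hom[OF m]] by blast
  have "g \<cdot> uncurry_left Z Y n = m"
    unfolding uncurry_left_post[OF n(1) g, symmetric] n(2) by (rule uncurry_curry_left[OF m])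
  then show ?thesis using uncurry_left_in_hom[OF n(1)] by blast
qed

text \<open>Any nonzero \<open>r\<close> works: the unit object is simple, so \<open>r\<close>
  generates all morphisms from \<open>G\<close> to it, and what kills \<open>r\<close> kills them
  all.\<close>

lemma unit_cover:
  obtains r where "r \<in> hom C G \<one>\<^sub>o" "\<And>T h. h \<in> hom C \<one>\<^sub>o T \<Longrightarrow> h \<cdot> r = 0 \<Longrightarrow> h = 0"
proof -
  obtain r where r: "r \<in> hom C G \<one>\<^sub>o" "r \<noteq> 0"
    using hom_nonzero[of "\<one>\<^sub>o"] unit_simple by (auto simp: simple_object_def)
  have "h = 0" if h: "h \<in> hom C \<one>\<^sub>o T" and 0: "h \<cdot> r = 0" for T h
  proof (rule faithful[OF h])
    fix k assume k: "k \<in> hom C G \<one>\<^sub>o"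
    obtain a where a: "a \<in> hom C G G" "r \<cdot> a = k" using simple_generated[OF unit_simple r k] by blast
    then show "h \<cdot> k = 0" using comp_assoc[OF a(1) r(1) h] 0 comp_zero_left[OF a(1)] by simp
  qed
  then show thesis using that r(1) by blast
qed

text \<open>After composition with \<open>r\<close> the cocharacter is the partial trace of
  \<open>id \<otimes> r\<close>. This morphism from \<open>D \<otimes> G\<close> to \<open>D\<close>
  can be decomposed along an exact sequence although the identity of \<open>D\<close> in general
  cannot.\<close>

lemma cocharacter_comp:
  assumes r: "r \<in> hom C G \<one>\<^sub>o"
  shows "\<chi> D \<cdot> r = \<iota> D \<cdot> curry_left D G (ident C D \<otimes>\<^sub>m r)"
  unfolding internal_cocharacter_def curry_left_point[OF r]
  by (rule comp_assoc[OF r coev_dual_in_hom \<iota>_in_hom, symmetric])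

lemma point_tensor_in_hom: "r \<in> hom C G \<one>\<^sub>o \<Longrightarrow> ident C D \<otimes>\<^sub>m r \<in> hom C (D \<otimes>\<^sub>o G) D"
  using tensor_in_hom[OF ident_in_hom, of r G "\<one>\<^sub>o" D] by (simp add: tensor_ob_unit_right)

lemma point_tensor_natural:
  assumes r: "r \<in> hom C G \<one>\<^sub>o" and f: "f \<in> hom C X Y"
  shows "f \<cdot> (ident C X \<otimes>\<^sub>m r) = (ident C Y \<otimes>\<^sub>m r) \<cdot> (f \<otimes>\<^sub>m ident C G)"
  using tensor_slide[OF f r] unfolding tensor_unit_right[OF f] .

lemma \<iota>_dinat: "dinatural C L \<iota>"
  using coend by (simp add: is_coend_def)

text \<open>Additivity of traces on short exact sequences: after precomposition with the projective
  cover \<open>r\<close> the identity of \<open>Y\<close> becomes block triangular.\<close>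

lemma cocharacter_additive:
  assumes "short_exact C X Y Z f g"
  shows "\<chi> Y = \<chi> X + \<chi> Z"
proof -
  obtain r where r: "r \<in> hom C G \<one>\<^sub>o" and repi: "\<And>T h. h \<in> hom C \<one>\<^sub>o T \<Longrightarrow> h \<cdot> r = 0 \<Longrightarrow> h = 0"
    using unit_cover by blast
  have ker: "is_kernel C X Y Z f g" and coker: "is_cokernel C X Y Z f g"
    using assms by (auto simp: short_exact_def)
  have f: "f \<in> hom C X Y" and g: "g \<in> hom C Y Z" and gf: "g \<cdot> f = 0" using ker by (auto simp: is_kernel_def)
  let ?r = "\<lambda>D. ident C D \<otimes>\<^sub>m r"
  note rD = point_tensor_in_hom[OF r]
  \<comment> \<open>\<open>k\<close> plays the part of a section of \<open>g\<close>, up to the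
    factor \<open>r\<close>; it exists because \<open>Z \<otimes> G\<close> is projective.\<close>
  obtain k where k: "k \<in> hom C (Z \<otimes>\<^sub>o G) Y" "g \<cdot> k = ?r Z"
    using lift_through_epi[OF g _ rD] cokernel_epi[OF coker] by blast
  have gG: "g \<otimes>\<^sub>m ident C G \<in> hom C (Y \<otimes>\<^sub>o G) (Z \<otimes>\<^sub>o G)" and fG: "f \<otimes>\<^sub>m ident C G \<in> hom C (X \<otimes>\<^sub>o G) (Y \<otimes>\<^sub>o G)"
    using tensor_in_hom f g ident_in_hom by auto
  have kg: "k \<cdot> (g \<otimes>\<^sub>m ident C G) \<in> hom C (Y \<otimes>\<^sub>o G) Y" using gG k(1) by (rule comp_in_hom)
  have "g \<cdot> (?r Y - k \<cdot> (g \<otimes>\<^sub>m ident C G)) = 0"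
    unfolding comp_diff_right[OF rD kg g] comp_assoc[OF gG k(1) g] k(2) point_tensor_natural[OF r g] by simp
  \<comment> \<open>\<open>q\<close> plays the part of the matching retraction onto
    \<open>X\<close>: what \<open>k\<close> leaves over is killed by \<open>g\<close> and so factors
    through \<open>f\<close>.\<close>
  then obtain q where q: "q \<in> hom C (Y \<otimes>\<^sub>o G) X" "f \<cdot> q = ?r Y - k \<cdot> (g \<otimes>\<^sub>m ident C G)"
    using ker hom_diff[OF rD kg] unfolding is_kernel_def by blast
  have fq: "f \<cdot> q \<in> hom C (Y \<otimes>\<^sub>o G) Y" using q(1) f by (rule comp_in_hom)
  have "f \<cdot> (q \<cdot> (f \<otimes>\<^sub>m ident C G)) = f \<cdot> ?r X"
  proof -
    have "(g \<otimes>\<^sub>m ident C G) \<cdot> (f \<otimes>\<^sub>m ident C G) = 0"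
      unfolding comp_tensor_ident[OF f g, symmetric] gf
      using tensor_scale_left[OF hom_zero ident_in_hom, of 0] by simp
    then have "k \<cdot> (g \<otimes>\<^sub>m ident C G) \<cdot> (f \<otimes>\<^sub>m ident C G) = 0"
      unfolding comp_assoc[OF fG gG k(1), symmetric] by (simp add: comp_zero_right[OF k(1)])
    then show ?thesis
      unfolding comp_assoc[OF fG q(1) f] q(2) comp_diff_left[OF fG rD kg] point_tensor_natural[OF r f] by simp
  qed
  then have qf: "q \<cdot> (f \<otimes>\<^sub>m ident C G) = ?r X"
    using kernel_mono[OF ker] comp_in_hom[OF fG q(1)] rD unfolding is_mono_def by blast
  \<comment> \<open>Each summand factors through an outer term, and cyclicity moves its trace there:
    \<open>q \<cdot> (f \<otimes> id)\<close> and \<open>g \<cdot> k\<close> are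
    \<open>id \<otimes> r\<close> on \<open>X\<close> and on \<open>Z\<close>.\<close>
  have split: "?r Y = f \<cdot> q + k \<cdot> (g \<otimes>\<^sub>m ident C G)" unfolding q(2) by simp
  have lin: "curry_left Y G (a + b) = curry_left Y G a + curry_left Y G b"
    if a: "a \<in> hom C (Y \<otimes>\<^sub>o G) Y" and b: "b \<in> hom C (Y \<otimes>\<^sub>o G) Y" for a b
  proof -
    have K: "coev C (dual C Y) \<otimes>\<^sub>m ident C G \<in> hom C G (dual C Y \<otimes>\<^sub>o (Y \<otimes>\<^sub>o G))"
      by ((assumption | rule typing duality_typed | simp only: ob_simps)+)
    show ?thesis
      unfolding curry_left_def tensor_add_right[OF a b ident_in_hom]
      by (rule comp_add_left[OF K tensor_in_hom[OF ident_in_hom a] tensor_in_hom[OF ident_in_hom b]])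
  qed
  have "\<chi> Y \<cdot> r = \<iota> Y \<cdot> curry_left Y G (f \<cdot> q) + \<iota> Y \<cdot> curry_left Y G (k \<cdot> (g \<otimes>\<^sub>m ident C G))"
    unfolding cocharacter_comp[OF r] split lin[OF fq kg]
    by (rule comp_add_right[OF curry_left_in_hom[OF fq] curry_left_in_hom[OF kg] \<iota>_in_hom])
  also have "\<iota> Y \<cdot> curry_left Y G (f \<cdot> q) = \<chi> X \<cdot> r"
    unfolding dinatural_cyclic[OF \<iota>_dinat q(1) f] qf cocharacter_comp[OF r] ..
  also have "\<iota> Y \<cdot> curry_left Y G (k \<cdot> (g \<otimes>\<^sub>m ident C G)) = \<chi> Z \<cdot> r"
    unfolding dinatural_cyclic[OF \<iota>_dinat k(1) g, symmetric] k(2) cocharacter_comp[OF r] ..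
  finally have "(\<chi> Y - (\<chi> X + \<chi> Z)) \<cdot> r = 0"
    using comp_diff_left[OF r cocharacter_in_hom hom_add[OF cocharacter_in_hom cocharacter_in_hom], of Y X Z]
      comp_add_left[OF r cocharacter_in_hom cocharacter_in_hom, of X Z] by simp
  then have "\<chi> Y - (\<chi> X + \<chi> Z) = 0"
    using repi[OF hom_diff[OF cocharacter_in_hom hom_add[OF cocharacter_in_hom cocharacter_in_hom]]] by blast
  then show ?thesis by simp
qed

text \<open>For \<open>w : G \<rightarrow> G \<otimes> G\<close> the functional
  \<open>m \<mapsto> tr (x \<mapsto> m \<circ> (x \<otimes> id) \<circ> w)\<close> on \<open>Hom(X \<otimes> G, X)\<close> is cyclic in \<open>X\<close>. It is therefore induced
  by a dinatural transformation to the coregular object, hence factors through \<open>L\<close>. Choosing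
  \<open>w\<close> as a lift of \<open>b\<close> yields the ordinary characters of the modules \<open>Hom(G, D)\<close>.\<close>

lemma cocharacter_trace:
  assumes b: "b \<in> hom C G G" and 0: "(\<Sum>D\<in>I. scale C (c D) (\<chi> D)) = 0"
  shows "(\<Sum>D\<in>I. c D * linear_trace (hom C G D) (\<lambda>x. x \<cdot> b)) = 0"
proof -
  obtain r where r: "r \<in> hom C G \<one>\<^sub>o" and repi: "\<And>T h. h \<in> hom C \<one>\<^sub>o T \<Longrightarrow> h \<cdot> r = 0 \<Longrightarrow> h = 0"
    using unit_cover by blast
  note rD = point_tensor_in_hom[OF r]
  have epi: "h = 0" if "h \<in> hom C G T" "h \<cdot> (ident C G \<otimes>\<^sub>m r) = 0" for h T
  proof (rule tensor_epi[OF r, where W = G and T = T])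
    show "h \<in> hom C (G \<otimes>\<^sub>o \<one>\<^sub>o) T" using that(1) by (simp add: tensor_ob_unit_right)
  qed (use repi that(2) in auto)
  obtain w where w: "w \<in> hom C G (G \<otimes>\<^sub>o G)" "(ident C G \<otimes>\<^sub>m r) \<cdot> w = b"
    using epi_surjective[OF rD _ b] epi by blast
  obtain T \<epsilon> where \<epsilon>: "linear_map_on (scale C) (*) (hom C G T) \<epsilon>"
    and ex: "\<And>X \<theta>. linear_map_on (scale C) (*) (hom C G X) \<theta> \<Longrightarrow> \<exists>h\<in>hom C X T. \<forall>k\<in>hom C G X. \<epsilon> (h \<cdot> k) = \<theta> k"
    and uniq: "\<And>X h. h \<in> hom C X T \<Longrightarrow> \<forall>k\<in>hom C G X. \<epsilon> (h \<cdot> k) = 0 \<Longrightarrow> h = 0"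
    by (rule coregular_object) (rule that; assumption)
  define t where "t X m = linear_trace (hom C G X) (\<lambda>x. m \<cdot> ((x \<otimes>\<^sub>m ident C G) \<cdot> w))" for X m
  have xw: "(x \<otimes>\<^sub>m ident C G) \<cdot> w \<in> hom C G (X \<otimes>\<^sub>o G)" if "x \<in> hom C G X" for x X
    using comp_in_hom[OF w(1) tensor_in_hom[OF that ident_in_hom]] .
  have xwlin: "linear_map_on (scale C) (scale C) (hom C G X) (\<lambda>x. (x \<otimes>\<^sub>m ident C G) \<cdot> w)" for X
  proof (rule linear_map_onI)
    fix x y assume x: "x \<in> hom C G X" and y: "y \<in> hom C G X"
    show "((x + y) \<otimes>\<^sub>m ident C G) \<cdot> w = (x \<otimes>\<^sub>m ident C G) \<cdot> w + (y \<otimes>\<^sub>m ident C G) \<cdot> w"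
      unfolding tensor_add_left[OF x y ident_in_hom]
      by (rule comp_add_left[OF w(1) tensor_in_hom[OF x ident_in_hom] tensor_in_hom[OF y ident_in_hom]])
    show "(scale C c x \<otimes>\<^sub>m ident C G) \<cdot> w = scale C c ((x \<otimes>\<^sub>m ident C G) \<cdot> w)" for c
      unfolding tensor_scale_left[OF x ident_in_hom]
      by (rule comp_scale_left[OF w(1) tensor_in_hom[OF x ident_in_hom]])
  qed
  have tlin: "linear_map_on (scale C) (*) (hom C (X \<otimes>\<^sub>o G) X) (t X)" for X
  proof (rule linear_map_onI)
    fix m m' assume m: "m \<in> hom C (X \<otimes>\<^sub>o G) X" and m': "m' \<in> hom C (X \<otimes>\<^sub>o G) X"
    note lt = linear_trace_sum[OF hom_subspace, of _ G X]
    have in_hom: "n \<cdot> ((x \<otimes>\<^sub>m ident C G) \<cdot> w) \<in> hom C G X" if "n \<in> hom C (X \<otimes>\<^sub>o G) X" "x \<in> hom C G X" for n x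
      using comp_in_hom[OF xw[OF that(2)] that(1)] .
    \<comment> \<open>A sum over two booleans stands for the sum of two maps, so that
      \<open>linear_trace_sum\<close> applies.\<close>
    have "t X (m + m') = linear_trace (hom C G X)
        (\<lambda>x. \<Sum>i\<in>{True, False}. scale C 1 ((if i then m else m') \<cdot> ((x \<otimes>\<^sub>m ident C G) \<cdot> w)))"
      unfolding t_def using comp_add_left[OF xw m m'] by (intro linear_trace_cong) simp
    also have "\<dots> = (\<Sum>i\<in>{True, False}. 1 * linear_trace (hom C G X) (\<lambda>x. (if i then m else m') \<cdot> ((x \<otimes>\<^sub>m
      ident C G) \<cdot> w)))"
      using in_hom m m' by (intro linear_trace_sum[OF hom_subspace]) auto
    finally show "t X (m + m') = t X m + t X m'" by (simp add: t_def)
    fix c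
    have "t X (scale C c m) = linear_trace (hom C G X) (\<lambda>x. \<Sum>i\<in>{()}. scale C c (m \<cdot> ((x \<otimes>\<^sub>m ident C G) \<cdot> w)))"
      unfolding t_def using comp_scale_left[OF xw m] by (intro linear_trace_cong) simp
    also have "\<dots> = (\<Sum>i\<in>{()}. c * linear_trace (hom C G X) (\<lambda>x. m \<cdot> ((x \<otimes>\<^sub>m ident C G) \<cdot> w)))"
      using in_hom m by (intro linear_trace_sum[OF hom_subspace]) auto
    finally show "t X (scale C c m) = c * t X m" by (simp add: t_def)
  qed
  have tcyc: "t Y (a \<cdot> m) = t X (m \<cdot> (a \<otimes>\<^sub>m ident C G))"
    if m: "m \<in> hom C (Y \<otimes>\<^sub>o G) X" and a: "a \<in> hom C X Y" for X Y m a
  proof -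
    obtain B B' where B: "finite B" "hom C G Y \<subseteq> span B" and B': "finite B'" "hom C G X \<subseteq> span B'"
      using hom_finite_dim by meson
    have "t Y (a \<cdot> m) = linear_trace (hom C G Y) (\<lambda>y. a \<cdot> (m \<cdot> ((y \<otimes>\<^sub>m ident C G) \<cdot> w)))"
      unfolding t_def using comp_assoc[OF xw m a] by (intro linear_trace_cong) simp
    also have "\<dots> = linear_trace (hom C G X) (\<lambda>x. m \<cdot> (((a \<cdot> x) \<otimes>\<^sub>m ident C G) \<cdot> w))"
    proof (rule linear_trace_cyclic[OF hom_subspace B(2,1) hom_subspace B'(2,1) _ _ comp_linear_right[OF a]])
      show "linear_map_on (scale C) (scale C) (hom C G Y) (\<lambda>y. m \<cdot> ((y \<otimes>\<^sub>m ident C G) \<cdot> w))"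
        by (rule linear_map_on_comp[OF xwlin _ comp_linear_right[OF m]]) (rule xw)
      show "m \<cdot> ((y \<otimes>\<^sub>m ident C G) \<cdot> w) \<in> hom C G X" if "y \<in> hom C G Y" for y
        by (rule comp_in_hom[OF xw[OF that] m])
      show "a \<cdot> x \<in> hom C G Y" if "x \<in> hom C G X" for x by (rule comp_in_hom[OF that a])
    qed
    also have "\<dots> = t X (m \<cdot> (a \<otimes>\<^sub>m ident C G))"
      unfolding t_def
    proof (rule linear_trace_cong)
      fix x assume x: "x \<in> hom C G X"
      have aG: "a \<otimes>\<^sub>m ident C G \<in> hom C (X \<otimes>\<^sub>o G) (Y \<otimes>\<^sub>o G)" by (rule tensor_in_hom[OF a ident_in_hom])
      have xG: "x \<otimes>\<^sub>m ident C G \<in> hom C (G \<otimes>\<^sub>o G) (X \<otimes>\<^sub>o G)" by (rule tensor_in_hom[OF x ident_in_hom])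
      show "m \<cdot> (((a \<cdot> x) \<otimes>\<^sub>m ident C G) \<cdot> w) = m \<cdot> (a \<otimes>\<^sub>m ident C G) \<cdot> ((x \<otimes>\<^sub>m ident C G) \<cdot> w)"
        unfolding comp_assoc[OF xw[OF x] aG m, symmetric] comp_assoc[OF w(1) xG aG] comp_tensor_ident[OF x a] ..
    qed
    finally show ?thesis .
  qed
  \<comment> \<open>The functional \<open>t X\<close>, carried over to morphisms from
    \<open>G\<close> to \<open>dual C X \<otimes> X\<close> by uncurrying, is represented by a
    morphism to the coregular object; this will be \<open>j X\<close>.\<close>
  have "\<exists>h\<in>hom C (dual C X \<otimes>\<^sub>o X) T. \<forall>n\<in>hom C G (dual C X \<otimes>\<^sub>o X). \<epsilon> (h \<cdot> n) = t X (uncurry_left X X n)" for X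
  proof (rule ex, rule linear_map_on_comp[OF _ _ tlin])
    let ?e = "ev C (dual C X) \<otimes>\<^sub>m ident C X"
    have e: "?e \<in> hom C (X \<otimes>\<^sub>o (dual C X \<otimes>\<^sub>o X)) X"
      by ((assumption | rule typing duality_typed | simp only: ob_simps)+)
    show "linear_map_on (scale C) (scale C) (hom C G (dual C X \<otimes>\<^sub>o X)) (uncurry_left X X)"
    proof (rule linear_map_onI)
      fix n n' assume n: "n \<in> hom C G (dual C X \<otimes>\<^sub>o X)" and n': "n' \<in> hom C G (dual C X \<otimes>\<^sub>o X)"
      show "uncurry_left X X (n + n') = uncurry_left X X n + uncurry_left X X n'"
        unfolding uncurry_left_def tensor_add_right[OF n n' ident_in_hom]
        by (rule comp_add_right[OF tensor_in_hom[OF ident_in_hom n] tensor_in_hom[OF ident_in_hom n'] e])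
      show "uncurry_left X X (scale C c n) = scale C c (uncurry_left X X n)" for c
        unfolding uncurry_left_def tensor_scale_right[OF ident_in_hom n]
        by (rule comp_scale_right[OF tensor_in_hom[OF ident_in_hom n] e])
    qed
  qed (rule uncurry_left_in_hom)
  then obtain j where j: "\<And>X. j X \<in> hom C (dual C X \<otimes>\<^sub>o X) T"
    "\<And>X n. n \<in> hom C G (dual C X \<otimes>\<^sub>o X) \<Longrightarrow> \<epsilon> (j X \<cdot> n) = t X (uncurry_left X X n)" by metis
  have \<epsilon>diff: "\<epsilon> (x - y) = \<epsilon> x - \<epsilon> y" if "x \<in> hom C G T" "y \<in> hom C G T" for x y
    using linear_map_onD(1)[OF \<epsilon> hom_diff[OF that] that(2)] by simp
  have \<epsilon>0: "\<epsilon> 0 = 0" using linear_map_onD(2)[OF \<epsilon> hom_zero, of 0] by simp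
  have "dinatural C T j"
    unfolding dinatural_def
  proof (intro conjI allI ballI j(1))
    fix X Y f assume f: "f \<in> hom C X Y"
    let ?Yf = "ident C (dual C Y) \<otimes>\<^sub>m f" and ?fX = "dual_mor C X Y f \<otimes>\<^sub>m ident C X"
    have Yf: "?Yf \<in> hom C (dual C Y \<otimes>\<^sub>o X) (dual C Y \<otimes>\<^sub>o Y)" by (rule tensor_in_hom[OF ident_in_hom f])
    have fX: "?fX \<in> hom C (dual C Y \<otimes>\<^sub>o X) (dual C X \<otimes>\<^sub>o X)" by (rule tensor_in_hom[OF dual_mor_in_hom[OF f]
      ident_in_hom])
    have jY: "j Y \<cdot> ?Yf \<in> hom C (dual C Y \<otimes>\<^sub>o X) T" and jX: "j X \<cdot> ?fX \<in> hom C (dual C Y \<otimes>\<^sub>o X) T"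
      by (rule comp_in_hom[OF Yf j(1)]) (rule comp_in_hom[OF fX j(1)])
    \<comment> \<open>Morphisms to \<open>T\<close> agree once \<open>\<epsilon>\<close> agrees
      after composition with everything from \<open>G\<close>, and there the claim is the cyclicity
      \<open>tcyc\<close>.\<close>
    have "j Y \<cdot> ?Yf - j X \<cdot> ?fX = 0"
    proof (rule uniq[OF hom_diff[OF jY jX]], rule ballI)
      fix n assume n: "n \<in> hom C G (dual C Y \<otimes>\<^sub>o X)"
      have "\<epsilon> (j Y \<cdot> ?Yf \<cdot> n) = t Y (f \<cdot> uncurry_left Y X n)"
        unfolding comp_assoc[OF n Yf j(1), symmetric] j(2)[OF comp_in_hom[OF n Yf]] uncurry_left_post[OF n f] ..
      also have "\<dots> = t X (uncurry_left Y X n \<cdot> (f \<otimes>\<^sub>m ident C G))"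
        by (rule tcyc[OF uncurry_left_in_hom[OF n] f])
      also have "\<dots> = \<epsilon> (j X \<cdot> ?fX \<cdot> n)"
        unfolding comp_assoc[OF n fX j(1), symmetric] j(2)[OF comp_in_hom[OF n fX]]
          uncurry_left_dual_mor[OF n f] ..
      finally show "\<epsilon> ((j Y \<cdot> ?Yf - j X \<cdot> ?fX) \<cdot> n) = 0"
        unfolding comp_diff_left[OF n jY jX] \<epsilon>diff[OF comp_in_hom[OF n jY] comp_in_hom[OF n jX]] by simp
    qed
    then show "j Y \<cdot> ?Yf = j X \<cdot> ?fX" by simp
  qed
  from coend_exists[OF this] obtain h where h: "h \<in> hom C L T" "\<And>X. h \<cdot> \<iota> X = j X" by blast
  \<comment> \<open>Here the choice of \<open>w\<close> pays off: \<open>id \<otimes> r\<close>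
    slides past \<open>x\<close> and meets \<open>w\<close>, which leaves \<open>b\<close>.\<close>
  have val: "\<epsilon> (h \<cdot> (\<chi> D \<cdot> r)) = linear_trace (hom C G D) (\<lambda>x. x \<cdot> b)" for D
  proof -
    have cl: "curry_left D G (ident C D \<otimes>\<^sub>m r) \<in> hom C G (dual C D \<otimes>\<^sub>o D)" by (rule curry_left_in_hom[OF rD])
    have "\<epsilon> (h \<cdot> (\<chi> D \<cdot> r)) = t D (ident C D \<otimes>\<^sub>m r)"
      unfolding cocharacter_comp[OF r] comp_assoc[OF cl \<iota>_in_hom h(1)] h(2) j(2)[OF cl]
        uncurry_curry_left[OF rD] ..
    also have "\<dots> = linear_trace (hom C G D) (\<lambda>x. x \<cdot> b)"
      unfolding t_def
    proof (rule linear_trace_cong)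
      fix x assume x: "x \<in> hom C G D"
      have xG: "x \<otimes>\<^sub>m ident C G \<in> hom C (G \<otimes>\<^sub>o G) (D \<otimes>\<^sub>o G)" by (rule tensor_in_hom[OF x ident_in_hom])
      show "(ident C D \<otimes>\<^sub>m r) \<cdot> ((x \<otimes>\<^sub>m ident C G) \<cdot> w) = x \<cdot> b"
        unfolding comp_assoc[OF w(1) xG rD] point_tensor_natural[OF r x, symmetric] comp_assoc[OF w(1) rD
          x, symmetric] w(2) ..
    qed
    finally show ?thesis .
  qed
  have "linear_map_on (scale C) (*) (hom C \<one>\<^sub>o L) (\<lambda>x. \<epsilon> (h \<cdot> (x \<cdot> r)))"
    by (rule linear_map_on_comp[OF linear_map_on_comp[OF comp_linear_left[OF r] _ comp_linear_right[OF
      h(1)]] _ \<epsilon>])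
      (use comp_in_hom[OF r] comp_in_hom[OF _ h(1)] in auto)
  from linear_map_on_sum[OF hom_subspace this, of I \<chi> c]
  have "\<epsilon> (h \<cdot> ((\<Sum>D\<in>I. scale C (c D) (\<chi> D)) \<cdot> r)) = (\<Sum>D\<in>I. c D * linear_trace (hom C G D) (\<lambda>x. x \<cdot> b))"
    using cocharacter_in_hom by (simp add: val comp_zero_left[OF r] comp_zero_right[OF h(1)] \<epsilon>0)
  then show ?thesis by (simp add: 0 comp_zero_left[OF r] comp_zero_right[OF h(1)] \<epsilon>0)
qed

text \<open>An idempotent is taken because a general endomorphism that kills the other simple
  modules might still act on \<open>Hom(G, S1)\<close> with trace zero.\<close>

theorem cocharacters_independent:
  assumes char0: "\<And>n. of_nat n = (0::'k) \<Longrightarrow> n = 0"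
    and fin: "finite \<S>" and simple: "\<And>S. S \<in> \<S> \<Longrightarrow> simple_object C S"
    and inequiv: "\<And>S S'. S \<in> \<S> \<Longrightarrow> S' \<in> \<S> \<Longrightarrow> equiv_in_Gr S S' \<Longrightarrow> S = S'"
    and 0: "(\<Sum>S\<in>\<S>. scale C (c S) (\<chi> S)) = 0" and S1: "S1 \<in> \<S>"
  shows "c S1 = 0"
proof -
  obtain e f where e: "e \<in> hom C G G" "e \<cdot> e = e" "\<And>S. S \<in> \<S> - {S1} \<Longrightarrow> annihilates e S"
    and f: "f \<in> hom C G S1" "f \<noteq> 0" "f \<cdot> e = f"
    by (rule separating_idempotent[of "\<S> - {S1}" S1]) (use fin simple inequiv[OF S1] S1 in auto)
  let ?t = "\<lambda>S. linear_trace (hom C G S) (\<lambda>x. x \<cdot> e)"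
  have "?t S = 0" if "S \<in> \<S> - {S1}" for S
  proof -
    have "?t S = linear_trace (hom C G S) (\<lambda>x. 0)"
      using e(3)[OF that] by (intro linear_trace_cong) (simp add: annihilates_def)
    then show ?thesis by (simp add: linear_trace_def representation_zero)
  qed
  then have "(\<Sum>S\<in>\<S>. c S * ?t S) = c S1 * ?t S1"
    using fin S1 by (subst sum.mono_neutral_right[of \<S> "{S1}"]) auto
  then have "c S1 * ?t S1 = 0" using cocharacter_trace[OF e(1) 0] by simp
  moreover have "?t S1 \<noteq> 0"
  proof -
    obtain B where B: "finite B" "hom C G S1 \<subseteq> span B" using hom_finite_dim by blast
    show ?thesis
      by (rule linear_trace_idempotent_nonzero[OF char0 hom_subspace B(2,1) comp_linear_left[OF e(1)] _ _
        f(1,3,2)])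
        (use e comp_in_hom comp_assoc[OF e(1) e(1), symmetric] in auto)
  qed
  ultimately show ?thesis by simp
qed

end

section \<open>Monoid rings\<close>

text \<open>Reduces identities in a free abelian group to generators; it is applied to the ring laws
  one variable at a time.\<close>

lemma additive_eq_on_free_abelian:
  fixes f g :: "('a \<Rightarrow>\<^sub>0 int) \<Rightarrow> 'b::ab_group_add"
  assumes "additive f" "additive g" "Poly_Mapping.keys u \<subseteq> X"
    and "\<And>x. x \<in> X \<Longrightarrow> f (frag_of x) = g (frag_of x)"
  shows "f u = g u"
  using assms(3)
proof (induction u rule: frag_induction)
  case zero
  show ?case using additive.zero assms(1,2) by metis
next
  case (diff u v)
  then show ?case using additive.diff[OF assms(1)] additive.diff[OF assms(2)] by simp
qed (rule assms(4))

text \<open>Larger index sets only add zero terms, so the products with \<open>u\<close>,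
  \<open>u'\<close> and \<open>u + u'\<close> can be written over common ones.\<close>

lemma monoid_ring_mult_sum:
  assumes "finite A" "Poly_Mapping.keys u \<subseteq> A" "finite B" "Poly_Mapping.keys v \<subseteq> B"
  shows "u \<otimes>\<^bsub>monoid_ring M\<^esub> v = (\<Sum>x\<in>A. \<Sum>y\<in>B.
     Poly_Mapping.single (x \<otimes>\<^bsub>M\<^esub> y) (Poly_Mapping.lookup u x * Poly_Mapping.lookup v y))"
proof -
  have "(\<Sum>y\<in>Poly_Mapping.keys v. Poly_Mapping.single (x \<otimes>\<^bsub>M\<^esub> y) (Poly_Mapping.lookup u x *
    Poly_Mapping.lookup v y)) =
     (\<Sum>y\<in>B. Poly_Mapping.single (x \<otimes>\<^bsub>M\<^esub> y) (Poly_Mapping.lookup u x * Poly_Mapping.lookup v y))" for x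
    using assms by (intro sum.mono_neutral_left) (auto simp: in_keys_iff)
  moreover have "(\<Sum>x\<in>Poly_Mapping.keys u. \<Sum>y\<in>B. Poly_Mapping.single (x \<otimes>\<^bsub>M\<^esub> y) (Poly_Mapping.lookup u x *
    Poly_Mapping.lookup v y)) =
     (\<Sum>x\<in>A. \<Sum>y\<in>B. Poly_Mapping.single (x \<otimes>\<^bsub>M\<^esub> y) (Poly_Mapping.lookup u x * Poly_Mapping.lookup v y))"
    using assms by (intro sum.mono_neutral_left) (auto simp: in_keys_iff)
  ultimately show ?thesis by (simp add: monoid_ring_def)
qed

lemma monoid_ring_mult_single:
  "frag_of x \<otimes>\<^bsub>monoid_ring M\<^esub> frag_of y = frag_of (x \<otimes>\<^bsub>M\<^esub> y)"
  by (subst monoid_ring_mult_sum[of "{x}" _ "{y}"]) auto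

lemma monoid_ring_mult_additive_left: "additive (\<lambda>u. u \<otimes>\<^bsub>monoid_ring M\<^esub> v)"
proof
  fix u u' :: "'a \<Rightarrow>\<^sub>0 int"
  let ?A = "Poly_Mapping.keys u \<union> Poly_Mapping.keys u'" and ?B = "Poly_Mapping.keys v"
  have *: "w \<otimes>\<^bsub>monoid_ring M\<^esub> v = (\<Sum>x\<in>?A. \<Sum>y\<in>?B.
     Poly_Mapping.single (x \<otimes>\<^bsub>M\<^esub> y) (Poly_Mapping.lookup w x * Poly_Mapping.lookup v y))"
    if "Poly_Mapping.keys w \<subseteq> ?A" for w
    using that by (intro monoid_ring_mult_sum) auto
  show "(u + u') \<otimes>\<^bsub>monoid_ring M\<^esub> v = u \<otimes>\<^bsub>monoid_ring M\<^esub> v + u' \<otimes>\<^bsub>monoid_ring M\<^esub> v"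
    using keys_add[of u u'] by (simp add: * lookup_add distrib_right single_add sum.distrib)
qed

lemma monoid_ring_mult_additive_right: "additive (\<lambda>v. u \<otimes>\<^bsub>monoid_ring M\<^esub> v)"
proof
  fix v v' :: "'a \<Rightarrow>\<^sub>0 int"
  let ?A = "Poly_Mapping.keys u" and ?B = "Poly_Mapping.keys v \<union> Poly_Mapping.keys v'"
  have *: "u \<otimes>\<^bsub>monoid_ring M\<^esub> w = (\<Sum>x\<in>?A. \<Sum>y\<in>?B.
     Poly_Mapping.single (x \<otimes>\<^bsub>M\<^esub> y) (Poly_Mapping.lookup u x * Poly_Mapping.lookup w y))"
    if "Poly_Mapping.keys w \<subseteq> ?B" for w
    using that by (intro monoid_ring_mult_sum) auto
  show "u \<otimes>\<^bsub>monoid_ring M\<^esub> (v + v') = u \<otimes>\<^bsub>monoid_ring M\<^esub> v + u \<otimes>\<^bsub>monoid_ring M\<^esub> v'"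
    using keys_add[of v v'] by (simp add: * lookup_add distrib_left single_add sum.distrib)
qed

lemma additive_comp: "additive f \<Longrightarrow> additive g \<Longrightarrow> additive (\<lambda>x. f (g x))"
  by (simp add: additive_def)

lemma monoid_ring_simps:
  "carrier (monoid_ring M) = {u. Poly_Mapping.keys u \<subseteq> carrier M}"
  "\<one>\<^bsub>monoid_ring M\<^esub> = Poly_Mapping.single \<one>\<^bsub>M\<^esub> 1" "\<zero>\<^bsub>monoid_ring M\<^esub> = 0"
  "u \<oplus>\<^bsub>monoid_ring M\<^esub> v = u + v"
  by (simp_all add: monoid_ring_def)

text \<open>The product is additive in each variable, so associativity and the unit laws need only
  be checked on generators, where they are the laws of the monoid.\<close>

lemma monoid_ring_is_ring:
  assumes "monoid M"
  shows "ring (monoid_ring M)"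
proof -
  interpret monoid M by fact
  let ?R = "monoid_ring M" and ?s = "\<lambda>x. frag_of x"
  note addl = monoid_ring_mult_additive_left[where M = M] and addr = monoid_ring_mult_additive_right[where
    M = M]
  have closed: "Poly_Mapping.keys (u \<otimes>\<^bsub>?R\<^esub> v) \<subseteq> carrier M"
    if "Poly_Mapping.keys u \<subseteq> carrier M" "Poly_Mapping.keys v \<subseteq> carrier M" for u v
    using that(1)
  proof (induction u rule: frag_induction)
    case zero
    then show ?case by (simp add: additive.zero[OF addl])
  next
    case (one x)
    show ?case using that(2)
    proof (induction v rule: frag_induction)
      case zero
      then show ?case by (simp add: additive.zero[OF addr])
    next
      case (one y)
      then show ?case using \<open>x \<in> carrier M\<close> by (simp add: monoid_ring_mult_single)
    next
      case (diff v w)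
      then show ?case
        by (simp add: additive.diff[OF addr]) (rule order_trans[OF keys_diff], simp)
    qed
  next
    case (diff u w)
    then show ?case
      by (simp add: additive.diff[OF addl]) (rule order_trans[OF keys_diff], simp)
  qed
  have assoc: "(u \<otimes>\<^bsub>?R\<^esub> v) \<otimes>\<^bsub>?R\<^esub> w = u \<otimes>\<^bsub>?R\<^esub> (v \<otimes>\<^bsub>?R\<^esub> w)"
    if u: "Poly_Mapping.keys u \<subseteq> carrier M" and v: "Poly_Mapping.keys v \<subseteq> carrier M"
      and w: "Poly_Mapping.keys w \<subseteq> carrier M" for u v w
  proof -
    have 1: "(?s x \<otimes>\<^bsub>?R\<^esub> ?s y) \<otimes>\<^bsub>?R\<^esub> w = ?s x \<otimes>\<^bsub>?R\<^esub> (?s y \<otimes>\<^bsub>?R\<^esub> w)"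
      if "x \<in> carrier M" "y \<in> carrier M" for x y
      by (rule additive_eq_on_free_abelian[OF addr additive_comp[OF addr addr] w])
        (use that in \<open>simp add: monoid_ring_mult_single m_assoc\<close>)
    have 2: "(?s x \<otimes>\<^bsub>?R\<^esub> v) \<otimes>\<^bsub>?R\<^esub> w = ?s x \<otimes>\<^bsub>?R\<^esub> (v \<otimes>\<^bsub>?R\<^esub> w)" if "x \<in> carrier M" for x
      by (rule additive_eq_on_free_abelian[OF additive_comp[OF addl addr] additive_comp[OF addr addl] v])
        (rule 1[OF that])
    show ?thesis
      by (rule additive_eq_on_free_abelian[OF additive_comp[OF addl addl] addl u]) (rule 2)
  qed
  have one: "?s \<one>\<^bsub>M\<^esub> \<otimes>\<^bsub>?R\<^esub> u = u" "u \<otimes>\<^bsub>?R\<^esub> ?s \<one>\<^bsub>M\<^esub> = u" if "Poly_Mapping.keys u \<subseteq> carrier M" for u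
  proof -
    have id: "additive (\<lambda>u::'a \<Rightarrow>\<^sub>0 int. u)" by (simp add: additive_def)
    show "?s \<one>\<^bsub>M\<^esub> \<otimes>\<^bsub>?R\<^esub> u = u"
      by (rule additive_eq_on_free_abelian[OF addr id that]) (simp add: monoid_ring_mult_single)
    show "u \<otimes>\<^bsub>?R\<^esub> ?s \<one>\<^bsub>M\<^esub> = u"
      by (rule additive_eq_on_free_abelian[OF addl id that]) (simp add: monoid_ring_mult_single)
  qed
  show ?thesis
  proof (rule ringI)
    show "abelian_group ?R"
    proof (rule abelian_groupI)
      fix x y assume "x \<in> carrier ?R" "y \<in> carrier ?R"
      then show "x \<oplus>\<^bsub>?R\<^esub> y \<in> carrier ?R" using keys_add[of x y] by (auto simp: monoid_ring_simps)
    next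
      fix x assume "x \<in> carrier ?R"
      then show "\<exists>y\<in>carrier ?R. y \<oplus>\<^bsub>?R\<^esub> x = \<zero>\<^bsub>?R\<^esub>"
        by (intro bexI[of _ "- x"]) (auto simp: monoid_ring_simps)
    qed (auto simp: monoid_ring_simps add.assoc add.commute)
    show "monoid ?R"
      by (rule monoidI) (simp_all add: monoid_ring_simps one assoc closed)
  qed (simp_all add: additive.add[OF addl] additive.add[OF addr] monoid_ring_simps)
qed

lemma group_closure_subset:
  assumes "S \<subseteq> H" "0 \<in> H" "\<And>x y. x \<in> H \<Longrightarrow> y \<in> H \<Longrightarrow> x - y \<in> H"
  shows "group_closure S \<subseteq> H"
proof
  fix x assume "x \<in> group_closure S"
  then show "x \<in> H" by (induction rule: group_closure.induct) (use assms in auto)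
qed

section \<open>The endomorphism algebra and ring homomorphisms into it\<close>

context coend_category
begin

lemma End_coend_simps:
  "carrier (End_coend C L \<iota>) = {f \<in> hom C L L. f \<cdot> \<mu> = \<mu> \<cdot> (f \<otimes>\<^sub>m ident C L)}"
  "f \<otimes>\<^bsub>End_coend C L \<iota>\<^esub> g = f \<cdot> g" "\<one>\<^bsub>End_coend C L \<iota>\<^esub> = ident C L" "\<zero>\<^bsub>End_coend C L \<iota>\<^esub> = 0"
  "f \<oplus>\<^bsub>End_coend C L \<iota>\<^esub> g = f + g" "c \<odot>\<^bsub>End_coend C L \<iota>\<^esub> f = scale C c f"
  by (simp_all add: End_coend_def)

lemma End_coend_closed:
  assumes f: "f \<in> carrier (End_coend C L \<iota>)" and g: "g \<in> carrier (End_coend C L \<iota>)"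
  shows "f + g \<in> carrier (End_coend C L \<iota>)" "f \<cdot> g \<in> carrier (End_coend C L \<iota>)"
    "scale C c f \<in> carrier (End_coend C L \<iota>)"
proof -
  have fh: "f \<in> hom C L L" "f \<cdot> \<mu> = \<mu> \<cdot> (f \<otimes>\<^sub>m ident C L)" and gh: "g \<in> hom C L L" "g \<cdot> \<mu> = \<mu> \<cdot> (g \<otimes>\<^sub>m ident C L)"
    using f g by (auto simp: End_coend_simps)
  have fL: "f \<otimes>\<^sub>m ident C L \<in> hom C (L \<otimes>\<^sub>o L) (L \<otimes>\<^sub>o L)" and gL: "g \<otimes>\<^sub>m ident C L \<in> hom C (L \<otimes>\<^sub>o L) (L \<otimes>\<^sub>o L)"
    using tensor_in_hom fh gh ident_in_hom by auto
  have "(f + g) \<cdot> \<mu> = \<mu> \<cdot> ((f + g) \<otimes>\<^sub>m ident C L)"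
    unfolding comp_add_left[OF mult_in_hom fh(1) gh(1)] tensor_add_left[OF fh(1) gh(1) ident_in_hom]
      comp_add_right[OF fL gL mult_in_hom] fh gh ..
  then show "f + g \<in> carrier (End_coend C L \<iota>)" using hom_add fh gh by (simp add: End_coend_simps)
  have "(f \<cdot> g) \<cdot> \<mu> = f \<cdot> \<mu> \<cdot> (g \<otimes>\<^sub>m ident C L)"
    unfolding comp_assoc[OF mult_in_hom gh(1) fh(1), symmetric] gh(2)
      by (rule comp_assoc[OF gL mult_in_hom fh(1)])
  also have "\<dots> = \<mu> \<cdot> ((f \<cdot> g) \<otimes>\<^sub>m ident C L)"
    unfolding fh(2) comp_tensor_ident[OF gh(1) fh(1)] by (rule comp_assoc[OF gL fL mult_in_hom, symmetric])
  finally show "f \<cdot> g \<in> carrier (End_coend C L \<iota>)" using comp_in_hom[OF gh(1) fh(1)]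
    by (simp add: End_coend_simps)
  have "scale C c f \<cdot> \<mu> = \<mu> \<cdot> (scale C c f \<otimes>\<^sub>m ident C L)"
    unfolding comp_scale_left[OF mult_in_hom fh(1)] tensor_scale_left[OF fh(1) ident_in_hom]
      comp_scale_right[OF fL mult_in_hom] fh ..
  then show "scale C c f \<in> carrier (End_coend C L \<iota>)" using hom_scale fh by (simp add: End_coend_simps)
qed

lemma End_coend_unit: "ident C L \<in> carrier (End_coend C L \<iota>)"
  by (simp add: End_coend_simps ident_in_hom tensor_ident comp_ident_left[OF mult_in_hom]
    comp_ident_right[OF mult_in_hom])

lemma defect_in_End: "\<O> D \<in> carrier (End_coend C L \<iota>)"
  by (simp add: End_coend_simps defect_in_hom defect_mult)

lemma End_coend_hom: "f \<in> carrier (End_coend C L \<iota>) \<Longrightarrow> f \<in> hom C L L"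
  by (simp add: End_coend_simps)

lemma End_coend_zero: "0 \<in> carrier (End_coend C L \<iota>)"
  using End_coend_closed(3)[OF End_coend_unit End_coend_unit, of 0] by simp

lemma End_coend_ring: "ring (End_coend C L \<iota>)"
proof (rule ringI)
  show "abelian_group (End_coend C L \<iota>)"
  proof (rule abelian_groupI)
    fix x assume x: "x \<in> carrier (End_coend C L \<iota>)"
    have "scale C (- 1) x + x = 0" by simp
    then show "\<exists>y\<in>carrier (End_coend C L \<iota>). y \<oplus>\<^bsub>End_coend C L \<iota>\<^esub> x = \<zero>\<^bsub>End_coend C L \<iota>\<^esub>"
      using End_coend_closed(3)[OF x x] unfolding End_coend_simps(4,5) by blast
  qed (simp_all only: End_coend_simps(4,5) End_coend_closed End_coend_zero add_ac add_0_right)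
  show "monoid (End_coend C L \<iota>)"
    by (rule monoidI; simp only: End_coend_simps(2,3) End_coend_closed End_coend_unit)
      (simp_all add: comp_assoc[OF End_coend_hom End_coend_hom End_coend_hom] comp_ident_left[OF
        End_coend_hom] comp_ident_right[OF End_coend_hom])
qed (simp_all add: End_coend_simps comp_add_left[where X = L and Y = L and Z = L] comp_add_right[where X =
  L and Y = L and Z = L])

text \<open>The additive extension of \<open>\<phi>\<close> from generators to the free abelian
  group, with integers acting through the field.\<close>

definition frag_scale :: "('i \<Rightarrow> 'm) \<Rightarrow> ('i \<Rightarrow>\<^sub>0 int) \<Rightarrow> 'm" where
  "frag_scale \<phi> u = (\<Sum>x\<in>Poly_Mapping.keys u. scale C (of_int (Poly_Mapping.lookup u x)) (\<phi> x))"

lemma frag_scale_additive: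
  fixes \<phi> :: "'i \<Rightarrow> 'm"
  shows "additive (frag_scale \<phi>)"
proof
  fix u v :: "'i \<Rightarrow>\<^sub>0 int"
  let ?A = "Poly_Mapping.keys u \<union> Poly_Mapping.keys v"
  have *: "frag_scale \<phi> w = (\<Sum>x\<in>?A. scale C (of_int (Poly_Mapping.lookup w x)) (\<phi> x))"
    if "Poly_Mapping.keys w \<subseteq> ?A" for w
    unfolding frag_scale_def using that by (intro sum.mono_neutral_left) (auto simp: in_keys_iff)
  show "frag_scale \<phi> (u + v) = frag_scale \<phi> u + frag_scale \<phi> v"
    using keys_add[of u v] by (simp add: * lookup_add scale_left_distrib sum.distrib)
qed

lemma frag_scale_single: "frag_scale \<phi> (frag_of x) = \<phi> x"
  by (simp add: frag_scale_def)

text \<open>The universal property of the monoid ring. It is applied first to the monoid of objects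
  and then to pairs of a scalar and a class.\<close>

lemma frag_scale_ring_hom:
  assumes M: "monoid M" and \<phi>: "\<And>x. x \<in> carrier M \<Longrightarrow> \<phi> x \<in> carrier (End_coend C L \<iota>)"
    and mult: "\<And>x y. x \<in> carrier M \<Longrightarrow> y \<in> carrier M \<Longrightarrow> \<phi> (x \<otimes>\<^bsub>M\<^esub> y) = \<phi> x \<cdot> \<phi> y"
    and one: "\<phi> \<one>\<^bsub>M\<^esub> = ident C L"
  shows "ring_hom_ring (monoid_ring M) (End_coend C L \<iota>) (frag_scale \<phi>)"
proof (rule ring_hom_ringI[OF monoid_ring_is_ring[OF M] End_coend_ring])
  note add = frag_scale_additive[of \<phi>]
  have closed: "frag_scale \<phi> u \<in> carrier (End_coend C L \<iota>)" if "Poly_Mapping.keys u \<subseteq> carrier M" for u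
    using that
  proof (induction u rule: frag_induction)
    case (diff u v)
    have "frag_scale \<phi> (u - v) = frag_scale \<phi> u + scale C (- 1) (frag_scale \<phi> v)"
      by (simp add: additive.diff[OF add])
    show ?case unfolding \<open>frag_scale \<phi> (u - v) = _\<close> by (intro End_coend_closed(1) End_coend_closed(3)[OF
      diff(2) diff(2)] diff(1))
  qed (simp_all only: additive.zero[OF add] End_coend_zero frag_scale_single \<phi>)
  show "frag_scale \<phi> u \<in> carrier (End_coend C L \<iota>)" if "u \<in> carrier (monoid_ring M)" for u
    using closed that by (simp add: monoid_ring_simps)
  show "frag_scale \<phi> (u \<oplus>\<^bsub>monoid_ring M\<^esub> v) = frag_scale \<phi> u \<oplus>\<^bsub>End_coend C L \<iota>\<^esub> frag_scale \<phi> v" for u v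
    by (simp add: monoid_ring_simps End_coend_simps additive.add[OF add])
  show "frag_scale \<phi> \<one>\<^bsub>monoid_ring M\<^esub> = \<one>\<^bsub>End_coend C L \<iota>\<^esub>"
    by (simp only: monoid_ring_simps End_coend_simps frag_scale_single one)
  fix u v assume "u \<in> carrier (monoid_ring M)" "v \<in> carrier (monoid_ring M)"
  then have u: "Poly_Mapping.keys u \<subseteq> carrier M" and v: "Poly_Mapping.keys v \<subseteq> carrier M"
    by (simp_all add: monoid_ring_simps)
  have fs_diff: "frag_scale \<phi> (a - b) = frag_scale \<phi> a - frag_scale \<phi> b" for a b by (rule additive.diff[OF add])
  have z: "frag_scale \<phi> 0 = 0" by (rule additive.zero[OF add])
  note ml = monoid_ring_mult_additive_left[where M = M] and mr = monoid_ring_mult_additive_right[where M = M]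
  have 1: "frag_scale \<phi> v \<in> hom C L L \<and>
      frag_scale \<phi> (frag_of x \<otimes>\<^bsub>monoid_ring M\<^esub> v) = \<phi> x \<cdot> frag_scale \<phi> v" if x: "x \<in> carrier M" for x
    using v
  proof (induction v rule: frag_induction)
    case zero
    then show ?case by (simp add: additive.zero[OF mr] z hom_zero comp_zero_right[OF End_coend_hom[OF \<phi>[OF x]]])
  next
    case (one y)
    then show ?case by (simp add: monoid_ring_mult_single frag_scale_single mult[OF x] End_coend_hom[OF \<phi>])
  next
    case (diff a b)
    then show ?case
      by (simp add: fs_diff additive.diff[OF mr] hom_diff comp_diff_right[where X = L and Y = L and Z = L]
        End_coend_hom[OF \<phi>[OF x]])
  qed
  have fv: "frag_scale \<phi> v \<in> hom C L L" using closed[OF v] by (rule End_coend_hom)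
  have "frag_scale \<phi> u \<in> hom C L L \<and>
      frag_scale \<phi> (u \<otimes>\<^bsub>monoid_ring M\<^esub> v) = frag_scale \<phi> u \<cdot> frag_scale \<phi> v"
    using u
  proof (induction u rule: frag_induction)
    case zero
    then show ?case by (simp add: additive.zero[OF ml] z hom_zero comp_zero_left[OF fv])
  next
    case (one x)
    then show ?case using 1[OF one] by (simp add: frag_scale_single End_coend_hom[OF \<phi>])
  next
    case (diff a b)
    then show ?case
      by (simp add: fs_diff additive.diff[OF ml] hom_diff comp_diff_left[where X = L and Y = L and Z = L] fv)
  qed
  then show "frag_scale \<phi> (u \<otimes>\<^bsub>monoid_ring M\<^esub> v) = frag_scale \<phi> u \<otimes>\<^bsub>End_coend C L \<iota>\<^esub> frag_scale \<phi> v"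
    by (simp add: End_coend_simps)
qed

end

section \<open>The isomorphism\<close>

locale coend_progenerated_char_0 = coend_progenerated_category C L \<iota> G
  for C :: "('k::field_char_0, 'o, 'm::ab_group_add) ribbon_data" (structure) and L \<iota> G
begin

section \<open>The Grothendieck ring as a ring of operators\<close>

abbreviation \<I> :: "('o \<Rightarrow>\<^sub>0 int) set" where
  "\<I> \<equiv> group_closure (grothendieck_relations C)"

lemma equiv_in_Gr_refl: "equiv_in_Gr X X"
  by (simp add: equiv_in_Gr_def)

lemma equiv_in_Gr_sym: "equiv_in_Gr X Y \<Longrightarrow> equiv_in_Gr Y X"
  using group_closure_minus_iff[of "frag_of X - frag_of Y"]
  by (simp add: equiv_in_Gr_def)

lemma equiv_in_Gr_trans: "equiv_in_Gr X Y \<Longrightarrow> equiv_in_Gr Y Z \<Longrightarrow> equiv_in_Gr X Z"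
  unfolding equiv_in_Gr_def by (drule (1) group_closure_add) simp

text \<open>The predicate depends only on the class of \<open>S\<close>, so simple objects in the
  same class receive literally the same representative.\<close>

definition representative :: "'o \<Rightarrow> 'o" where
  "representative S = (SOME S'. simple_object C S' \<and> equiv_in_Gr S' S)"

definition representatives :: "'o set" where
  "representatives = representative ` {S. simple_object C S}"

lemma representative:
  assumes "simple_object C S"
  shows "simple_object C (representative S)" "equiv_in_Gr (representative S) S"
  using someI_ex[of "\<lambda>S'. simple_object C S' \<and> equiv_in_Gr S' S"] assms equiv_in_Gr_refl
  unfolding representative_def by blast+

lemma representatives_simple: "S \<in> representatives \<Longrightarrow> simple_object C S"
  using representative by (auto simp: representatives_def)

lemma representatives_inequivalent:
  assumes S: "S \<in> representatives" and S': "S' \<in> representatives" and eq: "equiv_in_Gr S S'"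
  shows "S = S'"
proof -
  obtain X X' where X: "simple_object C X" "S = representative X" and X': "simple_object C X'"
    "S' = representative X'"
    using S S' by (auto simp: representatives_def)
  have XX': "equiv_in_Gr X X'"
    using representative(2)[OF X(1)] representative(2)[OF X'(1)] eq X X' equiv_in_Gr_sym equiv_in_Gr_trans
      by metis
  have "(\<lambda>S'. simple_object C S' \<and> equiv_in_Gr S' X) = (\<lambda>S'. simple_object C S' \<and> equiv_in_Gr S' X')"
    using equiv_in_Gr_trans[OF _ XX'] equiv_in_Gr_trans[OF _ equiv_in_Gr_sym[OF XX']] by blast
  then show ?thesis using X X' by (simp add: representative_def)
qed

lemma defects_independent:
  assumes fin: "finite \<S>" and sub: "\<S> \<subseteq> representatives"
    and 0: "(\<Sum>S\<in>\<S>. scale C (c S) (\<O> S)) = 0" and S: "S \<in> \<S>"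
  shows "c S = 0"
proof (rule cocharacters_independent[OF _ fin _ _ _ S])
  have "(\<Sum>S\<in>\<S>. scale C (c S) (\<O> S)) \<cdot> \<iota> \<one>\<^sub>o = (\<Sum>S\<in>\<S>. scale C (c S) (\<O> S \<cdot> \<iota> \<one>\<^sub>o))"
    by (rule comp_sum_left[OF defect_in_hom \<iota>_unit_in_hom])
  then show "(\<Sum>S\<in>\<S>. scale C (c S) (\<chi> S)) = 0"
    unfolding 0 comp_zero_left[OF \<iota>_unit_in_hom] defect_comp_unit by simp
  show "simple_object C S" if "S \<in> \<S>" for S using that sub representatives_simple by blast
  show "S = S'" if "S \<in> \<S>" "S' \<in> \<S>" "equiv_in_Gr S S'" for S S'
    using representatives_inequivalent[OF _ _ that(3)] that sub by blast
qed simp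

text \<open>Composition series express every object through simple ones, and each simple object is
  then exchanged for its representative.\<close>

lemma normal_form:
  "\<exists>v. Poly_Mapping.keys v \<subseteq> representatives \<and> u - v \<in> \<I>"
proof -
  have "Poly_Mapping.keys u \<subseteq> UNIV" by simp
  then show ?thesis
  proof (induction u rule: frag_induction)
    case zero
    show ?case by (intro exI[of _ 0]) simp
  next
    case (one D)
    obtain Ss where Ss: "\<forall>S\<in>set Ss. simple_object C S"
      "frag_of D - (\<Sum>S\<leftarrow>Ss. frag_of S) \<in> \<I>"
      using composition_series by blast
    have "\<exists>v. Poly_Mapping.keys v \<subseteq> representatives \<and> (\<Sum>S\<leftarrow>Ss. frag_of S) - v \<in> \<I>"
      using Ss(1)
    proof (induction Ss)
      case Nil
      show ?case by (intro exI[of _ 0]) simp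
    next
      case (Cons S Ss)
      then obtain v where v: "Poly_Mapping.keys v \<subseteq> representatives" "(\<Sum>S\<leftarrow>Ss. frag_of S) - v \<in> \<I>" by auto
      let ?v = "frag_of (representative S) + v"
      have "frag_of S - frag_of (representative S) \<in> \<I>"
        using equiv_in_Gr_sym[OF representative(2)] Cons.prems by (simp add: equiv_in_Gr_def)
      from group_closure_add[OF this v(2)]
      have "(\<Sum>S\<leftarrow>S # Ss. frag_of S) - ?v \<in> \<I>" by (simp add: algebra_simps)
      moreover have "Poly_Mapping.keys ?v \<subseteq> representatives"
        using keys_add[of "frag_of (representative S)" v] v(1) Cons.prems by (auto simp: representatives_def)
      ultimately show ?case by blast
    qed
    then obtain v where v: "Poly_Mapping.keys v \<subseteq> representatives" "(\<Sum>S\<leftarrow>Ss. frag_of S) - v \<in> \<I>" by blast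
    show ?case using v(1) group_closure_add[OF Ss(2) v(2)] by auto
  next
    case (diff a b)
    then obtain v w where vw: "Poly_Mapping.keys v \<subseteq> representatives" "a - v \<in> \<I>"
      "Poly_Mapping.keys w \<subseteq> representatives" "b - w \<in> \<I>" by blast
    have "(a - b) - (v - w) \<in> \<I>"
      using group_closure.diff[OF vw(2,4)] by (simp add: algebra_simps)
    moreover have "Poly_Mapping.keys (v - w) \<subseteq> representatives" using keys_diff[of v w] vw by auto
    ultimately show ?case by blast
  qed
qed

abbreviation \<psi> :: "('o \<Rightarrow>\<^sub>0 int) \<Rightarrow> 'm" where "\<psi> \<equiv> frag_scale \<O>"

lemma defect_additive:
  assumes "short_exact C X Y Z f g"
  shows "\<O> Y = \<O> X + \<O> Z"
proof -
  have xL: "\<chi> D \<otimes>\<^sub>m ident C L \<in> hom C L (L \<otimes>\<^sub>o L)" for D by (rule cocharacter_tensor_in_hom)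
  show ?thesis
    unfolding defect_operator_def cocharacter_additive[OF assms]
      tensor_add_left[OF cocharacter_in_hom cocharacter_in_hom ident_in_hom]
    by (rule comp_add_right[OF xL xL mult_in_hom])
qed

lemma \<psi>_relations: "u \<in> \<I> \<Longrightarrow> \<psi> u = 0"
proof -
  note add = frag_scale_additive[of \<O>]
  have "\<I> \<subseteq> {u. \<psi> u = 0}"
  proof (rule group_closure_subset)
    show "grothendieck_relations C \<subseteq> {u. \<psi> u = 0}"
      using defect_additive by (auto simp: grothendieck_relations_def additive.diff[OF add] frag_scale_single)
  qed (simp_all add: additive.zero[OF add] additive.diff[OF add])
  then show "u \<in> \<I> \<Longrightarrow> \<psi> u = 0" by blast
qed

text \<open>Modulo the relations \<open>u\<close> is an integer combination of representatives, and
  independence of their operators makes this combination zero; characteristic zero embeds the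
  integer coefficients into the field.\<close>

lemma \<psi>_kernel: "\<psi> u = 0 \<longleftrightarrow> u \<in> \<I>"
proof
  assume 0: "\<psi> u = 0"
  obtain v where v: "Poly_Mapping.keys v \<subseteq> representatives" "u - v \<in> \<I>" using normal_form by blast
  have "\<psi> u - \<psi> v = 0" using \<psi>_relations[OF v(2)] additive.diff[OF frag_scale_additive[of \<O>]] by simp
  then have "(\<Sum>S\<in>Poly_Mapping.keys v. scale C (of_int (Poly_Mapping.lookup v S)) (\<O> S)) = 0"
    using 0 by (simp add: frag_scale_def)
  from defects_independent[OF finite_keys v(1) this]
  have "v = 0" by (intro poly_mapping_eqI) (auto simp: in_keys_iff)
  then show "u \<in> \<I>" using v(2) by simp
qed (rule \<psi>_relations)

lemma object_monoid: "monoid (object_monoid C)"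
  by (rule monoidI) (simp_all add: object_monoid_def tensor_ob_assoc tensor_ob_unit_left tensor_ob_unit_right)

lemma \<psi>_ring_hom: "ring_hom_ring (monoid_ring (object_monoid C)) (End_coend C L \<iota>) \<psi>"
  by (rule frag_scale_ring_hom[OF object_monoid])
    (simp_all add: object_monoid_def defect_in_End defect_comp defect_unit)

lemma \<psi>_a_kernel: "a_kernel (monoid_ring (object_monoid C)) (End_coend C L \<iota>) \<psi> = \<I>"
  by (auto simp: a_kernel_def' End_coend_simps \<psi>_kernel monoid_ring_simps object_monoid_def)

text \<open>The relations form an ideal because they are the kernel of the ring homomorphism
  \<open>\<psi>\<close>; this gives the quotient its ring structure.\<close>

lemma relations_ideal: "ideal \<I> (monoid_ring (object_monoid C))"
  using ring_hom_ring.kernel_is_ideal[OF \<psi>_ring_hom] unfolding \<psi>_a_kernel .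

lemma Gr_ring: "ring (Gr C)"
  unfolding Gr_def by (rule ideal.quotient_is_ring[OF relations_ideal])

definition gr_class :: "('o \<Rightarrow>\<^sub>0 int) \<Rightarrow> ('o \<Rightarrow>\<^sub>0 int) set" where
  "gr_class u = \<I> +>\<^bsub>monoid_ring (object_monoid C)\<^esub> u"

text \<open>\<open>\<psi>\<close> is constant on each coset of the relations, so the image of a
  coset is a singleton.\<close>

definition \<psi>_Gr :: "('o \<Rightarrow>\<^sub>0 int) set \<Rightarrow> 'm" where
  "\<psi>_Gr X = the_elem (\<psi> ` X)"

lemma in_monoid_ring: "u \<in> carrier (monoid_ring (object_monoid C))"
  by (simp add: monoid_ring_simps object_monoid_def)

lemma gr_class_surj: "x \<in> carrier (Gr C) \<Longrightarrow> \<exists>u. x = gr_class u"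
  by (auto simp: Gr_def FactRing_def A_RCOSETS_def' gr_class_def a_r_coset_def')

lemma gr_class_in_Gr: "gr_class u \<in> carrier (Gr C)"
  unfolding gr_class_def Gr_def by (rule ring_hom_closed[OF ideal.rcos_ring_hom[OF relations_ideal]
    in_monoid_ring])

lemma gr_class_add: "gr_class (u + v) = gr_class u \<oplus>\<^bsub>Gr C\<^esub> gr_class v"
  using ring_hom_add[OF ideal.rcos_ring_hom[OF relations_ideal] in_monoid_ring in_monoid_ring, of u v]
  by (simp add: gr_class_def Gr_def monoid_ring_simps)

lemma gr_class_eq:
  assumes "u - v \<in> \<I>"
  shows "gr_class u = gr_class v"
proof -
  let ?R = "monoid_ring (object_monoid C)"
  have "u = (u - v) + v" by simp
  then have "u \<in> \<I> +>\<^bsub>?R\<^esub> v"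
    using assms unfolding a_r_coset_def' monoid_ring_simps by blast
  moreover have "abelian_group ?R" using monoid_ring_is_ring[OF object_monoid] by (rule ring.is_abelian_group)
  moreover have "subgroup \<I> (add_monoid ?R)"
    using additive_subgroup.a_subgroup[OF ideal.axioms(1)[OF relations_ideal]] .
  ultimately show ?thesis
    unfolding gr_class_def using abelian_group.a_repr_independence[OF _ _ in_monoid_ring] by metis
qed

lemma \<psi>_Gr_class: "\<psi>_Gr (gr_class u) = \<psi> u"
  using ring_hom_ring.the_elem_simp[OF \<psi>_ring_hom in_monoid_ring]
  unfolding \<psi>_a_kernel \<psi>_Gr_def gr_class_def .

lemma \<psi>_Gr_ring_hom: "\<psi>_Gr \<in> Ring.ring_hom (Gr C) (End_coend C L \<iota>)"
  using ring_hom_ring.the_elem_hom[OF \<psi>_ring_hom]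
  unfolding \<psi>_a_kernel Gr_def \<psi>_Gr_def[abs_def] .

section \<open>Extension of scalars to the field\<close>

abbreviation M :: "('k \<times> ('o \<Rightarrow>\<^sub>0 int) set) monoid" where
  "M \<equiv> field_monoid \<times>\<times> Gr C"

abbreviation \<J> :: "(('k \<times> ('o \<Rightarrow>\<^sub>0 int) set) \<Rightarrow>\<^sub>0 int) set" where
  "\<J> \<equiv> group_closure (tensor_relations (Gr C))"

abbreviation t :: "'k \<Rightarrow> ('o \<Rightarrow>\<^sub>0 int) set \<Rightarrow> ('k \<times> ('o \<Rightarrow>\<^sub>0 int) set) \<Rightarrow>\<^sub>0 int" where
  "t c x \<equiv> frag_of (c, x)"

text \<open>The map \<open>c \<otimes> x \<mapsto> c \<psi>_Gr(x)\<close>, on the free abelian group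
  over pairs before the passage to the tensor product.\<close>

definition \<Psi> :: "(('k \<times> ('o \<Rightarrow>\<^sub>0 int) set) \<Rightarrow>\<^sub>0 int) \<Rightarrow> 'm" where
  "\<Psi> = frag_scale (\<lambda>(c, x). scale C c (\<psi>_Gr x))"

lemma M_monoid: "monoid M"
proof (rule DirProd_monoid)
  show "monoid field_monoid" by (rule monoidI) (simp_all add: field_monoid_def mult.assoc)
  show "monoid (Gr C)" using Gr_ring by (rule ring.is_monoid)
qed

lemma \<Psi>_additive: "additive \<Psi>"
  unfolding \<Psi>_def by (rule frag_scale_additive)

lemma \<Psi>_single: "\<Psi> (t c x) = scale C c (\<psi>_Gr x)"
  unfolding \<Psi>_def frag_scale_single by simp

lemma \<psi>_Gr_in_End: "x \<in> carrier (Gr C) \<Longrightarrow> \<psi>_Gr x \<in> carrier (End_coend C L \<iota>)"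
  by (rule ring_hom_closed[OF \<psi>_Gr_ring_hom])

lemma \<Psi>_ring_hom: "ring_hom_ring (monoid_ring M) (End_coend C L \<iota>) \<Psi>"
  unfolding \<Psi>_def
proof (rule frag_scale_ring_hom[OF M_monoid])
  fix z assume z: "z \<in> carrier M"
  then show "(case z of (c, x) \<Rightarrow> scale C c (\<psi>_Gr x)) \<in> carrier (End_coend C L \<iota>)"
    by (cases z) (auto simp: DirProd_def intro: End_coend_closed(3)[OF \<psi>_Gr_in_End \<psi>_Gr_in_End])
  fix z' assume z': "z' \<in> carrier M"
  obtain c x c' x' where [simp]: "z = (c, x)" "z' = (c', x')" by (cases z; cases z')
  have x: "x \<in> carrier (Gr C)" "x' \<in> carrier (Gr C)" using z z' by (simp_all add: DirProd_def)
  note h = End_coend_hom[OF \<psi>_Gr_in_End[OF x(1)]] and h' = End_coend_hom[OF \<psi>_Gr_in_End[OF x(2)]]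
  have "\<psi>_Gr (x \<otimes>\<^bsub>Gr C\<^esub> x') = \<psi>_Gr x \<cdot> \<psi>_Gr x'"
    using ring_hom_mult[OF \<psi>_Gr_ring_hom x] by (simp add: End_coend_simps)
  then show "(case z \<otimes>\<^bsub>M\<^esub> z' of (c, x) \<Rightarrow> scale C c (\<psi>_Gr x)) =
      (case z of (c, x) \<Rightarrow> scale C c (\<psi>_Gr x)) \<cdot> (case z' of (c, x) \<Rightarrow> scale C c (\<psi>_Gr x))"
    by (simp add: DirProd_def field_monoid_def comp_scale_left[OF hom_scale[OF h'] h] comp_scale_right[OF h' h])
next
  show "(case \<one>\<^bsub>M\<^esub> of (c, x) \<Rightarrow> scale C c (\<psi>_Gr x)) = ident C L"
    using ring_hom_one[OF \<psi>_Gr_ring_hom] by (simp add: DirProd_def field_monoid_def End_coend_simps)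
qed

lemma tensor_relation_left:
  "x \<in> carrier (Gr C) \<Longrightarrow> t (c + c') x - t c x - t c' x \<in> \<J>"
  by (rule group_closure.base) (auto simp: tensor_relations_def)

lemma tensor_relation_right:
  "t c (gr_class (u + v)) - t c (gr_class u) - t c (gr_class v) \<in> \<J>"
proof -
  have "t c (gr_class (u + v)) - t c (gr_class u) - t c (gr_class v) \<in> tensor_relations (Gr C)"
    unfolding tensor_relations_def gr_class_add using gr_class_in_Gr by blast
  then show ?thesis by (intro group_closure.base) simp
qed

text \<open>Additivity for \<open>0 + 0\<close> leaves minus \<open>t 0 x\<close>; hence terms with
  coefficient zero may be added freely.\<close>

lemma tensor_zero_left: "x \<in> carrier (Gr C) \<Longrightarrow> t 0 x \<in> \<J>"
  using tensor_relation_left[of x 0 0] by simp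

lemma tensor_diff_left:
  "x \<in> carrier (Gr C) \<Longrightarrow> t (c - c') x - (t c x - t c' x) \<in> \<J>"
  using group_closure_minus_iff[of "t (c - c') x - (t c x - t c' x)"] tensor_relation_left[of x "c - c'" c']
  by (simp add: algebra_simps)

lemma group_closure_sum:
  "(\<And>i. i \<in> F \<Longrightarrow> f i \<in> group_closure S) \<Longrightarrow> sum f F \<in> group_closure S"
  by (induction F rule: infinite_finite_induct) (auto intro: group_closure_add)

abbreviation simple_comb :: "'o set \<Rightarrow> ('o \<Rightarrow> 'k) \<Rightarrow> ('k \<times> ('o \<Rightarrow>\<^sub>0 int) set) \<Rightarrow>\<^sub>0 int" where
  "simple_comb F c \<equiv> (\<Sum>S\<in>F. t (c S) (gr_class (frag_of S)))"

text \<open>The spanning property, as a predicate on single elements: being closed under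
  differences, it can be proved by induction over the free abelian group.\<close>

definition reducible_to_simples :: "(('k \<times> ('o \<Rightarrow>\<^sub>0 int) set) \<Rightarrow>\<^sub>0 int) \<Rightarrow> bool" where
  "reducible_to_simples u \<longleftrightarrow> (\<exists>F c. finite F \<and> F \<subseteq> representatives \<and> u - simple_comb F c \<in> \<J>)"

lemma reducible_cong:
  assumes "reducible_to_simples v" "u - v \<in> \<J>"
  shows "reducible_to_simples u"
proof -
  obtain F c where F: "finite F" "F \<subseteq> representatives" "v - simple_comb F c \<in> \<J>"
    using assms(1) by (auto simp: reducible_to_simples_def)
  have "u - simple_comb F c \<in> \<J>" using group_closure_add[OF assms(2) F(3)] by simp
  then show ?thesis using F by (auto simp: reducible_to_simples_def)
qed

text \<open>Padding with zero coefficients gives two combinations a common support before they are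
  subtracted.\<close>

lemma simple_comb_extend:
  assumes "finite G'" "F \<subseteq> G'"
  shows "simple_comb F c - simple_comb G' (\<lambda>S. if S \<in> F then c S else 0) \<in> \<J>"
proof -
  let ?c = "\<lambda>S. if S \<in> F then c S else 0"
  have "simple_comb G' ?c = simple_comb (G' - F) ?c + simple_comb F ?c"
    using assms by (intro sum.subset_diff)
  also have "simple_comb F ?c = simple_comb F c" by (intro sum.cong) auto
  finally have "simple_comb F c - simple_comb G' ?c = - simple_comb (G' - F) ?c" by simp
  moreover have "simple_comb (G' - F) ?c \<in> \<J>"
    by (intro group_closure_sum) (use tensor_zero_left gr_class_in_Gr in auto)
  ultimately show ?thesis by simp
qed

lemma group_closure_diff_cong:
  assumes "u - a \<in> group_closure S" "v - b \<in> group_closure S" "d - (a - b) \<in> group_closure S"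
  shows "(u - v) - d \<in> group_closure S"
proof -
  have "(u - v) - d = (u - a) - (v - b) - (d - (a - b))" by (simp add: algebra_simps)
  then show ?thesis using group_closure.diff[OF group_closure.diff[OF assms(1,2)] assms(3)] by simp
qed

lemma reducible_diff:
  assumes "reducible_to_simples u" "reducible_to_simples v"
  shows "reducible_to_simples (u - v)"
proof -
  obtain F c where F: "finite F" "F \<subseteq> representatives" "u - simple_comb F c \<in> \<J>"
    using assms(1) by (auto simp: reducible_to_simples_def)
  obtain F' c' where F': "finite F'" "F' \<subseteq> representatives" "v - simple_comb F' c' \<in> \<J>"
    using assms(2) by (auto simp: reducible_to_simples_def)
  let ?H = "F \<union> F'"
  let ?c = "\<lambda>S. if S \<in> F then c S else 0" and ?c' = "\<lambda>S. if S \<in> F' then c' S else 0"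
  have u: "u - simple_comb ?H ?c \<in> \<J>"
    using group_closure_add[OF F(3) simple_comb_extend[of ?H F c]] F F' by simp
  have v: "v - simple_comb ?H ?c' \<in> \<J>"
    using group_closure_add[OF F'(3) simple_comb_extend[of ?H F' c']] F F' by simp
  have "simple_comb ?H (\<lambda>S. ?c S - ?c' S) - (simple_comb ?H ?c - simple_comb ?H ?c') \<in> \<J>"
    unfolding sum_subtractf[symmetric] by (intro group_closure_sum tensor_diff_left gr_class_in_Gr)
  note red = group_closure_diff_cong[OF u v this]
  show ?thesis
    unfolding reducible_to_simples_def
  proof (intro exI conjI)
    show "(u - v) - simple_comb ?H (\<lambda>S. ?c S - ?c' S) \<in> \<J>" by (rule red)
  qed (use F F' in auto)
qed

lemma reducible_zero: "reducible_to_simples 0"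
  unfolding reducible_to_simples_def by (intro exI[of _ "{}"]) simp

lemma reducible_in_relations: "u \<in> \<J> \<Longrightarrow> reducible_to_simples u"
  using reducible_cong[OF reducible_zero, of u] by simp

lemma reducible_tensor: "reducible_to_simples (t c (gr_class v))" if "Poly_Mapping.keys v \<subseteq> representatives"
  using that
proof (induction v rule: frag_induction)
  case zero
  have "t c (gr_class 0) \<in> \<J>" using tensor_relation_right[of c 0 0] by simp
  then show ?case by (rule reducible_in_relations)
next
  case (one S)
  then show ?case unfolding reducible_to_simples_def by (intro exI[of _ "{S}"] exI[of _ "\<lambda>_. c"]) simp
next
  case (diff a b)
  have "t c (gr_class a) - t c (gr_class (a - b)) - t c (gr_class b) \<in> \<J>"
    using tensor_relation_right[of c "a - b" b] by simp
  from group_closure_minus_iff[THEN iffD2, OF this]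
  have "t c (gr_class (a - b)) - (t c (gr_class a) - t c (gr_class b)) \<in> \<J>"
    by (simp add: algebra_simps)
  then show ?case by (rule reducible_cong[OF reducible_diff[OF diff]])
qed

text \<open>Every class in \<open>Gr C\<close> has an integral normal form, and additivity in the
  second argument distributes the scalar over it.\<close>

lemma reducible: "reducible_to_simples u" if "Poly_Mapping.keys u \<subseteq> carrier M"
  using that
proof (induction u rule: frag_induction)
  case (one z)
  then obtain c x where z: "z = (c, x)" "x \<in> carrier (Gr C)" by (cases z) (simp add: DirProd_def)
  obtain u where u: "x = gr_class u" using gr_class_surj[OF z(2)] by blast
  obtain v where v: "Poly_Mapping.keys v \<subseteq> representatives" "u - v \<in> \<I>" using normal_form by blast
  show ?case unfolding z(1) u gr_class_eq[OF v(2)] by (rule reducible_tensor[OF v(1)])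
qed (auto intro: reducible_zero reducible_diff)

lemma \<Psi>_relations: "u \<in> \<J> \<Longrightarrow> \<Psi> u = 0"
proof -
  have "\<J> \<subseteq> {u. \<Psi> u = 0}"
  proof (rule group_closure_subset)
    show "tensor_relations (Gr C) \<subseteq> {u. \<Psi> u = 0}"
      using ring_hom_add[OF \<psi>_Gr_ring_hom]
      by (auto simp: tensor_relations_def additive.diff[OF \<Psi>_additive] \<Psi>_single scale_left_distrib
        scale_right_distrib End_coend_simps(5))
  qed (simp_all add: additive.zero[OF \<Psi>_additive] additive.diff[OF \<Psi>_additive])
  then show "u \<in> \<J> \<Longrightarrow> \<Psi> u = 0" by blast
qed

lemma tensor_relations_carrier: "\<J> \<subseteq> carrier (monoid_ring M)"
proof (rule group_closure_subset)
  have d: "u - v \<in> carrier (monoid_ring M)" if "u \<in> carrier (monoid_ring M)" "v \<in> carrier (monoid_ring M)"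
    for u v
    using that keys_diff[of u v] by (auto simp: monoid_ring_simps)
  then show "u - v \<in> carrier (monoid_ring M)" if "u \<in> carrier (monoid_ring M)"
    "v \<in> carrier (monoid_ring M)" for u v
    using that .
  have t: "t c x \<in> carrier (monoid_ring M)" if "x \<in> carrier (Gr C)" for c x
    using that by (simp add: monoid_ring_simps DirProd_def field_monoid_def)
  have "x \<oplus>\<^bsub>Gr C\<^esub> y \<in> carrier (Gr C)" if "x \<in> carrier (Gr C)" "y \<in> carrier (Gr C)" for x y
    using abelian_monoid.a_closed[OF abelian_group.axioms(1)[OF ring.is_abelian_group[OF Gr_ring]]] that
      by blast
  then show "tensor_relations (Gr C) \<subseteq> carrier (monoid_ring M)"
    unfolding tensor_relations_def by (auto intro!: d t)
qed (simp add: monoid_ring_simps)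

text \<open>The pattern of \<open>\<psi>_kernel\<close> with coefficients in the field: a kernel
  element reduces to a combination of representatives, whose coefficients vanish by
  independence.\<close>

lemma \<Psi>_a_kernel: "a_kernel (monoid_ring M) (End_coend C L \<iota>) \<Psi> = \<J>"
proof
  show "\<J> \<subseteq> a_kernel (monoid_ring M) (End_coend C L \<iota>) \<Psi>"
    using tensor_relations_carrier \<Psi>_relations by (auto simp: a_kernel_def' End_coend_simps(4))
  show "a_kernel (monoid_ring M) (End_coend C L \<iota>) \<Psi> \<subseteq> \<J>"
  proof
    fix u assume "u \<in> a_kernel (monoid_ring M) (End_coend C L \<iota>) \<Psi>"
    then have u: "Poly_Mapping.keys u \<subseteq> carrier M" and 0: "\<Psi> u = 0"
      by (simp_all add: a_kernel_def' monoid_ring_simps End_coend_simps(4))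
    obtain F c where F: "finite F" "F \<subseteq> representatives" "u - simple_comb F c \<in> \<J>"
      using reducible[OF u] by (auto simp: reducible_to_simples_def)
    have "\<Psi> (simple_comb F c) = 0"
      using \<Psi>_relations[OF F(3)] 0 by (simp add: additive.diff[OF \<Psi>_additive])
    then have "(\<Sum>S\<in>F. scale C (c S) (\<O> S)) = 0"
      by (simp add: additive.sum[OF \<Psi>_additive] \<Psi>_single \<psi>_Gr_class frag_scale_single)
    from defects_independent[OF F(1,2) this]
    have "simple_comb F c \<in> \<J>"
      by (intro group_closure_sum) (use tensor_zero_left gr_class_in_Gr in auto)
    from group_closure_add[OF F(3) this] show "u \<in> \<J>" by simp
  qed
qed

section \<open>The generated algebra and the isomorphism\<close>

lemma generated_by_defects:
  "generated_subalgebra (End_coend C L \<iota>) (range \<O>) =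
     (End_coend C L \<iota>)\<lparr>carrier := \<Psi> ` carrier (monoid_ring M)\<rparr>"
proof -
  let ?A = "End_coend C L \<iota>" and ?I = "\<Psi> ` carrier (monoid_ring M)"
  interpret R: ring "monoid_ring M" by (rule monoid_ring_is_ring[OF M_monoid])
  have hom: "\<Psi> \<in> Ring.ring_hom (monoid_ring M) ?A" by (rule ring_hom_ring.homh[OF \<Psi>_ring_hom])
  have t: "t c x \<in> carrier (monoid_ring M)" if "x \<in> carrier (Gr C)" for c x
    using that by (simp add: monoid_ring_simps DirProd_def field_monoid_def)
  have one_Gr: "\<one>\<^bsub>Gr C\<^esub> \<in> carrier (Gr C)" using monoid.one_closed[OF ring.is_monoid[OF Gr_ring]] .
  have \<psi>_one: "\<psi>_Gr \<one>\<^bsub>Gr C\<^esub> = ident C L" using ring_hom_one[OF \<psi>_Gr_ring_hom] by (simp add: End_coend_simps)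
  have mult: "\<Psi> (u \<otimes>\<^bsub>monoid_ring M\<^esub> v) = \<Psi> u \<cdot> \<Psi> v" if "u \<in> carrier (monoid_ring M)"
    "v \<in> carrier (monoid_ring M)" for u v
    using ring_hom_mult[OF hom that] by (simp add: End_coend_simps)
  have in_hom: "\<Psi> u \<in> hom C L L" if "u \<in> carrier (monoid_ring M)" for u
    using ring_hom_closed[OF hom that] by (rule End_coend_hom)
  have "is_subalgebra ?A ?I"
    unfolding is_subalgebra_def
  proof (intro conjI ballI allI)
    show "?I \<subseteq> carrier ?A" using ring_hom_closed[OF hom] by blast
    show "\<one>\<^bsub>?A\<^esub> \<in> ?I" using ring_hom_one[OF hom] R.one_closed by (metis imageI)
    show "\<zero>\<^bsub>?A\<^esub> \<in> ?I"
      using R.zero_closed additive.zero[OF \<Psi>_additive] unfolding monoid_ring_simps End_coend_simps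
        by (metis imageI)
    fix x y assume "x \<in> ?I" "y \<in> ?I"
    then obtain u v where uv: "u \<in> carrier (monoid_ring M)" "v \<in> carrier (monoid_ring M)" "x = \<Psi> u"
      "y = \<Psi> v" by blast
    then show "x \<oplus>\<^bsub>?A\<^esub> y \<in> ?I" "x \<otimes>\<^bsub>?A\<^esub> y \<in> ?I"
      using ring_hom_add[OF hom uv(1,2)] ring_hom_mult[OF hom uv(1,2)] R.a_closed[OF uv(1,2)]
        R.m_closed[OF uv(1,2)]
      by (metis imageI)+
  next
    \<comment> \<open>Scalars are realised inside the monoid ring as multiplication by
      \<open>c \<otimes> 1\<close>, which \<open>\<Psi>\<close> sends to \<open>c\<close> times the
      identity.\<close>
    fix c x assume "x \<in> ?I"
    then obtain u where u: "u \<in> carrier (monoid_ring M)" "x = \<Psi> u" by blast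
    have "\<Psi> (t c \<one>\<^bsub>Gr C\<^esub> \<otimes>\<^bsub>monoid_ring M\<^esub> u) = scale C c x"
      unfolding mult[OF t[OF one_Gr] u(1)] \<Psi>_single \<psi>_one u(2)
        comp_scale_left[OF in_hom[OF u(1)] ident_in_hom] comp_ident_left[OF in_hom[OF u(1)]] ..
    then show "c \<odot>\<^bsub>?A\<^esub> x \<in> ?I"
      using R.m_closed[OF t[OF one_Gr] u(1)] unfolding End_coend_simps by (metis imageI)
  qed
  moreover have "range \<O> \<subseteq> ?I"
  proof
    fix x assume "x \<in> range \<O>"
    then obtain D where "x = \<O> D" by blast
    then have "x = \<Psi> (t 1 (gr_class (frag_of D)))"
      by (simp add: \<Psi>_single \<psi>_Gr_class frag_scale_single)
    then show "x \<in> ?I" using t[OF gr_class_in_Gr] by blast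
  qed
  \<comment> \<open>Every value of \<open>\<Psi>\<close> is already a linear combination of
    operators \<open>\<O> D\<close>; their span is closed under products because \<open>\<O>\<close>
    is multiplicative.\<close>
  moreover have "?I \<subseteq> B" if B: "is_subalgebra ?A B" "range \<O> \<subseteq> B" for B
  proof -
    have B0: "0 \<in> B" and Badd: "\<And>x y. x \<in> B \<Longrightarrow> y \<in> B \<Longrightarrow> x + y \<in> B" and Bscale: "\<And>c x. x \<in> B \<Longrightarrow> scale C c x \<in> B"
      using B(1) by (simp_all add: is_subalgebra_def End_coend_simps)
    have Bdiff: "x - y \<in> B" if "x \<in> B" "y \<in> B" for x y
      using Badd[OF that(1) Bscale[OF that(2), of "- 1"]] by simp
    have \<psi>B: "\<psi> u \<in> B" for u
    proof -
      have "(\<Sum>x\<in>F. scale C (c x) (\<O> x)) \<in> B" for F c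
        using B(2) by (induction F rule: infinite_finite_induct) (auto intro: B0 Badd Bscale)
      then show ?thesis by (simp add: frag_scale_def)
    qed
    have "\<Psi> u \<in> B" if "Poly_Mapping.keys u \<subseteq> carrier M" for u
      using that
    proof (induction u rule: frag_induction)
      case zero
      then show ?case using B0 additive.zero[OF \<Psi>_additive] by simp
    next
      case (one z)
      then obtain c x where z: "z = (c, x)" "x \<in> carrier (Gr C)" by (cases z) (simp add: DirProd_def)
      obtain v where v: "x = gr_class v" using gr_class_surj[OF z(2)] by blast
      show ?case unfolding z(1) \<Psi>_single v \<psi>_Gr_class by (rule Bscale[OF \<psi>B])
    next
      case (diff a b)
      then show ?case unfolding additive.diff[OF \<Psi>_additive] by (rule Bdiff)
    qed
    then show ?thesis by (auto simp: monoid_ring_simps)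
  qed
  ultimately have "\<Inter> {B. is_subalgebra ?A B \<and> range \<O> \<subseteq> B} = ?I" by blast
  then show ?thesis by (simp add: generated_subalgebra_def)
qed

text \<open>The first isomorphism theorem for \<open>\<Psi>\<close> gives a ring isomorphism from
  the quotient to the image, and its inverse \<open>g\<close> points in the required direction.
  Scalars act on the quotient as multiplication by \<open>c \<otimes> 1\<close>, so linearity
  follows from multiplicativity.\<close>

theorem algebra_iso_nonempty:
  "algebra_iso (generated_subalgebra (End_coend C L \<iota>) (range \<O>)) (linearised_Gr C) \<noteq> {}"
proof -
  let ?A = "End_coend C L \<iota>" and ?R = "monoid_ring M"
  let ?B = "?A\<lparr>carrier := \<Psi> ` carrier ?R\<rparr>" and ?Q =
    "base_change_ring (Gr C) :: (('k \<times> ('o \<Rightarrow>\<^sub>0 int) set) \<Rightarrow>\<^sub>0 int) set ring"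
  let ?\<Theta> = "\<lambda>X. the_elem (\<Psi> ` X)"
  have Q: "?Q = ?R Quot \<J>" by (simp add: base_change_ring_def)
  have ideal: "ideal \<J> ?R" using ring_hom_ring.kernel_is_ideal[OF \<Psi>_ring_hom] unfolding \<Psi>_a_kernel .
  have ringQ: "ring ?Q" unfolding Q by (rule ideal.quotient_is_ring[OF ideal])
  have \<Theta>: "?\<Theta> \<in> ring_iso ?Q ?B"
    using ring_hom_ring.FactRing_iso_set_aux[OF \<Psi>_ring_hom] unfolding \<Psi>_a_kernel Q .
  define g where "g = inv_into (carrier ?Q) ?\<Theta>"
  have g: "g \<in> ring_iso ?B ?Q" unfolding g_def by (rule ring_iso_set_sym[OF ringQ \<Theta>])
  have bij: "bij_betw ?\<Theta> (carrier ?Q) (carrier ?B)" using \<Theta> by (simp add: ring_iso_def)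
  have \<Theta>g: "?\<Theta> (g x) = x" and gQ: "g x \<in> carrier ?Q" if "x \<in> carrier ?B" for x
    using bij_betw_inv_into_right[OF bij that] bij_betwE[OF bij_betw_inv_into[OF bij]] that
      unfolding g_def by auto
  have g\<Theta>: "g (?\<Theta> X) = X" if "X \<in> carrier ?Q" for X
    unfolding g_def by (rule bij_betw_inv_into_left[OF bij that])
  have pure: "pure_tensor (Gr C) c \<one>\<^bsub>Gr C\<^esub> \<in> carrier ?Q"
    "?\<Theta> (pure_tensor (Gr C) c \<one>\<^bsub>Gr C\<^esub>) = scale C c (ident C L)" for c
  proof -
    have "\<one>\<^bsub>Gr C\<^esub> \<in> carrier (Gr C)" using monoid.one_closed[OF ring.is_monoid[OF Gr_ring]] .
    then have t: "t c \<one>\<^bsub>Gr C\<^esub> \<in> carrier ?R" by (simp add: monoid_ring_simps DirProd_def field_monoid_def)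
    show "pure_tensor (Gr C) c \<one>\<^bsub>Gr C\<^esub> \<in> carrier ?Q"
      unfolding pure_tensor_def Q by (rule ring_hom_closed[OF ideal.rcos_ring_hom[OF ideal] t])
    have "\<psi>_Gr \<one>\<^bsub>Gr C\<^esub> = ident C L" using ring_hom_one[OF \<psi>_Gr_ring_hom] by (simp add: End_coend_simps)
    then show "?\<Theta> (pure_tensor (Gr C) c \<one>\<^bsub>Gr C\<^esub>) = scale C c (ident C L)"
      using ring_hom_ring.the_elem_simp[OF \<Psi>_ring_hom t] unfolding \<Psi>_a_kernel pure_tensor_def \<Psi>_single by simp
  qed
  \<comment> \<open>Verified after applying \<open>?\<Theta>\<close>, under which the pure tensor
    becomes \<open>c\<close> times the identity.\<close>
  have smult: "g (scale C c x) = pure_tensor (Gr C) c \<one>\<^bsub>Gr C\<^esub> \<otimes>\<^bsub>?Q\<^esub> g x" if x: "x \<in> carrier ?B" for c x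
  proof -
    let ?P = "pure_tensor (Gr C) c \<one>\<^bsub>Gr C\<^esub>"
    have xh: "x \<in> hom C L L" using x ring_hom_closed[OF ring_hom_ring.homh[OF \<Psi>_ring_hom]] End_coend_hom by auto
    have "?\<Theta> (?P \<otimes>\<^bsub>?Q\<^esub> g x) = ?\<Theta> ?P \<cdot> ?\<Theta> (g x)"
      using ring_iso_memE(2)[OF \<Theta> pure(1) gQ[OF x]] by (simp add: End_coend_simps)
    also have "\<dots> = scale C c x"
      unfolding pure(2) \<Theta>g[OF x] comp_scale_left[OF xh ident_in_hom] comp_ident_left[OF xh] ..
    finally have 1: "?\<Theta> (?P \<otimes>\<^bsub>?Q\<^esub> g x) = scale C c x" .
    show ?thesis
      using g\<Theta>[OF monoid.m_closed[OF ring.is_monoid[OF ringQ] pure(1)[of c] gQ[OF x]]] unfolding 1 .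
  qed
  have "g \<in> algebra_iso ?B (linearised_Gr C)"
    using g smult unfolding algebra_iso_def ring_iso_def Ring.ring_hom_def linearised_Gr_def base_change_def
    by (simp add: ring.defs End_coend_simps)
  then show ?thesis unfolding generated_by_defects by blast
qed

end

theorem mainTheorem2:
  fixes C :: "('k::{alg_closed_field, field_char_0}, 'o, 'm::ab_group_add) ribbon_data"
    and L :: 'o and \<iota> :: "'o \<Rightarrow> 'm"
  assumes "modular_tensor_category C"
    and "is_coend C L \<iota>"
  shows "algebra_iso
           (generated_subalgebra (End_coend C L \<iota>) (range (defect_operator C L \<iota>)))
           (linearised_Gr C) \<noteq> {}"
proof -
  interpret modular_tensor_category C by fact
  obtain G where "progenerated_category C G" using progenerated_if_finite[OF finite_category] .
  then interpret progenerated_category C G .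
  interpret coend_progenerated_char_0 C L \<iota> G
    by unfold_locales (use assms(2) unit_simple in auto)
  show ?thesis by (rule algebra_iso_nonempty)
qed

end
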